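(* Fix $N\in\mathbb{N}$ with $N\ge 4$, $h\in(0,1)$, and $\omega_0,\omega_1\in\mathbb{R}$ such that $\omega_0-\omega_1=1$ and $\theta:=(3h-1)\omega_0-(3h-2)\omega_1\neq 0$. Let $U^*(Y)=\omega_0(Y-h)+h(1-h)$ for $0\le Y\le h$ and $U^*(Y)=\omega_1(Y-h)+h(1-h)$ for $h\le Y\le 1$. Then for all sufficiently small $\varepsilon>0$ there exists a localised solution $(U^\varepsilon,V^\varepsilon,\eta^\varepsilon)$ of the two-layer problem (P) that is close to $(U^*,0,0)$ and is approximated by the functions $$\overline{\eta}^\varepsilon(X)=-\frac{3\varepsilon}{\theta}\,\mathrm{sech}^2\Big(\frac{\sqrt{3\varepsilon}}{2h(1-h)}X\Big),$$ $$\overline{U}^\varepsilon(X,Y)=\begin{cases}\omega_0(Y-h)+h(1-h)+\varepsilon-(1-h)\overline{\eta}^\varepsilon(X), & 0\le Y\le h+\overline{\eta}^\varepsilon(X),\\ \omega_1(Y-h)+h(1-h)+\varepsilon+h\,\overline{\eta}^\varepsilon(X), & h+\overline{\eta}^\varepsilon(X)\le Y\le 1,\end{cases}$$ $$\overline{V}^\varepsilon(X,Y)=-\int_0^Y\overline{U}^\varepsilon_X(X,\tilde Y)\,d\tilde Y,$$ in the sense that $$\|U^\varepsilon-\overline{U}^\varepsilon\|_{L^\infty}=\mathcal{O}(\varepsilon^2),\qquad \|V^\varepsilon-\overline{V}^\varepsilon\|_{L^\infty}=\mathcal{O}(\varepsilon^{5/2}),\qquad \|\eta^\varepsilon-\overline{\eta}^\varepsilon\|_{L^\infty}=\mathcal{O}(\varepsilon^2)$$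 as $\varepsilon\to0^+$. The velocity components $U^\varepsilon,V^\varepsilon$ are real-analytic away from the interface (i.e. on $\Omega_0\cup\Omega_1$), and $\eta^\varepsilon\in C^N(\mathbb{R})$. Furthermore, $U^\varepsilon$ and $\eta^\varepsilon$ are even in $X$, while $V^\varepsilon$ is odd in $X$.
   Context: Problem (P): given $h\in(0,1)$ and real $\omega_0,\omega_1$ with $\omega_0-\omega_1=1$, a solution $(U,V,\eta)$ consists of $\eta\in C^2(\mathbb{R})$ with $0<h+\eta<1$, defining $\Omega_0=\{(X,Y): 0<Y<h+\eta(X)\}$ and $\Omega_1=\{(X,Y): h+\eta(X)<Y<1\}$, and functions $U,V\in C^1(\overline{\Omega_0})\cap C^1(\overline{\Omega_1})\cap C^0(\overline{\Omega_0\cup\Omega_1})$ such that: $U_X+V_Y=0$ in $\Omega_0\cup\Omega_1$; $U_Y-V_X=\omega_i$ in $\Omega_i$ for $i=0,1$; $V=0$ on $Y=1$ and on $Y=0$; and $\eta_XU-V=0$ on $Y=h+\eta(X)$. Here $C^n(\overline{\mathcal U})$ denotes the functions on the open set $\mathcal U$ whose derivatives up to order $n$ exist, are bounded, and extend continuously to $\overline{\mathcal U}$. The interface is the curve $Y=h+\eta(X)$. A solution is localised if $\lim_{X\to\pm\infty}\eta(X)=0$. The $L^\infty$ norms of velocity components are over $\mathbb{R}\times[0,1]$. *)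

theory Defs
  imports "HOL-Analysis.Analysis" "HOL-Probability.Essential_Supremum"
begin

definition partial_deriv :: "'a::euclidean_space \<Rightarrow> ('a \<Rightarrow> real) \<Rightarrow> 'a \<Rightarrow> real" where
  "partial_deriv b f p = deriv (\<lambda>t. f (p + t *\<^sub>R b)) 0"

abbreviation dX :: "(real \<times> real \<Rightarrow> real) \<Rightarrow> real \<times> real \<Rightarrow> real" where
  "dX \<equiv> partial_deriv (1, 0)"

abbreviation dY :: "(real \<times> real \<Rightarrow> real) \<Rightarrow> real \<times> real \<Rightarrow> real" where
  "dY \<equiv> partial_deriv (0, 1)"

definition C0_closure :: "'a::euclidean_space set \<Rightarrow> ('a \<Rightarrow> real) \<Rightarrow> bool" where
  "C0_closure S f \<longleftrightarrow> bounded (f ` S) \<and>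
     (\<exists>g. continuous_on (closure S) g \<and> (\<forall>p\<in>S. g p = f p))"

text \<open>
  For open \<open>S\<close>, \<open>Cn_closure n S f\<close> says that all partial derivatives of \<open>f\<close> up to order
  \<open>n\<close> (order zero included) exist on \<open>S\<close>, are bounded on \<open>S\<close>, and extend continuously to
  the closure of \<open>S\<close>. Only the values of \<open>f\<close> on \<open>S\<close> matter. With \<open>S = UNIV\<close> this is
  the space of functions with bounded continuous derivatives up to order \<open>n\<close>.
\<close>

primrec Cn_closure :: "nat \<Rightarrow> 'a::euclidean_space set \<Rightarrow> ('a \<Rightarrow> real) \<Rightarrow> bool" where
  "Cn_closure 0 S f \<longleftrightarrow> C0_closure S f"
| "Cn_closure (Suc n) S f \<longleftrightarrow> C0_closure S f \<and>
     (\<forall>b\<in>Basis. (\<forall>p\<in>S. (\<lambda>t. f (p + t *\<^sub>R b)) field_differentiable (at 0)) \<and>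
                Cn_closure n S (partial_deriv b f))"

text \<open>The value is \<open>\<infinity>\<close> if \<open>f\<close> is not essentially bounded (or not measurable).\<close>

definition Linf_norm :: "'a::euclidean_space set \<Rightarrow> ('a \<Rightarrow> real) \<Rightarrow> ereal" where
  "Linf_norm S f = esssup (lebesgue_on S) (\<lambda>p. ereal \<bar>f p\<bar>)"

definition real_analytic_on2 :: "(real \<times> real \<Rightarrow> real) \<Rightarrow> (real \<times> real) set \<Rightarrow> bool" where
  "real_analytic_on2 f S \<longleftrightarrow>
     (\<forall>(x0, y0)\<in>S. \<exists>r>0. \<exists>a :: nat \<times> nat \<Rightarrow> real.
        \<forall>x y. \<bar>x - x0\<bar> < r \<and> \<bar>y - y0\<bar> < r \<longrightarrow>
          ((\<lambda>(i, j). a (i, j) * (x - x0) ^ i * (y - y0) ^ j) has_sum f (x, y)) UNIV)"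

definition Omega0 :: "real \<Rightarrow> (real \<Rightarrow> real) \<Rightarrow> (real \<times> real) set" where
  "Omega0 h \<eta> = {(X, Y). 0 < Y \<and> Y < h + \<eta> X}"

definition Omega1 :: "real \<Rightarrow> (real \<Rightarrow> real) \<Rightarrow> (real \<times> real) set" where
  "Omega1 h \<eta> = {(X, Y). h + \<eta> X < Y \<and> Y < 1}"

definition channel :: "(real \<times> real) set" where
  "channel = UNIV \<times> {0..1}"

text \<open>
  The velocity components \<open>U\<close>, \<open>V\<close> are total functions of which only the values in the
  closed channel matter. Elements of \<open>C\<^sup>0\<close> of a closure are identified with their continuous
  extensions: continuity on the closure of \<open>Omega0 h \<eta> \<union> Omega1 h \<eta>\<close>, which is the whole
  closed channel, gives the values on the walls and on the interface their meaning.
\<close>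

definition two_layer_solution ::
  "real \<Rightarrow> real \<Rightarrow> real \<Rightarrow> (real \<times> real \<Rightarrow> real) \<Rightarrow> (real \<times> real \<Rightarrow> real) \<Rightarrow> (real \<Rightarrow> real) \<Rightarrow> bool"
where
  "two_layer_solution h \<omega>0 \<omega>1 U V \<eta> \<longleftrightarrow>
     Cn_closure 2 UNIV \<eta> \<and>
     (\<forall>X. 0 < h + \<eta> X \<and> h + \<eta> X < 1) \<and>
     (\<forall>W\<in>{U, V}.
        Cn_closure 1 (Omega0 h \<eta>) W \<and>
        Cn_closure 1 (Omega1 h \<eta>) W \<and>
        Cn_closure 0 (Omega0 h \<eta> \<union> Omega1 h \<eta>) W \<and>
        continuous_on (closure (Omega0 h \<eta> \<union> Omega1 h \<eta>)) W) \<and>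
     (\<forall>p \<in> Omega0 h \<eta> \<union> Omega1 h \<eta>. dX U p + dY V p = 0) \<and>
     (\<forall>p \<in> Omega0 h \<eta>. dY U p - dX V p = \<omega>0) \<and>
     (\<forall>p \<in> Omega1 h \<eta>. dY U p - dX V p = \<omega>1) \<and>
     (\<forall>X. V (X, 1) = 0) \<and>
     (\<forall>X. V (X, 0) = 0) \<and>
     (\<forall>X. deriv \<eta> X * U (X, h + \<eta> X) - V (X, h + \<eta> X) = 0)"

definition localised :: "(real \<Rightarrow> real) \<Rightarrow> bool" where
  "localised \<eta> \<longleftrightarrow> (\<eta> \<longlongrightarrow> 0) at_top \<and> (\<eta> \<longlongrightarrow> 0) at_bot"

definition theta :: "real \<Rightarrow> real \<Rightarrow> real \<Rightarrow> real" where
  "theta h \<omega>0 \<omega>1 = (3 * h - 1) * \<omega>0 - (3 * h - 2) * \<omega>1"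

definition Ustar :: "real \<Rightarrow> real \<Rightarrow> real \<Rightarrow> real \<Rightarrow> real" where
  "Ustar h \<omega>0 \<omega>1 Y =
     (if Y \<le> h then \<omega>0 * (Y - h) + h * (1 - h) else \<omega>1 * (Y - h) + h * (1 - h))"

definition eta_bar :: "real \<Rightarrow> real \<Rightarrow> real \<Rightarrow> real \<Rightarrow> real \<Rightarrow> real" where
  "eta_bar h \<omega>0 \<omega>1 \<epsilon> X =
     - (3 * \<epsilon> / theta h \<omega>0 \<omega>1) * (1 / cosh (sqrt (3 * \<epsilon>) / (2 * h * (1 - h)) * X))\<^sup>2"

text \<open>
  When \<open>\<omega>0 - \<omega>1 = 1\<close> the two branches agree on \<open>Y = h + eta_bar h \<omega>0 \<omega>1 \<epsilon> X\<close>.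
\<close>

definition U_bar :: "real \<Rightarrow> real \<Rightarrow> real \<Rightarrow> real \<Rightarrow> real \<times> real \<Rightarrow> real" where
  "U_bar h \<omega>0 \<omega>1 \<epsilon> = (\<lambda>(X, Y).
     if Y \<le> h + eta_bar h \<omega>0 \<omega>1 \<epsilon> X
     then \<omega>0 * (Y - h) + h * (1 - h) + \<epsilon> - (1 - h) * eta_bar h \<omega>0 \<omega>1 \<epsilon> X
     else \<omega>1 * (Y - h) + h * (1 - h) + \<epsilon> + h * eta_bar h \<omega>0 \<omega>1 \<epsilon> X)"

text \<open>
  For each \<open>X\<close>, the integrand below may fail to be a genuine derivative only at the single
  point \<open>Y' = h + eta_bar h \<omega>0 \<omega>1 \<epsilon> X\<close>, which does not affect the integral.
\<close>

definition V_bar :: "real \<Rightarrow> real \<Rightarrow> real \<Rightarrow> real \<Rightarrow> real \<times> real \<Rightarrow> real" where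
  "V_bar h \<omega>0 \<omega>1 \<epsilon> = (\<lambda>(X, Y).
     - integral {0..Y} (\<lambda>Y'. dX (U_bar h \<omega>0 \<omega>1 \<epsilon>) (X, Y')))"

end

theory Submission
 imports Defs "HOL-Complex_Analysis.Complex_Analysis" "HOL-Probability.Probability" "HOL-Real_Asymp.Real_Asymp"
begin

text \<open>
Why small solitary waves exist. Write the velocity as a shear flow plus an irrotational remainder:
in each layer \<open>U - i V\<close> is the shear \<open>\<omega>\<^sub>i (Y - h) + h (1 - h) + \<epsilon>\<close> plus a holomorphic function
that is real on the wall. By Schwarz reflection in its wall a layer becomes a strip symmetric about
the real axis. With heights measured from the wall, \<open>Y = t (d + sg \<eta>(X))\<close> flattens it, with \<open>t\<close> in
\<open>[-1, 1]\<close>, \<open>d\<close> the depth and \<open>sg = 1\<close> below, \<open>-1\<close> above. Put \<open>x = \<mu> X\<close> and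
\<open>\<epsilon> = 4 (h (1 - h) \<mu>)\<^sup>2 / 3\<close>. The unknowns are the Fourier densities \<open>\<gamma>(\<xi>)\<close> of \<open>\<eta> / \<epsilon>\<close> and
\<open>F(t, \<xi>)\<close> of \<open>f / \<epsilon>\<close>, where \<open>f\<close> is the flattened holomorphic field. They are measured with weights
\<open>(1 + |\<xi>|)^s\<close>; for \<open>s \<ge> 2\<close> convolution is bounded in these norms, and \<open>s\<close> counts derivatives, which
is how any prescribed number \<open>N\<close> of derivatives of \<open>\<eta>\<close> is reached.

With \<open>Z = X + i t (d + sg \<eta>)\<close>, holomorphy means that the \<open>t\<close>-derivative of \<open>f Z\<^sub>X\<close> is the
\<open>X\<close>-derivative of \<open>f Z\<^sub>t\<close> (lemma \<open>flattened_holomorphic\<close>). For each frequency this is a linear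
ordinary differential equation in \<open>t\<close>, whose solution is an explicit exponential \<open>el\<close> plus an
integral operator \<open>SS\<close> that is bounded uniformly in the frequency, hence in \<open>\<mu>\<close>. The kinematic
condition prescribes the flux between \<open>t = -1\<close> and \<open>t = 1\<close> and so fixes the multiple of the
exponential. The field is thus given by \<open>\<gamma>\<close> explicitly up to a relative error \<open>O(\<epsilon>)\<close>, and the only
equation left is the continuity of \<open>U\<close> across the interface.

That equation is dispersive. The Dirichlet--Neumann symbols of the two layers are \<open>ch(\<mu> d \<xi>) / d\<close>
with \<open>ch k = k coth k = 1 + k\<^sup>2 / 3 + O(k\<^sup>4)\<close>, and in the quadratic terms the most singular
contributions of the two layers cancel (lemmas \<open>NN_el\<close> and \<open>interface_jump\<close>). What remains is
\<open>\<gamma> + P\<^sub>\<mu> (bb \<gamma> \<star> \<gamma> + O(\<mu>)) = 0\<close>, where \<open>P\<^sub>\<mu>\<close> tends to \<open>4 h (1 - h) / (4 + \<xi>\<^sup>2)\<close> with an error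
\<open>O(\<mu>\<^sup>2)\<close> (lemma \<open>PP_MM\<close>). The limit is the Fourier form of the travelling wave equation
\<open>4 \<zeta> - \<zeta>'' + 2 \<theta> \<zeta>\<^sup>2 = 0\<close> of Korteweg and de Vries, solved by \<open>\<zeta> = - (3 / \<theta>) sech\<^sup>2\<close>; this is where
\<open>\<theta> \<noteq> 0\<close> enters. The linearisation there is invertible on even functions: its kernel is spanned by
the odd function \<open>\<zeta>'\<close>, and variation of constants with the second, growing solution gives an explicit
bounded right inverse \<open>rr\<close>. So the distance of \<open>\<gamma>\<close> from the Fourier density of \<open>\<zeta>\<close>, together with
the two fields, is a fixed point of a map with Lipschitz constant \<open>O(\<mu>)\<close>, and that distance is
\<open>O(\<mu>\<^sup>2) = O(\<epsilon>)\<close> (lemma \<open>profile_exists\<close>).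

The estimates follow. The first one is \<open>\<eta> - \<eta>_bar = \<epsilon> O(\<mu>\<^sup>2)\<close>. The even part in \<open>t\<close> of the
exponential is \<open>1 + O(\<mu>\<^sup>2 \<xi>\<^sup>2)\<close>, so the irrotational part of \<open>U\<close> is \<open>-(1 - h) \<eta>\<close> below and \<open>h \<eta>\<close>
above, up to \<open>O(\<epsilon>\<^sup>2)\<close>. Each \<open>X\<close>-derivative gains a factor \<open>\<mu>\<close>, and \<open>V\<close> is the integral of \<open>-U\<^sub>X\<close>
from a wall, so its error is \<open>O(\<epsilon>\<^sup>2 \<mu>) = O(\<epsilon>\<^sup>5\<^sup>/\<^sup>2)\<close>. Analyticity in the layers is that of holomorphic
functions, and decay of \<open>\<eta>\<close> is the Riemann--Lebesgue lemma.
\<close>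

section \<open>Integrals depending on a parameter\<close>

lemma continuous_on_integral_dominated:
 fixes f :: "'a::{first_countable_topology, t2_space} \<Rightarrow> 'b \<Rightarrow> 'c::{banach, second_countable_topology}"
 assumes meas: "\<And>x. x \<in> S \<Longrightarrow> f x \<in> borel_measurable M"
  and cont: "\<And>t. continuous_on S (\<lambda>x. f x t)"
  and dom: "\<And>x t. x \<in> S \<Longrightarrow> norm (f x t) \<le> G t"
  and int: "integrable M G"
 shows "continuous_on S (\<lambda>x. integral\<^sup>L M (f x))" unfolding continuous_on_eq_continuous_within proof
 fix x assume x: "x \<in> S"
 show "continuous (at x within S) (\<lambda>x. integral\<^sup>L M (f x))" proof (rule continuous_within_sequentiallyI)
  fix u :: "nat \<Rightarrow> 'a" assume u: "u \<longlonglongrightarrow> x" "\<forall>n. u n \<in> S"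
  show "(\<lambda>n. integral\<^sup>L M (f (u n))) \<longlonglongrightarrow> integral\<^sup>L M (f x)"
  proof (rule integral_dominated_convergence[where w = G])
   show "AE t in M. (\<lambda>n. f (u n) t) \<longlonglongrightarrow> f x t"
    using continuous_on_tendsto_compose[OF cont u(1) x] u(2) by (intro AE_I2) simp
   show "f x \<in> borel_measurable M" by (rule meas[OF x])
   show "f (u n) \<in> borel_measurable M" for n by (rule meas) (use u in simp)
   show "AE t in M. norm (f (u n) t) \<le> G t" for n by (rule AE_I2, rule dom) (use u in simp)
  qed (rule int)
 qed
qed

text \<open>The difference quotients are dominated by twice the bound for the derivative, by the mean value
inequality on the convex set \<open>S\<close>; dominated convergence along sequences then gives the limit.
One-sided derivatives at the ends of an interval are included.\<close>

lemma has_vector_derivative_integral_dominated: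
 fixes f :: "real \<Rightarrow> 'b \<Rightarrow> 'c::{banach, second_countable_topology}"
 assumes S: "convex S" "x \<in> S"
  and int: "\<And>x. x \<in> S \<Longrightarrow> integrable M (f x)"
  and deriv: "\<And>x t. x \<in> S \<Longrightarrow> ((\<lambda>x. f x t) has_vector_derivative f' x t) (at x within S)"
  and meas: "\<And>x. x \<in> S \<Longrightarrow> f' x \<in> borel_measurable M"
  and dom: "\<And>x t. x \<in> S \<Longrightarrow> norm (f' x t) \<le> G t"
  and G: "integrable M G"
 shows "((\<lambda>x. integral\<^sup>L M (f x)) has_vector_derivative integral\<^sup>L M (f' x)) (at x within S)"
 unfolding has_vector_derivative_def has_derivative_within proof (intro conjI)
 show "bounded_linear (\<lambda>y. y *\<^sub>R integral\<^sup>L M (f' x))" by (rule bounded_linear_scaleR_left)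
 have int': "integrable M (f' y)" if "y \<in> S" for y proof (rule Bochner_Integration.integrable_bound[OF G meas[OF that]])
  show "AE t in M. norm (f' y t) \<le> norm (G t)" using order_trans[OF dom[OF that] abs_ge_self] by (intro AE_I2) simp
 qed
 define q where "q y t = (1 / norm (y - x)) *\<^sub>R (f y t - (f x t + (y - x) *\<^sub>R f' x t))" for y t
 have q_bd: "norm (q y t) \<le> 2 * G t" if "y \<in> S" for y t proof -
  have "norm (f y t - f x t) \<le> G t * norm (y - x)" using S(1) _ _ that S(2) proof (rule differentiable_bound)
   fix z assume "z \<in> S"
   then show "((\<lambda>x. f x t) has_derivative (\<lambda>y. y *\<^sub>R f' z t)) (at z within S)"
    using deriv by (simp add: has_vector_derivative_def)
   show "onorm (\<lambda>y. y *\<^sub>R f' z t) \<le> G t"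
    using dom[OF \<open>z \<in> S\<close>, of t] by (simp add: onorm_scaleR_left onorm_id)
  qed
  moreover have "norm ((y - x) *\<^sub>R f' x t) \<le> G t * norm (y - x)"
   using mult_right_mono[OF dom[OF S(2), of t], of "abs (y - x)"] by (simp add: mult.commute)
  ultimately have "norm (f y t - (f x t + (y - x) *\<^sub>R f' x t)) \<le> 2 * G t * norm (y - x)"
   using norm_triangle_ineq4[of "f y t - f x t" "(y - x) *\<^sub>R f' x t"] by (simp add: diff_diff_add)
  moreover have "0 \<le> G t" using order_trans[OF norm_ge_zero dom[OF S(2), of t]] .
  ultimately show ?thesis by (cases "y = x") (simp_all add: q_def pos_divide_le_eq mult.assoc)
 qed
 have eq: "(1 / norm (y - x)) *\<^sub>R (integral\<^sup>L M (f y) - (integral\<^sup>L M (f x) + (y - x) *\<^sub>R integral\<^sup>L M (f' x)))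
   = integral\<^sup>L M (q y)" if "y \<in> S" for y unfolding q_def using int[OF that] int[OF S(2)] int'[OF S(2)] by simp
 have "((\<lambda>y. integral\<^sup>L M (q y)) \<longlongrightarrow> 0) (at x within S)"
  unfolding tendsto_at_iff_sequentially comp_def proof (intro allI impI)
  fix u assume u: "\<forall>n. u n \<in> S - {x}" "u \<longlonglongrightarrow> x"
  have "(\<lambda>n. integral\<^sup>L M (q (u n))) \<longlonglongrightarrow> integral\<^sup>L M (\<lambda>_. 0 :: 'c)"
  proof (rule integral_dominated_convergence[where w = "\<lambda>t. 2 * G t"])
   show "AE t in M. (\<lambda>n. q (u n) t) \<longlonglongrightarrow> 0" proof (rule AE_I2)
    fix t
    have "((\<lambda>y. q y t) \<longlongrightarrow> 0) (at x within S)"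
     using deriv[OF S(2), of t] unfolding has_vector_derivative_def has_derivative_within q_def by simp
    then show "(\<lambda>n. q (u n) t) \<longlonglongrightarrow> 0"
     using u unfolding tendsto_at_iff_sequentially comp_def by blast
   qed
   show "q (u n) \<in> borel_measurable M" for n unfolding q_def using int[of "u n"] int[OF S(2)] int'[OF S(2)] u
    by (auto simp: q_def intro!: borel_measurable_scaleR borel_measurable_diff borel_measurable_add)
   show "AE t in M. norm (q (u n) t) \<le> 2 * G t" for n by (rule AE_I2, rule q_bd) (use u in simp)
   show "integrable M (\<lambda>t. 2 * G t)" using G by simp
  qed simp
  then show "(\<lambda>n. integral\<^sup>L M (q (u n))) \<longlonglongrightarrow> 0" by simp
 qed
 then show "((\<lambda>y. (1 / norm (y - x)) *\<^sub>R (integral\<^sup>L M (f y) -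
   (integral\<^sup>L M (f x) + (y - x) *\<^sub>R integral\<^sup>L M (f' x)))) \<longlongrightarrow> 0) (at x within S)"
 proof (rule Lim_transform_eventually)
  show "\<forall>\<^sub>F y in at x within S. integral\<^sup>L M (q y) = (1 / norm (y - x)) *\<^sub>R (integral\<^sup>L M (f y) -
   (integral\<^sup>L M (f x) + (y - x) *\<^sub>R integral\<^sup>L M (f' x)))"
   unfolding eventually_at_filter by (intro always_eventually allI impI) (rule eq[symmetric])
 qed
qed

section \<open>Weighted bounds and convolution\<close>

definition bnd :: "nat \<Rightarrow> real \<Rightarrow> (real \<Rightarrow> real) \<Rightarrow> bool" where
 "bnd s A f \<longleftrightarrow> continuous_on UNIV f \<and> (\<forall>xi. (1 + abs xi)^s * abs (f xi) \<le> A)"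

text \<open>The version for fields on a flattened layer; nothing is said about \<open>t\<close> outside \<open>[-1, 1]\<close>.\<close>

definition bnd2 :: "nat \<Rightarrow> real \<Rightarrow> (real \<Rightarrow> real \<Rightarrow> real) \<Rightarrow> bool" where
 "bnd2 s A F \<longleftrightarrow> continuous_on ({-1..1} \<times> UNIV) (\<lambda>(t, xi). F t xi) \<and>
   (\<forall>t\<in>{-1..1}. \<forall>xi. (1 + abs xi)^s * abs (F t xi) \<le> A)"

definition conv :: "(real \<Rightarrow> real) \<Rightarrow> (real \<Rightarrow> real) \<Rightarrow> real \<Rightarrow> real" where
 "conv f g xi = (LBINT t. f (xi - t) * g t)"

definition wint :: real where
 "wint = (LBINT t. 1 / (1 + abs t)^2)"

lemma integrable_weight2: "integrable lborel (\<lambda>t::real. 1 / (1 + abs t)^2)" proof -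
 have *: "integrable lborel (\<lambda>t::real. inverse (1 + t^2))"
  using integrable_inverse_1_plus_square by (simp add: set_integrable_def)
 show ?thesis proof (rule Bochner_Integration.integrable_bound[OF *])
  show "AE t in lborel. norm (1 / (1 + abs t)^2) \<le> norm (inverse (1 + t^2) :: real)" proof (rule AE_I2)
   fix t :: real
   have "1 + t\<^sup>2 \<le> (1 + abs t)\<^sup>2" by (simp add: power2_sum)
   then show "norm (1 / (1 + abs t)^2) \<le> norm (inverse (1 + t^2))" by (simp add: inverse_eq_divide frac_le add_pos_nonneg)
  qed
 qed measurable
qed

lemma weight_mono: "s \<le> s' \<Longrightarrow> (1 + abs (t::real))^s \<le> (1 + abs t)^s'" by (rule power_increasing) auto

lemma integrable_weight:
 assumes "2 \<le> s" shows "integrable lborel (\<lambda>t::real. 1 / (1 + abs t)^s)"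
 by (rule Bochner_Integration.integrable_bound[OF integrable_weight2])
   (auto intro!: AE_I2 divide_left_mono weight_mono assms)

lemma weight_le_wint:
 assumes "2 \<le> s" shows "(LBINT t. 1 / (1 + abs (t::real))^s) \<le> wint" unfolding wint_def
 by (rule integral_mono[OF integrable_weight[OF assms] integrable_weight2])
   (auto intro!: divide_left_mono weight_mono assms)

lemma wint_nonneg: "0 \<le> wint" unfolding wint_def by (rule Bochner_Integration.integral_nonneg) auto

lemma bndD:
 assumes "bnd s A f"
 shows "continuous_on S f" "(1 + abs xi)^s * abs (f xi) \<le> A" "abs (f xi) \<le> A / (1 + abs xi)^s" "0 \<le> A" "abs (f xi) \<le> A"
  "f \<in> borel_measurable borel" proof -
 show c: "continuous_on S f" and *: "(1 + abs xi)^s * abs (f xi) \<le> A" for xi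
  using assms unfolding bnd_def by (auto intro: continuous_on_subset)
 then show **: "abs (f xi) \<le> A / (1 + abs xi)^s" by (simp add: field_simps)
 show "0 \<le> A" using order_trans[OF _ *[of 0]] by simp
 have "1 \<le> (1 + abs xi)^s" by (simp add: one_le_power)
 then show "abs (f xi) \<le> A" using *[of xi] mult_right_mono[of 1 "(1 + abs xi)^s" "abs (f xi)"] by simp
 show "f \<in> borel_measurable borel" using assms unfolding bnd_def by (auto intro: borel_measurable_continuous_onI)
qed

lemma bndI:
 assumes "continuous_on UNIV f" "\<And>xi. abs (f xi) \<le> A / (1 + abs xi)^s"
 shows "bnd s A f" using assms unfolding bnd_def by (simp add: field_simps)

lemma bnd_weaken: "bnd s A f \<Longrightarrow> s' \<le> s \<Longrightarrow> A \<le> A' \<Longrightarrow> bnd s' A' f"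
 unfolding bnd_def by (meson abs_ge_zero mult_right_mono order_trans weight_mono)

lemma bnd_integrable:
 assumes "bnd s A f" "2 \<le> s"
 shows "integrable lborel f" "(LBINT t. abs (f t)) \<le> A * wint" proof -
 have i: "integrable lborel (\<lambda>t::real. A * (1 / (1 + abs t)^s))"
  using integrable_weight[OF assms(2)] by (rule integrable_mult_right)
 show *: "integrable lborel f" proof (rule Bochner_Integration.integrable_bound[OF i])
  show "f \<in> borel_measurable lborel" using bndD(6)[OF assms(1)] by simp
  show "AE t in lborel. norm (f t) \<le> norm (A * (1 / (1 + abs t)^s))" proof (rule AE_I2)
   fix t
   show "norm (f t) \<le> norm (A * (1 / (1 + abs t)^s))" using bndD(3)[OF assms(1), of t] bndD(4)[OF assms(1)] by simp
  qed
 qed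
 have "(LBINT t. abs (f t)) \<le> (LBINT t. A * (1 / (1 + abs t)^s))"
  using bndD(3)[OF assms(1)] by (intro integral_mono[OF integrable_abs[OF *] i]) auto
 also have "... = A * (LBINT t. 1 / (1 + abs t)^s)" by (rule integral_mult_right_zero)
 also have "... \<le> A * wint" using weight_le_wint[OF assms(2)] bndD(4)[OF assms(1)] by (rule mult_left_mono)
 finally show "(LBINT t. abs (f t)) \<le> A * wint" .
qed

lemma bnd2_cont_compose:
 assumes "bnd2 s A F" "continuous_on S f" "continuous_on S g" "f ` S \<subseteq> {-1..1}"
 shows "continuous_on S (\<lambda>x. F (f x) (g x))" proof -
 have c: "continuous_on ({-1..1} \<times> UNIV) (\<lambda>(t, xi). F t xi)" using assms(1) unfolding bnd2_def by blast
 have "(\<lambda>x. (f x, g x)) ` S \<subseteq> {-1..1} \<times> UNIV" using assms(4) by blast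
 from continuous_on_compose2[OF c continuous_on_Pair[OF assms(2,3)] this]
 show ?thesis by simp
qed

lemma bnd2D:
 assumes "bnd2 s A F" "t \<in> {-1..1}" shows "(1 + abs xi)^s * abs (F t xi) \<le> A" using assms unfolding bnd2_def by blast

lemma bnd2I:
 assumes "continuous_on ({-1..1} \<times> UNIV) (\<lambda>p. F (fst p) (snd p))"
  and "\<And>t xi. t \<in> {-1..1} \<Longrightarrow> (1 + abs xi)^s * abs (F t xi) \<le> A"
 shows "bnd2 s A F" using assms unfolding bnd2_def case_prod_unfold by blast

lemma bnd2_contD: "bnd2 s A F \<Longrightarrow> continuous_on ({-1..1} \<times> UNIV) (\<lambda>p. F (fst p) (snd p))"
 unfolding bnd2_def case_prod_unfold by blast

lemma bnd2_slice:
 assumes "bnd2 s A F" "t \<in> {-1..1}" shows "bnd s A (F t)" proof -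
 have "continuous_on UNIV (\<lambda>x. F t x)" by (rule bnd2_cont_compose[OF assms(1)]) (use assms(2) in auto)
 then show ?thesis using bnd2D[OF assms] unfolding bnd_def by blast
qed

lemma bnd_bnd2: "bnd s A f \<longleftrightarrow> bnd2 s A (\<lambda>_. f)" proof
 assume f: "bnd s A f"
 show "bnd2 s A (\<lambda>_. f)"
  by (rule bnd2I, rule continuous_on_compose2[OF bndD(1)[OF f, of UNIV] continuous_on_snd[OF continuous_on_id]])
    (use bndD(2)[OF f] in auto)
next
 assume "bnd2 s A (\<lambda>_. f)"
 from bnd2_slice[OF this, of 0] show "bnd s A f" by simp
qed

lemma bnd2_cont_t:
 assumes "bnd2 s A F" shows "continuous_on {-1..1} (\<lambda>t. F t xi)"
 by (rule bnd2_cont_compose[OF assms]) (auto intro: continuous_on_id)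

lemma bnd2_weaken: "bnd2 s A f \<Longrightarrow> s' \<le> s \<Longrightarrow> A \<le> A' \<Longrightarrow> bnd2 s' A' f"
 unfolding bnd2_def by (meson abs_ge_zero mult_right_mono order_trans weight_mono)

lemma bnd2_add:
 assumes "bnd2 s A F" "bnd2 s B G" shows "bnd2 s (A + B) (\<lambda>t xi. F t xi + G t xi)" proof -
 have "(1 + abs xi)^s * abs (F t xi + G t xi) \<le> A + B" if "t \<in> {-1..1}" for t xi proof -
  have "(1 + abs xi)^s * abs (F t xi + G t xi) \<le> (1 + abs xi)^s * (abs (F t xi) + abs (G t xi))"
   by (intro mult_left_mono) auto
  then show ?thesis using bnd2D[OF assms(1) that, of xi] bnd2D[OF assms(2) that, of xi] by (simp add: distrib_left)
 qed
 moreover have "continuous_on ({-1..1} \<times> UNIV) (\<lambda>p. F (fst p) (snd p) + G (fst p) (snd p))"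
  using assms unfolding bnd2_def case_prod_unfold by (intro continuous_on_add) auto
 ultimately show ?thesis unfolding bnd2_def case_prod_unfold by blast
qed

lemma bnd2_mult:
 assumes "bnd2 s A F" "continuous_on ({-1..1} \<times> UNIV) (\<lambda>(t, xi). m t xi)"
  "\<And>t xi. t \<in> {-1..1} \<Longrightarrow> abs (m t xi) \<le> B"
 shows "bnd2 s (B * A) (\<lambda>t xi. m t xi * F t xi)" proof -
 have "(1 + abs xi)^s * abs (m t xi * F t xi) \<le> B * A" if "t \<in> {-1..1}" for t xi proof -
  have "abs (m t xi) * ((1 + abs xi)^s * abs (F t xi)) \<le> B * A"
   using assms(3)[OF that, of xi] bnd2D[OF assms(1) that, of xi] by (intro mult_mono) auto
  then show ?thesis by (simp add: abs_mult mult_ac)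
 qed
 moreover have "continuous_on ({-1..1} \<times> UNIV) (\<lambda>p. m (fst p) (snd p) * F (fst p) (snd p))"
  using assms unfolding bnd2_def case_prod_unfold by (intro continuous_on_mult) auto
 ultimately show ?thesis unfolding bnd2_def case_prod_unfold by blast
qed

lemma bnd2_cmult: "bnd2 s A F \<Longrightarrow> bnd2 s (abs c * A) (\<lambda>t xi. c * F t xi)"
 by (rule bnd2_mult[where m = "\<lambda>_ _. c"]) auto

lemma bnd2_diff:
 assumes "bnd2 s A F" "bnd2 s B G" shows "bnd2 s (A + B) (\<lambda>t xi. F t xi - G t xi)"
 using bnd2_add[OF assms(1) bnd2_cmult[OF assms(2), of "-1"]] by simp

lemma bnd2_tmult: "bnd2 s A F \<Longrightarrow> bnd2 s A (\<lambda>t xi. t * F t xi)" proof -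
 assume F: "bnd2 s A F"
 have "bnd2 s (1 * A) (\<lambda>t xi. t * F t xi)"
  using continuous_on_fst[OF continuous_on_id, of "{-1..1::real} \<times> (UNIV :: real set)"]
  by (intro bnd2_mult[OF F]) (simp_all add: case_prod_unfold abs_le_iff)
 then show ?thesis by simp
qed

lemma bnd_add: "bnd s A f \<Longrightarrow> bnd s B g \<Longrightarrow> bnd s (A + B) (\<lambda>xi. f xi + g xi)"
 and bnd_diff: "bnd s A f \<Longrightarrow> bnd s B g \<Longrightarrow> bnd s (A + B) (\<lambda>xi. f xi - g xi)"
 and bnd_cmult: "bnd s A f \<Longrightarrow> bnd s (abs c * A) (\<lambda>xi. c * f xi)"
 unfolding bnd_bnd2 by (rule bnd2_add bnd2_diff bnd2_cmult; assumption)+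

lemma bnd_mult:
 assumes "bnd s A f" "continuous_on UNIV m" "\<And>xi. abs (m xi) \<le> B"
 shows "bnd s (B * A) (\<lambda>xi. m xi * f xi)" proof -
 have "continuous_on ({-1..1::real} \<times> UNIV) (\<lambda>p. m (snd p))"
  by (rule continuous_on_compose2[OF assms(2) continuous_on_snd[OF continuous_on_id]]) simp
 then show ?thesis
  using assms bnd2_mult[of s A "\<lambda>_. f" "\<lambda>_. m" B] unfolding bnd_bnd2 by (simp add: case_prod_unfold)
qed

lemma weight_triangle:
 fixes xi t :: real
 shows "(1 + abs xi)^s \<le> 2^s * ((1 + abs (xi - t))^s + (1 + abs t)^s)" proof -
 let ?m = "max (1 + abs (xi - t)) (1 + abs t)"
 have "1 + abs xi \<le> 2 * ?m" by (auto simp: max_def abs_if)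
 then have "(1 + abs xi)^s \<le> (2 * ?m)^s" by (rule power_mono) auto
 also have "... = 2^s * ?m^s" by (rule power_mult_distrib)
 also have "?m^s \<le> (1 + abs (xi - t))^s + (1 + abs t)^s" by (simp add: max_def)
 finally show ?thesis by simp
qed

definition ccon :: "nat \<Rightarrow> real" where "ccon s = 2^(s + 1) * wint"

lemma ccon_nonneg: "0 \<le> ccon s" using wint_nonneg by (simp add: ccon_def)

lemma conv_integrable:
 assumes "bnd s A f" "bnd s B g" "2 \<le> s"
 shows "integrable lborel (\<lambda>t. f (xi - t) * g t)" proof -
 have "integrable lborel (\<lambda>t. A * g t)" using bnd_integrable[OF assms(2,3)] by simp
 then show ?thesis proof (rule Bochner_Integration.integrable_bound)
  show "(\<lambda>t. f (xi - t) * g t) \<in> borel_measurable lborel"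
   using bndD(6)[OF assms(1)] bndD(6)[OF assms(2)] by measurable
  show "AE t in lborel. norm (f (xi - t) * g t) \<le> norm (A * g t)"
   using bndD(5)[OF assms(1)] bndD(4)[OF assms(1)] by (auto intro!: AE_I2 mult_right_mono simp: abs_mult)
 qed
qed

lemma integrable_weight_shift:
 assumes "2 \<le> s"
 shows "integrable lborel (\<lambda>t::real. 1 / (1 + abs (xi - t))^s)"
  "(LBINT t. 1 / (1 + abs (xi - t::real))^s) = (LBINT t. 1 / (1 + abs (t::real))^s)" proof -
 show "integrable lborel (\<lambda>t::real. 1 / (1 + abs (xi - t))^s)"
  using lborel_integrable_real_affine[OF integrable_weight[OF assms], of "-1" xi] by simp
 show "(LBINT t. 1 / (1 + abs (xi - t::real))^s) = (LBINT t. 1 / (1 + abs (t::real))^s)"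
  using lborel_integral_real_affine[of "-1" "\<lambda>t::real. 1 / (1 + abs t)^s" xi] by simp
qed

text \<open>Of the two frequencies adding up to \<open>xi\<close> one has at least half its modulus, so the weight at
\<open>xi\<close> can be charged to one factor, and the weight of the other factor makes the integral converge.
The weighted spaces are therefore Banach algebras under convolution.\<close>

lemma conv_abs_weight:
 assumes f: "bnd s A f" and g: "bnd s B g" and s: "2 \<le> s"
 shows "(1 + abs xi)^s * (LBINT t. abs (f (xi - t)) * abs (g t)) \<le> ccon s * A * B" proof -
 note [simp] = bndD(4)[OF f] bndD(4)[OF g]
 have bd: "(1 + abs xi)^s * (abs (f (xi - t)) * abs (g t))
   \<le> 2^s * A * B * (1 / (1 + abs t)^s + 1 / (1 + abs (xi - t))^s)" for t proof -
  have p: "0 < (1 + abs (xi - t))^s" "0 < (1 + abs t)^s" by auto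
  have "(1 + abs xi)^s * (abs (f (xi - t)) * abs (g t))
    \<le> (2^s * ((1 + abs (xi - t))^s + (1 + abs t)^s)) * ((A / (1 + abs (xi - t))^s) * (B / (1 + abs t)^s))"
   by (intro mult_mono weight_triangle bndD(3)[OF f] bndD(3)[OF g]) auto
  also have "... = 2^s * A * B * (1 / (1 + abs t)^s + 1 / (1 + abs (xi - t))^s)" using p by (simp add: field_simps)
  finally show ?thesis .
 qed
 have i: "integrable lborel (\<lambda>t. 2^s * A * B * (1 / (1 + abs t)^s + 1 / (1 + abs (xi - t))^s))"
  using integrable_weight[OF s] integrable_weight_shift(1)[OF s] by simp
 have "(1 + abs xi)^s * (LBINT t. abs (f (xi - t)) * abs (g t))
   = (LBINT t. (1 + abs xi)^s * (abs (f (xi - t)) * abs (g t)))" by simp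
 also have "... \<le> (LBINT t. 2^s * A * B * (1 / (1 + abs t)^s + 1 / (1 + abs (xi - t))^s))"
  using bd integrable_abs[OF conv_integrable[OF f g s, of xi]] by (intro integral_mono[OF _ i]) (auto simp: abs_mult)
 also have "... = 2^s * A * B * (2 * (LBINT t. 1 / (1 + abs (t::real))^s))"
  using integrable_weight[OF s] integrable_weight_shift[OF s] by simp
 also have "... \<le> 2^s * A * B * (2 * wint)" by (intro mult_left_mono weight_le_wint s) auto
 finally show ?thesis by (simp add: ccon_def mult_ac)
qed

lemma conv_abs_le: "abs (conv f g xi) \<le> (LBINT t. abs (f (xi - t)) * abs (g t))"
 using integral_abs_bound[of lborel "\<lambda>t. f (xi - t) * g t"] by (simp add: conv_def abs_mult)

lemma bnd2_conv:
 assumes F: "bnd2 s A F" and G: "bnd2 s B G" and s: "2 \<le> s"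
 shows "bnd2 s (ccon s * A * B) (\<lambda>t. conv (F t) (G t))" unfolding bnd2_def proof (intro conjI ballI allI)
 fix t xi :: real assume t: "t \<in> {-1..1}"
 have "(1 + abs xi)^s * abs (conv (F t) (G t) xi) \<le> (1 + abs xi)^s * (LBINT r. abs (F t (xi - r)) * abs (G t r))"
  by (intro mult_left_mono conv_abs_le) auto
 then show "(1 + abs xi)^s * abs (conv (F t) (G t) xi) \<le> ccon s * A * B"
  using conv_abs_weight[OF bnd2_slice[OF F t] bnd2_slice[OF G t] s] by (rule order_trans)
next
 have "continuous_on ({-1..1} \<times> UNIV) (\<lambda>p. LBINT r. F (fst p) (snd p - r) * G (fst p) r)"
 proof (rule continuous_on_integral_dominated)
  show "integrable lborel (\<lambda>r. A * (B * (1 / (1 + abs r)^s)))" by (intro integrable_mult_right integrable_weight s)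
  show "continuous_on ({-1..1} \<times> UNIV) (\<lambda>p. F (fst p) (snd p - r) * G (fst p) r)" for r
   by (intro continuous_on_mult bnd2_cont_compose[OF F] bnd2_cont_compose[OF G] continuous_intros) auto
  fix p :: "real \<times> real" assume "p \<in> {-1..1} \<times> UNIV"
  then have t: "fst p \<in> {-1..1}" by auto
  show "(\<lambda>r. F (fst p) (snd p - r) * G (fst p) r) \<in> borel_measurable lborel"
   using bndD(6)[OF bnd2_slice[OF F t]] bndD(6)[OF bnd2_slice[OF G t]] by measurable
  show "norm (F (fst p) (snd p - r) * G (fst p) r) \<le> A * (B * (1 / (1 + abs r)^s))" for r
   using mult_mono[OF bndD(5)[OF bnd2_slice[OF F t], of "snd p - r"] bndD(3)[OF bnd2_slice[OF G t], of r]
     bndD(4)[OF bnd2_slice[OF F t]]] by (simp add: abs_mult)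
 qed
 then show "continuous_on ({-1..1} \<times> UNIV) (\<lambda>(t, xi). conv (F t) (G t) xi)"
  by (simp add: conv_def case_prod_unfold)
qed

lemma bnd_conv:
 assumes "bnd s A f" "bnd s B g" "2 \<le> s"
 shows "bnd s (ccon s * A * B) (conv f g)" using bnd2_conv[of s A "\<lambda>_. f" B "\<lambda>_. g"] assms by (simp add: bnd_bnd2)

lemma conv_commute: "conv f g = conv g f" proof
 fix xi
 show "conv f g xi = conv g f xi" unfolding conv_def using lborel_integral_real_affine[of "-1" "\<lambda>t. f (xi - t) * g t" xi]
  by (simp add: mult.commute)
qed

lemma conv_add_right:
 assumes "bnd s A f" "bnd s B g" "bnd s B' g'" "2 \<le> s"
 shows "conv f (\<lambda>t. g t + g' t) xi = conv f g xi + conv f g' xi"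
 unfolding conv_def using conv_integrable[OF assms(1,2,4), of xi] conv_integrable[OF assms(1,3,4), of xi]
 by (simp add: distrib_left)

lemma conv_cmult_right: "conv f (\<lambda>t. c * g t) xi = c * conv f g xi"
 unfolding conv_def by (subst integral_mult_right_zero[symmetric]) (simp add: mult_ac)

lemma conv_cmult_left: "conv (\<lambda>t. c * f t) g xi = c * conv f g xi" by (metis conv_cmult_right conv_commute)

lemma conv_add_left:
 assumes "bnd s A f" "bnd s A' f'" "bnd s B g" "2 \<le> s"
 shows "conv (\<lambda>t. f t + f' t) g xi = conv f g xi + conv f' g xi"
 by (subst (1 2 3) conv_commute) (rule conv_add_right[OF assms(3,1,2,4)])

lemma conv_reflect:
 assumes "\<And>t. f' (- t) = a * f t" "\<And>t. g' (- t) = b * g t"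
 shows "conv f' g' (- xi) = a * b * conv f g xi" proof -
 have "conv f' g' (- xi) = (LBINT t. f' (- xi - (0 + -1 * t)) * g' (0 + -1 * t))"
  unfolding conv_def by (subst lborel_integral_real_affine[of "-1" _ 0]) auto
 also have "... = (LBINT t. (a * b) * (f (xi - t) * g t))" using assms(1)[of "xi - _"] by (simp add: assms(2) mult_ac)
 finally show ?thesis by (simp add: conv_def)
qed

section \<open>The Fourier representation\<close>

definition "FF a x = (LBINT xi. cis (xi * x) * of_real (a xi))"

lemma cis_measurable [measurable]: "cis \<in> borel_measurable borel" by (intro borel_measurable_continuous_onI continuous_intros)

lemma FF_integrable:
 assumes "integrable lborel a" shows "integrable lborel (\<lambda>xi. cis (xi * x) * of_real (a xi))"
 by (rule Bochner_Integration.integrable_bound[OF assms])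
   (use assms in \<open>auto simp: norm_mult\<close>)

lemma FF_norm_le: "norm (FF a x) \<le> (LBINT t. abs (a t))"
 using integral_norm_bound[of lborel "\<lambda>xi. cis (xi * x) * of_real (a xi)"] by (simp add: FF_def norm_mult)

lemma FF_bound:
 assumes "bnd s A a" "2 \<le> s" shows "norm (FF a x) \<le> A * wint"
 using FF_norm_le bnd_integrable(2)[OF assms] by (rule order_trans)

lemma FF_continuous2:
 assumes F: "bnd2 s A F" and s: "2 \<le> s"
 shows "continuous_on ({-1..1} \<times> UNIV) (\<lambda>p. FF (F (fst p)) (snd p))" unfolding FF_def
proof (rule continuous_on_integral_dominated)
 show "integrable lborel (\<lambda>r. A * (1 / (1 + abs r)^s))" by (intro integrable_mult_right integrable_weight s)
 show "continuous_on ({-1..1} \<times> UNIV) (\<lambda>p. cis (r * snd p) * of_real (F (fst p) r))" for r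
  by (intro continuous_intros bnd2_cont_compose[OF F]) auto
 fix p :: "real \<times> real" assume "p \<in> {-1..1} \<times> UNIV"
 then have t: "fst p \<in> {-1..1}" by auto
 show "(\<lambda>r. cis (r * snd p) * of_real (F (fst p) r)) \<in> borel_measurable lborel"
  using bndD(6)[OF bnd2_slice[OF F t]] by measurable
 show "norm (cis (r * snd p) * of_real (F (fst p) r)) \<le> A * (1 / (1 + abs r)^s)" for r
  using bndD(3)[OF bnd2_slice[OF F t], of r] by (simp add: norm_mult)
qed

lemma FF_continuous:
 assumes "bnd s A a" "2 \<le> s" shows "continuous_on S (FF a)" proof -
 have "continuous_on ({-1..1::real} \<times> UNIV) (\<lambda>p. FF a (snd p))"
  using FF_continuous2[of s A "\<lambda>_. a"] assms by (simp add: bnd_bnd2)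
 from continuous_on_compose2[OF this, of S "\<lambda>x. (0, x)"] show ?thesis by (simp add: continuous_on_Pair image_subset_iff)
qed

lemma bnd_xi: "bnd (Suc s) A a \<Longrightarrow> bnd s A (\<lambda>xi. xi * a xi)" proof -
 assume a: "bnd (Suc s) A a"
 show "bnd s A (\<lambda>xi. xi * a xi)" unfolding bnd_def proof (intro conjI allI)
  show "continuous_on UNIV (\<lambda>xi. xi * a xi)" by (intro continuous_intros bndD(1)[OF a])
  fix xi :: real
  have "(1 + abs xi)^s * (abs xi * abs (a xi)) \<le> (1 + abs xi)^s * ((1 + abs xi) * abs (a xi))"
   by (intro mult_left_mono mult_right_mono) auto
  then show "(1 + abs xi)^s * abs (xi * a xi) \<le> A" using bndD(2)[OF a, of xi] by (simp add: abs_mult mult_ac)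
 qed
qed

lemma bnd2_xi: "bnd2 (Suc s) A F \<Longrightarrow> bnd2 s A (\<lambda>t xi. xi * F t xi)" proof (rule bnd2I)
 assume F: "bnd2 (Suc s) A F"
 show "continuous_on ({- 1..1} \<times> UNIV) (\<lambda>p. snd p * F (fst p) (snd p))"
  by (intro continuous_intros bnd2_contD[OF F])
 fix t xi :: real assume "t \<in> {-1..1}"
 then show "(1 + abs xi)^s * abs (xi * F t xi) \<le> A" using bndD(2)[OF bnd_xi[OF bnd2_slice[OF F]]] by blast
qed

lemma FF_cmult: "FF (\<lambda>xi. c * a xi) x = of_real c * FF a x"
 unfolding FF_def by (subst integral_mult_right_zero[symmetric]) (simp add: mult_ac)

lemma FF_add:
 assumes "integrable lborel a" "integrable lborel b"
 shows "FF (\<lambda>xi. a xi + b xi) x = FF a x + FF b x"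
 unfolding FF_def using FF_integrable[OF assms(1)] FF_integrable[OF assms(2)] by (simp add: distrib_left)

lemma FF_diff:
 assumes "integrable lborel a" "integrable lborel b"
 shows "FF (\<lambda>xi. a xi - b xi) x = FF a x - FF b x"
 unfolding FF_def using FF_integrable[OF assms(1)] FF_integrable[OF assms(2)] by (simp add: right_diff_distrib)

lemma FF_uminus: "FF a (- x) = FF (\<lambda>xi. a (- xi)) x"
 unfolding FF_def by (subst lborel_integral_real_affine[of "-1" _ 0]) auto

lemma FF_cnj: "cnj (FF a x) = FF (\<lambda>xi. a (- xi)) x" proof -
 have "cnj (FF a x) = FF a (- x)" proof -
  have "cnj (FF a x) = (LBINT xi. cnj (cis (xi * x) * of_real (a xi)))"
   unfolding FF_def by (rule Bochner_Integration.integral_cnj[symmetric])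
  then show ?thesis by (simp add: FF_def cis_cnj del: Bochner_Integration.integral_cnj)
 qed
 then show ?thesis by (simp add: FF_uminus)
qed

lemma FF_even_real:
 assumes "\<And>xi. a (- xi) = a xi" shows "Im (FF a x) = 0" "FF a x = of_real (Re (FF a x))" "FF a (- x) = FF a x" proof -
 have "cnj (FF a x) = FF a x" by (simp add: FF_cnj assms)
 then show "Im (FF a x) = 0" by (simp add: complex_eq_iff)
 then show "FF a x = of_real (Re (FF a x))" by (simp add: complex_eq_iff)
 show "FF a (- x) = FF a x" by (simp add: FF_uminus assms)
qed

lemma FF_x_deriv:
 assumes a: "bnd s A a" and s: "3 \<le> s"
 shows "(FF a has_vector_derivative (\<i> * FF (\<lambda>xi. xi * a xi) x)) (at x)" proof -
 obtain s' where s': "s = Suc s'" "2 \<le> s'" using s by (cases s) auto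
 have b: "bnd s' A (\<lambda>xi. xi * a xi)" using a s' bnd_xi by blast
 have "((\<lambda>x. LBINT xi. cis (xi * x) * of_real (a xi)) has_vector_derivative
   (LBINT xi. \<i> * (cis (xi * x) * of_real (xi * a xi)))) (at x within UNIV)"
 proof (rule has_vector_derivative_integral_dominated)
  show "integrable lborel (\<lambda>xi. abs (xi * a xi))" using bnd_integrable(1)[OF b s'(2)] by (rule integrable_abs)
  show "integrable lborel (\<lambda>xi. cis (xi * x) * of_real (a xi))" for x
   using bnd_integrable(1)[OF a] s by (intro FF_integrable) auto
  show "(\<lambda>xi. \<i> * (cis (xi * x) * of_real (xi * a xi))) \<in> borel_measurable lborel" for x
   using bndD(6)[OF a] by measurable
  show "norm (\<i> * (cis (xi * x) * of_real (xi * a xi))) \<le> abs (xi * a xi)" for x xi by (simp add: norm_mult abs_mult)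
  show "((\<lambda>x. cis (xi * x) * of_real (a xi)) has_vector_derivative
    \<i> * (cis (xi * x) * of_real (xi * a xi))) (at x within UNIV)" for x xi
   by (auto simp: has_vector_derivative_def scaleR_conv_of_real mult_ac intro!: derivative_eq_intros ext)
 qed auto
 then show ?thesis by (simp add: FF_def [abs_def])
qed

lemma FF_t_deriv:
 assumes F: "bnd2 s A F" and F': "bnd2 s' B F'" and s: "2 \<le> s" "2 \<le> s'"
  and d: "\<And>t xi. t \<in> {-1..1} \<Longrightarrow> ((\<lambda>t. F t xi) has_real_derivative F' t xi) (at t within {-1..1})"
  and t: "t \<in> {-1..1}"
 shows "((\<lambda>t. FF (F t) x) has_vector_derivative FF (F' t) x) (at t within {-1..1})" unfolding FF_def
proof (rule has_vector_derivative_integral_dominated)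
 show "convex {-1..1::real}" "t \<in> {-1..1}" using t by auto
 show "integrable lborel (\<lambda>r. B * (1 / (1 + abs r)^s'))" by (intro integrable_mult_right integrable_weight s)
 fix t :: real assume t: "t \<in> {-1..1}"
 show "integrable lborel (\<lambda>xi. cis (xi * x) * of_real (F t xi))"
  by (intro FF_integrable bnd_integrable[OF bnd2_slice[OF F t] s(1)])
 show "(\<lambda>xi. cis (xi * x) * of_real (F' t xi)) \<in> borel_measurable lborel"
  by (intro borel_measurable_integrable FF_integrable bnd_integrable[OF bnd2_slice[OF F' t] s(2)])
 fix xi
 show "norm (cis (xi * x) * of_real (F' t xi)) \<le> B * (1 / (1 + abs xi)^s')"
  using bndD(3)[OF bnd2_slice[OF F' t], of xi] by (simp add: norm_mult)
 show "((\<lambda>x'. cis (xi * x) * of_real (F x' xi)) has_vector_derivative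
   cis (xi * x) * of_real (F' t xi)) (at t within {- 1..1})" using d[OF t, of xi]
  by (intro has_vector_derivative_mult_right has_vector_derivative_of_real)
    (simp add: has_real_derivative_iff_has_vector_derivative)
qed

text \<open>Fubini. Convolution of densities is how every product of fields enters the equations.\<close>

lemma FF_conv:
 assumes a: "bnd s A a" and b: "bnd s B b" and s: "2 \<le> s"
 shows "FF (conv a b) x = FF a x * FF b x" proof -
 define g where "g t xi = cis (xi * x) * of_real (a (xi - t) * b t)" for t xi
 have [measurable]: "a \<in> borel_measurable borel" "b \<in> borel_measurable borel" using bndD(6)[OF a] bndD(6)[OF b] by auto
 have ia: "integrable lborel a" and ib: "integrable lborel b" using bnd_integrable(1) a b s by auto
 have ish: "integrable lborel (\<lambda>xi. a (xi - t))" for t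
  using lborel_integrable_real_affine[OF ia, of 1 "- t"] by (simp add: add.commute)
 have ash: "(LBINT xi. abs (a (xi - t))) = (LBINT xi. abs (a xi))" for t
  using lborel_integral_real_affine[of 1 "\<lambda>xi. abs (a xi)" "- t"] by (simp add: add.commute)
 have gint: "integrable (lborel \<Otimes>\<^sub>M lborel) (\<lambda>(t, xi). g t xi)" proof (rule lborel_pair.Fubini_integrable)
  show "(\<lambda>(t, xi). g t xi) \<in> borel_measurable (lborel \<Otimes>\<^sub>M lborel)" unfolding g_def by measurable
  have "(\<lambda>t. LBINT xi. norm (case (t, xi) of (t, xi) \<Rightarrow> g t xi)) = (\<lambda>t. (LBINT xi. abs (a xi)) * abs (b t))"
   by (rule ext) (simp add: g_def norm_mult ash)
  then show "integrable lborel (\<lambda>t. LBINT xi. norm (case (t, xi) of (t, xi) \<Rightarrow> g t xi))" using ib by simp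
  show "AE t in lborel. integrable lborel (\<lambda>xi. case (t, xi) of (t, xi) \<Rightarrow> g t xi)"
   using FF_integrable[OF integrable_mult_left[OF ish]] by (intro AE_I2) (simp add: g_def)
 qed
 have "FF (conv a b) x = (LBINT xi. LBINT t. g t xi)"
  unfolding FF_def g_def conv_def by (simp only: integral_mult_right_zero integral_complex_of_real)
 also have "... = (LBINT t. LBINT xi. g t xi)" using lborel_pair.Fubini_integral[OF gint] .
 also have "... = (LBINT t. cis (t * x) * of_real (b t) * FF a x)" proof (rule Bochner_Integration.integral_cong)
  fix t
  have "(LBINT xi. g t xi) = (LBINT xi. g t (t + 1 * xi))" using lborel_integral_real_affine[of 1 "g t" t] by simp
  also have "... = (LBINT xi. (cis (t * x) * of_real (b t)) * (cis (xi * x) * of_real (a xi)))"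
  proof (rule Bochner_Integration.integral_cong)
   fix xi
   have "cis ((t + 1 * xi) * x) = cis (t * x) * cis (xi * x)" by (simp add: cis_mult distrib_right)
   then show "g t (t + 1 * xi) = (cis (t * x) * of_real (b t)) * (cis (xi * x) * of_real (a xi))" by (simp add: g_def mult_ac)
  qed simp
  also have "... = cis (t * x) * of_real (b t) * FF a x" unfolding FF_def by (rule integral_mult_right_zero)
  finally show "(LBINT xi. g t xi) = cis (t * x) * of_real (b t) * FF a x" .
 qed simp
 also have "... = FF a x * FF b x" by (simp add: FF_def mult.commute)
 finally show ?thesis .
qed

text \<open>Riemann--Lebesgue: shifting the frequency by half a period of the oscillation
 flips the sign of the integral, and translation is continuous in mean.\<close>

lemma FF_tendsto_0_at_top:
 assumes a: "bnd s A a" and s: "2 \<le> s"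
 shows "(FF a \<longlongrightarrow> 0) at_top" proof -
 note a2 = bnd_weaken[OF a s order_refl]
 have [measurable]: "a \<in> borel_measurable borel" using bndD(6)[OF a] by auto
 have ia: "integrable lborel a" using bnd_integrable(1)[OF a s] .
 define m where "m h = (LBINT xi. abs (a xi - a (xi - h)))" for h
 have "continuous_on {-1..1} m" unfolding m_def proof (rule continuous_on_integral_dominated)
  show "integrable lborel (\<lambda>xi. 5 * A * (1 / (1 + abs xi)^2))" by (intro integrable_mult_right integrable_weight2)
  show "continuous_on {-1..1} (\<lambda>h. abs (a xi - a (xi - h)))" for xi
   by (intro continuous_intros continuous_on_compose2[OF bndD(1)[OF a, of UNIV]]) auto
  fix h xi :: real assume h: "h \<in> {-1..1}"
  have "1 + abs xi \<le> 2 * (1 + abs (xi - h))" using h by (auto simp: abs_if)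
  then have "(1 + abs xi)^2 \<le> (2 * (1 + abs (xi - h)))^2" by (rule power_mono) auto
  then have "(1 + abs xi)^2 \<le> 4 * (1 + abs (xi - h))^2" unfolding power_mult_distrib by simp
  then have "(1 + abs xi)^2 * abs (a (xi - h)) \<le> 4 * (1 + abs (xi - h))^2 * abs (a (xi - h))" by (intro mult_right_mono) auto
  also have "... \<le> 4 * A" using bndD(2)[OF a2, of "xi - h"] by simp
  finally have "(1 + abs xi)^2 * (abs (a xi) + abs (a (xi - h))) \<le> 5 * A"
   using bndD(2)[OF a2, of xi] by (simp add: distrib_left)
  then have "abs (a xi) + abs (a (xi - h)) \<le> 5 * A * (1 / (1 + abs xi)^2)" by (simp add: pos_le_divide_eq mult.commute)
  then show "norm (abs (a xi - a (xi - h))) \<le> 5 * A * (1 / (1 + abs xi)^2)" by simp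
 qed simp
 then have "(m \<longlongrightarrow> m 0) (at 0 within {-1..1})" by (simp add: continuous_on_def)
 then have m0: "(m \<longlongrightarrow> 0) (at 0 within {-1..1})" by (simp add: m_def)
 have le: "norm (FF a x) \<le> m (pi / x) / 2" if x: "x > 0" for x proof -
  have ish: "integrable lborel (\<lambda>xi. a (xi - pi / x))"
   using lborel_integrable_real_affine[OF ia, of 1 "- pi / x"] by (simp add: add.commute)
  have "FF (\<lambda>xi. a (xi - pi / x)) x = (LBINT xi. cis ((pi / x + 1 * xi) * x) * of_real (a ((pi / x + 1 * xi) - pi / x)))"
   unfolding FF_def by (subst lborel_integral_real_affine[of 1 _ "pi / x"]) auto
  also have "... = (LBINT xi. (- 1) * (cis (xi * x) * of_real (a xi)))"
   using x by (intro Bochner_Integration.integral_cong) (auto simp: distrib_right cis_mult[symmetric])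
  also have "... = - FF a x" by (simp add: FF_def)
  finally have "2 * FF a x = FF (\<lambda>xi. a xi - a (xi - pi / x)) x" by (simp add: FF_diff[OF ia ish])
  then have "2 * norm (FF a x) = norm (FF (\<lambda>xi. a xi - a (xi - pi / x)) x)" by (metis norm_mult norm_numeral)
  also have "... \<le> m (pi / x)" unfolding m_def by (rule FF_norm_le)
  finally show ?thesis by simp
 qed
 have "filterlim (\<lambda>x. pi / x) (at 0 within {-1..1}) at_top" unfolding filterlim_at proof
  show "\<forall>\<^sub>F x in at_top. pi / x \<in> {-1..1} \<and> pi / x \<noteq> 0"
   using eventually_gt_at_top[of pi] proof eventually_elim
   case (elim x)
   then have "0 < x" using pi_gt_zero by linarith
   then have "0 < pi / x" "pi / x \<le> 1" using elim by (simp_all add: divide_le_eq)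
   moreover have "- 1 \<le> pi / x" using \<open>0 < pi / x\<close> by linarith
   ultimately show ?case using \<open>0 < x\<close> by simp
  qed
  show "((\<lambda>x. pi / x) \<longlongrightarrow> 0) at_top" by real_asymp
 qed
 from filterlim_compose[OF m0 this] have "((\<lambda>x. m (pi / x)) \<longlongrightarrow> 0) at_top" .
 then have "((\<lambda>x. m (pi / x) / 2) \<longlongrightarrow> 0) at_top" using tendsto_divide[of _ 0 _ "\<lambda>_. 2" 2] by simp
 then show ?thesis by (rule Lim_null_comparison[rotated])
    (use le in \<open>auto intro!: eventually_mono[OF eventually_gt_at_top[of 0]]\<close>)
qed

lemma bnd_uminus: "bnd s A a \<Longrightarrow> bnd s A (\<lambda>xi. a (- xi))" unfolding bnd_def
 by (auto intro!: continuous_on_compose2[of UNIV a] continuous_intros dest: spec[of _ "- _"])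

lemma FF_tendsto_0_at_bot:
 assumes a: "bnd s A a" and s: "2 \<le> s"
 shows "(FF a \<longlongrightarrow> 0) at_bot"
 unfolding filterlim_at_bot_mirror using FF_tendsto_0_at_top[OF bnd_uminus[OF a] s] by (simp add: FF_uminus[abs_def])

section \<open>Fourier cosine transform and inversion\<close>

text \<open>The normalisation makes \<open>FF\<close> the inverse of \<open>FT\<close> on even functions.\<close>

definition "FT g xi = (1 / (2 * pi)) * (LBINT x. cos (xi * x) * g x)"

lemma cos_sin_measurable [measurable]:
 "(cos :: real \<Rightarrow> real) \<in> borel_measurable borel" "(sin :: real \<Rightarrow> real) \<in> borel_measurable borel"
 by (intro borel_measurable_continuous_onI continuous_intros)+

lemma FT_even: "FT g (- xi) = FT g xi" by (simp add: FT_def)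

lemma cos_integrable:
 fixes g :: "real \<Rightarrow> real"
 assumes "integrable lborel g" shows "integrable lborel (\<lambda>x. cos (xi * x) * g x)"
proof (rule Bochner_Integration.integrable_bound[OF assms])
 show "(\<lambda>x. cos (xi * x) * g x) \<in> borel_measurable lborel" using borel_measurable_integrable[OF assms] by measurable
 show "AE x in lborel. norm (cos (xi * x) * g x) \<le> norm (g x)" by (rule AE_I2) (simp add: abs_mult mult_left_le_one_le)
qed

lemma sin_integrable:
 fixes g :: "real \<Rightarrow> real"
 assumes "integrable lborel g" shows "integrable lborel (\<lambda>x. sin (xi * x) * g x)"
proof (rule Bochner_Integration.integrable_bound[OF assms])
 show "(\<lambda>x. sin (xi * x) * g x) \<in> borel_measurable lborel" using borel_measurable_integrable[OF assms] by measurable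
 show "AE x in lborel. norm (sin (xi * x) * g x) \<le> norm (g x)" by (rule AE_I2) (simp add: abs_mult mult_left_le_one_le)
qed

lemma FT_abs_le:
 assumes "integrable lborel g" shows "abs (FT g xi) \<le> (1 / (2 * pi)) * (LBINT x. abs (g x))" proof -
 have "abs (LBINT x. cos (xi * x) * g x) \<le> (LBINT x. abs (cos (xi * x) * g x))" by (rule integral_abs_bound)
 also have "... \<le> (LBINT x. abs (g x))" using assms cos_integrable[OF assms]
  by (intro integral_mono integrable_abs) (auto simp: abs_mult mult_left_le_one_le)
 finally show ?thesis by (simp add: FT_def abs_mult divide_right_mono)
qed

lemma FT_continuous:
 assumes "integrable lborel g" shows "continuous_on UNIV (FT g)" proof -
 have "continuous_on UNIV (\<lambda>xi. LBINT x. cos (xi * x) * g x)"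
 proof (rule continuous_on_integral_dominated[where G = "\<lambda>x. abs (g x)"])
  show "(\<lambda>x. cos (xi * x) * g x) \<in> borel_measurable lborel" for xi using cos_integrable[OF assms] by auto
 qed (use assms in \<open>auto simp: abs_mult mult_left_le_one_le intro!: continuous_intros\<close>)
 then show ?thesis unfolding FT_def[abs_def] by (intro continuous_intros)
qed

lemma FT_add:
 assumes "integrable lborel f" "integrable lborel g"
 shows "FT (\<lambda>x. f x + g x) xi = FT f xi + FT g xi"
 unfolding FT_def using cos_integrable[OF assms(1), of xi] cos_integrable[OF assms(2), of xi] by (simp add: distrib_left)

lemma FT_cmult: "FT (\<lambda>x. c * g x) xi = c * FT g xi" proof -
 have "(LBINT x. cos (xi * x) * (c * g x)) = c * (LBINT x. cos (xi * x) * g x)"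
  by (subst integral_mult_right_zero[symmetric]) (simp add: mult_ac)
 then show ?thesis by (simp add: FT_def)
qed

lemma odd_integral_0:
 fixes f :: "real \<Rightarrow> real"
 assumes "\<And>x. f (- x) = - f x" shows "(LBINT x. f x) = 0" using lborel_integral_real_affine[of "-1" f 0] by (simp add: assms)

lemma FT_cis:
 assumes "integrable lborel g" and even: "\<And>x. g (- x) = g x"
 shows "(LBINT x. cis (xi * x) * of_real (g x)) = 2 * pi * FT g xi" proof -
 have c: "integrable lborel (\<lambda>x. cis (xi * x) * of_real (g x))"
  using FF_integrable[OF assms(1), of xi] by (simp add: mult.commute)
 have "(LBINT x. sin (xi * x) * g x) = 0" by (rule odd_integral_0) (simp add: even)
 then have "Im (LBINT x. cis (xi * x) * of_real (g x)) = 0" by (simp add: integral_Im[symmetric] c)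
 moreover have "Re (LBINT x. cis (xi * x) * of_real (g x)) = 2 * pi * FT g xi" by (simp add: integral_Re[symmetric] c FT_def)
 ultimately show ?thesis by (simp add: complex_eq_iff)
qed

lemma gaussian_integral_cis:
 "integrable lborel (\<lambda>v. cis (t * v) * of_real (std_normal_density v))"
 "(LBINT v. cis (t * v) * of_real (std_normal_density v)) = of_real (exp (- (t\<^sup>2) / 2))" proof -
 have "integrable lborel std_normal_density" using integrable_normal_moment[of 1 0 0] by simp
 then show "integrable lborel (\<lambda>v. cis (t * v) * of_real (std_normal_density v))"
  using FF_integrable[of std_normal_density t] by (simp add: mult.commute)
 have "(LBINT v. cis (t * v) * of_real (std_normal_density v))
   = (LBINT v. std_normal_density v *\<^sub>R iexp (t * v))" by (simp add: cis_conv_exp scaleR_conv_of_real mult.commute)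
 also have "... = char std_normal_distribution t" unfolding char_def by (rule integral_density[symmetric]) auto
 finally show "(LBINT v. cis (t * v) * of_real (std_normal_density v)) = of_real (exp (- (t\<^sup>2) / 2))"
  by (simp add: char_std_normal_distribution)
qed

text \<open>Damping the frequencies by a Gaussian makes the double integral absolutely convergent. Exchanging
the integrals leaves the Fourier transform of the Gaussian, that is, a Gaussian average of \<open>g\<close> over
the scale \<open>d\<close>; inversion is the limit \<open>d \<rightarrow> 0\<close>.\<close>

lemma gaussian_regularised_inversion:
 assumes g: "integrable lborel g" and even: "\<And>x. g (- x) = g x" and d: "0 < d"
 shows "(LBINT xi. cis (xi * x) * of_real (FT g xi * exp (- (d * xi)\<^sup>2 / 2)))
   = of_real (LBINT u. g (x - d * u) * std_normal_density u)" proof -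
 have [measurable]: "g \<in> borel_measurable borel" using g by auto
 define k where "k xi y = of_real (exp (- (d * xi)\<^sup>2 / 2) / (2 * pi)) * cis (xi * (x - y)) * of_real (g y)" for xi y
 have e_int: "integrable lborel (\<lambda>xi. exp (- (d * xi)\<^sup>2 / 2))" proof -
  have "integrable lborel (\<lambda>v. sqrt (2 * pi) * std_normal_density v)" using integrable_normal_moment[of 1 0 0] by simp
  then have "integrable lborel (\<lambda>v::real. exp (- v\<^sup>2 / 2))" by (simp add: std_normal_density_def)
  then show ?thesis using lborel_integrable_real_affine[of "\<lambda>v::real. exp (- v\<^sup>2 / 2)" d 0] d by simp
 qed
 have kint: "integrable (lborel \<Otimes>\<^sub>M lborel) (\<lambda>(xi, y). k xi y)" proof (rule lborel_pair.Fubini_integrable)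
  show "(\<lambda>(xi, y). k xi y) \<in> borel_measurable (lborel \<Otimes>\<^sub>M lborel)" unfolding k_def by measurable
  have "(\<lambda>xi. LBINT y. norm (case (xi, y) of (xi, y) \<Rightarrow> k xi y)) = (\<lambda>xi. exp (- (d * xi)\<^sup>2 / 2) * ((LBINT y. abs (g y)) / (2 * pi)))"
   by (rule ext) (simp add: k_def norm_mult norm_divide)
  then show "integrable lborel (\<lambda>xi. LBINT y. norm (case (xi, y) of (xi, y) \<Rightarrow> k xi y))" using e_int by simp
  have "integrable lborel (\<lambda>y. k xi y)" for xi proof (rule Bochner_Integration.integrable_bound)
   show "integrable lborel (\<lambda>y. (exp (- (d * xi)\<^sup>2 / 2) / (2 * pi)) * g y)" using g by simp
   show "k xi \<in> borel_measurable lborel" unfolding k_def[abs_def] by measurable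
  qed (auto simp: k_def norm_mult norm_divide abs_mult)
  then show "AE xi in lborel. integrable lborel (\<lambda>y. case (xi, y) of (xi, y) \<Rightarrow> k xi y)" by simp
 qed
 have "(LBINT xi. cis (xi * x) * of_real (FT g xi * exp (- (d * xi)\<^sup>2 / 2))) = (LBINT xi. LBINT y. k xi y)"
 proof (rule Bochner_Integration.integral_cong)
  fix xi
  have "(LBINT y. k xi y) = (LBINT y. (of_real (exp (- (d * xi)\<^sup>2 / 2) / (2 * pi)) * cis (xi * x)) * (cis (- xi * y) * of_real (g y)))"
  proof (rule Bochner_Integration.integral_cong)
   fix y
   have "cis (xi * (x - y)) = cis (xi * x) * cis (- xi * y)" by (simp add: cis_mult algebra_simps)
   then show "k xi y = (of_real (exp (- (d * xi)\<^sup>2 / 2) / (2 * pi)) * cis (xi * x)) * (cis (- xi * y) * of_real (g y))"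
    by (simp add: k_def mult_ac)
  qed simp
  also have "... = (of_real (exp (- (d * xi)\<^sup>2 / 2) / (2 * pi)) * cis (xi * x)) * (2 * pi * FT g xi)"
   using FT_cis[OF g even, of "- xi"] by (simp add: FT_even)
  finally show "cis (xi * x) * of_real (FT g xi * exp (- (d * xi)\<^sup>2 / 2)) = (LBINT y. k xi y)" by simp
 qed simp
 also have "... = (LBINT y. LBINT xi. k xi y)" using lborel_pair.Fubini_integral[OF kint] by simp
 also have "... = (LBINT y. of_real (g y * (std_normal_density ((x - y) / d) / d)))"
 proof (rule Bochner_Integration.integral_cong)
  fix y
  have "(LBINT xi. k xi y) = (1 / d) *\<^sub>R (LBINT v. k (v / d) y)"
   using lborel_integral_real_affine[of "1 / d" "\<lambda>xi. k xi y" 0] d by simp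
  also have "(LBINT v. k (v / d) y) = (LBINT v. of_real (g y / sqrt (2 * pi)) * (cis ((x - y) / d * v) * of_real (std_normal_density v)))"
  proof (rule Bochner_Integration.integral_cong)
   fix v
   have "sqrt (2 * pi) * sqrt (2 * pi) = 2 * pi" by simp
   then have "exp (- v\<^sup>2 / 2) / (2 * pi) = std_normal_density v / sqrt (2 * pi)"
    by (simp add: std_normal_density_def field_simps)
   then have "k (v / d) y = of_real (std_normal_density v / sqrt (2 * pi)) * cis (v / d * (x - y)) * of_real (g y)"
    using d by (simp add: k_def)
   then show "k (v / d) y = of_real (g y / sqrt (2 * pi)) * (cis ((x - y) / d * v) * of_real (std_normal_density v))"
    by (simp add: mult_ac)
  qed simp
  also have "... = of_real (g y / sqrt (2 * pi)) * of_real (exp (- (((x - y) / d)\<^sup>2) / 2))"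
   unfolding integral_mult_right_zero gaussian_integral_cis(2) ..
  also have "(1 / d) *\<^sub>R ... = of_real (g y * (std_normal_density ((x - y) / d) / d))"
   by (simp add: std_normal_density_def scaleR_conv_of_real)
  finally show "(LBINT xi. k xi y) = of_real (g y * (std_normal_density ((x - y) / d) / d))" .
 qed simp
 also have "... = of_real (LBINT y. g y * (std_normal_density ((x - y) / d) / d))" by (rule integral_complex_of_real)
 also have "(LBINT y. g y * (std_normal_density ((x - y) / d) / d)) = (LBINT u. g (x - d * u) * std_normal_density u)"
  using lborel_integral_real_affine[of "- d" "\<lambda>y. g y * (std_normal_density ((x - y) / d) / d)" x] d by simp
 finally show ?thesis .
qed

lemma FT_inversion:
 assumes g: "integrable lborel g" and even: "\<And>x. g (- x) = g x"
  and cont: "continuous_on UNIV g" and bdd: "\<And>x. abs (g x) \<le> B"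
  and ghat: "integrable lborel (FT g)"
 shows "FF (FT g) x = of_real (g x)" proof -
 have [measurable]: "g \<in> borel_measurable borel" "FT g \<in> borel_measurable borel" using g ghat by auto
 define d where "d n = 1 / real (Suc n)" for n
 have d0: "d \<longlonglongrightarrow> 0" unfolding d_def by real_asymp
 have 1: "(\<lambda>n. LBINT xi. cis (xi * x) * of_real (FT g xi * exp (- (d n * xi)\<^sup>2 / 2))) \<longlonglongrightarrow>
   (LBINT xi. cis (xi * x) * of_real (FT g xi))"
 proof (rule integral_dominated_convergence[where w = "\<lambda>xi. abs (FT g xi)"])
  show "AE xi in lborel. (\<lambda>n. cis (xi * x) * of_real (FT g xi * exp (- (d n * xi)\<^sup>2 / 2)))
    \<longlonglongrightarrow> cis (xi * x) * of_real (FT g xi)" proof (rule AE_I2)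
   fix xi
   have "(\<lambda>n. cis (xi * x) * of_real (FT g xi * exp (- (d n * xi)\<^sup>2 / 2)))
     \<longlonglongrightarrow> cis (xi * x) * of_real (FT g xi * exp (- (0 * xi)\<^sup>2 / 2))" by (intro tendsto_intros d0) auto
   then show "(\<lambda>n. cis (xi * x) * of_real (FT g xi * exp (- (d n * xi)\<^sup>2 / 2)))
    \<longlonglongrightarrow> cis (xi * x) * of_real (FT g xi)" by simp
  qed
  show "AE xi in lborel. norm (cis (xi * x) * of_real (FT g xi * exp (- (d n * xi)\<^sup>2 / 2))) \<le> abs (FT g xi)" for n
   by (rule AE_I2) (simp add: norm_mult mult_left_le)
 qed (use ghat in auto)
 have 2: "(\<lambda>n. LBINT u. g (x - d n * u) * std_normal_density u) \<longlonglongrightarrow> (LBINT u. g x * std_normal_density u)"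
 proof (rule integral_dominated_convergence[where w = "\<lambda>u. B * std_normal_density u"])
  show "integrable lborel (\<lambda>u. B * std_normal_density u)" using integrable_normal_moment[of 1 0 0] by simp
  show "AE u in lborel. (\<lambda>n. g (x - d n * u) * std_normal_density u) \<longlonglongrightarrow> g x * std_normal_density u"
  proof (rule AE_I2)
   fix u
   have "(\<lambda>n. x - d n * u) \<longlonglongrightarrow> x - 0 * u" by (intro tendsto_intros d0)
   then have "(\<lambda>n. g (x - d n * u)) \<longlonglongrightarrow> g x"
    using continuous_on_tendsto_compose[OF cont, of "\<lambda>n. x - d n * u" x] by simp
   then show "(\<lambda>n. g (x - d n * u) * std_normal_density u) \<longlonglongrightarrow> g x * std_normal_density u"
    by (intro tendsto_intros)
  qed
  show "AE u in lborel. norm (g (x - d n * u) * std_normal_density u) \<le> B * std_normal_density u" for n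
   using bdd by (intro AE_I2) (simp add: abs_mult mult_right_mono)
 qed auto
 have 3: "(LBINT xi. cis (xi * x) * of_real (FT g xi * exp (- (d n * xi)\<^sup>2 / 2)))
   = of_real (LBINT u. g (x - d n * u) * std_normal_density u)" for n
  by (rule gaussian_regularised_inversion[OF g even]) (simp add: d_def)
 have "(LBINT u. g x * std_normal_density u) = g x" using integral_normal_moment_even[of 1 0 0] by simp
 then have "(\<lambda>n. of_real (LBINT u. g (x - d n * u) * std_normal_density u)) \<longlonglongrightarrow> complex_of_real (g x)"
  using tendsto_of_real[OF 2] by simp
 then show ?thesis using 1 unfolding 3 FF_def by (rule LIMSEQ_unique[rotated])
qed

section \<open>The linearisation at the solitary wave\<close>

definition sech2 :: "real \<Rightarrow> real" where "sech2 x = 1 / (cosh x)\<^sup>2"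
text \<open>Up to a factor \<open>hv\<close> is the derivative of \<open>sech2\<close>. It solves the equation
\<open>w'' = (4 - 12 sech2) w\<close>, the linearisation at the solitary wave, because of translation invariance.
The function \<open>hp\<close> below is a second solution, even and growing like \<open>exp (2 |x|)\<close>, obtained by
reduction of order. The functions \<open>hv1\<close> and \<open>hp1\<close> are their derivatives.\<close>

definition "hv x = sech2 x * tanh x"
definition "hv1 x = 3 * (sech2 x)\<^sup>2 - 2 * sech2 x"
definition "hp x = 2 * (cosh x)\<^sup>2 + 5 - 15 * sech2 x + 15 * x * hv x"
definition "hp1 x = 4 * cosh x * sinh x + 45 * hv x + 15 * x * hv1 x"

lemma cosh_nz: "cosh (x::real) \<noteq> 0" using cosh_real_pos[of x] by linarith

lemma sech2_cosh: "sech2 x * (cosh x)\<^sup>2 = 1" by (simp add: sech2_def cosh_nz)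

lemma tanh_sq: "(tanh x)\<^sup>2 = 1 - sech2 x" proof -
 have "(sinh x)\<^sup>2 = (cosh x)\<^sup>2 - 1" using cosh_square_eq[of x] by simp
 then show ?thesis using cosh_nz[of x] by (simp add: tanh_def sech2_def power_divide field_simps)
qed

lemma sech2_deriv: "(sech2 has_real_derivative - 2 * hv x) (at x)" proof -
 have "((\<lambda>x. 1 / (cosh x)\<^sup>2) has_real_derivative - 2 * hv x) (at x)" using cosh_nz[of x]
  by (auto intro!: derivative_eq_intros simp: hv_def sech2_def tanh_def field_simps power2_eq_square)
 then show ?thesis by (simp add: sech2_def[abs_def])
qed

lemma tanh_deriv: "((tanh :: real \<Rightarrow> real) has_real_derivative sech2 x) (at x)"
 using cosh_nz[of x] by (auto intro!: derivative_eq_intros simp: tanh_sq)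

lemma hv_deriv: "(hv has_real_derivative hv1 x) (at x)" proof -
 have "((\<lambda>x. sech2 x * tanh x) has_real_derivative - 2 * hv x * tanh x + sech2 x * sech2 x) (at x)"
  using DERIV_mult'[OF sech2_deriv tanh_deriv, of x] by (simp add: add.commute)
 moreover have "- 2 * hv x * tanh x + sech2 x * sech2 x = hv1 x" proof -
  have "- 2 * hv x * tanh x + sech2 x * sech2 x = - 2 * sech2 x * (tanh x)\<^sup>2 + (sech2 x)\<^sup>2"
   by (simp add: hv_def power2_eq_square)
  then show ?thesis unfolding tanh_sq hv1_def by (simp add: algebra_simps power2_eq_square)
 qed
 ultimately show ?thesis by (simp only: hv_def[abs_def])
qed

lemma hv1_deriv: "(hv1 has_real_derivative (4 - 12 * sech2 x) * hv x) (at x)" unfolding hv1_def[abs_def]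
 by (auto intro!: derivative_eq_intros sech2_deriv simp: algebra_simps)

lemma hp_deriv: "(hp has_real_derivative hp1 x) (at x)" unfolding hp_def[abs_def] hp1_def
 by (auto intro!: derivative_eq_intros sech2_deriv hv_deriv simp: algebra_simps)

lemma hp1_deriv: "(hp1 has_real_derivative (4 - 12 * sech2 x) * hp x) (at x)" proof -
 have "(hp1 has_real_derivative 4 * ((sinh x)\<^sup>2 + (cosh x)\<^sup>2) + 60 * hv1 x + 15 * x * ((4 - 12 * sech2 x) * hv x)) (at x)"
  unfolding hp1_def[abs_def] by (auto intro!: derivative_eq_intros hv_deriv hv1_deriv simp: algebra_simps power2_eq_square)
 moreover have "4 * ((sinh x)\<^sup>2 + (cosh x)\<^sup>2) + 60 * hv1 x = (4 - 12 * sech2 x) * (2 * (cosh x)\<^sup>2 + 5 - 15 * sech2 x)"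
 proof -
  have s: "(sinh x)\<^sup>2 = (cosh x)\<^sup>2 - 1" using cosh_square_eq[of x] by simp
  show ?thesis using sech2_cosh[of x] unfolding s hv1_def by algebra
 qed
 moreover have "15 * x * ((4 - 12 * sech2 x) * hv x) + (4 - 12 * sech2 x) * (2 * (cosh x)\<^sup>2 + 5 - 15 * sech2 x)
   = (4 - 12 * sech2 x) * hp x" by (simp add: hp_def algebra_simps)
 ultimately show ?thesis by (elim DERIV_cong) linarith
qed

lemma hp_hv_wronskian: "hp x * hv1 x - hp1 x * hv x = - 8" proof -
 have 1: "cosh x * sinh x * sech2 x = tanh x" using cosh_nz[of x] by (simp add: sech2_def tanh_def power2_eq_square)
 have "hp x * hv1 x - hp1 x * hv x = (2 * (cosh x)\<^sup>2 + 5 - 15 * sech2 x) * hv1 x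
   - 4 * (cosh x * sinh x * sech2 x) * tanh x - 45 * (sech2 x)\<^sup>2 * (tanh x)\<^sup>2"
  by (simp add: hp_def hp1_def hv_def algebra_simps power2_eq_square)
 also have "... = (2 * (cosh x)\<^sup>2 + 5 - 15 * sech2 x) * hv1 x - 4 * (tanh x)\<^sup>2 - 45 * (sech2 x)\<^sup>2 * (tanh x)\<^sup>2"
  unfolding 1 by (simp add: power2_eq_square)
 also have "... = - 8" using sech2_cosh[of x] unfolding tanh_sq hv1_def by algebra
 finally show ?thesis .
qed

lemma sech2_even: "sech2 (- x) = sech2 x" by (simp add: sech2_def)
lemma hv_odd: "hv (- x) = - hv x" by (simp add: hv_def sech2_even)
lemma hp_even: "hp (- x) = hp x" by (simp add: hp_def sech2_even hv_odd)

lemma sech2_pos: "0 < sech2 x" by (simp add: sech2_def cosh_nz)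

lemma sech2_le_1: "sech2 x \<le> 1" using zero_le_power2[of "tanh x"] unfolding tanh_sq by simp

lemma cosh_le_exp: "cosh (x::real) \<le> exp (abs x)" by (simp add: cosh_def abs_if)

lemma cosh_ge_exp: "exp (abs (x::real)) / 2 \<le> cosh x" by (simp add: cosh_def abs_if)

lemma exp_abs_sq: "(exp (abs x))\<^sup>2 = exp (2 * abs (x::real))" by (simp add: exp_double)

lemma sech2_bound: "sech2 x \<le> 4 * exp (- 2 * abs x)" proof -
 have "(exp (abs x) / 2)\<^sup>2 \<le> (cosh x)\<^sup>2" by (rule power_mono[OF cosh_ge_exp]) simp
 then have "exp (2 * abs x) / 4 \<le> (cosh x)\<^sup>2" by (simp add: power_divide exp_abs_sq)
 then have "1 / (cosh x)\<^sup>2 \<le> 1 / (exp (2 * abs x) / 4)" by (rule divide_left_mono) (auto simp: cosh_nz)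
 then show ?thesis by (simp add: sech2_def exp_minus inverse_eq_divide)
qed

lemma abs_tanh_le_1: "abs (tanh (x::real)) \<le> 1" using tanh_real_bounds[of x] by auto

lemma hv_bound: "abs (hv x) \<le> 4 * exp (- 2 * abs x)" proof -
 have "abs (hv x) \<le> sech2 x * 1" unfolding hv_def abs_mult using sech2_pos[of x] by (intro mult_mono abs_tanh_le_1) auto
 then show ?thesis using sech2_bound[of x] by simp
qed

lemma hv1_bound: "abs (hv1 x) \<le> 20 * exp (- 2 * abs x)" proof -
 have "(sech2 x)\<^sup>2 \<le> sech2 x" using sech2_le_1[of x] sech2_pos[of x] by (simp add: power2_eq_square mult_left_le)
 then have "abs (hv1 x) \<le> 5 * sech2 x" unfolding hv1_def using sech2_pos[of x] zero_le_power2[of "sech2 x"] by linarith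
 then show ?thesis using sech2_bound[of x] by simp
qed

lemma x_exp_le: "abs x * exp (- 2 * abs (x::real)) \<le> 1" proof -
 have "abs x \<le> exp (2 * abs x)" using exp_ge_add_one_self[of "2 * abs x"] by linarith
 then show ?thesis by (simp add: exp_minus divide_simps)
qed

lemma hp_bound: "abs (hp x) \<le> 82 * exp (2 * abs x)" proof -
 have "(cosh x)\<^sup>2 \<le> (exp (abs x))\<^sup>2" by (rule power_mono[OF cosh_le_exp]) simp
 then have c: "(cosh x)\<^sup>2 \<le> exp (2 * abs x)" by (simp add: exp_abs_sq)
 have "abs x * abs (hv x) \<le> abs x * (4 * exp (- 2 * abs x))" by (intro mult_left_mono hv_bound) auto
 then have xv: "abs (x * hv x) \<le> 4" using x_exp_le[of x] by (simp add: abs_mult)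
 have "1 \<le> exp (2 * abs x)" by simp
 then show ?thesis unfolding hp_def mult.assoc[of 15]
  using c xv sech2_pos[of x] sech2_le_1[of x] zero_le_power2[of "cosh x"] by linarith
qed

lemma hp1_bound: "abs (hp1 x) \<le> 484 * exp (2 * abs x)" proof -
 have "abs (sinh x) \<le> cosh x" by (simp add: sinh_def cosh_def abs_le_iff)
 then have "cosh x * abs (sinh x) \<le> exp (abs x) * exp (abs x)" using cosh_le_exp[of x] by (intro mult_mono) auto
 then have c: "abs (cosh x * sinh x) \<le> exp (2 * abs x)" by (simp add: abs_mult exp_abs_sq[symmetric] power2_eq_square)
 have "abs x * abs (hv1 x) \<le> abs x * (20 * exp (- 2 * abs x))" by (intro mult_left_mono hv1_bound) auto
 then have xv: "abs (x * hv1 x) \<le> 20" using x_exp_le[of x] by (simp add: abs_mult)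
 have e: "1 \<le> exp (2 * abs x)" by simp
 have "exp (- 2 * abs x) \<le> 1" by simp
 then have "abs (hv x) \<le> 4" using hv_bound[of x] by linarith
 then show ?thesis unfolding hp1_def mult.assoc[of 15] mult.assoc[of 4] using c xv e by linarith
qed

subsection \<open>Antiderivatives\<close>

definition ant :: "(real \<Rightarrow> real) \<Rightarrow> real \<Rightarrow> real" where
 "ant f x = (LBINT y=ereal 0..ereal x. f y)"

lemma ant_0: "ant f 0 = 0" by (simp add: ant_def zero_ereal_def[symmetric])

lemma ant_deriv:
 assumes "continuous_on UNIV f" shows "(ant f has_real_derivative f x) (at x)" proof -
 define c where "c = abs x + 1"
 have c: "- c \<le> 0" "0 \<le> c" "- c < x" "x < c" by (auto simp: c_def)
 have "((\<lambda>u. LBINT y=ereal 0..ereal u. f y) has_vector_derivative f x) (at x within {-c..c})"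
  by (rule interval_integral_FTC2) (use c assms in \<open>auto intro: continuous_on_subset\<close>)
 then have "(ant f has_vector_derivative f x) (at x within {-c..c})" by (simp add: ant_def[abs_def])
 moreover have "at x within {-c..c} = at x" by (rule at_within_interior) (use c in auto)
 ultimately show ?thesis by (simp add: has_real_derivative_iff_has_vector_derivative)
qed

lemma ant_unique:
 assumes "\<And>x. (F has_real_derivative f x) (at x)" "F 0 = 0" "continuous_on UNIV f"
 shows "F x = ant f x" proof -
 have "\<forall>x. ((\<lambda>x. F x - ant f x) has_real_derivative 0) (at x)"
  using DERIV_diff[OF assms(1) ant_deriv[OF assms(3)]] by simp
 from DERIV_isconst_all[OF this, of x 0] show ?thesis by (simp add: assms(2) ant_0)
qed

lemma ant_mirror_deriv:
 assumes "continuous_on UNIV f" shows "((\<lambda>x. ant f (- x)) has_real_derivative - f (- x)) (at x)"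
 using ant_deriv[OF assms, of "- x"] unfolding DERIV_mirror .

lemma ant_of_even:
 assumes "continuous_on UNIV f" "\<And>x. f (- x) = f x" shows "ant f (- x) = - ant f x" proof -
 have "- ant f (- x) = ant f x" by (rule ant_unique[OF _ _ assms(1)])
    (auto intro!: derivative_eq_intros ant_mirror_deriv assms(1) simp: assms(2) ant_0)
 then show ?thesis by simp
qed

lemma ant_of_odd:
 assumes "continuous_on UNIV f" "\<And>x. f (- x) = - f x" shows "ant f (- x) = ant f x"
 using ant_mirror_deriv[OF assms(1)] by (intro ant_unique[OF _ _ assms(1)]) (simp_all add: assms(2) ant_0)

lemma ant_diff:
 assumes "continuous_on UNIV f" "continuous_on UNIV g" shows "ant (\<lambda>x. f x - g x) x = ant f x - ant g x"
 by (rule ant_unique[symmetric])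
   (auto intro!: derivative_eq_intros ant_deriv assms continuous_intros simp: ant_0)

lemma ant_bound:
 assumes "continuous_on UNIV f" "\<And>x. abs (f x) \<le> M" shows "abs (ant f x) \<le> M * abs x" proof -
 have "norm (ant f x - ant f 0) \<le> M * norm (x - 0)"
  by (rule field_differentiable_bound[of UNIV]) (use assms ant_deriv in auto)
 then show ?thesis by (simp add: ant_0)
qed

text \<open>Adding or subtracting the exponential that bounds the tail makes the antiderivative monotone, so
both one-sided bounds persist in the limit.\<close>

lemma ant_tail:
 assumes f: "continuous_on UNIV f" and M: "\<And>x. abs (f x) \<le> 4 * M * exp (- 4 * abs x)"
 obtains L where "\<And>x. 0 \<le> x \<Longrightarrow> abs (L - ant f x) \<le> M * exp (- 4 * x)" proof -
 define h1 where "h1 x = ant f x - M * exp (- 4 * x)" for x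
 define h2 where "h2 x = ant f x + M * exp (- 4 * x)" for x
 have M0: "0 \<le> M" using M[of 0] by (simp add: order_trans[OF abs_ge_zero])
 have d: "(h1 has_real_derivative f x + 4 * M * exp (- 4 * x)) (at x)"
    "(h2 has_real_derivative f x - 4 * M * exp (- 4 * x)) (at x)" for x
  unfolding h1_def h2_def by (auto intro!: derivative_eq_intros ant_deriv f)
 have h1_mono: "h1 x \<le> h1 y" if "0 \<le> x" "x \<le> y" for x y proof (rule DERIV_nonneg_imp_nondecreasing[OF that(2)])
  fix z assume "x \<le> z" "z \<le> y"
  then show "\<exists>D. (h1 has_real_derivative D) (at z) \<and> 0 \<le> D"
   using d(1)[of z] M[of z] that(1) by (intro exI[of _ "f z + 4 * M * exp (- 4 * z)"]) (auto simp: abs_le_iff)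
 qed
 have h2_mono: "h2 y \<le> h2 x" if "0 \<le> x" "x \<le> y" for x y proof (rule DERIV_nonpos_imp_nonincreasing[OF that(2)])
  fix z assume "x \<le> z" "z \<le> y"
  then show "\<exists>D. (h2 has_real_derivative D) (at z) \<and> D \<le> 0"
   using d(2)[of z] M[of z] that(1) by (intro exI[of _ "f z - 4 * M * exp (- 4 * z)"]) (auto simp: abs_le_iff)
 qed
 have h12: "h1 x \<le> h2 x" for x using M0 by (simp add: h1_def h2_def)
 have le: "h1 y \<le> h2 x" if "0 \<le> x" "0 \<le> y" for x y
  using h1_mono[of y x] h2_mono[of x y] h12[of x] h12[of y] that by linarith
 define L where "L = (SUP y\<in>{0..}. h1 y)"
 have bdd: "bdd_above (h1 ` {0..})" using le[of 0] by (intro bdd_aboveI2[of _ _ "h2 0"]) auto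
 have "abs (L - ant f x) \<le> M * exp (- 4 * x)" if "0 \<le> x" for x proof -
  have "h1 x \<le> L" unfolding L_def using bdd that by (intro cSUP_upper) auto
  moreover have "L \<le> h2 x" unfolding L_def using le that by (intro cSUP_least) auto
  ultimately show ?thesis by (auto simp: h1_def h2_def abs_le_iff)
 qed
 then show ?thesis by (rule that)
qed

definition "tl_int f = Lim at_top (ant f)"

lemma tl_int_tendsto:
 assumes f: "continuous_on UNIV f" and M: "\<And>x. abs (f x) \<le> 4 * M * exp (- 4 * abs x)"
 shows "(ant f \<longlongrightarrow> tl_int f) at_top" "0 \<le> x \<Longrightarrow> abs (tl_int f - ant f x) \<le> M * exp (- 4 * x)"
proof -
 obtain L where L: "\<And>x. 0 \<le> x \<Longrightarrow> abs (L - ant f x) \<le> M * exp (- 4 * x)"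
  using ant_tail[OF assms] by blast
 have "((\<lambda>x. M * exp (- 4 * x)) \<longlongrightarrow> 0) at_top" by real_asymp
 then have "((\<lambda>x. ant f x - L) \<longlongrightarrow> 0) at_top" by (rule Lim_null_comparison[rotated])
    (use L in \<open>auto simp: abs_minus_commute intro!: eventually_mono[OF eventually_ge_at_top[of 0]]\<close>)
 then have lim: "(ant f \<longlongrightarrow> L) at_top" by (simp add: LIM_zero_iff)
 then have "tl_int f = L" unfolding tl_int_def by (intro tendsto_Lim) auto
 then show "(ant f \<longlongrightarrow> tl_int f) at_top" "0 \<le> x \<Longrightarrow> abs (tl_int f - ant f x) \<le> M * exp (- 4 * x)"
  using lim L by auto
qed


subsection \<open>Solving the linearised equation\<close>

text \<open>Variation of constants for \<open>4 w - w'' - 12 sech2 w = g\<close>, the factor 8 being the Wronskian. The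
growing solution \<open>hp\<close> is multiplied by an integral of \<open>g hv\<close> from \<open>x\<close> to infinity, which makes the
product decay at \<open>+\<infinity>\<close>. For even \<open>g\<close> the integral of the odd function \<open>g hv\<close> over the line
vanishes, so the product decays at \<open>-\<infinity>\<close> as well: evenness is the solvability condition.\<close>

definition "lsol g x = (hv x * ant (\<lambda>y. g y * hp y) x + hp x * (tl_int (\<lambda>y. g y * hv y) - ant (\<lambda>y. g y * hv y) x)) / 8"

definition "lsol1 g x = (hv1 x * ant (\<lambda>y. g y * hp y) x + hp1 x * (tl_int (\<lambda>y. g y * hv y) - ant (\<lambda>y. g y * hv y) x)) / 8"

lemma hv_cont: "continuous_on UNIV hv" using hv_deriv by (intro DERIV_continuous_on) (auto intro: DERIV_subset)

lemma hp_cont: "continuous_on UNIV hp" using hp_deriv by (intro DERIV_continuous_on) (auto intro: DERIV_subset)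

lemma sech2_cont: "continuous_on S sech2" using sech2_deriv by (intro DERIV_continuous_on) (auto intro: DERIV_subset)

context
 fixes g :: "real \<Rightarrow> real" and G :: real
 assumes g: "continuous_on UNIV g" and even: "\<And>x. g (- x) = g x"
  and gb: "\<And>x. abs (g x) \<le> G * exp (- 2 * abs x)"
begin

lemma gp_cont: "continuous_on UNIV (\<lambda>y. g y * hp y)" and gv_cont: "continuous_on UNIV (\<lambda>y. g y * hv y)"
 by (intro continuous_intros g hp_cont hv_cont)+

lemma lsol_deriv: "(lsol g has_real_derivative lsol1 g x) (at x)" unfolding lsol_def[abs_def] lsol1_def
 by (rule DERIV_cong[OF DERIV_cdivide[OF DERIV_add[OF DERIV_mult'[OF hv_deriv ant_deriv[OF gp_cont]]
     DERIV_mult'[OF hp_deriv DERIV_diff[OF DERIV_const ant_deriv[OF gv_cont]]]]]])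
   (simp add: algebra_simps)

lemma lsol1_deriv: "(lsol1 g has_real_derivative (4 - 12 * sech2 x) * lsol g x - g x) (at x)" proof -
 let ?A = "ant (\<lambda>y. g y * hp y) x" and ?B = "tl_int (\<lambda>y. g y * hv y) - ant (\<lambda>y. g y * hv y) x"
 have "(lsol1 g has_real_derivative
   ((4 - 12 * sech2 x) * hv x * ?A + hv1 x * (g x * hp x) + ((4 - 12 * sech2 x) * hp x * ?B - hp1 x * (g x * hv x))) / 8) (at x)"
  unfolding lsol1_def[abs_def]
  by (rule DERIV_cong[OF DERIV_cdivide[OF DERIV_add[OF DERIV_mult'[OF hv1_deriv ant_deriv[OF gp_cont]]
     DERIV_mult'[OF hp1_deriv DERIV_diff[OF DERIV_const ant_deriv[OF gv_cont]]]]]])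
    (simp add: algebra_simps)
 moreover have "((4 - 12 * sech2 x) * hv x * ?A + hv1 x * (g x * hp x) + ((4 - 12 * sech2 x) * hp x * ?B - hp1 x * (g x * hv x))) / 8
   = (4 - 12 * sech2 x) * lsol g x - g x" proof -
  have "hv1 x * (g x * hp x) - hp1 x * (g x * hv x) = g x * (hp x * hv1 x - hp1 x * hv x)" by (simp add: algebra_simps)
  also have "... = - 8 * g x" by (simp only: hp_hv_wronskian)
  finally have "hv1 x * (g x * hp x) = hp1 x * (g x * hv x) - 8 * g x" by linarith
  moreover have "(4 - 12 * sech2 x) * lsol g x = ((4 - 12 * sech2 x) * hv x * ?A + (4 - 12 * sech2 x) * hp x * ?B) / 8"
   by (simp add: lsol_def distrib_left mult.assoc)
  moreover have "h = k - 8 * c \<Longrightarrow> L = (P + Q) / 8 \<Longrightarrow> (P + h + (Q - k)) / 8 = L - c" for h k c L P Q :: real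
   by (simp add: field_simps)
  ultimately show ?thesis by blast
 qed
 ultimately show ?thesis by (rule DERIV_cong)
qed

lemma lsol_even: "lsol g (- x) = lsol g x" proof -
 have "ant (\<lambda>y. g y * hp y) (- x) = - ant (\<lambda>y. g y * hp y) x"
  by (rule ant_of_even[OF gp_cont]) (simp add: even hp_even)
 moreover have "ant (\<lambda>y. g y * hv y) (- x) = ant (\<lambda>y. g y * hv y) x"
  by (rule ant_of_odd[OF gv_cont]) (simp add: even hv_odd)
 ultimately show ?thesis by (simp add: lsol_def hv_odd hp_even)
qed

lemma ant_gp_bound: "abs (ant (\<lambda>y. g y * hp y) x) \<le> 82 * G * exp (abs x)" proof -
 have G0: "0 \<le> G" using order_trans[OF abs_ge_zero gb[of 0]] by simp
 have "abs (g y * hp y) \<le> 82 * G" for y proof -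
  have "abs (g y * hp y) \<le> (G * exp (- 2 * abs y)) * (82 * exp (2 * abs y))"
   unfolding abs_mult using G0 by (intro mult_mono gb hp_bound) auto
  also have "... = 82 * G * (exp (- 2 * abs y) * exp (2 * abs y))" by simp
  also have "... = 82 * G" by (simp only: exp_add[symmetric]) simp
  finally show ?thesis .
 qed
 then have "abs (ant (\<lambda>y. g y * hp y) x) \<le> 82 * G * abs x" by (rule ant_bound[OF gp_cont])
 also have "... \<le> 82 * G * exp (abs x)" proof (rule mult_left_mono)
  show "abs x \<le> exp (abs x)" using exp_ge_add_one_self[of "abs x"] by linarith
 qed (use G0 in simp)
 finally show ?thesis .
qed

lemma gv_bound: "abs (g x * hv x) \<le> 4 * G * exp (- 4 * abs x)" proof -
 have G0: "0 \<le> G" using order_trans[OF abs_ge_zero gb[of 0]] by simp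
 have "abs (g x * hv x) \<le> (G * exp (- 2 * abs x)) * (4 * exp (- 2 * abs x))"
  unfolding abs_mult using G0 by (intro mult_mono gb hv_bound) auto
 also have "... = 4 * G * exp (- 4 * abs x)" by (simp add: exp_add[symmetric])
 finally show ?thesis .
qed

lemma tl_gv_bound: "abs (tl_int (\<lambda>y. g y * hv y) - ant (\<lambda>y. g y * hv y) x) \<le> G * exp (- 4 * abs x)" proof -
 have "ant (\<lambda>y. g y * hv y) x = ant (\<lambda>y. g y * hv y) (abs x)"
  using ant_of_odd[OF gv_cont, of x] by (simp add: even hv_odd abs_if)
 then show ?thesis using tl_int_tendsto(2)[OF gv_cont gv_bound, of "abs x"] by simp
qed

lemma lsol_bounds: "abs (lsol g x) \<le> 52 * G * exp (- abs x)" "abs (lsol1 g x) \<le> 266 * G * exp (- abs x)" proof -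
 have G0: "0 \<le> G" using order_trans[OF abs_ge_zero gb[of 0]] by simp
 let ?A = "ant (\<lambda>y. g y * hp y) x" and ?B = "tl_int (\<lambda>y. g y * hv y) - ant (\<lambda>y. g y * hv y) x"
 have *: "abs ((p * ?A + q * ?B) / 8) \<le> (82 * c + d) / 8 * G * exp (- abs x)"
  if pq: "abs p \<le> c * exp (- 2 * abs x)" "abs q \<le> d * exp (2 * abs x)" "0 \<le> c" "0 \<le> d" for p q c d proof -
  have "abs (p * ?A) \<le> (c * exp (- 2 * abs x)) * (82 * G * exp (abs x))"
   unfolding abs_mult using that by (intro mult_mono ant_gp_bound) auto
  also have "... = 82 * c * G * exp (- abs x)" by (simp add: exp_add[symmetric])
  finally have 1: "abs (p * ?A) \<le> 82 * c * G * exp (- abs x)" .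
  have "abs (q * ?B) \<le> (d * exp (2 * abs x)) * (G * exp (- 4 * abs x))"
   unfolding abs_mult using that by (intro mult_mono tl_gv_bound) auto
  also have "... = d * G * exp (- 2 * abs x)" by (simp add: exp_add[symmetric])
  also have "... \<le> d * G * exp (- abs x)" using G0 that by (intro mult_left_mono) auto
  finally have 2: "abs (q * ?B) \<le> d * G * exp (- abs x)" .
  have "abs (p * ?A + q * ?B) \<le> 82 * c * G * exp (- abs x) + d * G * exp (- abs x)" using 1 2 by linarith
  then show ?thesis by (simp add: algebra_simps)
 qed
 show "abs (lsol g x) \<le> 52 * G * exp (- abs x)" proof -
  have "abs (lsol g x) \<le> (82 * 4 + 82) / 8 * G * exp (- abs x)" unfolding lsol_def by (rule *[OF hv_bound hp_bound]) auto
  also have "... \<le> 52 * G * exp (- abs x)" using G0 by (intro mult_right_mono) auto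
  finally show ?thesis .
 qed
 show "abs (lsol1 g x) \<le> 266 * G * exp (- abs x)" proof -
  have "abs (lsol1 g x) \<le> (82 * 20 + 484) / 8 * G * exp (- abs x)"
   unfolding lsol1_def by (rule *[OF hv1_bound hp1_bound]) auto
  also have "... \<le> 266 * G * exp (- abs x)" using G0 by (intro mult_right_mono) auto
  finally show ?thesis .
 qed
qed

end

lemma lsol_diff:
 assumes "continuous_on UNIV f" "\<And>x. abs (f x) \<le> F * exp (- 2 * abs x)"
  "continuous_on UNIV g" "\<And>x. abs (g x) \<le> G * exp (- 2 * abs x)"
  and ev: "\<And>x. f (- x) = f x" "\<And>x. g (- x) = g x"
 shows "lsol (\<lambda>x. f x - g x) x = lsol f x - lsol g x" proof -
 have cf: "continuous_on UNIV (\<lambda>y. f y * hp y)" "continuous_on UNIV (\<lambda>y. f y * hv y)"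
  and cg: "continuous_on UNIV (\<lambda>y. g y * hp y)" "continuous_on UNIV (\<lambda>y. g y * hv y)"
  by (intro continuous_intros assms hp_cont hv_cont)+
 have 1: "ant (\<lambda>y. (f y - g y) * hp y) x = ant (\<lambda>y. f y * hp y) x - ant (\<lambda>y. g y * hp y) x" for x
  using ant_diff[OF cf(1) cg(1)] by (simp add: left_diff_distrib)
 have 2: "ant (\<lambda>y. (f y - g y) * hv y) x = ant (\<lambda>y. f y * hv y) x - ant (\<lambda>y. g y * hv y) x" for x
  using ant_diff[OF cf(2) cg(2)] by (simp add: left_diff_distrib)
 have "((\<lambda>x. ant (\<lambda>y. f y * hv y) x - ant (\<lambda>y. g y * hv y) x) \<longlongrightarrow>
   tl_int (\<lambda>y. f y * hv y) - tl_int (\<lambda>y. g y * hv y)) at_top"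
  by (intro tendsto_diff tl_int_tendsto(1)[OF cf(2) gv_bound[OF assms(1) ev(1) assms(2)]]
    tl_int_tendsto(1)[OF cg(2) gv_bound[OF assms(3) ev(2) assms(4)]])
 then have "((ant (\<lambda>y. (f y - g y) * hv y)) \<longlongrightarrow> tl_int (\<lambda>y. f y * hv y) - tl_int (\<lambda>y. g y * hv y)) at_top"
  by (simp add: 2[abs_def])
 then have 3: "tl_int (\<lambda>y. (f y - g y) * hv y) = tl_int (\<lambda>y. f y * hv y) - tl_int (\<lambda>y. g y * hv y)"
  unfolding tl_int_def[of "\<lambda>y. (f y - g y) * hv y"] by (intro tendsto_Lim) auto
 show ?thesis unfolding lsol_def 1 2 3 by (simp add: algebra_simps diff_divide_distrib[symmetric] add_divide_distrib[symmetric])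
qed

lemma integrable_exp_abs: "integrable lborel (\<lambda>x::real. exp (- abs x))" proof (rule Bochner_Integration.integrable_bound)
 show "integrable lborel (\<lambda>x::real. 2 * (1 / (1 + abs x)^2))" by (intro integrable_mult_right integrable_weight2)
 show "AE x::real in lborel. norm (exp (- abs x)) \<le> norm (2 * (1 / (1 + abs x)^2))" proof (rule AE_I2)
  fix x :: real
  have "1 + abs x + (abs x)\<^sup>2 / 2 \<le> exp (abs x)" by (rule exp_lower_Taylor_quadratic) simp
  then have "(1 + abs x)\<^sup>2 / 2 \<le> exp (abs x)" by (simp add: power2_sum)
  then have "1 / exp (abs x) \<le> 1 / ((1 + abs x)\<^sup>2 / 2)" by (intro divide_left_mono) (auto intro!: mult_pos_pos)
  then show "norm (exp (- abs x)) \<le> norm (2 * (1 / (1 + abs x)^2))" by (simp add: exp_minus inverse_eq_divide)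
 qed
qed measurable

definition eint :: real where "eint = (LBINT x. exp (- abs (x::real)))"

lemma eint_nonneg: "0 \<le> eint" unfolding eint_def by (rule Bochner_Integration.integral_nonneg) auto

lemma expdec_integrable:
 fixes g :: "real \<Rightarrow> real"
 assumes "continuous_on UNIV g" "\<And>x. abs (g x) \<le> C * exp (- abs x)"
 shows "integrable lborel g" "(LBINT x. abs (g x)) \<le> C * eint" proof -
 have C: "integrable lborel (\<lambda>x. C * exp (- abs (x::real)))" using integrable_exp_abs by simp
 show i: "integrable lborel g" proof (rule Bochner_Integration.integrable_bound[OF C])
  show "g \<in> borel_measurable lborel" using assms(1) by (auto intro: borel_measurable_continuous_onI)
  show "AE x in lborel. norm (g x) \<le> norm (C * exp (- abs x))" proof (rule AE_I2)
   fix x show "norm (g x) \<le> norm (C * exp (- abs x))" using assms(2)[of x] by simp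
  qed
 qed
 have "(LBINT x. abs (g x)) \<le> (LBINT x. C * exp (- abs (x::real)))" by (intro integral_mono integrable_abs i C assms(2))
 then show "(LBINT x. abs (g x)) \<le> C * eint" by (simp add: eint_def)
qed

lemma exp_abs_tendsto:
 "((\<lambda>x::real. C * exp (- abs x)) \<longlongrightarrow> 0) at_top" "((\<lambda>x::real. C * exp (- abs x)) \<longlongrightarrow> 0) at_bot"
 by real_asymp+

text \<open>The derivative of \<open>xi w(x) sin (xi x) + w'(x) cos (xi x)\<close> is
\<open>(xi\<^sup>2 w + w'') cos (xi x)\<close>, and its boundary values vanish.\<close>

lemma FT_second_deriv:
 assumes w: "\<And>x. (w has_real_derivative w1 x) (at x)" "\<And>x. (w1 has_real_derivative w2 x) (at x)"
  and c: "continuous_on UNIV w2"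
  and b: "\<And>x. abs (w x) \<le> C * exp (- abs x)" "\<And>x. abs (w1 x) \<le> C * exp (- abs x)"
  and i2: "integrable lborel w2"
 shows "xi\<^sup>2 * FT w xi = - FT w2 xi" proof -
 define F where "F x = w1 x * cos (xi * x) + xi * w x * sin (xi * x)" for x
 define f where "f x = cos (xi * x) * w2 x + xi\<^sup>2 * (cos (xi * x) * w x)" for x
 have cw: "continuous_on UNIV w" using w(1) by (intro DERIV_continuous_on) (auto intro: DERIV_subset)
 have iw: "integrable lborel w" using expdec_integrable(1)[OF cw b(1)] .
 have fi: "integrable lborel f" unfolding f_def using cos_integrable[OF iw, of xi] cos_integrable[OF i2, of xi] by simp
 have Fd: "(F has_vector_derivative f x) (at x)" for x
  unfolding has_real_derivative_iff_has_vector_derivative[symmetric] F_def f_def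
  by (auto intro!: derivative_eq_intros w simp: algebra_simps power2_eq_square)
 have Fb: "abs (F x) \<le> ((1 + abs xi) * C) * exp (- abs x)" for x proof -
  have "abs (F x) \<le> abs (w1 x) * abs (cos (xi * x)) + abs xi * (abs (w x) * abs (sin (xi * x)))"
   unfolding F_def by (rule order_trans[OF abs_triangle_ineq]) (simp add: abs_mult)
  also have "... \<le> abs (w1 x) * 1 + abs xi * (abs (w x) * 1)" by (intro add_mono mult_left_mono) auto
  also have "... \<le> C * exp (- abs x) + abs xi * (C * exp (- abs x))" using b[of x] by (intro add_mono mult_left_mono) auto
  finally show ?thesis by (simp add: algebra_simps)
 qed
 have "(LBINT x=-\<infinity>..\<infinity>. f x) = 0 - 0" proof (rule interval_integral_FTC_integrable[where F = F])
  show "isCont f x" for x proof -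
   have "continuous_on UNIV f" unfolding f_def by (intro continuous_intros c cw)
   then show ?thesis by (simp add: continuous_on_eq_continuous_at)
  qed
  show "set_integrable lborel (einterval (-\<infinity>) \<infinity>) f" using fi by (simp add: set_integrable_def)
  show "((F \<circ> real_of_ereal) \<longlongrightarrow> 0) (at_right (-\<infinity>))" "((F \<circ> real_of_ereal) \<longlongrightarrow> 0) (at_left \<infinity>)"
   unfolding ereal_tendsto_simps using Lim_null_comparison[OF always_eventually exp_abs_tendsto(2)[of "(1 + abs xi) * C"], of F]
    Lim_null_comparison[OF always_eventually exp_abs_tendsto(1)[of "(1 + abs xi) * C"], of F] Fb by simp_all
 qed (use Fd in auto)
 then have "(LBINT x. f x) = 0" by (simp add: interval_lebesgue_integral_def set_lebesgue_integral_def)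
 moreover have "(LBINT x. f x) = (LBINT x. cos (xi * x) * w2 x) + xi\<^sup>2 * (LBINT x. cos (xi * x) * w x)"
  unfolding f_def using cos_integrable[OF iw, of xi] cos_integrable[OF i2, of xi] by simp
 ultimately have "xi\<^sup>2 * (LBINT x. cos (xi * x) * w x) = - (LBINT x. cos (xi * x) * w2 x)" by linarith
 then show ?thesis by (simp add: FT_def)
qed

lemma FT_product:
 assumes g: "integrable lborel g" and a: "integrable lborel a" and ev: "\<And>xi. a (- xi) = a xi"
 shows "conv (FT g) a xi = FT (\<lambda>x. g x * Re (FF a x)) xi" proof -
 have [measurable]: "g \<in> borel_measurable borel" "a \<in> borel_measurable borel" using g a by auto
 define k where "k t x = cos ((xi - t) * x) * g x * a t" for t x
 have le: "abs (k t x) \<le> abs (a t) * abs (g x)" for t x proof -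
  have "abs (k t x) = abs (cos ((xi - t) * x)) * (abs (a t) * abs (g x))" by (simp add: k_def abs_mult)
  also have "... \<le> 1 * (abs (a t) * abs (g x))" by (intro mult_right_mono) auto
  finally show ?thesis by simp
 qed
 have kint: "integrable (lborel \<Otimes>\<^sub>M lborel) (\<lambda>(t, x). k t x)"
 proof (rule Bochner_Integration.integrable_bound)
  show "integrable (lborel \<Otimes>\<^sub>M lborel) (\<lambda>(t, x). a t * g x)"
   by (intro lborel_pair.Fubini_integrable) (use g a in \<open>auto simp: abs_mult\<close>)
  show "(\<lambda>(t, x). k t x) \<in> borel_measurable (lborel \<Otimes>\<^sub>M lborel)" unfolding k_def by measurable
  show "AE p in lborel \<Otimes>\<^sub>M lborel. norm (case p of (t, x) \<Rightarrow> k t x) \<le> norm (case p of (t, x) \<Rightarrow> a t * g x)"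
   using le by (intro AE_I2) (auto simp: abs_mult split: prod.split)
 qed
 have "conv (FT g) a xi = (LBINT t. (1 / (2 * pi)) * (LBINT x. k t x))" unfolding conv_def FT_def k_def by simp
 also have "... = (1 / (2 * pi)) * (LBINT t. LBINT x. k t x)" by (rule integral_mult_right_zero)
 also have "(LBINT t. LBINT x. k t x) = (LBINT x. LBINT t. k t x)" using lborel_pair.Fubini_integral[OF kint] by simp
 also have "... = (LBINT x. cos (xi * x) * (g x * Re (FF a x)))" proof (rule Bochner_Integration.integral_cong)
  fix x
  have FFre: "(LBINT t. cos (t * x) * a t) = Re (FF a x)" and FFim: "(LBINT t. sin (t * x) * a t) = Im (FF a x)"
   unfolding FF_def by (simp_all add: integral_Re[symmetric] integral_Im[symmetric] FF_integrable[OF a])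
  have ci: "integrable lborel (\<lambda>t. cos (t * x) * a t)" "integrable lborel (\<lambda>t. sin (t * x) * a t)"
   using cos_integrable[OF a, of x] sin_integrable[OF a, of x] by (simp_all add: mult.commute)
  have "(LBINT t. k t x) = (LBINT t. g x * (cos (xi * x) * (cos (t * x) * a t) + sin (xi * x) * (sin (t * x) * a t)))"
   by (rule Bochner_Integration.integral_cong) (auto simp: k_def left_diff_distrib cos_diff algebra_simps)
  also have "... = g x * (cos (xi * x) * Re (FF a x) + sin (xi * x) * Im (FF a x))" using ci by (simp add: FFre FFim)
  also have "Im (FF a x) = 0" by (rule FF_even_real(1)[of a, OF ev])
  finally show "(LBINT t. k t x) = cos (xi * x) * (g x * Re (FF a x))" by simp
 qed simp
 finally show ?thesis by (simp add: FT_def[of "\<lambda>x. g x * Re (FF a x)"])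
qed

subsection \<open>The Fourier transform of the solitary wave\<close>

definition s0 :: "real \<Rightarrow> real" where "s0 = FT sech2"

lemma s0_even: "s0 (- xi) = s0 xi" by (simp add: s0_def FT_even)

lemma exp2_le_exp: "exp (- 2 * abs (x::real)) \<le> exp (- abs x)" by simp

lemma sech2_expdec: "abs (sech2 x) \<le> 4 * exp (- abs x)" using sech2_bound[of x] exp2_le_exp[of x] sech2_pos[of x] by linarith

lemma sech2_sq_expdec: "abs (sech2 x * sech2 x) \<le> 4 * exp (- abs x)" proof -
 have "sech2 x * sech2 x \<le> sech2 x" using sech2_le_1[of x] sech2_pos[of x] by (intro mult_left_le) auto
 then show ?thesis using sech2_expdec[of x] sech2_pos[of x] by (simp only: abs_mult abs_of_pos)
qed

lemma sech2_integrable: "integrable lborel sech2" by (rule expdec_integrable(1)[OF sech2_cont sech2_expdec])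

lemma bnd_div4:
 assumes "bnd s A f" shows "bnd (s + 2) (2 * A) (\<lambda>xi. f xi / (4 + xi\<^sup>2))" unfolding bnd_def proof (intro conjI allI)
 have "4 + xi\<^sup>2 \<noteq> 0" for xi :: real using zero_le_power2[of xi] by linarith
 then show "continuous_on UNIV (\<lambda>xi. f xi / (4 + xi\<^sup>2))" by (intro continuous_intros bndD(1)[OF assms]) auto
 fix xi :: real
 have p: "0 < 4 + xi\<^sup>2" using zero_le_power2[of xi] by linarith
 have "0 \<le> (1 - abs xi)\<^sup>2" by simp
 then have "(1 + abs xi)\<^sup>2 \<le> 2 * (4 + xi\<^sup>2)" by (simp add: power2_sum power2_diff)
 then have "(1 + abs xi)\<^sup>2 * ((1 + abs xi)^s * abs (f xi)) \<le> 2 * (4 + xi\<^sup>2) * A"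
  using bndD(2)[OF assms, of xi] by (intro mult_mono) auto
 then show "(1 + abs xi)^(s + 2) * abs (f xi / (4 + xi\<^sup>2)) \<le> 2 * A"
  using p by (simp add: abs_divide power2_eq_square divide_le_eq mult_ac)
qed

lemma FT_bnd0:
 fixes g :: "real \<Rightarrow> real"
 assumes "continuous_on UNIV g" "\<And>x. abs (g x) \<le> C * exp (- abs x)"
 shows "bnd 0 (C * eint) (FT g)" unfolding bnd_def proof (intro conjI allI)
 note i = expdec_integrable[OF assms]
 show "continuous_on UNIV (FT g)" by (rule FT_continuous[OF i(1)])
 fix xi :: real
 have "abs (FT g xi) \<le> 1 / (2 * pi) * (LBINT x. abs (g x))" by (rule FT_abs_le[OF i(1)])
 also have "... \<le> 1 * (LBINT x. abs (g x))" using pi_gt3 by (intro mult_right_mono Bochner_Integration.integral_nonneg) auto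
 finally show "(1 + abs xi)^0 * abs (FT g xi) \<le> C * eint" using i(2) by simp
qed

text \<open>This is \<open>sech2'' = 4 sech2 - 6 sech2\<^sup>2\<close> in Fourier variables.\<close>

lemma s0_ode: "s0 xi = 6 * FT (\<lambda>x. sech2 x * sech2 x) xi / (4 + xi\<^sup>2)" proof -
 have d2: "((\<lambda>x. - 2 * hv x) has_real_derivative 4 * sech2 x - 6 * (sech2 x * sech2 x)) (at x)" for x
  by (rule DERIV_cong[OF DERIV_cmult[OF hv_deriv]]) (simp add: hv1_def power2_eq_square)
 have i2: "integrable lborel (\<lambda>x. sech2 x * sech2 x)"
  by (rule expdec_integrable(1)[OF _ sech2_sq_expdec]) (intro continuous_intros sech2_cont)
 have "xi\<^sup>2 * FT sech2 xi = - FT (\<lambda>x. 4 * sech2 x - 6 * (sech2 x * sech2 x)) xi"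
 proof (rule FT_second_deriv[where C = 8])
  show "(sech2 has_real_derivative - 2 * hv x) (at x)" for x by (rule sech2_deriv)
  show "abs (sech2 x) \<le> 8 * exp (- abs x)" for x using sech2_expdec[of x] exp_ge_zero[of "- abs x"] by linarith
  show "abs (- 2 * hv x) \<le> 8 * exp (- abs x)" for x proof -
   have "abs (hv x) \<le> 4 * exp (- abs x)" using hv_bound[of x] exp2_le_exp[of x] by linarith
   then show ?thesis by (simp add: abs_mult)
  qed
  show "continuous_on UNIV (\<lambda>x. 4 * sech2 x - 6 * (sech2 x * sech2 x))" by (intro continuous_intros sech2_cont)
  show "integrable lborel (\<lambda>x. 4 * sech2 x - 6 * (sech2 x * sech2 x))" using sech2_integrable i2 by simp
 qed (rule d2)
 also have "FT (\<lambda>x. 4 * sech2 x - 6 * (sech2 x * sech2 x)) xi = 4 * FT sech2 xi - 6 * FT (\<lambda>x. sech2 x * sech2 x) xi"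
  using FT_add[of "\<lambda>x. 4 * sech2 x" "\<lambda>x. (- 6) * (sech2 x * sech2 x)" xi] sech2_integrable i2
   FT_cmult[of 4 sech2 xi] FT_cmult[of "- 6" "\<lambda>x. sech2 x * sech2 x" xi] by simp
 finally have "(4 + xi\<^sup>2) * s0 xi = 6 * FT (\<lambda>x. sech2 x * sech2 x) xi" by (simp add: s0_def algebra_simps)
 moreover have "4 + xi\<^sup>2 \<noteq> 0" using zero_le_power2[of xi] by linarith
 ultimately show ?thesis by (simp add: field_simps)
qed

lemma s0_bnd2: "\<exists>C. bnd 2 C s0" proof -
 have "bnd 0 (4 * eint) (FT (\<lambda>x. sech2 x * sech2 x))" by (intro FT_bnd0 continuous_intros sech2_cont sech2_sq_expdec)
 from bnd_div4[OF bnd_cmult[OF this, of 6]] show ?thesis by (auto simp: s0_ode[abs_def] numeral_2_eq_2)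
qed

lemma FF_s0: "FF s0 x = of_real (sech2 x)" proof -
 obtain C where "bnd 2 C s0" using s0_bnd2 by blast
 then have "integrable lborel s0" by (rule bnd_integrable) simp
 then show ?thesis unfolding s0_def by (intro FT_inversion[OF sech2_integrable sech2_even sech2_cont, of 1])
    (use sech2_le_1 sech2_pos in \<open>auto simp: abs_of_pos\<close>)
qed

lemma s0_eq: "s0 xi = 6 / (4 + xi\<^sup>2) * conv s0 s0 xi" proof -
 obtain C where "bnd 2 C s0" using s0_bnd2 by blast
 then have "integrable lborel s0" by (rule bnd_integrable) simp
 then have "conv s0 s0 xi = FT (\<lambda>x. sech2 x * sech2 x) xi"
  using FT_product[OF sech2_integrable, of s0 xi] s0_even by (simp add: s0_def[symmetric] FF_s0)
 then show ?thesis by (simp add: s0_ode)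
qed

text \<open>Each use of the profile equation gains two powers, so \<^term>\<open>s0\<close> decays faster than
 every power.\<close>

lemma s0_bnd: "\<exists>C. bnd s C s0" proof -
 have "\<exists>C. bnd (2 * n + 2) C s0" for n proof (induction n)
  case 0 then show ?case using s0_bnd2 by (simp add: numeral_2_eq_2)
 next
  case (Suc n)
  then obtain C where C: "bnd (2 * n + 2) C s0" by blast
  have eq: "(\<lambda>xi. 6 * conv s0 s0 xi / (4 + xi\<^sup>2)) = s0" proof
   fix xi show "6 * conv s0 s0 xi / (4 + xi\<^sup>2) = s0 xi" using s0_eq[of xi] by simp
  qed
  have "bnd (2 * n + 2) (ccon (2 * n + 2) * C * C) (conv s0 s0)" by (rule bnd_conv[OF C C]) simp
  from bnd_div4[OF bnd_cmult[OF this, of 6]] show ?case unfolding eq by auto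
 qed
 then obtain C where "bnd (2 * s + 2) C s0" by blast
 then have "bnd s C s0" by (rule bnd_weaken) auto
 then show ?thesis by (rule exI)
qed


subsection \<open>A bounded right inverse\<close>

text \<open>For an even density \<open>f\<close> of a function \<open>F\<close>, the equation
\<open>\<delta> - 12 / (4 + xi\<^sup>2) s0 \<star> \<delta> = f\<close> is solved by \<open>\<delta> = f + w_hat\<close>, where
\<open>4 w - w'' = 12 sech2 (F + w)\<close>, that is, \<open>w\<close> solves the linearised equation with right-hand side
\<open>12 sech2 F\<close>. In this form \<open>F\<close> is never differentiated, and \<open>w\<close> decays exponentially.\<close>

definition "rrw f = lsol (\<lambda>x. 12 * sech2 x * Re (FF f x))"

definition "rr f xi = f xi + FT (rrw f) xi"

context
 fixes f :: "real \<Rightarrow> real" and A :: real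
 assumes f: "bnd 2 A f" and ev: "\<And>xi. f (- xi) = f xi"
begin

lemma rr_source:
 shows "continuous_on UNIV (\<lambda>x. 12 * sech2 x * Re (FF f x))"
  and "12 * sech2 (- x) * Re (FF f (- x)) = 12 * sech2 x * Re (FF f x)"
  and "abs (12 * sech2 x * Re (FF f x)) \<le> (48 * (A * wint)) * exp (- 2 * abs x)" proof -
 show "continuous_on UNIV (\<lambda>x. 12 * sech2 x * Re (FF f x))"
  by (intro continuous_intros sech2_cont FF_continuous[OF f]) simp
 show "12 * sech2 (- x) * Re (FF f (- x)) = 12 * sech2 x * Re (FF f x)" by (simp add: sech2_even FF_even_real(3)[of f, OF ev])
 have "abs (Re (FF f x)) \<le> A * wint" using abs_Re_le_cmod FF_bound[OF f order_refl] by (rule order_trans)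
 then have "abs (12 * sech2 x * Re (FF f x)) \<le> (12 * (4 * exp (- 2 * abs x))) * (A * wint)"
  unfolding abs_mult using sech2_bound[of x] sech2_pos[of x] by (intro mult_mono) auto
 then show "abs (12 * sech2 x * Re (FF f x)) \<le> (48 * (A * wint)) * exp (- 2 * abs x)" by (simp add: mult_ac)
qed

lemma rrw_even: "rrw f (- x) = rrw f x" unfolding rrw_def by (rule lsol_even[OF rr_source])

lemma rrw_deriv: "(rrw f has_real_derivative lsol1 (\<lambda>x. 12 * sech2 x * Re (FF f x)) x) (at x)"
 unfolding rrw_def by (rule lsol_deriv[OF rr_source])

lemma rrw_cont: "continuous_on UNIV (rrw f)" using rrw_deriv by (intro DERIV_continuous_on) (auto intro: DERIV_subset)

lemma rrw_bound: "abs (rrw f x) \<le> 52 * (48 * (A * wint)) * exp (- abs x)"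
 unfolding rrw_def by (rule lsol_bounds(1)[OF rr_source])

lemma rrw_integrable: "integrable lborel (rrw f)" by (rule expdec_integrable(1)[OF rrw_cont rrw_bound])

lemma rrw_hat_eq0: "FT (rrw f) xi = 12 * FT (\<lambda>x. sech2 x * (rrw f x + Re (FF f x))) xi / (4 + xi\<^sup>2)"
 and rrw_hat_bnd2: "bnd 2 (24 * (4 * (52 * (48 * (A * wint)) + A * wint) * eint)) (FT (rrw f))" proof -
 let ?g = "\<lambda>x. 12 * sech2 x * Re (FF f x)"
 define B where "B = 52 * (48 * (A * wint)) + A * wint"
 have Re_le: "abs (Re (FF f x)) \<le> A * wint" for x using abs_Re_le_cmod FF_bound[OF f order_refl] by (rule order_trans)
 have A0: "0 \<le> A * wint" using bndD(4)[OF f] wint_nonneg by simp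
 have pc: "continuous_on UNIV (\<lambda>x. sech2 x * (rrw f x + Re (FF f x)))"
  by (intro continuous_intros sech2_cont rrw_cont FF_continuous[OF f]) simp
 have pb: "abs (sech2 x * (rrw f x + Re (FF f x))) \<le> (4 * B) * exp (- abs x)" for x proof -
  have "exp (- abs x) \<le> 1" by simp
  then have "52 * (48 * (A * wint)) * exp (- abs x) \<le> 52 * (48 * (A * wint))" using A0 by (intro mult_left_le) auto
  then have "abs (rrw f x + Re (FF f x)) \<le> B" using rrw_bound[of x] Re_le[of x] unfolding B_def by linarith
  then have "abs (sech2 x * (rrw f x + Re (FF f x))) \<le> (4 * exp (- abs x)) * B"
   unfolding abs_mult using sech2_expdec[of x] by (intro mult_mono) auto
  then show ?thesis by (simp add: mult_ac)
 qed
 have pi: "integrable lborel (\<lambda>x. sech2 x * (rrw f x + Re (FF f x)))" by (rule expdec_integrable(1)[OF pc pb])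
 have eq: "(4 - 12 * sech2 x) * rrw f x - ?g x = 4 * rrw f x + (- 12) * (sech2 x * (rrw f x + Re (FF f x)))" for x
  by (simp add: algebra_simps)
 have e1: "xi\<^sup>2 * FT (rrw f) xi = - FT (\<lambda>x. (4 - 12 * sech2 x) * rrw f x - ?g x) xi" for xi
 proof (rule FT_second_deriv[where C = "266 * (48 * (A * wint))"])
  show "(rrw f has_real_derivative lsol1 ?g x) (at x)" for x by (rule rrw_deriv)
  show "(lsol1 ?g has_real_derivative (4 - 12 * sech2 x) * rrw f x - ?g x) (at x)" for x
   unfolding rrw_def by (rule lsol1_deriv[OF rr_source])
  show "continuous_on UNIV (\<lambda>x. (4 - 12 * sech2 x) * rrw f x - ?g x)"
   by (intro continuous_intros sech2_cont rrw_cont FF_continuous[OF f]) simp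
  show "abs (rrw f x) \<le> 266 * (48 * (A * wint)) * exp (- abs x)" for x
   by (rule order_trans[OF rrw_bound]) (use A0 in \<open>intro mult_right_mono; simp\<close>)
  show "abs (lsol1 ?g x) \<le> 266 * (48 * (A * wint)) * exp (- abs x)" for x by (rule lsol_bounds(2)[OF rr_source])
  show "integrable lborel (\<lambda>x. (4 - 12 * sech2 x) * rrw f x - ?g x)"
   unfolding eq using rrw_integrable pi by (intro Bochner_Integration.integrable_add integrable_mult_right)
 qed
 have e2: "FT (\<lambda>x. (4 - 12 * sech2 x) * rrw f x - ?g x) xi
   = 4 * FT (rrw f) xi + (- 12) * FT (\<lambda>x. sech2 x * (rrw f x + Re (FF f x))) xi" for xi
  unfolding eq using rrw_integrable pi by (subst FT_add) (simp_all only: FT_cmult integrable_mult_right)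
 have *: "(4 + xi\<^sup>2) * FT (rrw f) xi = 12 * FT (\<lambda>x. sech2 x * (rrw f x + Re (FF f x))) xi" for xi
  using e1[of xi] e2[of xi] by (simp add: distrib_right)
 have nz: "4 + xi\<^sup>2 \<noteq> 0" for xi :: real using zero_le_power2[of xi] by linarith
 have ***: "FT (rrw f) xi = 12 * FT (\<lambda>x. sech2 x * (rrw f x + Re (FF f x))) xi / (4 + xi\<^sup>2)" for xi
  using *[of xi] nz[of xi] by (simp add: eq_divide_eq mult.commute)
 then show "FT (rrw f) xi = 12 * FT (\<lambda>x. sech2 x * (rrw f x + Re (FF f x))) xi / (4 + xi\<^sup>2)" .
 have "bnd (0 + 2) (2 * (abs 12 * (4 * B * eint))) (\<lambda>xi. 12 * FT (\<lambda>x. sech2 x * (rrw f x + Re (FF f x))) xi / (4 + xi\<^sup>2))"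
  by (rule bnd_div4[OF bnd_cmult[OF FT_bnd0[OF pc pb]]])
 then show "bnd 2 (24 * (4 * (52 * (48 * (A * wint)) + A * wint) * eint)) (FT (rrw f))"
  by (simp add: ***[abs_def] B_def numeral_2_eq_2)
qed

lemma FF_rrw_hat: "FF (FT (rrw f)) x = of_real (rrw f x)" proof (rule FT_inversion[OF rrw_integrable rrw_even rrw_cont])
 have A0: "0 \<le> A * wint" using bndD(4)[OF f] wint_nonneg by simp
 show "abs (rrw f x) \<le> 52 * (48 * (A * wint))" for x proof -
  have "52 * (48 * (A * wint)) * exp (- abs x) \<le> 52 * (48 * (A * wint))" using A0 by (intro mult_left_le) auto
  then show ?thesis using rrw_bound[of x] by linarith
 qed
 show "integrable lborel (FT (rrw f))" by (rule bnd_integrable(1)[OF rrw_hat_bnd2 order_refl])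
qed

lemma rr_bnd2: "\<exists>B. bnd 2 B (rr f)" unfolding rr_def[abs_def] using bnd_add[OF f rrw_hat_bnd2] by blast

lemma rr_even: "rr f (- xi) = rr f xi" by (simp add: rr_def ev FT_even)

lemma rrw_hat_eq: "FT (rrw f) xi = 12 * conv s0 (rr f) xi / (4 + xi\<^sup>2)" proof -
 obtain B where B: "bnd 2 B (rr f)" using rr_bnd2 by blast
 have i: "integrable lborel f" "integrable lborel (FT (rrw f))" "integrable lborel (rr f)"
  using bnd_integrable(1)[OF f] bnd_integrable(1)[OF rrw_hat_bnd2] bnd_integrable(1)[OF B] by auto
 have "FF (rr f) x = FF f x + of_real (rrw f x)" for x unfolding rr_def[abs_def] using FF_add[OF i(1,2)] by (simp add: FF_rrw_hat)
 then have "Re (FF (rr f) x) = rrw f x + Re (FF f x)" for x by simp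
 then show ?thesis unfolding s0_def using FT_product[OF sech2_integrable i(3) rr_even, of xi] by (simp add: rrw_hat_eq0)
qed

lemma rr_eq: "rr f xi - 12 / (4 + xi\<^sup>2) * conv s0 (rr f) xi = f xi" unfolding rr_def[of f xi] rrw_hat_eq by simp

end

lemma rr_diff:
 assumes f: "bnd 2 A f" "\<And>xi. f (- xi) = f xi" and g: "bnd 2 B g" "\<And>xi. g (- xi) = g xi"
 shows "rr (\<lambda>xi. f xi - g xi) xi = rr f xi - rr g xi" proof -
 have i: "integrable lborel f" "integrable lborel g" using bnd_integrable(1) f(1) g(1) by auto
 have "rrw (\<lambda>xi. f xi - g xi) x = rrw f x - rrw g x" for x
  unfolding rrw_def FF_diff[OF i] minus_complex.sel right_diff_distrib
  by (rule lsol_diff[OF rr_source(1)[OF f] rr_source(3)[OF f] rr_source(1)[OF g] rr_source(3)[OF g]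
     rr_source(2)[OF f] rr_source(2)[OF g]])
 then have "FT (rrw (\<lambda>xi. f xi - g xi)) xi = FT (\<lambda>x. rrw f x + (- 1) * rrw g x) xi"
  by (intro arg_cong[of _ _ "\<lambda>h. FT h xi"] ext) simp
 also have "... = FT (rrw f) xi - FT (rrw g) xi"
  using rrw_integrable[OF f] rrw_integrable[OF g] by (subst FT_add) (auto simp: FT_cmult[of "- 1", simplified])
 finally show ?thesis by (simp add: rr_def)
qed

definition evn :: "(real \<Rightarrow> real) \<Rightarrow> bool" where "evn f \<longleftrightarrow> (\<forall>xi. f (- xi) = f xi)"

lemma evnD: "evn f \<Longrightarrow> f (- xi) = f xi" by (simp add: evn_def)

text \<open>Bootstrapping: by \<open>rrw_hat_eq\<close> the correction is \<open>12 s0 \<star> (f + correction)\<close> divided by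
\<open>4 + xi\<^sup>2\<close>, so as long as its known decay is below that of \<open>f\<close> it improves by two powers. In the end
it beats \<open>f\<close> by one power, which absorbs the additional factor \<open>1 + mu |xi|\<close> used below.\<close>

lemma rr_bnd:
 assumes s: "2 \<le> s"
 shows "\<exists>C\<ge>0. \<forall>f A. bnd s A f \<longrightarrow> evn f \<longrightarrow> bnd (s + 1) (C * A) (FT (rrw f))"
proof -
 obtain M where M: "bnd s M s0" using s0_bnd by blast
 have "\<exists>C\<ge>0. \<forall>f A. bnd s A f \<longrightarrow> evn f \<longrightarrow> bnd (min (k + 2) (s + 1)) (C * A) (FT (rrw f))" for k
 proof (induction k)
  case 0
  have "bnd (min (0 + 2) (s + 1)) (24 * (4 * (52 * (48 * wint) + wint) * eint) * A) (FT (rrw f))"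
   if "bnd s A f" "evn f" for f A proof -
   have "bnd 2 A f" using that(1) s by (rule bnd_weaken) simp
   from rrw_hat_bnd2[OF this evnD[OF that(2)]]
   have "bnd 2 (24 * (4 * (52 * (48 * (A * wint)) + A * wint) * eint)) (FT (rrw f))" .
   moreover have "24 * (4 * (52 * (48 * (A * wint)) + A * wint) * eint) = 24 * (4 * (52 * (48 * wint) + wint) * eint) * A"
    by (simp add: algebra_simps)
   moreover have "min (0 + 2) (s + 1) = 2" using s by simp
   ultimately show ?thesis by (simp only:)
  qed
  then show ?case using wint_nonneg eint_nonneg by (intro exI[of _ "24 * (4 * (52 * (48 * wint) + wint) * eint)"]) simp
 next
  case (Suc k)
  then obtain C where C0: "0 \<le> C" and
   C: "\<And>f A. bnd s A f \<Longrightarrow> evn f \<Longrightarrow> bnd (min (k + 2) (s + 1)) (C * A) (FT (rrw f))" by blast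
  let ?r = "min (k + 2) s"
  have r: "2 \<le> ?r" "?r \<le> s" using s by auto
  have M0: "0 \<le> M" using bndD(4)[OF M] .
  have "bnd (min (Suc k + 2) (s + 1)) (2 * (12 * (ccon ?r * M * (1 + C))) * A) (FT (rrw f))"
   if f: "bnd s A f" "evn f" for f A proof -
   have f2: "bnd 2 A f" using f(1) s by (rule bnd_weaken) simp
   have "bnd ?r A f" using f(1) by (rule bnd_weaken) auto
   moreover have "bnd ?r (C * A) (FT (rrw f))" using C[OF f] by (rule bnd_weaken) auto
   ultimately have "bnd ?r (A + C * A) (rr f)" unfolding rr_def[abs_def] by (rule bnd_add)
   with bnd_weaken[OF M r(2) order_refl] have "bnd ?r (ccon ?r * M * (A + C * A)) (conv s0 (rr f))"
    by (rule bnd_conv[OF _ _ r(1)])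
   from bnd_div4[OF bnd_cmult[OF this, of 12]]
   have "bnd (?r + 2) (2 * (abs 12 * (ccon ?r * M * (A + C * A)))) (FT (rrw f))"
    unfolding rrw_hat_eq[OF f2 evnD[OF f(2)], abs_def] .
   then show ?thesis by (rule bnd_weaken) (simp, simp add: algebra_simps)
  qed
  then show ?case using C0 M0 ccon_nonneg[of ?r] by (intro exI[of _ "2 * (12 * (ccon ?r * M * (1 + C)))"]) simp
 qed
 from this[of s] show ?thesis by simp
qed

section \<open>Symbols of the linear problem in a layer\<close>

text \<open>\<open>ch k\<close> is \<open>k coth k\<close> and \<open>ee k - ee (- k) = k\<close>. Splitting \<open>k coth k\<close> into the two positive
functions \<open>ee k\<close> and \<open>ee (- k)\<close> removes the singularity of the quotient at zero, and neither grows
faster than \<open>|k|\<close>.\<close>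

definition ee :: "real \<Rightarrow> real" where
 "ee k = (if k = 0 then 1 / 2 else k / (1 - exp (- 2 * k)))"

definition "ch k = ee k + ee (- k)"

lemma ee_mult: "ee k * (1 - exp (- 2 * k)) = k" by (simp add: ee_def)

lemma ee_exp: "ee k * exp (- 2 * k) = ee (- k)" proof (cases "k = 0")
 case False
 then have "1 - exp (- 2 * k) \<noteq> 0" "1 - exp (2 * k) \<noteq> 0" by auto
 moreover have "exp (2 * k) * exp (- 2 * k) = 1" by (simp add: exp_add[symmetric])
 ultimately show ?thesis using False by (simp add: ee_def field_simps)
qed (simp add: ee_def)

lemma ee_diff: "ee k - ee (- k) = k" using ee_mult[of k] ee_exp[of k] by (simp add: right_diff_distrib)

lemma ee_pos: "0 < ee k" by (cases "k > 0") (auto simp: ee_def zero_less_divide_iff)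

lemma ee_le: "ee k \<le> 1 / 2 + max 0 k" proof -
 have pos: "ee k \<le> 1 / 2 + k" if "0 < k" for k proof -
  have "exp (- 2 * k) * (1 + 2 * k) \<le> exp (- 2 * k) * exp (2 * k)"
   using exp_ge_add_one_self[of "2 * k"] by (intro mult_left_mono) auto
  also have "... = 1" by (simp add: exp_add[symmetric])
  finally have "k \<le> (1 / 2 + k) * (1 - exp (- 2 * k))" by (simp add: algebra_simps)
  then show ?thesis using that by (simp add: ee_def pos_divide_le_eq)
 qed
 consider "k = 0" | "0 < k" | "k < 0" by linarith
 then show ?thesis proof cases
  case 1 then show ?thesis by (simp add: ee_def)
 next
  case 2 then show ?thesis using pos[of k] by simp
 next
  case 3 then show ?thesis using pos[of "- k"] ee_diff[of k] by simp
 qed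
qed

lemma ee_cont: "continuous_on UNIV ee" proof -
 have "isCont ee k" for k proof (cases "k = 0")
  case True
  have l: "((\<lambda>k. k / (1 - exp (- 2 * k))) \<longlongrightarrow> 1 / 2) (at (0::real))" by real_asymp
  have "(ee \<longlongrightarrow> 1 / 2) (at 0)" by (rule Lim_transform_eventually[OF l]) (simp add: eventually_at_filter ee_def)
  then show ?thesis using True by (simp add: isCont_def ee_def)
 next
  case False
  have "isCont (\<lambda>k. k / (1 - exp (- 2 * k))) k" using False by (intro continuous_intros) auto
  moreover have ev: "\<forall>\<^sub>F x in nhds k. ee x = x / (1 - exp (- 2 * x))"
   using eventually_nhds_in_open[of "- {0}" k] False by (auto elim!: eventually_mono simp: ee_def)
  ultimately show ?thesis using isCont_cong[OF ev] by simp
 qed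
 then show ?thesis by (simp add: continuous_on_eq_continuous_at)
qed

lemma ch_even: "ch (- k) = ch k" by (simp add: ch_def)
lemma ch_0: "ch 0 = 1" by (simp add: ch_def ee_def)
lemma ch_cont: "continuous_on UNIV ch"
 unfolding ch_def[abs_def] by (intro continuous_intros ee_cont continuous_on_compose2[OF ee_cont]) auto

lemma ch_sinh: "ch k * sinh k = k * cosh k" proof -
 have "ch k * (1 - exp (- 2 * k)) = ee k * (1 - exp (- 2 * k)) + ee k * (1 - exp (- 2 * k)) * exp (- 2 * k)"
  unfolding ch_def ee_exp[of k, symmetric] by (simp add: algebra_simps)
 also have "... = k * (1 + exp (- 2 * k))" by (simp only: ee_mult) (simp add: algebra_simps)
 finally have *: "ch k * (1 - exp (- 2 * k)) = k * (1 + exp (- 2 * k))" .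
 have e: "exp k * exp (- 2 * k) = exp (- k)" by (simp add: exp_add[symmetric])
 have "ch k * sinh k = (exp k / 2) * (ch k * (1 - exp (- 2 * k)))" using e by (simp add: sinh_def algebra_simps)
 also have "... = k * cosh k" unfolding * using e by (simp add: cosh_def algebra_simps)
 finally show ?thesis .
qed

lemma ch_lower_abs: "abs k \<le> ch k" using ee_diff[of k] ee_pos[of k] ee_pos[of "- k"] by (auto simp: ch_def)

lemma ch_upper_abs: "ch k \<le> 1 + abs k" using ee_le[of k] ee_le[of "- k"] by (auto simp: ch_def)

lemma nonneg_from_deriv:
 fixes f :: "real \<Rightarrow> real"
 assumes "\<And>x. 0 \<le> x \<Longrightarrow> (f has_real_derivative f' x) (at x)" "\<And>x. 0 \<le> x \<Longrightarrow> 0 \<le> f' x" "f 0 = 0" "0 \<le> k"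
 shows "0 \<le> f k" using DERIV_nonneg_imp_nondecreasing[of 0 k f] assms by auto

lemma sinh_le_xcosh: assumes "0 \<le> k" shows "sinh k \<le> k * cosh (k::real)" proof -
 have "0 \<le> k * cosh k - sinh k" by (rule nonneg_from_deriv[of "\<lambda>k. k * cosh k - sinh k" "\<lambda>k. k * sinh k" k])
    (auto intro!: derivative_eq_intros assms)
 then show ?thesis by simp
qed

lemma x_le_sinh: assumes "0 \<le> k" shows "k \<le> sinh (k::real)" proof -
 have "0 \<le> sinh k - k" by (rule nonneg_from_deriv[of "\<lambda>k. sinh k - k" "\<lambda>k. cosh k - 1" k])
    (auto intro!: derivative_eq_intros assms simp: cosh_real_ge_1)
 then show ?thesis by simp
qed

text \<open>Multiplied by \<open>sinh k\<close> both inequalities hold at zero and follow for positive \<open>k\<close> by comparing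
derivatives, repeatedly.\<close>

lemma ch_taylor:
 "1 + k\<^sup>2 / 3 - k^4 / 18 \<le> ch k" "ch k \<le> 1 + k\<^sup>2 / 3" proof -
 have main: "1 + k\<^sup>2 / 3 - k^4 / 18 \<le> ch k \<and> ch k \<le> 1 + k\<^sup>2 / 3" if k: "0 < k" for k proof
  have sp: "0 < sinh k" using k by simp
  have "0 \<le> (1 + k\<^sup>2 / 3) * sinh k - k * cosh k"
   by (rule nonneg_from_deriv[of "\<lambda>k. (1 + k\<^sup>2 / 3) * sinh k - k * cosh k" "\<lambda>k. (k / 3) * (k * cosh k - sinh k)"])
     (use k in \<open>auto intro!: derivative_eq_intros mult_nonneg_nonneg simp: sinh_le_xcosh, simp add: field_simps power2_eq_square\<close>)
  then have "ch k * sinh k \<le> (1 + k\<^sup>2 / 3) * sinh k" by (simp add: ch_sinh)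
  then show "ch k \<le> 1 + k\<^sup>2 / 3" using sp by simp
  \<comment> \<open>\<open>k cosh k - sinh k \<ge> k^3 / 3\<close> and \<open>k \<ge> sinh k (1 - k^2 / 6)\<close> combine to the lower bound\<close>
  have c3: "0 \<le> k * cosh k - sinh k - k^3 / 3"
  proof (rule nonneg_from_deriv[of "\<lambda>k. k * cosh k - sinh k - k^3 / 3" "\<lambda>k. k * (sinh k - k)"])
   show "0 \<le> x \<Longrightarrow> 0 \<le> x * (sinh x - x)" for x :: real using x_le_sinh[of x] by simp
  qed (use k in \<open>auto intro!: derivative_eq_intros simp: algebra_simps power2_eq_square\<close>)
  have d: "0 \<le> x \<Longrightarrow> 0 \<le> 1 - (cosh x * (1 - x\<^sup>2 / 6) - (x / 3) * sinh x)" for x :: real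
  proof (rule nonneg_from_deriv[of "\<lambda>x. 1 - (cosh x * (1 - x\<^sup>2 / 6) - (x / 3) * sinh x)"
     "\<lambda>x. (2 / 3) * (x * cosh x - sinh x) + (x\<^sup>2 / 6) * sinh x"])
   show "0 \<le> x \<Longrightarrow> 0 \<le> (2 / 3) * (x * cosh x - sinh x) + (x\<^sup>2 / 6) * sinh x" for x :: real
    using sinh_le_xcosh[of x] by simp
  qed (auto intro!: derivative_eq_intros simp: field_simps power2_eq_square)
  have s6: "0 \<le> k - sinh k * (1 - k\<^sup>2 / 6)"
   by (rule nonneg_from_deriv[of "\<lambda>k. k - sinh k * (1 - k\<^sup>2 / 6)" "\<lambda>x. 1 - (cosh x * (1 - x\<^sup>2 / 6) - (x / 3) * sinh x)"])
     (use k d in \<open>auto intro!: derivative_eq_intros simp: field_simps power2_eq_square\<close>)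
  have "(k\<^sup>2 / 3) * (sinh k * (1 - k\<^sup>2 / 6)) \<le> (k\<^sup>2 / 3) * k" using s6 by (intro mult_left_mono) auto
  also have "... = k^3 / 3" by (simp add: power2_eq_square power3_eq_cube)
  also have "... \<le> (ch k - 1) * sinh k" using c3 by (simp add: left_diff_distrib ch_sinh)
  finally have "((k\<^sup>2 / 3) * (1 - k\<^sup>2 / 6)) * sinh k \<le> (ch k - 1) * sinh k" by (simp add: mult_ac)
  then have "(k\<^sup>2 / 3) * (1 - k\<^sup>2 / 6) \<le> ch k - 1" using sp by simp
  then show "1 + k\<^sup>2 / 3 - k^4 / 18 \<le> ch k" by (simp add: algebra_simps power4_eq_xxxx power2_eq_square)
 qed
 consider "k = 0" | "0 < k" | "0 < - k" by linarith
 then have "1 + k\<^sup>2 / 3 - k^4 / 18 \<le> ch k \<and> ch k \<le> 1 + k\<^sup>2 / 3"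
  by cases (use main[of k] main[of "- k"] ch_even[of k] ch_0 in auto)
 then show "1 + k\<^sup>2 / 3 - k^4 / 18 \<le> ch k" "ch k \<le> 1 + k\<^sup>2 / 3" by auto
qed

lemma ch_ge_1: "1 \<le> ch k" proof (cases "abs k \<le> 1")
 case True
 then have "k\<^sup>2 \<le> 1" by (simp add: abs_square_le_1)
 then have "k\<^sup>2 * k\<^sup>2 \<le> k\<^sup>2 * 1" by (intro mult_left_mono) auto
 then have "k^4 \<le> k\<^sup>2" by (simp add: power2_eq_square power4_eq_xxxx)
 then show ?thesis using ch_taylor(1)[of k] zero_le_power2[of k] by linarith
next
 case False then show ?thesis using ch_lower_abs[of k] by linarith
qed

lemma ch_lower: "min (k\<^sup>2) (abs k) / 9 \<le> ch k - 1" proof (cases "abs k \<le> 2")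
 case True
 then have "k\<^sup>2 \<le> 4" using power_mono[of "abs k" 2 2] by simp
 then have "k\<^sup>2 * k\<^sup>2 \<le> k\<^sup>2 * 4" by (intro mult_left_mono) auto
 then have "k^4 \<le> 4 * k\<^sup>2" by (simp add: power2_eq_square power4_eq_xxxx)
 then show ?thesis using ch_taylor(1)[of k] by linarith
next
 case False then show ?thesis using ch_lower_abs[of k] by linarith
qed

text \<open>The solution of \<open>y' = - k y\<close> on \<open>[-1, 1]\<close> normalised by \<open>y 1 - y (-1) = - 2 k\<close>. Its values at the
ends have mean \<open>ch k\<close>, and \<open>el 0 t = 1\<close>, so the normalisation stays regular at \<open>k = 0\<close>.\<close>

definition "el k t = 2 * ee k * exp (- k * (t + 1))"

lemma el_pos: "0 < el k t" by (simp add: el_def ee_pos)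

lemma el_reflect: "el (- k) (- t) = el k t" proof -
 have "el (- k) (- t) = 2 * ee k * (exp (- 2 * k) * exp (- (- k) * (- t + 1)))" unfolding el_def ee_exp[of k, symmetric] by simp
 also have "exp (- 2 * k) * exp (- (- k) * (- t + 1)) = exp (- k * (t + 1))"
  unfolding exp_add[symmetric] by (simp add: algebra_simps)
 finally show ?thesis by (simp add: el_def)
qed

lemma el_ends: "el k 1 = 2 * ee (- k)" "el k (- 1) = 2 * ee k" using ee_exp[of k] by (simp_all add: el_def mult.commute[of k 2])

lemma el_le:
 assumes "t \<in> {-1..1}" shows "el k t \<le> 1 + 2 * abs k" proof (cases "0 \<le> k")
 case True
 then have "0 \<le> k * (t + 1)" using assms by simp
 then have "exp (- k * (t + 1)) \<le> 1" by simp
 then have "el k t \<le> 2 * ee k * 1" unfolding el_def using ee_pos[of k] by (intro mult_left_mono) auto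
 then show ?thesis using ee_le[of k] True by simp
next
 case False
 then have "k * (1 - t) \<le> 0" using assms by (simp add: mult_nonpos_nonneg)
 then have "exp (k * (1 - t)) \<le> 1" by simp
 then have "el (- k) (- t) \<le> 2 * ee (- k) * 1" unfolding el_def using ee_pos[of "- k"]
  by (intro mult_left_mono) (auto simp: algebra_simps)
 then show ?thesis using ee_le[of "- k"] False by (simp add: el_reflect)
qed

lemma el_cont: "continuous_on S f \<Longrightarrow> continuous_on S g \<Longrightarrow> continuous_on S (\<lambda>x. el (f x) (g x))"
 unfolding el_def by (intro continuous_intros continuous_on_compose2[OF ee_cont]) auto

section \<open>The linear problem in a flattened layer\<close>

definition JJ :: "real \<Rightarrow> (real \<Rightarrow> real) \<Rightarrow> real \<Rightarrow> real" where
 "JJ k s t = integral {-1..t} (\<lambda>z. exp (k * z) * s z)"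

text \<open>The particular solution of \<open>y' = - k (y + s)\<close>, \<open>k = \<nu> xi\<close>, with equal values at both
ends. It carries no flux, so the flux condition concerns the exponential alone.\<close>

definition "SS \<nu> s t xi = - exp (- (\<nu> * xi) * t) *
   ((\<nu> * xi) * JJ (\<nu> * xi) (\<lambda>z. s z xi) t + ee (- (\<nu> * xi)) * JJ (\<nu> * xi) (\<lambda>z. s z xi) 1)"

lemma JJ_deriv:
 assumes "continuous_on {-1..1} s" "t \<in> {-1..1}"
 shows "(JJ k s has_real_derivative exp (k * t) * s t) (at t within {-1..1})" proof -
 have "((\<lambda>u. integral {-1..u} (\<lambda>z. exp (k * z) * s z)) has_real_derivative exp (k * t) * s t) (at t within {-1..1})"
  by (rule integral_has_real_derivative) (intro continuous_intros assms, rule assms)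
 then show ?thesis by (simp add: JJ_def[abs_def])
qed

lemma JJ_cont2:
 assumes s: "continuous_on ({-1..1} \<times> UNIV) (\<lambda>p. s (fst p) (snd p))"
 shows "continuous_on ({-1..1} \<times> UNIV) (\<lambda>p. JJ (\<nu> * snd p) (\<lambda>z. s z (snd p)) (fst p))" proof -
 have eq: "JJ k f t = (t + 1) * integral {0..1} (\<lambda>r. exp (k * (r * (t + 1) - 1)) * f (r * (t + 1) - 1))"
  if t: "t \<in> {-1..1}" and f: "continuous_on {-1..1} f" for k f t proof (cases "t = -1")
  case True then show ?thesis by (simp add: JJ_def)
 next
  case False
  then have t1: "0 < t + 1" using t by auto
  have c: "continuous_on {-1..t} (\<lambda>z. exp (k * z) * f z)"
   using t by (intro continuous_intros continuous_on_subset[OF f]) auto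
  then have "((\<lambda>z. exp (k * z) * f z) has_integral JJ k f t) (cbox (-1) t)"
   unfolding JJ_def by (simp add: integrable_continuous_interval integrable_integral)
  from has_integral_affinity[OF this, of "t + 1" "-1"] t1
  have "((\<lambda>r. exp (k * ((t + 1) * r - 1)) * f ((t + 1) * r - 1)) has_integral JJ k f t / (t + 1))
    ((\<lambda>x. (1 / (t + 1)) *\<^sub>R x + - ((1 / (t + 1)) *\<^sub>R - 1)) ` cbox (- 1) t)"
   by (simp add: divide_inverse mult.commute)
  moreover have "((\<lambda>x. (1 / (t + 1)) *\<^sub>R x + - ((1 / (t + 1)) *\<^sub>R - 1)) ` cbox (- 1) t) = {0..1}" proof -
   have eq: "(\<lambda>x. (1 / (t + 1)) *\<^sub>R x + - ((1 / (t + 1)) *\<^sub>R - 1)) = (\<lambda>x. (x + 1) / (t + 1))"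
    by (auto simp: add_divide_distrib)
   have "y \<in> (\<lambda>x. (x + 1) / (t + 1)) ` {-1..t}" if "y \<in> {0..1}" for y proof
    show "y = ((y * (t + 1) - 1) + 1) / (t + 1)" using t1 by simp
    have "0 \<le> y * (t + 1)" "y * (t + 1) \<le> 1 * (t + 1)" using that t1 by (auto intro!: mult_right_mono)
    then show "y * (t + 1) - 1 \<in> {-1..t}" by auto
   qed
   moreover have "(x + 1) / (t + 1) \<in> {0..1}" if "x \<in> {-1..t}" for x using that t1 by auto
   ultimately show ?thesis unfolding eq by auto
  qed
  ultimately have "integral {0..1} (\<lambda>r. exp (k * ((t + 1) * r - 1)) * f ((t + 1) * r - 1)) = JJ k f t / (t + 1)"
   by (simp add: integral_unique)
  then show ?thesis using t1 by (simp add: mult.commute)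
 qed
 have "continuous_on ({-1..1} \<times> UNIV) (\<lambda>p. (fst p + 1) *
   integral (cbox 0 1) (\<lambda>r. exp (\<nu> * snd p * (r * (fst p + 1) - 1)) * s (r * (fst p + 1) - 1) (snd p)))"
 proof (intro continuous_intros integral_continuous_on_param)
  have 1: "continuous_on (({-1..1} \<times> UNIV) \<times> cbox 0 1) (\<lambda>q::(real\<times>real)\<times>real. (\<lambda>p. s (fst p) (snd p)) (snd q * (fst (fst q) + 1) - 1, snd (fst q)))"
  proof (rule continuous_on_compose2[OF s])
   show "(\<lambda>q::(real\<times>real)\<times>real. (snd q * (fst (fst q) + 1) - 1, snd (fst q))) ` (({-1..1} \<times> UNIV) \<times> cbox 0 1) \<subseteq> {-1..1} \<times> UNIV"
   proof safe
    fix t xi r :: real assume t: "t \<in> {-1..1}" and r: "r \<in> cbox 0 1"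
    then have "0 \<le> r * (t + 1)" by simp
    moreover have "r * (t + 1) \<le> 1 * (t + 1)" using t r by (intro mult_right_mono) auto
    ultimately show "snd ((t, xi), r) * (fst (fst ((t, xi), r)) + 1) - 1 \<in> {-1..1}" using t by auto
   qed simp
  qed (intro continuous_intros)
  have "continuous_on (({-1..1} \<times> UNIV) \<times> cbox 0 1) (\<lambda>q::(real\<times>real)\<times>real.
   exp (\<nu> * snd (fst q) * (snd q * (fst (fst q) + 1) - 1)) * s (snd q * (fst (fst q) + 1) - 1) (snd (fst q)))"
   using 1 by (intro continuous_intros) simp_all
  then show "continuous_on (({-1..1} \<times> UNIV) \<times> cbox 0 1) (\<lambda>(p, r).
   exp (\<nu> * snd p * (r * (fst p + 1) - 1)) * s (r * (fst p + 1) - 1) (snd p))" by (simp add: case_prod_unfold)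
 qed
 then show ?thesis proof (rule continuous_on_eq)
  fix p :: "real \<times> real" assume p: "p \<in> {-1..1} \<times> UNIV"
  have "continuous_on {-1..1} (\<lambda>z. (\<lambda>p. s (fst p) (snd p)) (z, snd p))"
   by (rule continuous_on_compose2[OF s]) (auto intro!: continuous_intros)
  then show "(fst p + 1) * integral (cbox 0 1) (\<lambda>r. exp (\<nu> * snd p * (r * (fst p + 1) - 1)) * s (r * (fst p + 1) - 1) (snd p))
   = JJ (\<nu> * snd p) (\<lambda>z. s z (snd p)) (fst p)"
   using p eq[of "fst p" "\<lambda>z. s z (snd p)" "\<nu> * snd p"] by auto
 qed
qed

lemma exp_integral: "k * integral {a..b} (\<lambda>z. exp (k * z)) = exp (k * b) - exp (k * a)" if "a \<le> b" for a b k :: real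
proof -
 have "((\<lambda>z. k * exp (k * z)) has_integral exp (k * b) - exp (k * a)) {a..b}"
  using that by (intro fundamental_theorem_of_calculus)
   (auto intro!: derivative_eq_intros simp flip: has_real_derivative_iff_has_vector_derivative)
 from integral_unique[OF this] show ?thesis by simp
qed

lemma ee_exp_integral: "ee (- k) * integral {-1..1} (\<lambda>z. exp (k * z)) = exp (- k)" proof (cases "k = 0")
 case True then show ?thesis by (simp add: ee_def)
next
 case False
 have "k * (ee (- k) * integral {-1..1} (\<lambda>z. exp (k * z))) = ee (- k) * (exp k - exp (- k))"
  using exp_integral[of "-1" 1 k] by simp
 also have "... = ee k * (1 - exp (- 2 * k)) * exp (- k)" proof -
  have "exp (- 2 * k) * exp k = exp (- k)" "exp (- 2 * k) * exp (- k) = exp (- 2 * k) * exp (- k)"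
   by (simp_all add: exp_add[symmetric])
  then show ?thesis unfolding ee_exp[of k, symmetric] by (simp add: algebra_simps)
 qed
 also have "... = k * exp (- k)" by (simp only: ee_mult)
 finally show ?thesis using False by simp
qed

text \<open>The particular solution operator is minus an average against a probability kernel, so it
 does not increase the supremum over the layer; this holds uniformly in the frequency.\<close>

lemma SS_abs_le:
 assumes c: "continuous_on {-1..1} (\<lambda>z. s z xi)" and M: "\<And>z. z \<in> {-1..1} \<Longrightarrow> abs (s z xi) \<le> M"
  and t: "t \<in> {-1..1}"
 shows "abs (SS \<nu> s t xi) \<le> M" proof -
 define k where "k = \<nu> * xi"
 define f where "f z = exp (k * z) * s z xi" for z
 define I where "I a b = integral {a..b} (\<lambda>z. exp (k * z))" for a b
 have fc: "continuous_on {-1..1} f" unfolding f_def by (intro continuous_intros c)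
 have fle: "abs (integral {a..b} f) \<le> M * I a b" if "{a..b} \<subseteq> {-1..1}" for a b proof -
  have "norm (integral {a..b} f) \<le> integral {a..b} (\<lambda>z. M * exp (k * z))" proof (rule integral_norm_bound_integral)
   show "f integrable_on {a..b}" using continuous_on_subset[OF fc that] by (rule integrable_continuous_interval)
   show "(\<lambda>z. M * exp (k * z)) integrable_on {a..b}" by (intro integrable_continuous_interval continuous_intros)
   fix z assume "z \<in> {a..b}"
   then show "norm (f z) \<le> M * exp (k * z)"
    using M[of z] that by (auto simp: f_def abs_mult mult.commute[of M] intro!: mult_left_mono)
  qed
  then show ?thesis by (simp add: I_def)
 qed
 define A where "A = integral {-1..t} f"
 define B where "B = integral {t..1} f"
 have AB: "integral {-1..1} f = A + B" unfolding A_def B_def using t fc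
  by (intro Henstock_Kurzweil_Integration.integral_combine[symmetric] integrable_continuous_interval) auto
 have I12: "I (-1) 1 = I (-1) t + I t 1" unfolding I_def using t
  by (intro Henstock_Kurzweil_Integration.integral_combine[symmetric] integrable_continuous_interval continuous_intros) auto
 have ek: "ee k = k + ee (- k)" using ee_diff[of k] by linarith
 have "SS \<nu> s t xi = - exp (- k * t) * (k * A + ee (- k) * (A + B))"
  unfolding SS_def JJ_def AB[symmetric] unfolding A_def f_def k_def by simp
 also have "... = - exp (- k * t) * (ee k * A + ee (- k) * B)" unfolding ek by (simp add: algebra_simps)
 finally have "abs (SS \<nu> s t xi) = exp (- k * t) * abs (ee k * A + ee (- k) * B)" by (simp add: abs_mult)
 also have "... \<le> exp (- k * t) * (ee k * (M * I (-1) t) + ee (- k) * (M * I t 1))" proof (rule mult_left_mono)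
  have "abs (ee k * A) \<le> ee k * (M * I (-1) t)" "abs (ee (- k) * B) \<le> ee (- k) * (M * I t 1)"
   unfolding A_def B_def abs_mult using ee_pos[of k] ee_pos[of "- k"] t by (auto intro!: mult_left_mono fle)
  then show "abs (ee k * A + ee (- k) * B) \<le> ee k * (M * I (-1) t) + ee (- k) * (M * I t 1)" by linarith
 qed simp
 also have "ee k * (M * I (-1) t) + ee (- k) * (M * I t 1) = M * (k * I (-1) t + ee (- k) * I (-1) 1)"
  unfolding I12 ek by (simp add: algebra_simps)
 also have "k * I (-1) t + ee (- k) * I (-1) 1 = exp (k * t)"
  using exp_integral[of "-1" t k] ee_exp_integral[of k] t by (simp add: I_def)
 also have "exp (- k * t) * (M * exp (k * t)) = M" by (simp add: exp_minus)
 finally show ?thesis .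
qed

lemma bnd2_SS:
 assumes F: "bnd2 s A F" shows "bnd2 s A (SS \<nu> F)" proof (rule bnd2I)
 note J = JJ_cont2[OF bnd2_contD[OF F], of \<nu>]
 have J1: "continuous_on ({-1..1} \<times> UNIV) (\<lambda>p::real\<times>real. JJ (\<nu> * snd p) (\<lambda>z. F z (snd p)) 1)"
 proof -
  have "continuous_on ({-1..1} \<times> UNIV) (\<lambda>p::real\<times>real. (\<lambda>p. JJ (\<nu> * snd p) (\<lambda>z. F z (snd p)) (fst p)) (1, snd p))"
   by (rule continuous_on_compose2[OF J]) (auto intro!: continuous_intros)
  then show ?thesis by simp
 qed
 have E: "continuous_on ({-1..1} \<times> UNIV) (\<lambda>p::real\<times>real. ee (- (\<nu> * snd p)))"
  by (rule continuous_on_compose2[OF ee_cont]) (auto intro!: continuous_intros)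
 show "continuous_on ({-1..1} \<times> UNIV) (\<lambda>p. SS \<nu> F (fst p) (snd p))"
  unfolding SS_def by (intro continuous_intros J J1 E)
 fix t xi :: real assume t: "t \<in> {-1..1}"
 have "abs (SS \<nu> F t xi) \<le> A / (1 + abs xi)^s"
  by (rule SS_abs_le[OF bnd2_cont_t[OF F] _ t]) (rule bndD(3)[OF bnd2_slice[OF F]])
 then show "(1 + abs xi)^s * abs (SS \<nu> F t xi) \<le> A" by (simp add: field_simps)
qed

lemma SS_deriv:
 assumes F: "continuous_on {-1..1} (\<lambda>z. F z xi)" and t: "t \<in> {-1..1}"
 shows "((\<lambda>t. SS \<nu> F t xi) has_real_derivative - (\<nu> * xi) * (SS \<nu> F t xi + F t xi)) (at t within {-1..1})"
proof -
 let ?k = "\<nu> * xi" and ?J = "JJ (\<nu> * xi) (\<lambda>z. F z xi)"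
 have "exp (- ?k * t) * exp (?k * t) = 1" by (simp add: exp_add[symmetric])
 then have e: "exp (- ?k * t) * (?k * (exp (?k * t) * F t xi)) = ?k * F t xi"
  by (simp only: mult.left_commute[of "exp (- ?k * t)" ?k] mult.assoc[symmetric]) (simp add: mult.assoc)
 have "((\<lambda>t. - exp (- ?k * t) * (?k * ?J t + ee (- ?k) * ?J 1)) has_real_derivative
   (?k * exp (- ?k * t)) * (?k * ?J t + ee (- ?k) * ?J 1) + (?k * (exp (?k * t) * F t xi)) * (- exp (- ?k * t))) (at t within {-1..1})"
  by (auto intro!: derivative_eq_intros JJ_deriv F t)
 then show ?thesis unfolding SS_def by (rule DERIV_cong) (use e in \<open>simp add: algebra_simps\<close>)
qed

lemma JJ_reflect:
 assumes s: "continuous_on {-1..1} s" and t: "t \<in> {-1..1}"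
  and s': "\<And>z. z \<in> {-1..1} \<Longrightarrow> s' (- z) = c * s z"
 shows "JJ (- k) s' (- t) = c * (JJ k s 1 - JJ k s t)" proof -
 have "JJ (- k) s' (- t) = integral {t..1} (\<lambda>z. exp (k * z) * s' (- z))" unfolding JJ_def
  using Henstock_Kurzweil_Integration.integral_reflect_real[of 1 t "\<lambda>z. exp (k * z) * s' (- z)"] by simp
 also have "... = integral {t..1} (\<lambda>z. c * (exp (k * z) * s z))" by (rule integral_cong) (use t s' in auto)
 also have "... = c * integral {t..1} (\<lambda>z. exp (k * z) * s z)" by simp
 also have "integral {t..1} (\<lambda>z. exp (k * z) * s z) = JJ k s 1 - JJ k s t" proof -
  have "integral {-1..t} (\<lambda>z. exp (k * z) * s z) + integral {t..1} (\<lambda>z. exp (k * z) * s z) = integral {-1..1} (\<lambda>z. exp (k * z) * s z)"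
   using t by (intro Henstock_Kurzweil_Integration.integral_combine integrable_continuous_interval continuous_intros s) auto
  then show ?thesis by (simp add: JJ_def)
 qed
 finally show ?thesis .
qed

lemma SS_reflect:
 assumes s: "continuous_on {-1..1} (\<lambda>z. F z xi)" and t: "t \<in> {-1..1}"
  and s': "\<And>z. z \<in> {-1..1} \<Longrightarrow> F (- z) (- xi) = c * F z xi"
 shows "SS \<nu> F (- t) (- xi) = c * SS \<nu> F t xi" proof -
 let ?k = "\<nu> * xi" and ?J = "JJ (\<nu> * xi) (\<lambda>z. F z xi)"
 have J: "JJ (- ?k) (\<lambda>z. F z (- xi)) (- t) = c * (?J 1 - ?J t)" by (rule JJ_reflect[OF s t]) (rule s')
 have "JJ (- ?k) (\<lambda>z. F z (- xi)) (- (- 1)) = c * (?J 1 - ?J (- 1))" by (rule JJ_reflect[OF s]) (auto intro: s')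
 then have J1: "JJ (- ?k) (\<lambda>z. F z (- xi)) 1 = c * ?J 1" by (simp add: JJ_def)
 have "SS \<nu> F (- t) (- xi) = - exp (- ?k * t) * (- ?k * (c * (?J 1 - ?J t)) + ee ?k * (c * ?J 1))"
  using J J1 by (simp add: SS_def)
 also have "... = c * SS \<nu> F t xi" proof -
  have ek: "ee ?k = ?k + ee (- ?k)" using ee_diff[of ?k] by linarith
  show ?thesis unfolding SS_def ek by (simp add: algebra_simps)
 qed
 finally show ?thesis .
qed

lemma SS_ends:
 "SS \<nu> F 1 xi = - ee (\<nu> * xi) * exp (- (\<nu> * xi)) * JJ (\<nu> * xi) (\<lambda>z. F z xi) 1"
 "SS \<nu> F (- 1) xi = SS \<nu> F 1 xi" proof -
 let ?k = "\<nu> * xi" and ?J = "JJ (\<nu> * xi) (\<lambda>z. F z xi)"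
 have "SS \<nu> F 1 xi = - exp (- ?k) * ((?k + ee (- ?k)) * ?J 1)" by (simp add: SS_def distrib_right)
 also have "?k + ee (- ?k) = ee ?k" using ee_diff[of ?k] by linarith
 finally show 1: "SS \<nu> F 1 xi = - ee ?k * exp (- ?k) * ?J 1" by simp
 have "SS \<nu> F (- 1) xi = - exp ?k * (ee (- ?k) * ?J 1)" by (simp add: SS_def JJ_def)
 also have "... = - (ee ?k * (exp ?k * exp (- 2 * ?k)) * ?J 1)" unfolding ee_exp[of ?k, symmetric] by (simp add: mult_ac)
 also have "exp ?k * exp (- 2 * ?k) = exp (- ?k)" by (simp add: exp_add[symmetric])
 finally show "SS \<nu> F (- 1) xi = SS \<nu> F 1 xi" unfolding 1 by simp
qed

lemma JJ_lin:
 assumes "continuous_on {-1..1} f" "continuous_on {-1..1} g" "t \<in> {-1..1}"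
 shows "JJ k (\<lambda>z. f z + g z) t = JJ k f t + JJ k g t" "JJ k (\<lambda>z. c * f z) t = c * JJ k f t" proof -
 have "(\<lambda>z. exp (k * z) * f z) integrable_on {-1..t}" "(\<lambda>z. exp (k * z) * g z) integrable_on {-1..t}"
  using assms by (auto intro!: integrable_continuous_interval continuous_intros intro: continuous_on_subset)
 then show "JJ k (\<lambda>z. f z + g z) t = JJ k f t + JJ k g t"
  by (simp add: JJ_def distrib_left Henstock_Kurzweil_Integration.integral_add)
 show "JJ k (\<lambda>z. c * f z) t = c * JJ k f t"
  unfolding JJ_def by (subst Henstock_Kurzweil_Integration.integral_mult_right[symmetric]) (simp add: mult_ac)
qed

section \<open>Weights adapted to the wave number\<close>

text \<open>The Dirichlet--Neumann symbols grow like \<open>mu |xi|\<close>. With the factor \<open>1 + mu |xi|\<close> in the norm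
of the surface profile they act boundedly, uniformly in \<open>mu\<close>; a full power of \<open>1 + |xi|\<close> would lose
this uniformity.\<close>

definition "bndm mu s A f \<longleftrightarrow> bnd s A (\<lambda>xi. (1 + mu * abs xi) * f xi)"

lemma bnd_dom:
 assumes "bnd s A g" "continuous_on UNIV f" "\<And>xi. abs (f xi) \<le> abs (g xi)"
 shows "bnd s A f" unfolding bnd_def proof (intro conjI allI assms(2))
 fix xi :: real
 have "(1 + abs xi)^s * abs (f xi) \<le> (1 + abs xi)^s * abs (g xi)" by (intro mult_left_mono assms(3)) auto
 also have "... \<le> A" by (rule bndD(2)[OF assms(1)])
 finally show "(1 + abs xi)^s * abs (f xi) \<le> A" .
qed

lemma mu_weight_nz: "0 \<le> mu \<Longrightarrow> 1 + mu * abs (xi::real) > 0" by (simp add: add_pos_nonneg)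

lemma bndm_cont:
 assumes "0 \<le> mu" "bndm mu s A f" shows "continuous_on S f" proof -
 have nz: "1 + mu * abs xi \<noteq> 0" for xi :: real by (rule less_imp_neq[THEN not_sym, OF mu_weight_nz[OF assms(1)]])
 have "continuous_on S (\<lambda>xi. ((1 + mu * abs xi) * f xi) / (1 + mu * abs xi))"
  using assms(2) nz unfolding bndm_def by (intro continuous_intros bndD(1)) auto
 then show ?thesis by (simp only: nonzero_mult_div_cancel_left[OF nz])
qed

abbreviation slope :: "real \<Rightarrow> (real \<Rightarrow> real) \<Rightarrow> real \<Rightarrow> real" where
 "slope mu f \<equiv> \<lambda>x. mu * x * f x"

lemma bndm_bnd:
 assumes "0 \<le> mu" "bndm mu s A f"
 shows "bnd s A f" "bnd s A (slope mu f)" proof -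
 note c = bndm_cont[OF assms, of UNIV] and b = assms(2)[unfolded bndm_def]
 have p: "0 \<le> mu * abs xi" for xi :: real using assms(1) by simp
 have e: "abs ((1 + mu * abs xi) * f xi) = (1 + mu * abs xi) * abs (f xi)" for xi
  unfolding abs_mult abs_of_pos[OF mu_weight_nz[OF assms(1)]] ..
 show "bnd s A f" proof (rule bnd_dom[OF b c])
  fix xi
  have "1 * abs (f xi) \<le> (1 + mu * abs xi) * abs (f xi)" by (rule mult_right_mono) (use p[of xi] in simp_all)
  then show "abs (f xi) \<le> abs ((1 + mu * abs xi) * f xi)" unfolding e by simp
 qed
 show "bnd s A (slope mu f)" proof (rule bnd_dom[OF b])
  show "continuous_on UNIV (slope mu f)" by (intro continuous_intros c)
  fix xi
  have "(mu * abs xi) * abs (f xi) \<le> (1 + mu * abs xi) * abs (f xi)" by (rule mult_right_mono) simp_all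
  then show "abs (mu * xi * f xi) \<le> abs ((1 + mu * abs xi) * f xi)" unfolding e using assms(1) by (simp add: abs_mult)
 qed
qed

lemma bndmI:
 assumes "continuous_on UNIV f" "\<And>xi. (1 + mu * abs xi) * abs (f xi) \<le> A / (1 + abs xi)^s" "0 \<le> mu"
 shows "bndm mu s A f" unfolding bndm_def proof (rule bndI)
 show "continuous_on UNIV (\<lambda>xi. (1 + mu * abs xi) * f xi)" by (intro continuous_intros assms)
 show "abs ((1 + mu * abs xi) * f xi) \<le> A / (1 + abs xi)^s" for xi
  using assms(2)[of xi] mu_weight_nz[OF assms(3), of xi] by (simp add: abs_mult)
qed

lemma bndm_of_bnd:
 assumes "bnd (s + 1) A f" "0 \<le> mu" "mu \<le> 1" shows "bndm mu s A f" proof (rule bndmI[OF bndD(1)[OF assms(1)] _ assms(2)])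
 fix xi :: real
 have "mu * abs xi \<le> 1 * abs xi" using assms by (intro mult_right_mono) auto
 then have "(1 + mu * abs xi) * abs (f xi) \<le> (1 + abs xi) * (A / (1 + abs xi)^(s + 1))"
  using bndD(3)[OF assms(1), of xi] by (intro mult_mono) auto
 also have "... = A / (1 + abs xi)^s" proof -
  have "1 + abs xi \<noteq> 0" by linarith
  then show ?thesis by simp
 qed
 finally show "(1 + mu * abs xi) * abs (f xi) \<le> A / (1 + abs xi)^s" .
qed

lemma bndm_add: "bndm mu s A f \<Longrightarrow> bndm mu s B g \<Longrightarrow> bndm mu s (A + B) (\<lambda>xi. f xi + g xi)"
 unfolding bndm_def using bnd_add[of s A "\<lambda>xi. (1 + mu * abs xi) * f xi" B "\<lambda>xi. (1 + mu * abs xi) * g xi"]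
 by (simp add: distrib_left)

lemma bndm_diff: "bndm mu s A f \<Longrightarrow> bndm mu s B g \<Longrightarrow> bndm mu s (A + B) (\<lambda>xi. f xi - g xi)"
 unfolding bndm_def using bnd_diff[of s A "\<lambda>xi. (1 + mu * abs xi) * f xi" B "\<lambda>xi. (1 + mu * abs xi) * g xi"]
 by (simp add: right_diff_distrib)

lemma bndm_cmult: "bndm mu s A f \<Longrightarrow> bndm mu s (abs c * A) (\<lambda>xi. c * f xi)"
 unfolding bndm_def using bnd_cmult[of s A "\<lambda>xi. (1 + mu * abs xi) * f xi" c] by (simp add: mult_ac)

lemma bndm_weaken: "bndm mu s A f \<Longrightarrow> s' \<le> s \<Longrightarrow> A \<le> A' \<Longrightarrow> bndm mu s' A' f"
 unfolding bndm_def by (rule bnd_weaken)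

lemma bndm_mult:
 assumes "bnd s A f" "continuous_on UNIV m" "\<And>xi. (1 + mu * abs xi) * abs (m xi) \<le> B" "0 \<le> mu"
 shows "bndm mu s (B * A) (\<lambda>xi. m xi * f xi)" proof -
 have "bnd s (B * A) (\<lambda>xi. ((1 + mu * abs xi) * m xi) * f xi)" using assms mu_weight_nz[OF assms(4)]
  by (intro bnd_mult continuous_intros) (auto simp: abs_mult)
 then show ?thesis by (simp add: bndm_def mult.assoc)
qed

lemma bndm_mult':
 assumes "bndm mu s A f" "continuous_on UNIV m" "\<And>xi. abs (m xi) \<le> B"
 shows "bndm mu s (B * A) (\<lambda>xi. m xi * f xi)"
 using bnd_mult[OF assms(1)[unfolded bndm_def] assms(2,3)] by (simp add: bndm_def mult_ac)

lemma bndm_nonneg: "bndm mu s A f \<Longrightarrow> 0 \<le> A" unfolding bndm_def by (rule bndD(4))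

lemma bndm_conv:
 assumes f: "bndm mu s A f" and g: "bndm mu s B g" and s: "2 \<le> s" and mu: "0 \<le> mu"
 shows "bndm mu s (ccon s * A * B) (conv f g)" proof (rule bndmI[OF _ _ mu])
 note fb = bndm_bnd(1)[OF mu f] and gb = bndm_bnd(1)[OF mu g]
 show "continuous_on UNIV (conv f g)" by (rule bndD(1)[OF bnd_conv[OF fb gb s]])
 fix xi :: real
 let ?f = "\<lambda>xi. (1 + mu * abs xi) * f xi" and ?g = "\<lambda>xi. (1 + mu * abs xi) * g xi"
 have w: "1 + mu * abs xi \<le> (1 + mu * abs (xi - t)) * (1 + mu * abs t)" for t proof -
  have "mu * abs xi \<le> mu * (abs (xi - t) + abs t)" using mu by (intro mult_left_mono) auto
  moreover have "0 \<le> mu * abs (xi - t) * (mu * abs t)" using mu by simp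
  ultimately show ?thesis by (simp add: algebra_simps)
 qed
 have "(1 + mu * abs xi) * abs (conv f g xi) \<le> (1 + mu * abs xi) * (LBINT t. abs (f (xi - t)) * abs (g t))"
  using mu_weight_nz[OF mu, of xi] by (intro mult_left_mono conv_abs_le) auto
 also have "... = (LBINT t. (1 + mu * abs xi) * (abs (f (xi - t)) * abs (g t)))" by simp
 also have "... \<le> (LBINT t. abs (?f (xi - t)) * abs (?g t))" proof (rule integral_mono)
  show "integrable lborel (\<lambda>t. (1 + mu * abs xi) * (abs (f (xi - t)) * abs (g t)))"
   using integrable_abs[OF conv_integrable[OF fb gb s, of xi]] by (simp add: abs_mult)
  show "integrable lborel (\<lambda>t. abs (?f (xi - t)) * abs (?g t))"
   using integrable_abs[OF conv_integrable[OF f[unfolded bndm_def] g[unfolded bndm_def] s, of xi]] by (simp add: abs_mult)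
  fix t
  have "(1 + mu * abs xi) * (abs (f (xi - t)) * abs (g t)) \<le> ((1 + mu * abs (xi - t)) * (1 + mu * abs t)) * (abs (f (xi - t)) * abs (g t))"
   by (intro mult_right_mono w) auto
  then show "(1 + mu * abs xi) * (abs (f (xi - t)) * abs (g t)) \<le> abs (?f (xi - t)) * abs (?g t)"
   using mu by (simp add: abs_mult mult_ac)
 qed
 also have "... \<le> ccon s * A * B / (1 + abs xi)^s"
  using conv_abs_weight[OF f[unfolded bndm_def] g[unfolded bndm_def] s, of xi] by (simp add: pos_le_divide_eq mult.commute)
 finally show "(1 + mu * abs xi) * abs (conv f g xi) \<le> ccon s * A * B / (1 + abs xi)^s" .
qed

lemma conv_diff2:
 assumes "bnd s A f" "bnd s A' f'" "bnd s B g" "bnd s B' g'" "2 \<le> s"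
 shows "conv f g xi - conv f' g' xi = conv (\<lambda>xi. f xi - f' xi) g xi + conv f' (\<lambda>xi. g xi - g' xi) xi" proof -
 have "conv (\<lambda>xi. f xi + (- 1) * f' xi) g xi = conv f g xi + (- 1) * conv f' g xi"
  by (subst conv_add_left[OF assms(1) bnd_cmult[OF assms(2)] assms(3,5)]) (simp only: conv_cmult_left)
 moreover have "conv f' (\<lambda>xi. g xi + (- 1) * g' xi) xi = conv f' g xi + (- 1) * conv f' g' xi"
  by (subst conv_add_right[OF assms(2,3) bnd_cmult[OF assms(4)] assms(5)]) (simp only: conv_cmult_right)
 ultimately show ?thesis by simp
qed

lemma bndm_conv_diff:
 assumes "bndm mu s G f" "bndm mu s G f'" "bndm mu s D (\<lambda>xi. f xi - f' xi)" "2 \<le> s" "0 \<le> mu"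
 shows "bndm mu s (2 * ccon s * G * D) (\<lambda>xi. conv f f xi - conv f' f' xi)" proof -
 note b = bndm_bnd(1)[OF assms(5)]
 have eq: "conv f f xi - conv f' f' xi = conv (\<lambda>xi. f xi - f' xi) f xi + conv f' (\<lambda>xi. f xi - f' xi) xi" for xi
  by (rule conv_diff2[OF b[OF assms(1)] b[OF assms(2)] b[OF assms(1)] b[OF assms(2)] assms(4)])
 have "bndm mu s (ccon s * D * G + ccon s * G * D) (\<lambda>xi. conv f f xi - conv f' f' xi)"
  unfolding eq by (intro bndm_add bndm_conv assms)
 then show ?thesis by (simp add: algebra_simps)
qed

section \<open>The nonlinear layer operators\<close>

lemma bnd2_el:
 assumes g: "bndm mu s A g" and mu: "0 \<le> mu" and d: "0 \<le> d" "d \<le> 1"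
 shows "bnd2 s (2 * A) (\<lambda>t xi. el (mu * d * xi) t * g xi)" proof (rule bnd2I)
 note gc = bndm_cont[OF mu g]
 show "continuous_on ({- 1..1} \<times> UNIV) (\<lambda>p. el (mu * d * snd p) (fst p) * g (snd p))"
  by (intro continuous_intros el_cont continuous_on_compose2[OF gc]) auto
 fix t xi :: real assume t: "t \<in> {-1..1}"
 have "abs (mu * d * xi) \<le> mu * abs xi"
  using mult_mono[of d 1 "mu * abs xi" "mu * abs xi"] d mu by (simp add: abs_mult mult_ac)
 then have "abs (el (mu * d * xi) t) \<le> 2 * (1 + mu * abs xi)"
  unfolding abs_of_pos[OF el_pos] by (intro order_trans[OF el_le[OF t]]) simp
 then have "abs (el (mu * d * xi) t) * abs (g xi) \<le> (2 * (1 + mu * abs xi)) * abs (g xi)" by (rule mult_right_mono) simp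
 then have "(1 + abs xi)^s * abs (el (mu * d * xi) t * g xi) \<le> (1 + abs xi)^s * (2 * abs ((1 + mu * abs xi) * g xi))"
  using mu_weight_nz[OF mu, of xi] by (intro mult_left_mono) (auto simp: abs_mult mult.assoc[symmetric])
 also have "... \<le> 2 * A" using bndD(2)[OF g[unfolded bndm_def], of xi] by simp
 finally show "(1 + abs xi)^s * abs (el (mu * d * xi) t * g xi) \<le> 2 * A" .
qed

text \<open>In Fourier variables, for a field with density \<open>F\<close> over the flattened layer, put
\<open>H = F - e sg t (mu xi g \<star> F)\<close>, the density of \<open>f Z\<^sub>X\<close>. Holomorphy becomes
\<open>H' = - k (H + e sg srcf)\<close> with \<open>k = mu d xi\<close>, and the kinematic condition reads
\<open>H 1 - H (-1) = 2 sg mu xi m\<close> with \<open>m = (a + e) g + e (w / 2) g \<star> g\<close>. Hence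
\<open>H = - (sg / d) el m + e sg SS srcf\<close>. Writing \<open>F\<close> as its leading term plus \<open>e p\<close> (this is \<open>layF\<close>)
turns the relation into the fixed point equation \<open>p = layP p\<close>. Finally \<open>NN\<close> collects the
products of \<open>g\<close> and \<open>F\<close> in the even part of \<open>F\<close> at the interface.\<close>

definition "srcf mu d g F t xi = t * conv (slope mu g) (F t) xi + (1 / d) * conv g (F t) xi"

lemma bnd2_conv_slope:
 assumes g: "bndm mu s A g" and F: "bnd2 s B F" and mu: "0 \<le> mu" and s: "2 \<le> s"
 shows "bnd2 s (ccon s * A * B) (\<lambda>t. conv (slope mu g) (F t))"
  "bnd2 s (ccon s * A * B) (\<lambda>t. conv g (F t))"
 using bnd2_conv[OF bndm_bnd(2)[OF mu g, unfolded bnd_bnd2] F s] bnd2_conv[OF bndm_bnd(1)[OF mu g, unfolded bnd_bnd2] F s] by auto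

lemma bnd2_srcf:
 assumes g: "bndm mu s A g" and F: "bnd2 s B F" and mu: "0 \<le> mu" and s: "2 \<le> s" and d: "0 < d"
 shows "bnd2 s ((1 + 1 / d) * (ccon s * A * B)) (srcf mu d g F)" proof -
 have "bnd2 s (ccon s * A * B + abs (1 / d) * (ccon s * A * B)) (srcf mu d g F)" unfolding srcf_def[abs_def]
  by (intro bnd2_add bnd2_tmult bnd2_cmult bnd2_conv_slope[OF g F mu s])
 then show ?thesis using d by (simp add: algebra_simps)
qed

lemma srcf_diff:
 assumes g: "bndm mu s A g" "bndm mu s A' g'" and F: "bnd2 s B F" "bnd2 s B' F'" and mu: "0 \<le> mu" and s: "2 \<le> s"
  and t: "t \<in> {-1..1}"
 shows "srcf mu d g F t xi - srcf mu d g' F' t xi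
  = srcf mu d (\<lambda>xi. g xi - g' xi) F t xi + srcf mu d g' (\<lambda>t xi. F t xi - F' t xi) t xi" proof -
 note sl = bnd2_slice[OF F(1) t] bnd2_slice[OF F(2) t]
 have 1: "conv (slope mu g) (F t) xi - conv (slope mu g') (F' t) xi
   = conv (\<lambda>x. mu * x * (g x - g' x)) (F t) xi + conv (slope mu g') (\<lambda>xi. F t xi - F' t xi) xi"
  using conv_diff2[OF bndm_bnd(2)[OF mu g(1)] bndm_bnd(2)[OF mu g(2)] sl s, of xi] by (simp add: right_diff_distrib)
 have 2: "conv g (F t) xi - conv g' (F' t) xi
   = conv (\<lambda>x. g x - g' x) (F t) xi + conv g' (\<lambda>xi. F t xi - F' t xi) xi"
  by (rule conv_diff2[OF bndm_bnd(1)[OF mu g(1)] bndm_bnd(1)[OF mu g(2)] sl s])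
 show ?thesis unfolding srcf_def using 1 2 by (simp add: algebra_simps)
qed

lemma bnd2_cong:
 assumes "bnd2 s A F" "\<And>t xi. t \<in> {-1..1} \<Longrightarrow> G t xi = F t xi" shows "bnd2 s A G" proof (rule bnd2I)
 show "continuous_on ({-1..1} \<times> UNIV) (\<lambda>p. G (fst p) (snd p))"
  by (rule continuous_on_eq[OF bnd2_contD[OF assms(1)]]) (use assms(2) in auto)
qed (use assms bnd2D in auto)

definition "layF mu e a d sg g p t xi = (- sg * (a / d)) * (el (mu * d * xi) t * g xi) + e * p t xi"

definition "layP mu e a d sg w g p t xi = (- sg / d) * (el (mu * d * xi) t * (g xi + w / 2 * conv g g xi))
   + sg * (SS (mu * d) (srcf mu d g (layF mu e a d sg g p)) t xi
   + t * conv (slope mu g) (layF mu e a d sg g p t) xi)"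

definition "NN mu d g F xi = - SS (mu * d) (srcf mu d g F) 1 xi
   - (conv (slope mu g) (F 1) xi - conv (slope mu g) (F (- 1)) xi) / 2"

text \<open>The densities are real, so this symmetry says that the field takes conjugate values at \<open>t\<close> and
\<open>- t\<close>; in particular it is real on the wall \<open>t = 0\<close>.\<close>

definition sym2 :: "(real \<Rightarrow> real \<Rightarrow> real) \<Rightarrow> bool" where
 "sym2 F \<longleftrightarrow> (\<forall>t\<in>{-1..1}. \<forall>xi. F (- t) (- xi) = F t xi)"

lemma sym2D: "sym2 F \<Longrightarrow> t \<in> {-1..1} \<Longrightarrow> F (- t) (- xi) = F t xi" by (simp add: sym2_def)

lemma conv_sym:
 assumes "evn g" "sym2 F" "t \<in> {-1..1}"
 shows "conv g (F (- t)) (- xi) = conv g (F t) xi"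
  "conv (slope mu g) (F (- t)) (- xi) = - conv (slope mu g) (F t) xi"
 using conv_reflect[of g 1 g "F (- t)" 1 "F t" xi] conv_reflect[of "slope mu g" "- 1" "slope mu g" "F (- t)" 1 "F t" xi]
  evnD[OF assms(1)] sym2D[OF assms(2,3)] by simp_all

lemma evn_conv: "evn f \<Longrightarrow> evn g \<Longrightarrow> evn (conv f g)"
 using conv_reflect[of f 1 f g 1 g] by (simp add: evn_def)

lemma sym2_el: "evn g \<Longrightarrow> sym2 (\<lambda>t xi. el (\<nu> * xi) t * g xi)"
 using el_reflect by (simp add: sym2_def evn_def)

lemma sym2_layF: "evn g \<Longrightarrow> sym2 p \<Longrightarrow> sym2 (layF mu e a d sg g p)"
 using sym2_el[of g "mu * d"] by (simp add: sym2_def layF_def)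

lemma sym2_srcf:
 assumes "evn g" "sym2 F" shows "sym2 (srcf mu d g F)" unfolding sym2_def srcf_def using conv_sym[OF assms] by simp

lemma layer_facts:
 assumes g: "bndm mu s G g" and F: "bnd2 s B F" and mu: "0 \<le> mu" and s: "2 \<le> s" and d: "0 < d"
 shows "bnd2 s ((1 + 1 / d) * (ccon s * G * B)) (SS (mu * d) (srcf mu d g F))"
  "bnd2 s (ccon s * G * B) (\<lambda>t xi. t * conv (slope mu g) (F t) xi)"
  "bnd s ((2 + 1 / d) * (ccon s * G * B)) (NN mu d g F)"
  "continuous_on {-1..1} (\<lambda>z. srcf mu d g F z xi)" proof -
 show 1: "bnd2 s ((1 + 1 / d) * (ccon s * G * B)) (SS (mu * d) (srcf mu d g F))" by (intro bnd2_SS bnd2_srcf assms)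
 show 2: "bnd2 s (ccon s * G * B) (\<lambda>t xi. t * conv (slope mu g) (F t) xi)" by (intro bnd2_tmult bnd2_conv_slope assms)
 have "bnd s (abs (-1) * ((1 + 1 / d) * (ccon s * G * B)) + abs (1/2) * (ccon s * G * B + ccon s * G * B))
   (\<lambda>xi. (- 1) * SS (mu * d) (srcf mu d g F) 1 xi - (1 / 2) * (conv (slope mu g) (F 1) xi - conv (slope mu g) (F (- 1)) xi))"
  by (intro bnd_diff bnd_cmult bnd2_slice[OF 1] bnd2_slice[OF bnd2_conv_slope(1)[OF g F mu s]]) auto
 moreover have "(\<lambda>xi. (- 1) * SS (mu * d) (srcf mu d g F) 1 xi - (1 / 2) * (conv (slope mu g) (F 1) xi - conv (slope mu g) (F (- 1)) xi)) = NN mu d g F"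
  by (rule ext) (simp add: NN_def)
 ultimately have "bnd s (abs (-1) * ((1 + 1 / d) * (ccon s * G * B)) + abs (1/2) * (ccon s * G * B + ccon s * G * B)) (NN mu d g F)"
  by (simp only:)
 then show "bnd s ((2 + 1 / d) * (ccon s * G * B)) (NN mu d g F)" by (rule bnd_weaken) (simp_all add: algebra_simps)
 show "continuous_on {-1..1} (\<lambda>z. srcf mu d g F z xi)" by (rule bnd2_cont_t[OF bnd2_srcf[OF assms]])
qed

lemma evn_NN:
 assumes g: "bndm mu s G g" and F: "bnd2 s B F" and mu: "0 \<le> mu" and s: "2 \<le> s" and d: "0 < d"
  and ev: "evn g" "sym2 F"
 shows "evn (NN mu d g F)" unfolding evn_def proof
 fix xi
 have "SS (mu * d) (srcf mu d g F) (- (- 1)) (- xi) = 1 * SS (mu * d) (srcf mu d g F) (- 1) xi"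
  by (rule SS_reflect[where F = "srcf mu d g F" and xi = xi, OF layer_facts(4)[OF g F mu s d]]) (use sym2D[OF sym2_srcf[OF ev]] in auto)
 then have "SS (mu * d) (srcf mu d g F) 1 (- xi) = SS (mu * d) (srcf mu d g F) 1 xi" by (simp add: SS_ends(2))
 then show "NN mu d g F (- xi) = NN mu d g F xi"
  using conv_sym(2)[OF ev, of 1 mu xi] conv_sym(2)[OF ev, of "- 1" mu xi] by (simp add: NN_def)
qed

lemma layer_diff_facts:
 assumes g: "bndm mu s G g" "bndm mu s G g'" "bndm mu s D (\<lambda>xi. g xi - g' xi)"
  and F: "bnd2 s B F" "bnd2 s B F'" "bnd2 s E (\<lambda>t xi. F t xi - F' t xi)"
  and mu: "0 \<le> mu" and s: "2 \<le> s" and d: "0 < d"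
 shows "bnd2 s ((1 + 1 / d) * (ccon s * (D * B + G * E))) (\<lambda>t xi. SS (mu * d) (srcf mu d g F) t xi - SS (mu * d) (srcf mu d g' F') t xi)"
  "bnd2 s (ccon s * (D * B + G * E)) (\<lambda>t xi. t * conv (slope mu g) (F t) xi - t * conv (slope mu g') (F' t) xi)"
  "bnd s ((2 + 1 / d) * (ccon s * (D * B + G * E))) (\<lambda>xi. NN mu d g F xi - NN mu d g' F' xi)" proof -
 let ?h = "\<lambda>xi. g xi - g' xi" and ?E = "\<lambda>t xi. F t xi - F' t xi"
 note f1 = layer_facts[OF g(3) F(1) mu s d] and f2 = layer_facts[OF g(2) F(3) mu s d]
 note f3 = layer_facts[OF g(1) F(1) mu s d] and f4 = layer_facts[OF g(2) F(2) mu s d]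
 have eqS: "SS (mu * d) (srcf mu d g F) t xi - SS (mu * d) (srcf mu d g' F') t xi
   = SS (mu * d) (srcf mu d ?h F) t xi + SS (mu * d) (srcf mu d g' ?E) t xi" if t: "t \<in> {-1..1}" for t xi proof -
  have "JJ k (\<lambda>z. srcf mu d g F z xi) u - JJ k (\<lambda>z. srcf mu d g' F' z xi) u
    = JJ k (\<lambda>z. srcf mu d ?h F z xi) u + JJ k (\<lambda>z. srcf mu d g' ?E z xi) u" if u: "u \<in> {-1..1}" for k u
  proof -
   have "JJ k (\<lambda>z. srcf mu d g F z xi) u = JJ k (\<lambda>z. srcf mu d g' F' z xi + (srcf mu d ?h F z xi + srcf mu d g' ?E z xi)) u"
    unfolding JJ_def proof (rule integral_cong)
    fix z assume "z \<in> {-1..u}"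
    then have "z \<in> {-1..1}" using u by auto
    from srcf_diff[OF g(1,2) F(1,2) mu s this, of d xi]
    show "exp (k * z) * srcf mu d g F z xi = exp (k * z) * (srcf mu d g' F' z xi + (srcf mu d ?h F z xi + srcf mu d g' ?E z xi))"
     by simp
   qed
   then show ?thesis using f1(4)[of xi] f2(4)[of xi] f4(4)[of xi] u by (simp add: JJ_lin(1) continuous_on_add)
  qed
  from this[OF t, of "mu * d * xi"] this[of 1 "mu * d * xi"] show ?thesis unfolding SS_def by (simp add: algebra_simps)
 qed
 have "bnd2 s ((1 + 1 / d) * (ccon s * D * B) + (1 + 1 / d) * (ccon s * G * E))
   (\<lambda>t xi. SS (mu * d) (srcf mu d g F) t xi - SS (mu * d) (srcf mu d g' F') t xi)"
  by (rule bnd2_cong[OF bnd2_add[OF f1(1) f2(1)]]) (rule eqS)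
 then show "bnd2 s ((1 + 1 / d) * (ccon s * (D * B + G * E))) (\<lambda>t xi. SS (mu * d) (srcf mu d g F) t xi - SS (mu * d) (srcf mu d g' F') t xi)"
  by (simp add: algebra_simps)
 have eqC: "conv (slope mu g) (F t) xi - conv (slope mu g') (F' t) xi
   = conv (\<lambda>x. mu * x * ?h x) (F t) xi + conv (slope mu g') (?E t) xi" if t: "t \<in> {-1..1}" for t xi
  using conv_diff2[OF bndm_bnd(2)[OF mu g(1)] bndm_bnd(2)[OF mu g(2)] bnd2_slice[OF F(1) t] bnd2_slice[OF F(2) t] s, of xi]
  by (simp add: right_diff_distrib)
 have "bnd2 s (ccon s * D * B + ccon s * G * E)
   (\<lambda>t xi. t * conv (slope mu g) (F t) xi - t * conv (slope mu g') (F' t) xi)"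
 proof (rule bnd2_cong[OF bnd2_add[OF f1(2) f2(2)]])
  fix t xi :: real assume "t \<in> {-1..1}"
  from eqC[OF this, of xi]
  show "t * conv (slope mu g) (F t) xi - t * conv (slope mu g') (F' t) xi
   = t * conv (\<lambda>x. mu * x * ?h x) (F t) xi + t * conv (slope mu g') (?E t) xi"
   by (simp flip: right_diff_distrib distrib_left)
 qed
 then show "bnd2 s (ccon s * (D * B + G * E)) (\<lambda>t xi. t * conv (slope mu g) (F t) xi - t * conv (slope mu g') (F' t) xi)"
  by (simp add: algebra_simps)
 have eqN: "NN mu d g F xi - NN mu d g' F' xi = NN mu d ?h F xi + NN mu d g' ?E xi" for xi
  using eqS[of 1 xi] eqC[of 1 xi] eqC[of "- 1" xi] unfolding NN_def by (simp add: field_simps)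
 have "bnd s ((2 + 1 / d) * (ccon s * D * B) + (2 + 1 / d) * (ccon s * G * E)) (\<lambda>xi. NN mu d g F xi - NN mu d g' F' xi)"
  unfolding eqN by (rule bnd_add[OF f1(3) f2(3)])
 then show "bnd s ((2 + 1 / d) * (ccon s * (D * B + G * E))) (\<lambda>xi. NN mu d g F xi - NN mu d g' F' xi)"
  by (simp add: algebra_simps)
qed

lemma NN_add_right:
 assumes g: "bndm mu s G g" and F: "bnd2 s B F" "bnd2 s B' F'"
  and mu: "0 \<le> mu" and s: "2 \<le> s" and d: "0 < d"
 shows "NN mu d g (\<lambda>t xi. F t xi + e * F' t xi) xi = NN mu d g F xi + e * NN mu d g F' xi" proof -
 note f1 = layer_facts[OF g F(1) mu s d] and f2 = layer_facts[OF g F(2) mu s d]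
 have C: "conv f (\<lambda>xi. F t xi + e * F' t xi) xi = conv f (F t) xi + e * conv f (F' t) xi"
  if "bnd s G f" "t \<in> {-1..1}" for f t
  by (subst conv_add_right[OF that(1) bnd2_slice[OF F(1) that(2)] bnd_cmult[OF bnd2_slice[OF F(2) that(2)]] s])
    (simp only: conv_cmult_right)
 have J: "JJ k (\<lambda>z. srcf mu d g (\<lambda>t xi. F t xi + e * F' t xi) z xi) 1
   = JJ k (\<lambda>z. srcf mu d g F z xi) 1 + e * JJ k (\<lambda>z. srcf mu d g F' z xi) 1" for k proof -
  have "JJ k (\<lambda>z. srcf mu d g (\<lambda>t xi. F t xi + e * F' t xi) z xi) 1 = JJ k (\<lambda>z. srcf mu d g F z xi + e * srcf mu d g F' z xi) 1"
   unfolding JJ_def proof (rule integral_cong)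
   fix z :: real assume z: "z \<in> {-1..1}"
   show "exp (k * z) * srcf mu d g (\<lambda>t xi. F t xi + e * F' t xi) z xi = exp (k * z) * (srcf mu d g F z xi + e * srcf mu d g F' z xi)"
    unfolding srcf_def C[OF bndm_bnd(1)[OF mu g] z] C[OF bndm_bnd(2)[OF mu g] z] by (simp add: algebra_simps)
  qed
  then show ?thesis using f1(4)[of xi] f2(4)[of xi] by (simp add: JJ_lin(1) JJ_lin(2)[OF f2(4) f2(4)] continuous_on_mult_left)
 qed
 show ?thesis proof -
  have m: "1 \<in> {-1..1::real}" "- 1 \<in> {-1..1::real}" by auto
  show ?thesis unfolding NN_def SS_ends J C[OF bndm_bnd(2)[OF mu g] m(1)] C[OF bndm_bnd(2)[OF mu g] m(2)]
   by (simp add: algebra_simps add_divide_distrib diff_divide_distrib)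
 qed
qed

lemma layF_bnd:
 assumes g: "bndm mu s G g" and p: "bnd2 s B p" and mu: "0 \<le> mu"
  and d: "0 < d" "d \<le> 1" and a: "0 \<le> a" "a \<le> 1" and sg: "abs sg = 1" and e: "0 \<le> e"
 shows "bnd2 s (2 / d * G + e * B) (layF mu e a d sg g p)" proof -
 have "bnd2 s (abs (- sg * (a / d)) * (2 * G) + abs e * B) (layF mu e a d sg g p)"
  unfolding layF_def[abs_def] using d by (intro bnd2_add bnd2_cmult bnd2_el g p mu) auto
 moreover have "abs (- sg * (a / d)) * (2 * G) \<le> 2 / d * G" proof -
  have "a / d \<le> 1 / d" using a d by (intro divide_right_mono) auto
  then have "a / d * (2 * G) \<le> 1 / d * (2 * G)" using bndm_nonneg[OF g] by (intro mult_right_mono) auto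
  then show ?thesis using a d sg by (simp add: abs_mult)
 qed
 ultimately show ?thesis using e by (elim bnd2_weaken) auto
qed

lemma layF_diff: "layF mu e a d sg g p t xi - layF mu e a d sg g' p' t xi
  = layF mu e a d sg (\<lambda>xi. g xi - g' xi) (\<lambda>t xi. p t xi - p' t xi) t xi"
 by (simp add: layF_def right_diff_distrib)

lemma layP_bnd:
 assumes g: "bndm mu s G g" and p: "bnd2 s B p" and mu: "0 \<le> mu" and s: "2 \<le> s"
  and d: "0 < d" "d \<le> 1" and a: "0 \<le> a" "a \<le> 1" and sg: "abs sg = 1" and e: "0 \<le> e"
 shows "bnd2 s (2 / d * (G + abs w / 2 * (ccon s * G * G)) + (2 + 1 / d) * (ccon s * G * (2 / d * G + e * B))) (layP mu e a d sg w g p)"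
proof -
 note F = layF_bnd[OF g p mu d a sg e]
 have gg: "bndm mu s (G + abs (w / 2) * (ccon s * G * G)) (\<lambda>xi. g xi + w / 2 * conv g g xi)"
  by (intro bndm_add bndm_cmult bndm_conv g s mu)
 have "bnd2 s (abs (- sg / d) * (2 * (G + abs (w / 2) * (ccon s * G * G)))
   + abs sg * ((1 + 1 / d) * (ccon s * G * (2 / d * G + e * B)) + ccon s * G * (2 / d * G + e * B))) (layP mu e a d sg w g p)"
  unfolding layP_def[abs_def] using d by (intro bnd2_add bnd2_cmult bnd2_el gg mu layer_facts[OF g F mu s d(1)]) auto
 then show ?thesis by (rule bnd2_weaken) (use sg d in \<open>auto simp: field_simps\<close>)
qed

lemma layP_lip:
 assumes g: "bndm mu s G g" "bndm mu s G g'" "bndm mu s D (\<lambda>xi. g xi - g' xi)"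
  and p: "bnd2 s B p" "bnd2 s B p'" "bnd2 s E (\<lambda>t xi. p t xi - p' t xi)"
  and mu: "0 \<le> mu" and s: "2 \<le> s"
  and d: "0 < d" "d \<le> 1" and a: "0 \<le> a" "a \<le> 1" and sg: "abs sg = 1" and e: "0 \<le> e"
 shows "bnd2 s (2 / d * (D + abs w * (ccon s * G * D)) + (2 + 1 / d) * (ccon s * (D * (2 / d * G + e * B) + G * (2 / d * D + e * E))))
  (\<lambda>t xi. layP mu e a d sg w g p t xi - layP mu e a d sg w g' p' t xi)" proof -
 note F = layF_bnd[OF g(1) p(1) mu d a sg e] layF_bnd[OF g(2) p(2) mu d a sg e]
 have FD: "bnd2 s (2 / d * D + e * E) (\<lambda>t xi. layF mu e a d sg g p t xi - layF mu e a d sg g' p' t xi)"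
  unfolding layF_diff by (rule layF_bnd[OF g(3) p(3) mu d a sg e])
 note L = layer_diff_facts[OF g F FD mu s d(1)]
 have gg: "bndm mu s (D + abs (w / 2) * (2 * ccon s * G * D)) (\<lambda>xi. (g xi - g' xi) + w / 2 * (conv g g xi - conv g' g' xi))"
  by (intro bndm_add bndm_cmult bndm_conv_diff g s mu)
 have eq: "layP mu e a d sg w g p t xi - layP mu e a d sg w g' p' t xi
   = (- sg / d) * (el (mu * d * xi) t * ((g xi - g' xi) + w / 2 * (conv g g xi - conv g' g' xi)))
   + sg * ((SS (mu * d) (srcf mu d g (layF mu e a d sg g p)) t xi - SS (mu * d) (srcf mu d g' (layF mu e a d sg g' p')) t xi)
   + (t * conv (slope mu g) (layF mu e a d sg g p t) xi - t * conv (slope mu g') (layF mu e a d sg g' p' t) xi))" for t xi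
  by (simp add: layP_def algebra_simps)
 have "bnd2 s (abs (- sg / d) * (2 * (D + abs (w / 2) * (2 * ccon s * G * D)))
   + abs sg * ((1 + 1 / d) * (ccon s * (D * (2 / d * G + e * B) + G * (2 / d * D + e * E)))
    + ccon s * (D * (2 / d * G + e * B) + G * (2 / d * D + e * E))))
  (\<lambda>t xi. layP mu e a d sg w g p t xi - layP mu e a d sg w g' p' t xi)"
  unfolding eq using d by (intro bnd2_add bnd2_cmult bnd2_el gg mu L) auto
 then show ?thesis by (rule bnd2_weaken) (use sg d in \<open>auto simp: field_simps\<close>)
qed

lemma sym2_layP:
 assumes g: "bndm mu s G g" and p: "bnd2 s B p" and mu: "0 \<le> mu" and s: "2 \<le> s"
  and d: "0 < d" "d \<le> 1" and a: "0 \<le> a" "a \<le> 1" and sg: "abs sg = 1" and e: "0 \<le> e"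
  and ev: "evn g" "sym2 p"
 shows "sym2 (layP mu e a d sg w g p)" unfolding sym2_def proof (intro ballI allI)
 fix t xi :: real assume t: "t \<in> {-1..1}"
 note F = layF_bnd[OF g p mu d a sg e]
 note sF = sym2_layF[OF ev, of mu e a d sg]
 have 1: "SS (mu * d) (srcf mu d g (layF mu e a d sg g p)) (- t) (- xi) = 1 * SS (mu * d) (srcf mu d g (layF mu e a d sg g p)) t xi"
  by (rule SS_reflect[where F = "srcf mu d g (layF mu e a d sg g p)" and xi = xi, OF layer_facts(4)[OF g F mu s d(1)] t]) (use sym2D[OF sym2_srcf[OF ev(1) sF]] in auto)
 have 2: "el (mu * d * - xi) (- t) = el (mu * d * xi) t" using el_reflect[of "mu * d * xi" t] by simp
 show "layP mu e a d sg w g p (- t) (- xi) = layP mu e a d sg w g p t xi"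
  unfolding layP_def 1 2 conv_sym(2)[OF ev(1) sF t] using evnD[OF ev(1)] evnD[OF evn_conv[OF ev(1) ev(1)]] by simp
qed

text \<open>A product of two Dirichlet--Neumann symbols grows quadratically. After the square of one wave
number, the same for both layers, is subtracted it grows only like the product of the weights at the
frequencies \<open>xi - t\<close> and \<open>t\<close> that interact. Here \<open>x\<close>, \<open>y\<close>, \<open>z\<close> stand for \<open>mu |xi|\<close>, \<open>mu |t|\<close>,
\<open>mu |xi - t|\<close>, and \<open>c\<close>, \<open>c'\<close> for the symbols minus their value \<open>1 / d\<close> at zero. The second bound records that \<open>c\<close> and \<open>c'\<close> vanish to second order.\<close>

lemma symbol_product_bounds:
 fixes x y z c c' d :: real
 assumes d: "0 < d" and z: "0 \<le> x" "0 \<le> y" "x \<le> y + z" "y \<le> x + z"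
  and c: "0 \<le> c" "c \<le> x" "x - 1 / d \<le> c" "c \<le> d * x\<^sup>2"
  and c': "0 \<le> c'" "c' \<le> y" "y - 1 / d \<le> c'" "c' \<le> d * y\<^sup>2"
 defines "X \<equiv> (c + c') / d + c * c'"
 shows "abs (X - y\<^sup>2) \<le> (1 + 2 / d) * ((1 + z) * (1 + y))" "abs (X - y\<^sup>2) \<le> 7 * (z\<^sup>2 + y\<^sup>2)"
proof -
 have z0: "0 \<le> z" using z by linarith
 have cc1: "c * c' \<le> x * y" using c c' z by (intro mult_mono) auto
 have cd: "(c + c') / d \<le> (x + y) / d" using c c' d by (intro divide_right_mono) auto
 have cc2: "x * y - (x + y) / d \<le> c * c'" proof -
  have "x * (y - c') \<le> x * (1 / d)" using c' z by (intro mult_left_mono) auto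
  moreover have "c' * (x - c) \<le> y * (1 / d)" using c c' z d by (intro mult_mono) auto
  ultimately show ?thesis by (simp add: algebra_simps add_divide_distrib)
 qed
 have yz: "abs (x * y - y\<^sup>2) \<le> z * y" proof -
  have "abs (x * y - y\<^sup>2) = abs (x - y) * y" using z by (simp add: power2_eq_square abs_mult flip: left_diff_distrib)
  also have "... \<le> z * y" using z by (intro mult_right_mono) auto
  finally show ?thesis .
 qed
 have X1: "abs (X - y\<^sup>2) \<le> z * y + (x + y) / d"
  using cc1 cc2 cd yz divide_nonneg_pos[of "c + c'" d] c c' d unfolding X_def by linarith
 have "x + y \<le> 2 * ((1 + z) * (1 + y))" proof -
  have "0 \<le> z * y" using z0 z by simp
  moreover have "(1 + z) * (1 + y) = 1 + z + y + z * y" by (simp add: algebra_simps)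
  ultimately show ?thesis using z z0 by linarith
 qed
 then have "(x + y) / d \<le> 2 * ((1 + z) * (1 + y)) / d" using d by (intro divide_right_mono) auto
 moreover have "z * y \<le> (1 + z) * (1 + y)" using z z0 by (intro mult_mono) auto
 ultimately show "abs (X - y\<^sup>2) \<le> (1 + 2 / d) * ((1 + z) * (1 + y))" using X1 distrib_right[of 1 "2 / d" "(1 + z) * (1 + y)"] by simp
 have X0: "0 \<le> X" unfolding X_def using c c' d by simp
 have "(c + c') / d \<le> (d * x\<^sup>2 + d * y\<^sup>2) / d" using c c' d by (intro divide_right_mono) auto
 also have "... = x\<^sup>2 + y\<^sup>2" using d by (simp add: field_simps)
 finally have cA: "(c + c') / d \<le> x\<^sup>2 + y\<^sup>2" .
 have cB: "2 * (x * y) \<le> x\<^sup>2 + y\<^sup>2" using sum_squares_bound[of x y] by (simp add: mult.assoc)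
 have X2: "2 * X \<le> 3 * (x\<^sup>2 + y\<^sup>2)" unfolding X_def using cA cB cc1 by argo
 moreover have xz: "x\<^sup>2 \<le> 2 * (z\<^sup>2 + y\<^sup>2)" proof -
  have "x\<^sup>2 \<le> (y + z)\<^sup>2" using z by (intro power_mono) auto
  also have "... \<le> 2 * (z\<^sup>2 + y\<^sup>2)" using sum_squares_bound[of y z] by (simp add: power2_sum)
  finally show ?thesis .
 qed
 have "p2 \<le> 2 * r + 2 * q \<Longrightarrow> 2 * X' \<le> 3 * p2 + 3 * q \<Longrightarrow> 0 \<le> X' \<Longrightarrow> 0 \<le> r \<Longrightarrow> 0 \<le> q \<Longrightarrow> abs (X' - q) \<le> 7 * r + 7 * q"
  for p2 q r X' :: real by linarith
 from this[OF xz[unfolded distrib_left] X2[unfolded distrib_left] X0]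
 show "abs (X - y\<^sup>2) \<le> 7 * (z\<^sup>2 + y\<^sup>2)" unfolding distrib_left by simp
qed

text \<open>\<open>Cs\<close> is the Dirichlet--Neumann symbol of a layer of depth \<open>d\<close> and \<open>tau\<close> the dispersive part of
the sum of both. \<open>PP\<close> is the inverse of the linear part of the continuity condition divided by \<open>ep\<close>,
and \<open>MM\<close> its limit for \<open>mu \<rightarrow> 0\<close>. The quadratic part of the condition has the symbol \<open>bb + rs\<close>, and
\<open>bb\<close> is its value at \<open>mu = 0\<close>.\<close>

locale two_layers =
 fixes h w0 w1 :: real and s :: nat
 assumes h: "0 < h" "h < 1" and w: "w0 - w1 = 1" and th: "theta h w0 w1 \<noteq> 0" and s: "3 \<le> s"
begin

definition "aa = h * (1 - h)"
definition "bb = theta h w0 w1 / (2 * aa)"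
definition "ep mu = 4 * aa\<^sup>2 * mu\<^sup>2 / 3"
definition "Cs mu d xi = ch (mu * d * xi) / d"
definition "tau mu xi = (Cs mu h xi - 1 / h) + (Cs mu (1 - h) xi - 1 / (1 - h))"
definition "PP mu xi = 1 / (3 / (4 * aa * mu\<^sup>2) * tau mu xi + tau mu xi + 1 / aa)"
definition "MM xi = 4 * aa / (4 + xi\<^sup>2)"
definition "rs mu xi t = (w0 * (Cs mu h xi - 1 / h) + w1 * (Cs mu (1 - h) xi - 1 / (1 - h))) / 2
  - aa * ((Cs mu h xi * Cs mu h t - 1 / h\<^sup>2) - (Cs mu (1 - h) xi * Cs mu (1 - h) t - 1 / (1 - h)\<^sup>2))"
definition "RR mu f g xi = (LBINT t. rs mu xi t * (f (xi - t) * g t))"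

lemma aa: "0 < aa" "aa \<le> 1" "1 / h + 1 / (1 - h) = 1 / aa" proof -
 show "0 < aa" using h by (simp add: aa_def)
 show "aa \<le> 1" unfolding aa_def using h by (intro mult_le_one) auto
 show "1 / h + 1 / (1 - h) = 1 / aa" using h by (simp add: aa_def field_simps)
qed

lemma s2: "2 \<le> s" using s by simp

lemma Cs_facts:
 assumes d: "0 < d" "d < 1" and mu: "0 \<le> mu"
 shows "0 \<le> Cs mu d xi - 1 / d" "Cs mu d xi - 1 / d \<le> mu * abs xi" "mu * abs xi \<le> Cs mu d xi"
  "Cs mu d xi - 1 / d \<le> d * (mu * abs xi)\<^sup>2 / 3" "d * (min ((mu * abs xi)\<^sup>2) (mu * abs xi)) / 9 \<le> Cs mu d xi - 1 / d"
  "abs (Cs mu d xi - 1 / d - d * (mu * abs xi)\<^sup>2 / 3) \<le> (mu * abs xi)^4 / 18" proof -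
 define K where "K = mu * abs xi"
 have K0: "0 \<le> K" using mu by (simp add: K_def)
 have k: "abs (mu * d * xi) = d * K" "(mu * d * xi)\<^sup>2 = d\<^sup>2 * K\<^sup>2" "(mu * d * xi)^4 = d^4 * K^4"
  using d mu by (auto simp: K_def abs_mult power_mult_distrib power_even_abs)
 have C: "Cs mu d xi - 1 / d = (ch (mu * d * xi) - 1) / d" by (simp add: Cs_def diff_divide_distrib)
 show "0 \<le> Cs mu d xi - 1 / d" unfolding C using d ch_ge_1[of "mu * d * xi"] by simp
 have "(ch (mu * d * xi) - 1) / d \<le> (d * K) / d" using ch_upper_abs[of "mu * d * xi"] d k by (intro divide_right_mono) auto
 then show "Cs mu d xi - 1 / d \<le> mu * abs xi" unfolding C using d by (simp add: K_def)
 have "(d * K) / d \<le> ch (mu * d * xi) / d" using ch_lower_abs[of "mu * d * xi"] d k by (intro divide_right_mono) auto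
 then show "mu * abs xi \<le> Cs mu d xi" unfolding Cs_def using d by (simp add: K_def)
 have "(ch (mu * d * xi) - 1) / d \<le> (d\<^sup>2 * K\<^sup>2 / 3) / d"
  using ch_taylor(2)[of "mu * d * xi"] d k by (intro divide_right_mono) auto
 then show "Cs mu d xi - 1 / d \<le> d * (mu * abs xi)\<^sup>2 / 3"
  unfolding C K_def[symmetric] using d by (simp add: power2_eq_square)
 have "(min (d\<^sup>2 * K\<^sup>2) (d * K) / 9) / d \<le> (ch (mu * d * xi) - 1) / d"
  using ch_lower[of "mu * d * xi"] d k by (intro divide_right_mono) auto
 moreover have "d * min (K\<^sup>2) K / 9 \<le> (min (d\<^sup>2 * K\<^sup>2) (d * K) / 9) / d" proof -
  have "d * d * min (K\<^sup>2) K \<le> min (d\<^sup>2 * K\<^sup>2) (d * K)" proof (rule min.boundedI)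
   have "d * d * min (K\<^sup>2) K \<le> d * d * K\<^sup>2" using d by (intro mult_left_mono) auto
   then show "d * d * min (K\<^sup>2) K \<le> d\<^sup>2 * K\<^sup>2" by (simp add: power2_eq_square)
   have "d * d * min (K\<^sup>2) K \<le> d * 1 * K" using d K0 by (intro mult_mono) auto
   then show "d * d * min (K\<^sup>2) K \<le> d * K" by simp
  qed
  then show ?thesis using d by (simp add: pos_le_divide_eq mult_ac)
 qed
 ultimately show "d * (min ((mu * abs xi)\<^sup>2) (mu * abs xi)) / 9 \<le> Cs mu d xi - 1 / d"
  unfolding C K_def[symmetric] by linarith
 have "abs ((ch (mu * d * xi) - 1) - d\<^sup>2 * K\<^sup>2 / 3) \<le> d^4 * K^4 / 18" proof -
  have "0 \<le> d^4 * K^4" using d K0 by simp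
  then show ?thesis using ch_taylor[of "mu * d * xi"] unfolding k by linarith
 qed
 then have "abs ((ch (mu * d * xi) - 1) - d\<^sup>2 * K\<^sup>2 / 3) / d \<le> (d^4 * K^4 / 18) / d" using d by (intro divide_right_mono) auto
 also have "... = d^3 * (K^4 / 18)" using d by (simp add: power_numeral_reduce)
 also have "... \<le> 1 * (K^4 / 18)" using d K0 by (intro mult_right_mono power_le_one) auto
 also have "abs ((ch (mu * d * xi) - 1) - d\<^sup>2 * K\<^sup>2 / 3) / d = abs (((ch (mu * d * xi) - 1) - d\<^sup>2 * K\<^sup>2 / 3) / d)"
  using d by (simp add: abs_divide)
 also have "((ch (mu * d * xi) - 1) - d\<^sup>2 * K\<^sup>2 / 3) / d = Cs mu d xi - 1 / d - d * K\<^sup>2 / 3"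
  using d unfolding C by (simp add: field_simps power2_eq_square)
 finally show "abs (Cs mu d xi - 1 / d - d * (mu * abs xi)\<^sup>2 / 3) \<le> (mu * abs xi)^4 / 18"
  unfolding K_def[symmetric] by simp
qed

lemma Cs_cont: "continuous_on S f \<Longrightarrow> continuous_on S (\<lambda>x. Cs mu d (f x))"
 unfolding Cs_def by (cases "d = 0") (auto intro!: continuous_intros continuous_on_compose2[OF ch_cont])

lemma Cs_even: "Cs mu d (- xi) = Cs mu d xi" using ch_even[of "mu * d * xi"] by (simp add: Cs_def)

lemma tau_bounds:
 assumes mu: "0 \<le> mu"
 shows "min ((mu * abs xi)\<^sup>2) (mu * abs xi) / 9 \<le> tau mu xi" "tau mu xi \<le> (mu * abs xi)\<^sup>2 / 3"
  "abs (tau mu xi - (mu * abs xi)\<^sup>2 / 3) \<le> (mu * abs xi)^4 / 9" "0 \<le> tau mu xi" proof -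
 define K where "K = mu * abs xi"
 have h': "0 < 1 - h" "1 - h < 1" using h by auto
 note c0 = Cs_facts[OF h mu, of xi, folded K_def] and c1 = Cs_facts[OF h' mu, of xi, folded K_def]
 have "min (K\<^sup>2) K / 9 = h * min (K\<^sup>2) K / 9 + (1 - h) * min (K\<^sup>2) K / 9"
  by (simp add: algebra_simps add_divide_distrib[symmetric])
 then show "min ((mu * abs xi)\<^sup>2) (mu * abs xi) / 9 \<le> tau mu xi"
  using c0(5) c1(5) unfolding tau_def K_def[symmetric] by linarith
 have e: "K\<^sup>2 / 3 = h * K\<^sup>2 / 3 + (1 - h) * K\<^sup>2 / 3" by (simp add: algebra_simps add_divide_distrib[symmetric])
 then show "tau mu xi \<le> (mu * abs xi)\<^sup>2 / 3" using c0(4) c1(4) unfolding tau_def K_def[symmetric] by linarith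
 show "abs (tau mu xi - (mu * abs xi)\<^sup>2 / 3) \<le> (mu * abs xi)^4 / 9"
  using c0(6) c1(6) e unfolding tau_def K_def[symmetric] by linarith
 show "0 \<le> tau mu xi" using c0(1) c1(1) unfolding tau_def by linarith
qed

lemma weight_sq: "(1 + abs (xi::real))\<^sup>2 \<le> 2 * (1 + xi\<^sup>2)" proof -
 have "0 \<le> (1 - abs xi)\<^sup>2" by simp
 then show ?thesis by (simp add: power2_sum power2_diff)
qed

lemma MM_bounds: "0 < MM xi" "MM xi \<le> aa" "MM xi \<le> 8 * aa / (1 + abs xi)\<^sup>2" "continuous_on S MM" "MM (- xi) = MM xi"
proof -
 have p: "0 < 4 + xi\<^sup>2" for xi :: real using zero_le_power2[of xi] by linarith
 show "0 < MM xi" using p[of xi] aa by (simp add: MM_def)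
 show "MM xi \<le> aa" using p[of xi] aa by (simp add: MM_def divide_le_eq)
 have "4 * aa / (4 + xi\<^sup>2) \<le> 4 * aa / ((1 + abs xi)\<^sup>2 / 2)"
  using aa p[of xi] weight_sq[of xi] by (intro divide_left_mono mult_pos_pos) auto
 then show "MM xi \<le> 8 * aa / (1 + abs xi)\<^sup>2" by (simp add: MM_def)
 have "4 + xi\<^sup>2 \<noteq> 0" for xi :: real using p[of xi] by linarith
 then show "continuous_on S MM" unfolding MM_def[abs_def] by (intro continuous_intros) auto
 show "MM (- xi) = MM xi" by (simp add: MM_def)
qed

context
 fixes mu :: real
 assumes mu: "0 < mu" "mu \<le> 1"
begin

definition "PQ xi = 3 / (4 * aa * mu\<^sup>2) * tau mu xi + tau mu xi + 1 / aa"

lemma PP_PQ: "PP mu xi = 1 / PQ xi" by (simp add: PP_def PQ_def)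

lemma PQ_lower: "1 / aa \<le> PQ xi" "0 < PQ xi"
 "mu * abs xi \<le> 1 \<Longrightarrow> (1 + abs xi)\<^sup>2 / (24 * aa) \<le> PQ xi"
 "1 \<le> mu * abs xi \<Longrightarrow> mu * abs xi / (12 * aa * mu\<^sup>2) \<le> PQ xi" proof -
 have mu0: "0 \<le> mu" using mu by simp
 note t = tau_bounds[OF mu0, of xi]
 define q where "q = 3 / (4 * aa * mu\<^sup>2)"
 have q: "0 < q" using aa mu by (simp add: q_def)
 then have qt: "0 \<le> q * tau mu xi" using t(4) by simp
 then show 1: "1 / aa \<le> PQ xi" unfolding PQ_def q_def[symmetric] using t(4) by linarith
 then show "0 < PQ xi" using aa by (meson less_le_trans zero_less_divide_1_iff)
 {
  assume K: "mu * abs xi \<le> 1"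
  then have "(mu * abs xi)\<^sup>2 \<le> mu * abs xi" using mu by (simp add: power2_eq_square mult_left_le)
  then have "(mu * abs xi)\<^sup>2 / 9 \<le> tau mu xi" using t(1) by (simp add: min_def split: if_splits)
  then have "q * ((mu * abs xi)\<^sup>2 / 9) \<le> q * tau mu xi" using q by (intro mult_left_mono) auto
  moreover have "q * ((mu * abs xi)\<^sup>2 / 9) = xi\<^sup>2 / (12 * aa)"
   using mu aa by (simp add: q_def power_mult_distrib field_simps)
  moreover have "(1 + abs xi)\<^sup>2 / (24 * aa) \<le> 2 * (1 + xi\<^sup>2) / (24 * aa)"
   using aa weight_sq by (intro divide_right_mono) auto
  moreover have "2 * (1 + xi\<^sup>2) / (24 * aa) = 1 / (12 * aa) + xi\<^sup>2 / (12 * aa)" using aa by (simp add: field_simps)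
  moreover have "1 / (12 * aa) \<le> 1 / aa" using aa by (simp add: field_simps)
  ultimately show "(1 + abs xi)\<^sup>2 / (24 * aa) \<le> PQ xi" unfolding PQ_def q_def[symmetric] using t(4) by linarith
 }
 {
  assume K: "1 \<le> mu * abs xi"
  then have "mu * abs xi \<le> (mu * abs xi)\<^sup>2" by (simp add: power2_eq_square mult_le_cancel_left1)
  then have "mu * abs xi / 9 \<le> tau mu xi" using t(1) by (simp add: min_def split: if_splits)
  then have "q * (mu * abs xi / 9) \<le> q * tau mu xi" using q by (intro mult_left_mono) auto
  moreover have "q * (mu * abs xi / 9) = mu * abs xi / (12 * aa * mu\<^sup>2)" using mu aa by (simp add: q_def)
  ultimately show "mu * abs xi / (12 * aa * mu\<^sup>2) \<le> PQ xi"
   unfolding PQ_def q_def[symmetric] using t(4) zero_le_divide_1_iff[of aa] aa(1) by linarith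
 }
qed

lemma PP_pos: "0 < PP mu xi" using PQ_lower(2) by (simp add: PP_PQ)

lemma PP_high: assumes "1 \<le> mu * abs xi" shows "(1 + mu * abs xi) * PP mu xi \<le> 24 * aa * mu\<^sup>2" proof -
 define K where "K = mu * abs xi"
 have K: "1 \<le> K" using assms by (simp add: K_def)
 have "PP mu xi \<le> 1 / (K / (12 * aa * mu\<^sup>2))"
  unfolding PP_PQ using PQ_lower(2,4)[of xi] assms K aa mu unfolding K_def[symmetric] by (intro divide_left_mono) auto
 also have "... = 12 * aa * mu\<^sup>2 / K" by simp
 finally have "(1 + K) * PP mu xi \<le> (2 * K) * (12 * aa * mu\<^sup>2 / K)" using K PP_pos[of xi] by (intro mult_mono) auto
 also have "... = 24 * aa * mu\<^sup>2" using K by simp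
 finally show ?thesis by (simp add: K_def)
qed

lemma PP_low: assumes "mu * abs xi \<le> 1" shows "PP mu xi \<le> 24 * aa / (1 + abs xi)\<^sup>2" proof -
 have "PP mu xi \<le> 1 / ((1 + abs xi)\<^sup>2 / (24 * aa))" unfolding PP_PQ using PQ_lower(2)[of xi] PQ_lower(3)[OF assms] aa
  by (intro divide_left_mono mult_pos_pos divide_pos_pos) auto
 then show ?thesis by simp
qed

lemma PP_bound: "(1 + mu * abs xi) * abs (PP mu xi) \<le> 24 * aa" proof (cases "mu * abs xi \<le> 1")
 case True
 have "PP mu xi \<le> 1 / (1 / aa)" unfolding PP_PQ using PQ_lower(1,2)[of xi] aa by (intro divide_left_mono) auto
 then have "(1 + mu * abs xi) * PP mu xi \<le> 2 * aa" using True PP_pos[of xi] by (intro mult_mono) auto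
 then show ?thesis using PP_pos[of xi] aa by simp
next
 case False
 have "24 * aa * mu\<^sup>2 \<le> 24 * aa * 1" using aa mu by (intro mult_left_mono power_le_one) auto
 then show ?thesis using PP_high[of xi] False PP_pos[of xi] by simp
qed

lemma PP_cont: "continuous_on UNIV (PP mu)" proof -
 have "PQ xi \<noteq> 0" for xi using PQ_lower(2)[of xi] by simp
 moreover have "continuous_on UNIV PQ" unfolding PQ_def tau_def by (intro continuous_intros Cs_cont)
 ultimately have "continuous_on UNIV (\<lambda>xi. 1 / PQ xi)" by (intro continuous_intros) auto
 then show ?thesis by (simp add: PP_PQ[abs_def])
qed

lemma PP_even: "PP mu (- xi) = PP mu xi" by (simp add: PP_def tau_def Cs_even)

text \<open>For \<open>mu |xi| \<ge> 1\<close> both operators are small by themselves. Otherwise the difference of their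
inverses is \<open>O(mu\<^sup>2 (1 + |xi|)\<^sup>4)\<close> by the fourth order Taylor remainder of \<open>ch\<close>, and each operator
gains two powers of \<open>1 + |xi|\<close>.\<close>

lemma PP_MM: "(1 + mu * abs xi) * abs (PP mu xi - MM xi) \<le> 160 * mu\<^sup>2" proof (cases "mu * abs xi \<le> 1")
 case False
 then have K: "1 \<le> mu * abs xi" by simp
 have x0: "xi \<noteq> 0" using K by auto
 have "MM xi \<le> 4 * aa / xi\<^sup>2" unfolding MM_def using aa x0 by (intro divide_left_mono) (auto intro!: mult_pos_pos add_pos_pos)
 then have "(1 + mu * abs xi) * MM xi \<le> (2 * (mu * abs xi) * (mu * abs xi)) * (4 * aa / xi\<^sup>2)" proof (intro mult_mono)
  have "mu * abs xi * 1 \<le> (mu * abs xi) * (mu * abs xi)" using K by (intro mult_left_mono) auto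
  then show "1 + mu * abs xi \<le> 2 * (mu * abs xi) * (mu * abs xi)" using K by linarith
 qed (use mu MM_bounds(1)[of xi] in auto)
 also have "... = 8 * aa * mu\<^sup>2" using x0 by (simp add: power2_eq_square field_simps)
 finally have m: "(1 + mu * abs xi) * MM xi \<le> 8 * aa * mu\<^sup>2" .
 have "(1 + mu * abs xi) * abs (PP mu xi - MM xi) \<le> (1 + mu * abs xi) * (PP mu xi + MM xi)"
  using PP_pos[of xi] MM_bounds(1)[of xi] mu by (intro mult_left_mono) auto
 also have "... \<le> 32 * aa * mu\<^sup>2" using PP_high[OF K] m by (simp add: distrib_left)
 also have "... \<le> 160 * mu\<^sup>2" using aa by (intro mult_right_mono) auto
 finally show ?thesis .
next
 case True
 have mu0: "0 \<le> mu" using mu by simp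
 define u where "u = (1 + abs xi)\<^sup>2"
 have u: "0 < u" by (simp add: u_def)
 have xu: "xi\<^sup>2 \<le> u" "1 \<le> u" unfolding u_def by (simp_all add: power2_sum)
 note t = tau_bounds[OF mu0, of xi]
 have Mi: "1 / MM xi = 1 / aa + xi\<^sup>2 / (4 * aa)" using aa by (simp add: MM_def field_simps)
 have "PQ xi - 1 / MM xi = 3 / (4 * aa * mu\<^sup>2) * (tau mu xi - (mu * abs xi)\<^sup>2 / 3) + tau mu xi"
  unfolding PQ_def Mi using mu aa by (simp add: power_mult_distrib field_simps)
 also have "abs ... \<le> 3 / (4 * aa * mu\<^sup>2) * ((mu * abs xi)^4 / 9) + (mu * abs xi)\<^sup>2 / 3" proof -
  have "abs (3 / (4 * aa * mu\<^sup>2) * (tau mu xi - (mu * abs xi)\<^sup>2 / 3)) \<le> 3 / (4 * aa * mu\<^sup>2) * ((mu * abs xi)^4 / 9)"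
   unfolding abs_mult using t(3) aa mu by (intro mult_mono) auto
  then show ?thesis using t(2,4) by linarith
 qed
 also have "... = mu\<^sup>2 * (xi\<^sup>2 * xi\<^sup>2 / (12 * aa) + xi\<^sup>2 / 3)"
  using mu aa by (simp add: power_mult_distrib field_simps power4_eq_xxxx power2_eq_square)
 also have "... \<le> mu\<^sup>2 * (u * u / (12 * aa) + u * u / 3)" proof -
  have "xi\<^sup>2 * xi\<^sup>2 \<le> u * u" using xu u by (intro mult_mono) auto
  moreover have "xi\<^sup>2 * 1 \<le> u * u" using xu u by (intro mult_mono) auto
  ultimately show ?thesis using aa by (intro mult_left_mono add_mono divide_right_mono) auto
 qed
 finally have D: "abs (PQ xi - 1 / MM xi) \<le> mu\<^sup>2 * (u * u / (12 * aa) + u * u / 3)" .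
 have "PP mu xi - MM xi = - (PP mu xi * MM xi * (PQ xi - 1 / MM xi))"
  using PQ_lower(2)[of xi] MM_bounds(1)[of xi] by (simp add: PP_PQ field_simps)
 then have "abs (PP mu xi - MM xi) = (PP mu xi * MM xi) * abs (PQ xi - 1 / MM xi)"
  using PP_pos[of xi] MM_bounds(1)[of xi] by (simp add: abs_mult)
 also have "... \<le> ((24 * aa / u) * (8 * aa / u)) * (mu\<^sup>2 * (u * u / (12 * aa) + u * u / 3))"
  using PP_low[OF True] MM_bounds(1,3)[of xi] PP_pos[of xi] D aa u unfolding u_def[symmetric] by (intro mult_mono) auto
 also have "... = mu\<^sup>2 * (16 * aa + 64 * aa\<^sup>2)" using u aa by (simp add: field_simps power2_eq_square)
 also have "... \<le> mu\<^sup>2 * 80" proof -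
  have "aa\<^sup>2 \<le> 1" using aa by (intro power_le_one) auto
  then show ?thesis using aa by (intro mult_left_mono) auto
 qed
 finally have "(1 + mu * abs xi) * abs (PP mu xi - MM xi) \<le> 2 * (mu\<^sup>2 * 80)" using True by (intro mult_mono) auto
 then show ?thesis by simp
qed

text \<open>\<open>PP\<close> gains two powers at low frequencies, so one lost power can be traded for a factor \<open>mu\<close>;
at high frequencies it is itself of size \<open>mu\<^sup>2\<close>.\<close>

lemma PP_smooth:
 assumes g: "bnd s A1 g" "bnd (s - 1) (mu * A2) g" and A2: "0 \<le> A2"
 shows "bndm mu s (48 * aa * mu * (A1 + A2)) (\<lambda>xi. PP mu xi * g xi)" proof (rule bndmI)
 show "continuous_on UNIV (\<lambda>xi. PP mu xi * g xi)" by (intro continuous_intros PP_cont bndD(1)[OF g(1)])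
 show "0 \<le> mu" using mu by simp
 fix xi :: real
 have A1: "0 \<le> A1" using bndD(4)[OF g(1)] .
 have W: "0 < (1 + abs xi)^s" by simp
 show "(1 + mu * abs xi) * abs (PP mu xi * g xi) \<le> 48 * aa * mu * (A1 + A2) / (1 + abs xi)^s"
 proof (cases "mu * abs xi \<le> 1")
  case True
  have "(1 + mu * abs xi) * abs (PP mu xi * g xi) = (1 + mu * abs xi) * (PP mu xi * abs (g xi))"
   using PP_pos[of xi] by (simp add: abs_mult)
  also have "... \<le> 2 * ((24 * aa / (1 + abs xi)\<^sup>2) * (mu * A2 / (1 + abs xi)^(s - 1)))"
   using True PP_low[OF True] PP_pos[of xi] bndD(3)[OF g(2), of xi] mu aa by (intro mult_mono) auto
  also have "... = 48 * aa * mu * A2 / ((1 + abs xi)\<^sup>2 * (1 + abs xi)^(s - 1))" by simp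
  also have "(1 + abs xi)\<^sup>2 * (1 + abs xi)^(s - 1) = (1 + abs xi)^(s + 1)" using s by (simp flip: power_add)
  also have "48 * aa * mu * A2 / (1 + abs xi)^(s + 1) \<le> 48 * aa * mu * (A1 + A2) / (1 + abs xi)^s"
   using aa mu A1 A2 by (intro frac_le mult_left_mono weight_mono mult_nonneg_nonneg) auto
  finally show ?thesis .
 next
  case False
  have "(1 + mu * abs xi) * abs (PP mu xi * g xi) = ((1 + mu * abs xi) * PP mu xi) * abs (g xi)"
   using PP_pos[of xi] by (simp add: abs_mult)
  also have "... \<le> (24 * aa * mu\<^sup>2) * (A1 / (1 + abs xi)^s)"
   by (rule mult_mono) (use PP_high[of xi] False bndD(3)[OF g(1), of xi] aa in auto)
  also have "... \<le> (48 * aa * mu) * ((A1 + A2) / (1 + abs xi)^s)" proof (rule mult_mono)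
   have "24 * aa * mu * mu \<le> 24 * aa * mu * 1" using aa mu by (intro mult_left_mono) auto
   then show "24 * aa * mu\<^sup>2 \<le> 48 * aa * mu" using aa mu by (simp add: power2_eq_square)
  qed (use A1 A2 aa mu in \<open>auto intro!: divide_right_mono\<close>)
  finally show ?thesis by simp
 qed
qed

end

end

context two_layers
begin

definition "Cr = abs w0 + abs w1 + 14 + 2 / h + 2 / (1 - h)"

lemma Cr_nonneg: "0 \<le> Cr" using h by (simp add: Cr_def)

text \<open>The bad term \<open>(mu t)\<^sup>2\<close> of \<open>symbol_product_bounds\<close> is the same in both layers, and \<open>rs\<close>
contains the difference of the two products. The intermediate bound \<open>rs_bound_mixed\<close> interpolates
between the two.\<close>

lemma rs_bounds:
 assumes mu: "0 \<le> mu"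
 shows "abs (rs mu xi t) \<le> Cr * ((1 + mu * abs (xi - t)) * (1 + mu * abs t))"
  "abs (rs mu xi t) \<le> Cr * ((mu * abs (xi - t))\<^sup>2 + (mu * abs t)\<^sup>2)" proof -
 define x y z where "x = mu * abs xi" and "y = mu * abs t" and "z = mu * abs (xi - t)"
 have xyz: "0 \<le> x" "0 \<le> y" "0 \<le> z" "x \<le> y + z" "y \<le> x + z"
  using mu mult_left_mono[of "abs xi" "abs t + abs (xi - t)" mu] mult_left_mono[of "abs t" "abs xi + abs (xi - t)" mu]
  by (auto simp: x_def y_def z_def distrib_left)
 have h': "0 < 1 - h" "1 - h < 1" using h by auto
 have layer: "abs ((Cs mu d xi * Cs mu d t - 1 / d\<^sup>2) - y\<^sup>2) \<le> (1 + 2 / d) * ((1 + z) * (1 + y))"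
   "abs ((Cs mu d xi * Cs mu d t - 1 / d\<^sup>2) - y\<^sup>2) \<le> 7 * (z\<^sup>2 + y\<^sup>2)"
   "abs (Cs mu d xi - 1 / d) \<le> (1 + z) * (1 + y)" "abs (Cs mu d xi - 1 / d) \<le> 2 * (z\<^sup>2 + y\<^sup>2)"
  if d: "0 < d" "d < 1" for d proof -
  note c = Cs_facts[OF d mu, of xi, folded x_def] and c' = Cs_facts[OF d mu, of t, folded y_def]
  have sq: "Cs mu d xi - 1 / d \<le> d * x\<^sup>2" "Cs mu d t - 1 / d \<le> d * y\<^sup>2" proof -
   have "0 \<le> d * x\<^sup>2" "0 \<le> d * y\<^sup>2" using d by auto
   then show "Cs mu d xi - 1 / d \<le> d * x\<^sup>2" "Cs mu d t - 1 / d \<le> d * y\<^sup>2" using c(4) c'(4) by linarith+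
  qed
  have e: "Cs mu d xi * Cs mu d t - 1 / d\<^sup>2 = ((Cs mu d xi - 1 / d) + (Cs mu d t - 1 / d)) / d + (Cs mu d xi - 1 / d) * (Cs mu d t - 1 / d)"
   using d by (simp add: field_simps power2_eq_square)
  show "abs ((Cs mu d xi * Cs mu d t - 1 / d\<^sup>2) - y\<^sup>2) \<le> (1 + 2 / d) * ((1 + z) * (1 + y))"
   "abs ((Cs mu d xi * Cs mu d t - 1 / d\<^sup>2) - y\<^sup>2) \<le> 7 * (z\<^sup>2 + y\<^sup>2)" proof -
   have c3: "x - 1 / d \<le> Cs mu d xi - 1 / d" "y - 1 / d \<le> Cs mu d t - 1 / d" using c(3) c'(3) by auto
   note S = symbol_product_bounds[OF d(1) xyz(1,2,4,5) c(1,2) c3(1) sq(1) c'(1,2) c3(2) sq(2)]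
   show "abs ((Cs mu d xi * Cs mu d t - 1 / d\<^sup>2) - y\<^sup>2) \<le> (1 + 2 / d) * ((1 + z) * (1 + y))"
    "abs ((Cs mu d xi * Cs mu d t - 1 / d\<^sup>2) - y\<^sup>2) \<le> 7 * (z\<^sup>2 + y\<^sup>2)" unfolding e by (rule S)+
  qed
  have "x \<le> (1 + z) * (1 + y)" proof -
   have "0 \<le> z * y" "(1 + z) * (1 + y) = 1 + z + y + z * y" using xyz by (auto simp: algebra_simps)
   then show ?thesis using xyz by linarith
  qed
  then show "abs (Cs mu d xi - 1 / d) \<le> (1 + z) * (1 + y)" using c(1,2) by linarith
  have "x\<^sup>2 \<le> (y + z)\<^sup>2" using xyz by (intro power_mono) auto
  also have "... \<le> 2 * (z\<^sup>2 + y\<^sup>2)" using sum_squares_bound[of y z] by (simp add: power2_sum)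
  finally have "x\<^sup>2 \<le> 2 * (z\<^sup>2 + y\<^sup>2)" .
  moreover have "d * x\<^sup>2 \<le> 1 * x\<^sup>2" using d by (intro mult_right_mono) auto
  ultimately show "abs (Cs mu d xi - 1 / d) \<le> 2 * (z\<^sup>2 + y\<^sup>2)" using c(1) sq(1) by linarith
 qed
 have comb: "abs (rs mu xi t) \<le> (abs w0 * p0 + abs w1 * p1) / 2 + (q0 + q1)"
  if "abs (Cs mu h xi - 1 / h) \<le> p0" "abs (Cs mu (1 - h) xi - 1 / (1 - h)) \<le> p1"
   "abs ((Cs mu h xi * Cs mu h t - 1 / h\<^sup>2) - y\<^sup>2) \<le> q0"
   "abs ((Cs mu (1 - h) xi * Cs mu (1 - h) t - 1 / (1 - h)\<^sup>2) - y\<^sup>2) \<le> q1" for p0 p1 q0 q1 proof -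
  have 1: "abs (w0 * (Cs mu h xi - 1 / h)) \<le> abs w0 * p0" "abs (w1 * (Cs mu (1 - h) xi - 1 / (1 - h))) \<le> abs w1 * p1"
   unfolding abs_mult using that by (auto intro!: mult_left_mono)
  let ?D = "(Cs mu h xi * Cs mu h t - 1 / h\<^sup>2) - (Cs mu (1 - h) xi * Cs mu (1 - h) t - 1 / (1 - h)\<^sup>2)"
  have "abs (?D) \<le> q0 + q1" using that(3,4) by linarith
  then have "abs (aa * ?D) \<le> 1 * (q0 + q1)" unfolding abs_mult using aa by (intro mult_mono) auto
  then have 2: "abs (aa * ?D) \<le> q0 + q1" by simp
  have "abs a \<le> A \<Longrightarrow> abs b \<le> B \<Longrightarrow> abs c \<le> C \<Longrightarrow> abs ((a + b) / 2 - c) \<le> (A + B) / 2 + C" for a b c A B C :: real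
   unfolding add_divide_distrib by linarith
  from this[OF 1 2] show ?thesis unfolding rs_def .
 qed
 have P0: "0 \<le> (1 + z) * (1 + y)" using xyz by simp
 have "abs (rs mu xi t) \<le> (abs w0 * ((1 + z) * (1 + y)) + abs w1 * ((1 + z) * (1 + y))) / 2
   + ((1 + 2 / h) * ((1 + z) * (1 + y)) + (1 + 2 / (1 - h)) * ((1 + z) * (1 + y)))"
  by (rule comb[OF layer(3)[OF h] layer(3)[OF h'] layer(1)[OF h] layer(1)[OF h']])
 also have "... = ((abs w0 + abs w1) / 2 + 2 + 2 / h + 2 / (1 - h)) * ((1 + z) * (1 + y))"
  by (simp add: algebra_simps add_divide_distrib)
 also have "... \<le> Cr * ((1 + z) * (1 + y))" unfolding Cr_def by (intro mult_right_mono P0) simp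
 finally show "abs (rs mu xi t) \<le> Cr * ((1 + mu * abs (xi - t)) * (1 + mu * abs t))" by (simp add: y_def z_def)
 have "abs (rs mu xi t) \<le> (abs w0 * (2 * (z\<^sup>2 + y\<^sup>2)) + abs w1 * (2 * (z\<^sup>2 + y\<^sup>2))) / 2 + (7 * (z\<^sup>2 + y\<^sup>2) + 7 * (z\<^sup>2 + y\<^sup>2))"
  by (rule comb[OF layer(4)[OF h] layer(4)[OF h'] layer(2)[OF h] layer(2)[OF h']])
 also have "... = (abs w0 + abs w1 + 14) * (z\<^sup>2 + y\<^sup>2)" by (simp add: algebra_simps add_divide_distrib)
 also have "... \<le> Cr * (z\<^sup>2 + y\<^sup>2)" unfolding Cr_def using h by (intro mult_right_mono) auto
 finally show "abs (rs mu xi t) \<le> Cr * ((mu * abs (xi - t))\<^sup>2 + (mu * abs t)\<^sup>2)" by (simp add: y_def z_def)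
qed

lemma rs_bound_mixed:
 assumes mu: "0 \<le> mu"
 shows "abs (rs mu xi t) \<le> Cr * ((mu * abs (xi - t) + mu * abs t) * ((1 + mu * abs (xi - t)) * (1 + mu * abs t)))" proof -
 define y z where "y = mu * abs t" and "z = mu * abs (xi - t)"
 have yz: "0 \<le> y" "0 \<le> z" using mu by (auto simp: y_def z_def)
 have P1: "1 \<le> (1 + z) * (1 + y)" using yz mult_mono[of 1 "1 + z" 1 "1 + y"] by simp
 note b = rs_bounds[OF mu, of xi t, folded y_def z_def]
 show ?thesis unfolding y_def[symmetric] z_def[symmetric] proof (cases "1 \<le> z + y")
  case True
  have "1 * ((1 + z) * (1 + y)) \<le> (z + y) * ((1 + z) * (1 + y))" using True P1 by (intro mult_right_mono) auto
  then have "Cr * ((1 + z) * (1 + y)) \<le> Cr * ((z + y) * ((1 + z) * (1 + y)))" using Cr_nonneg by (intro mult_left_mono) auto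
  then show "abs (rs mu xi t) \<le> Cr * ((z + y) * ((1 + z) * (1 + y)))" using b(1) by linarith
 next
  case False
  have "z\<^sup>2 \<le> z * 1" "y\<^sup>2 \<le> y * 1" unfolding power2_eq_square using False yz by (auto intro: mult_left_le)
  then have "z\<^sup>2 + y\<^sup>2 \<le> (z + y) * 1" by simp
  also have "... \<le> (z + y) * ((1 + z) * (1 + y))" using yz P1 by (intro mult_left_mono) auto
  finally have "Cr * (z\<^sup>2 + y\<^sup>2) \<le> Cr * ((z + y) * ((1 + z) * (1 + y)))" using Cr_nonneg by (intro mult_left_mono)
  then show "abs (rs mu xi t) \<le> Cr * ((z + y) * ((1 + z) * (1 + y)))" using b(2) by linarith
 qed
qed

lemma rs_cont: "continuous_on S (\<lambda>xi. rs mu xi t)" "continuous_on S (\<lambda>t. rs mu xi t)"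
 unfolding rs_def by (intro continuous_intros Cs_cont; simp)+

lemma rs_even: "rs mu (- xi) (- t) = rs mu xi t" by (simp add: rs_def Cs_even)

lemma RR_even: assumes "evn f" "evn g" shows "evn (RR mu f g)" unfolding evn_def proof
 fix xi
 have "RR mu f g (- xi) = (LBINT t. rs mu (- xi) (0 + - 1 * t) * (f (- xi - (0 + - 1 * t)) * g (0 + - 1 * t)))"
  unfolding RR_def by (subst lborel_integral_real_affine[of "- 1" _ 0]) auto
 also have "... = RR mu f g xi" unfolding RR_def using evnD[OF assms(1), of "xi - _"] evnD[OF assms(2)] by (simp add: rs_even)
 finally show "RR mu f g (- xi) = RR mu f g xi" .
qed

lemma RR_majorised:
 assumes f: "continuous_on UNIV f" and g: "continuous_on UNIV g" and r: "2 \<le> r"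
  and F: "bnd r A F" "bnd r B G" "bnd r A' F'" "bnd r B' G'"
  and le: "\<And>xi t. abs (rs mu xi t * (f (xi - t) * g t)) \<le> c * (abs (F (xi - t)) * abs (G t) + abs (F' (xi - t)) * abs (G' t))"
  and c: "0 \<le> c"
 shows "integrable lborel (\<lambda>t. rs mu xi t * (f (xi - t) * g t))"
  "(1 + abs xi)^r * abs (RR mu f g xi) \<le> c * (ccon r * A * B + ccon r * A' * B')" proof -
 have i: "integrable lborel (\<lambda>t. abs (F (xi - t)) * abs (G t))" "integrable lborel (\<lambda>t. abs (F' (xi - t)) * abs (G' t))"
  using integrable_abs[OF conv_integrable[OF F(1,2) r, of xi]] integrable_abs[OF conv_integrable[OF F(3,4) r, of xi]]
  by (simp_all add: abs_mult)
 then have ic: "integrable lborel (\<lambda>t. c * (abs (F (xi - t)) * abs (G t) + abs (F' (xi - t)) * abs (G' t)))" by simp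
 show I: "integrable lborel (\<lambda>t. rs mu xi t * (f (xi - t) * g t))"
 proof (rule Bochner_Integration.integrable_bound[OF ic])
  have "continuous_on UNIV (\<lambda>t. rs mu xi t * (f (xi - t) * g t))"
   by (intro continuous_intros rs_cont g continuous_on_compose2[OF f]) auto
  then show "(\<lambda>t. rs mu xi t * (f (xi - t) * g t)) \<in> borel_measurable lborel"
   by (auto intro: borel_measurable_continuous_onI)
  show "AE t in lborel. norm (rs mu xi t * (f (xi - t) * g t)) \<le> norm (c * (abs (F (xi - t)) * abs (G t) + abs (F' (xi - t)) * abs (G' t)))"
   unfolding real_norm_def by (intro AE_I2 order_trans[OF le abs_ge_self])
 qed
 have "abs (RR mu f g xi) \<le> (LBINT t. abs (rs mu xi t * (f (xi - t) * g t)))" unfolding RR_def by (rule integral_abs_bound)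
 also have "... \<le> (LBINT t. c * (abs (F (xi - t)) * abs (G t) + abs (F' (xi - t)) * abs (G' t)))"
  by (intro integral_mono integrable_abs I ic le)
 also have "... = c * ((LBINT t. abs (F (xi - t)) * abs (G t)) + (LBINT t. abs (F' (xi - t)) * abs (G' t)))" using i by simp
 finally have "(1 + abs xi)^r * abs (RR mu f g xi)
   \<le> (1 + abs xi)^r * (c * ((LBINT t. abs (F (xi - t)) * abs (G t)) + (LBINT t. abs (F' (xi - t)) * abs (G' t))))"
  by (intro mult_left_mono) auto
 also have "... = c * ((1 + abs xi)^r * (LBINT t. abs (F (xi - t)) * abs (G t)) + (1 + abs xi)^r * (LBINT t. abs (F' (xi - t)) * abs (G' t)))"
  by (simp add: algebra_simps)
 also have "... \<le> c * (ccon r * A * B + ccon r * A' * B')" by (intro mult_left_mono add_mono conv_abs_weight F r c)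
 finally show "(1 + abs xi)^r * abs (RR mu f g xi) \<le> c * (ccon r * A * B + ccon r * A' * B')" .
qed

lemma bnd_zero: "bnd r 0 (\<lambda>_. 0)" by (simp add: bnd_def)

context
 fixes mu :: real
 assumes mu: "0 \<le> mu" "mu \<le> 1"
begin

text \<open>Without a loss of derivatives \<open>RR\<close> is merely bounded; at the cost of one derivative it is
\<open>O(mu)\<close>. Together with \<open>PP_smooth\<close> this makes the contribution of \<open>RR\<close> to the contraction small.\<close>

lemma RR_basic:
 assumes f: "bndm mu s A f" and g: "bndm mu s B g"
 shows "integrable lborel (\<lambda>t. rs mu xi t * (f (xi - t) * g t))"
  "bnd s (Cr * (ccon s * A * B)) (RR mu f g)"
  "bnd (s - 1) (mu * (2 * Cr * (ccon (s - 1) * A * B))) (RR mu f g)" proof -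
 let ?F = "\<lambda>xi. (1 + mu * abs xi) * f xi" and ?G = "\<lambda>xi. (1 + mu * abs xi) * g xi"
 note F = f[unfolded bndm_def] and G = g[unfolded bndm_def]
 note fc = bndm_cont[OF mu(1) f, of UNIV] and gc = bndm_cont[OF mu(1) g, of UNIV]
 have e: "abs (?F (xi - t)) * abs (?G t) = (1 + mu * abs (xi - t)) * (1 + mu * abs t) * abs (f (xi - t) * g t)" for xi t
  using mu(1) by (simp add: abs_mult abs_of_nonneg)
 have le1: "abs (rs mu xi t * (f (xi - t) * g t)) \<le> Cr * (abs (?F (xi - t)) * abs (?G t) + abs ((\<lambda>_. 0) (xi - t)) * abs ((\<lambda>_. 0) t))" for xi t
 proof -
  have "abs (rs mu xi t) * abs (f (xi - t) * g t) \<le> Cr * ((1 + mu * abs (xi - t)) * (1 + mu * abs t)) * abs (f (xi - t) * g t)"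
   by (intro mult_right_mono rs_bounds mu) auto
  then show ?thesis unfolding e by (simp add: abs_mult mult.assoc)
 qed
 note M = RR_majorised[OF fc gc s2 F G bnd_zero bnd_zero le1 Cr_nonneg]
 show "integrable lborel (\<lambda>t. rs mu xi t * (f (xi - t) * g t))" by (rule M(1))
 have "continuous_on UNIV (\<lambda>xi. LBINT t. rs mu xi t * (f (xi - t) * g t))" proof (rule continuous_on_integral_dominated)
  show "(\<lambda>t. rs mu xi t * (f (xi - t) * g t)) \<in> borel_measurable lborel" for xi
   using M(1)[of xi] by (rule borel_measurable_integrable)
  show "continuous_on UNIV (\<lambda>xi. rs mu xi t * (f (xi - t) * g t))" for t
   by (intro continuous_intros rs_cont continuous_on_compose2[OF fc]) auto
  show "integrable lborel (\<lambda>t. Cr * A * abs (?G t))"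
   using bnd_integrable(1)[OF G s2] by (intro integrable_mult_right integrable_abs)
  fix xi t
  have "abs (rs mu xi t * (f (xi - t) * g t)) \<le> Cr * (abs (?F (xi - t)) * abs (?G t))" using le1[of xi t] by simp
  also have "... \<le> Cr * (A * abs (?G t))"
   using bndD(5)[OF F, of "xi - t"] Cr_nonneg by (intro mult_left_mono mult_right_mono) auto
  finally show "norm (rs mu xi t * (f (xi - t) * g t)) \<le> Cr * A * abs (?G t)" by (simp add: mult.assoc)
 qed
 then have RRc: "continuous_on UNIV (RR mu f g)" by (simp add: RR_def[abs_def])
 show "bnd s (Cr * (ccon s * A * B)) (RR mu f g)" using M(2) RRc by (simp add: bnd_def)
 have s': "Suc (s - 1) = s" "2 \<le> s - 1" using s by auto
 have F': "bnd (s - 1) A (\<lambda>xi. xi * ?F xi)" using bnd_xi[of "s - 1" A ?F] F s' by simp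
 have G': "bnd (s - 1) B (\<lambda>xi. xi * ?G xi)" using bnd_xi[of "s - 1" B ?G] G s' by simp
 have F1: "bnd (s - 1) A ?F" and G1: "bnd (s - 1) B ?G" using bnd_weaken[OF F] bnd_weaken[OF G] by auto
 have le2: "abs (rs mu xi t * (f (xi - t) * g t))
   \<le> (Cr * mu) * (abs ((\<lambda>xi. xi * ?F xi) (xi - t)) * abs (?G t) + abs (?F (xi - t)) * abs ((\<lambda>xi. xi * ?G xi) t))" for xi t
 proof -
  have "abs (rs mu xi t) * abs (f (xi - t) * g t)
    \<le> Cr * ((mu * abs (xi - t) + mu * abs t) * ((1 + mu * abs (xi - t)) * (1 + mu * abs t))) * abs (f (xi - t) * g t)"
   by (intro mult_right_mono rs_bound_mixed mu) auto
  also have "... = (Cr * mu) * ((abs (xi - t) + abs t) * (abs (?F (xi - t)) * abs (?G t)))" proof -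
   have "C * ((m * p + m * q) * (P * Q)) * r = (C * m) * ((p + q) * (P * Q * r))" for C m p q P Q r :: real
    by (simp add: algebra_simps)
   then show ?thesis unfolding e by simp
  qed
  also have "... = (Cr * mu) * (abs ((\<lambda>xi. xi * ?F xi) (xi - t)) * abs (?G t) + abs (?F (xi - t)) * abs ((\<lambda>xi. xi * ?G xi) t))"
  proof -
   have "C * ((p + q) * (P * Q)) = C * ((p * P) * Q + P * (q * Q))" for C p q P Q :: real by (simp add: algebra_simps)
   then show ?thesis unfolding abs_mult[of "xi - t" "?F (xi - t)"] abs_mult[of t "?G t"] .
  qed
  finally show ?thesis by (simp only: abs_mult)
 qed
 have "0 \<le> Cr * mu" using Cr_nonneg mu by simp
 note M2 = RR_majorised(2)[OF fc gc s'(2) F' G1 F1 G' le2 this]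
 show "bnd (s - 1) (mu * (2 * Cr * (ccon (s - 1) * A * B))) (RR mu f g)" using M2 RRc by (simp add: bnd_def mult_ac)
qed

lemma RR_smooth:
 assumes f: "bnd (s + 2) A f"
 shows "bnd s (mu\<^sup>2 * (2 * Cr * (ccon s * A * A))) (RR mu f f)" proof -
 have f1: "bnd s A f" "bnd (s + 1) A f" using bnd_weaken[OF f] by auto
 have f2: "bnd s A (\<lambda>xi. xi * (xi * f xi))" using bnd_xi[of s A "\<lambda>xi. xi * f xi"] bnd_xi[of "Suc s" A f] f by simp
 note fc = bndD(1)[OF f1(1), of UNIV]
 have le: "abs (rs mu xi t * (f (xi - t) * f t))
   \<le> (Cr * mu\<^sup>2) * (abs ((\<lambda>xi. xi * (xi * f xi)) (xi - t)) * abs (f t) + abs (f (xi - t)) * abs ((\<lambda>xi. xi * (xi * f xi)) t))" for xi t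
 proof -
  have "abs (rs mu xi t) * abs (f (xi - t) * f t) \<le> Cr * ((mu * abs (xi - t))\<^sup>2 + (mu * abs t)\<^sup>2) * abs (f (xi - t) * f t)"
   by (intro mult_right_mono rs_bounds mu) auto
  also have "... = (Cr * mu\<^sup>2) * ((abs (xi - t) * (abs (xi - t) * abs (f (xi - t)))) * abs (f t) + abs (f (xi - t)) * (abs t * (abs t * abs (f t))))"
   by (simp only: abs_mult power2_eq_square distrib_left distrib_right mult_ac)
  finally show ?thesis by (simp only: abs_mult)
 qed
 have "0 \<le> Cr * mu\<^sup>2" using Cr_nonneg by simp
 note M = RR_majorised(2)[OF fc fc s2 f2 f1(1) f1(1) f2 le this]
 have "bndm mu s A f" by (rule bndm_of_bnd[OF f1(2) mu])
 from bndD(1)[OF RR_basic(2)[OF this this], of UNIV] M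
 show ?thesis by (simp add: bnd_def mult_ac)
qed

lemma RR_diff:
 assumes "bndm mu s A f" "bndm mu s A' f'" "bndm mu s D (\<lambda>xi. f xi - f' xi)"
 shows "RR mu f f xi - RR mu f' f' xi = RR mu (\<lambda>xi. f xi - f' xi) f xi + RR mu f' (\<lambda>xi. f xi - f' xi) xi" proof -
 note i1 = RR_basic(1)[OF assms(3,1), of xi] and i2 = RR_basic(1)[OF assms(2,3), of xi]
 note i3 = RR_basic(1)[OF assms(1,1), of xi] and i4 = RR_basic(1)[OF assms(2,2), of xi]
 have "RR mu f f xi - RR mu f' f' xi = (LBINT t. rs mu xi t * (f (xi - t) * f t) - rs mu xi t * (f' (xi - t) * f' t))"
  unfolding RR_def using i3 i4 by (rule Bochner_Integration.integral_diff[symmetric])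
 also have "... = (LBINT t. rs mu xi t * ((f (xi - t) - f' (xi - t)) * f t) + rs mu xi t * (f' (xi - t) * (f t - f' t)))"
  by (simp add: algebra_simps)
 also have "... = RR mu (\<lambda>xi. f xi - f' xi) f xi + RR mu f' (\<lambda>xi. f xi - f' xi) xi"
  unfolding RR_def using i1 i2 by (rule Bochner_Integration.integral_add)
 finally show ?thesis .
qed

end

end

section \<open>Coding weighted functions as bounded continuous functions\<close>

text \<open>The Banach fixed point theorem needs a type that is a complete metric space. Profile and fields
are represented by bounded continuous functions: decoding symmetrises and divides by the weight, so
that every code stands for functions with the right symmetry and decay. Deviations from the
limiting profile are also divided by \<open>mu\<close>. Encoding clamps \<open>t\<close> to \<open>[-1, 1]\<close>.\<close>

type_synonym code =
 "(real \<Rightarrow>\<^sub>C real) \<times> ((real \<times> real) \<Rightarrow>\<^sub>C real) \<times> ((real \<times> real) \<Rightarrow>\<^sub>C real)"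

definition dec1 :: "nat \<Rightarrow> real \<Rightarrow> (real \<Rightarrow>\<^sub>C real) \<Rightarrow> real \<Rightarrow> real" where
 "dec1 s mu g xi = mu * ((apply_bcontfun g xi + apply_bcontfun g (- xi)) / 2) / ((1 + mu * abs xi) * (1 + abs xi)^s)"

definition dec2 :: "nat \<Rightarrow> ((real \<times> real) \<Rightarrow>\<^sub>C real) \<Rightarrow> real \<Rightarrow> real \<Rightarrow> real" where
 "dec2 s p t xi = ((apply_bcontfun p (t, xi) + apply_bcontfun p (- t, - xi)) / 2) / (1 + abs xi)^s"

definition enc1 :: "nat \<Rightarrow> real \<Rightarrow> (real \<Rightarrow> real) \<Rightarrow> (real \<Rightarrow>\<^sub>C real)" where
 "enc1 s mu f = Bcontfun (\<lambda>xi. ((1 + mu * abs xi) * (1 + abs xi)^s) * f xi / mu)"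

definition enc2 :: "nat \<Rightarrow> (real \<Rightarrow> real \<Rightarrow> real) \<Rightarrow> ((real \<times> real) \<Rightarrow>\<^sub>C real)" where
 "enc2 s F = Bcontfun (\<lambda>p. (1 + abs (snd p))^s * F (max (- 1) (min 1 (fst p))) (snd p))"

lemma bcontfun_abs_le: "abs (apply_bcontfun g x) \<le> norm g" for g :: "'a::topological_space \<Rightarrow>\<^sub>C real"
 using norm_bounded[of g x] by simp

lemma half_sum_le: "abs a \<le> N \<Longrightarrow> abs b \<le> N \<Longrightarrow> abs ((a + b) / 2) \<le> (N::real)"
 unfolding add_divide_distrib by linarith

lemma weight_nz: "(1 + abs (xi::real))^s \<noteq> 0" "0 < (1 + abs xi)^s" by auto

lemma dec1_facts:
 assumes mu: "0 < mu"
 shows "bndm mu s (mu * norm g) (dec1 s mu g)" "evn (dec1 s mu g)"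
  "dec1 s mu g xi - dec1 s mu g' xi = dec1 s mu (g - g') xi" proof -
 have nz: "1 + mu * abs xi > 0" for xi :: real using mu by (intro mu_weight_nz) simp
 have nz2: "(1 + mu * abs xi) * (1 + abs xi)^s \<noteq> 0" for xi :: real using nz[of xi] weight_nz[of xi s] by simp
 show "bndm mu s (mu * norm g) (dec1 s mu g)" proof (rule bndmI)
  show "continuous_on UNIV (dec1 s mu g)" unfolding dec1_def[abs_def]
   by (intro continuous_intros continuous_on_compose2[OF continuous_on_apply_bcontfun[of UNIV]]) (use nz2 in auto)
  show "0 \<le> mu" using mu by simp
  fix xi :: real
  have "abs ((apply_bcontfun g xi + apply_bcontfun g (- xi)) / 2) \<le> norm g" by (intro half_sum_le bcontfun_abs_le)
  then have "mu * abs ((apply_bcontfun g xi + apply_bcontfun g (- xi)) / 2) / (1 + abs xi)^s \<le> mu * norm g / (1 + abs xi)^s"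
   using mu by (intro divide_right_mono mult_left_mono) auto
  moreover have "(1 + mu * abs xi) * abs (dec1 s mu g xi) = mu * abs ((apply_bcontfun g xi + apply_bcontfun g (- xi)) / 2) / (1 + abs xi)^s"
   using mu nz[of xi] by (simp add: dec1_def abs_mult abs_divide)
  ultimately show "(1 + mu * abs xi) * abs (dec1 s mu g xi) \<le> mu * norm g / (1 + abs xi)^s" by simp
 qed
 show "evn (dec1 s mu g)" by (simp add: evn_def dec1_def add.commute)
 show "dec1 s mu g xi - dec1 s mu g' xi = dec1 s mu (g - g') xi"
  unfolding dec1_def diff_divide_distrib[symmetric] by (simp add: algebra_simps add_divide_distrib diff_divide_distrib)
qed

lemma dec2_facts:
 shows "bnd2 s (norm p) (dec2 s p)" "sym2 (dec2 s p)"
  "dec2 s p t xi - dec2 s p' t xi = dec2 s (p - p') t xi" proof -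
 show "bnd2 s (norm p) (dec2 s p)" proof (rule bnd2I)
  show "continuous_on ({- 1..1} \<times> UNIV) (\<lambda>q. dec2 s p (fst q) (snd q))" unfolding dec2_def
   by (intro continuous_intros continuous_on_compose2[OF continuous_on_apply_bcontfun[of UNIV]]) auto
  fix t xi :: real
  have "abs ((apply_bcontfun p (t, xi) + apply_bcontfun p (- t, - xi)) / 2) \<le> norm p" by (intro half_sum_le bcontfun_abs_le)
  then show "(1 + abs xi)^s * abs (dec2 s p t xi) \<le> norm p" by (simp add: dec2_def abs_divide)
 qed
 show "sym2 (dec2 s p)" by (simp add: sym2_def dec2_def add.commute)
 show "dec2 s p t xi - dec2 s p' t xi = dec2 s (p - p') t xi" unfolding dec2_def diff_divide_distrib[symmetric] by simp
qed

lemma enc1_facts: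
 assumes mu: "0 < mu" and f: "bndm mu s A f"
 shows "norm (enc1 s mu f) \<le> A / mu" "evn f \<Longrightarrow> dec1 s mu (enc1 s mu f) = f"
  "bndm mu s A' f' \<Longrightarrow> enc1 s mu f - enc1 s mu f' = enc1 s mu (\<lambda>xi. f xi - f' xi)" proof -
 have nz: "1 + mu * abs xi > 0" for xi :: real using mu by (intro mu_weight_nz) simp
 have le: "\<bar>((1 + mu * abs xi) * (1 + \<bar>xi\<bar>)^s) * f xi / mu\<bar> \<le> A / mu" if "bndm mu s A f" for f A xi
 proof -
  have "(1 + abs xi)^s * abs ((1 + mu * abs xi) * f xi) \<le> A" using bndD(2)[OF that[unfolded bndm_def], of xi] .
  then have "\<bar>((1 + mu * abs xi) * (1 + \<bar>xi\<bar>)^s) * f xi\<bar> \<le> A" by (simp add: abs_mult mult_ac)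
  then show ?thesis using mu by (simp add: abs_divide divide_right_mono)
 qed
 have ap: "apply_bcontfun (enc1 s mu f) = (\<lambda>xi. ((1 + mu * abs xi) * (1 + abs xi)^s) * f xi / mu)" if "bndm mu s A f" for f A
 proof -
  have "continuous_on UNIV (\<lambda>xi. ((1 + mu * abs xi) * (1 + abs xi)^s) * f xi / mu)"
   using mu by (intro continuous_intros bndm_cont[OF _ that]) auto
  then have "(\<lambda>xi. ((1 + mu * abs xi) * (1 + abs xi)^s) * f xi / mu) \<in> bcontfun"
   using le[OF that] by (intro bcontfun_normI[where b = "A / mu"]) auto
  then show ?thesis unfolding enc1_def by (rule Bcontfun_inverse)
 qed
 show "norm (enc1 s mu f) \<le> A / mu" by (rule norm_bound) (use le[OF f] in \<open>simp add: ap[OF f]\<close>)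
 show "dec1 s mu (enc1 s mu f) = f" if "evn f" proof
  fix xi
  have n: "1 + mu * abs xi \<noteq> 0" using nz[of xi] by simp
  show "dec1 s mu (enc1 s mu f) xi = f xi" unfolding dec1_def ap[OF f] using evnD[OF that, of xi] mu n weight_nz[of xi s] by simp
 qed
 show "enc1 s mu f - enc1 s mu f' = enc1 s mu (\<lambda>xi. f xi - f' xi)" if f': "bndm mu s A' f'"
  by (rule bcontfun_eqI) (simp add: ap[OF f] ap[OF f'] ap[OF bndm_diff[OF f f']] right_diff_distrib diff_divide_distrib)
qed

lemma enc2_facts:
 assumes F: "bnd2 s A F"
 shows "norm (enc2 s F) \<le> A" "sym2 F \<Longrightarrow> t \<in> {-1..1} \<Longrightarrow> dec2 s (enc2 s F) t xi = F t xi"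
  "bnd2 s A' F' \<Longrightarrow> enc2 s F - enc2 s F' = enc2 s (\<lambda>t xi. F t xi - F' t xi)" proof -
 have cl: "max (- 1) (min 1 t) \<in> {-1..1}" for t :: real by auto
 have le: "\<bar>(1 + \<bar>snd p\<bar>)^s * F (max (- 1) (min 1 (fst p))) (snd p)\<bar> \<le> A" if "bnd2 s A F" for A F and p :: "real \<times> real"
  using bnd2D[OF that cl, of "snd p" "fst p"] by (simp add: abs_mult)
 have ap: "apply_bcontfun (enc2 s F) = (\<lambda>p. (1 + abs (snd p))^s * F (max (- 1) (min 1 (fst p))) (snd p))" if "bnd2 s A F" for A F
 proof -
  have "continuous_on UNIV (\<lambda>p::real\<times>real. F (max (- 1) (min 1 (fst p))) (snd p))"
   by (rule bnd2_cont_compose[OF that]) (auto intro!: continuous_intros)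
  then have "continuous_on UNIV (\<lambda>p. (1 + abs (snd p))^s * F (max (- 1) (min 1 (fst p))) (snd p))"
   by (intro continuous_intros)
  then have "(\<lambda>p. (1 + abs (snd p))^s * F (max (- 1) (min 1 (fst p))) (snd p)) \<in> bcontfun"
   using le[OF that] by (intro bcontfun_normI[where b = A]) auto
  then show ?thesis unfolding enc2_def by (rule Bcontfun_inverse)
 qed
 show "norm (enc2 s F) \<le> A" by (rule norm_bound) (use le[OF F] in \<open>simp add: ap[OF F]\<close>)
 show "dec2 s (enc2 s F) t xi = F t xi" if "sym2 F" "t \<in> {-1..1}" proof -
  have "max (- 1) (min 1 t) = t" "max (- 1) (min 1 (- t)) = - t" using that(2) by auto
  then show ?thesis unfolding dec2_def ap[OF F] using sym2D[OF that, of xi] weight_nz[of xi s] by simp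
 qed
 show "enc2 s F - enc2 s F' = enc2 s (\<lambda>t xi. F t xi - F' t xi)" if F': "bnd2 s A' F'"
  by (rule bcontfun_eqI) (simp add: ap[OF F] ap[OF F'] ap[OF bnd2_diff[OF F F']] right_diff_distrib)
qed

context two_layers
begin

section \<open>Solving the profile equations by contraction\<close>

definition "g0 xi = - (3 / theta h w0 w1) * s0 xi"

lemma g0_even: "evn g0" by (simp add: evn_def g0_def s0_even)

lemma g0_bnd: "\<exists>C. bnd r C g0" proof -
 obtain C where "bnd r C s0" using s0_bnd by blast
 from bnd_cmult[OF this, of "- (3 / theta h w0 w1)"] show ?thesis unfolding g0_def[abs_def] by blast
qed

text \<open>For \<open>g = g0 + d\<close> the continuity condition follows from \<open>L d = EE\<close>, where \<open>L\<close> is the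
linearisation of the limiting equation at \<open>g0\<close> (lemma \<open>profile_equation\<close>). The terms of \<open>EE\<close> are
small for different reasons: the first is quadratic in \<open>d\<close>, in the second \<open>PP\<close> is close to \<open>MM\<close>,
the third contains \<open>RR\<close>, and the last one carries the factor \<open>ep mu\<close>.\<close>

definition "EE mu g d p q xi = (- bb) * (MM xi * conv d d xi) + (- bb) * ((PP mu xi - MM xi) * conv g g xi)
  + (- 1) * (PP mu xi * RR mu g g xi) + (- ep mu) * (PP mu xi * (NN mu h g p xi + NN mu (1 - h) g q xi))"

lemma ep_bounds: assumes "0 < mu" "mu \<le> 1" shows "0 < ep mu" "ep mu \<le> 2 * mu\<^sup>2" "ep mu \<le> 2 * mu" "ep mu \<le> 2"
proof -
 show "0 < ep mu" using aa assms by (simp add: ep_def)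
 have "aa\<^sup>2 \<le> 1" using aa by (intro power_le_one) auto
 then have "4 * aa\<^sup>2 / 3 * mu\<^sup>2 \<le> 2 * mu\<^sup>2" by (intro mult_right_mono) auto
 then show 1: "ep mu \<le> 2 * mu\<^sup>2" by (simp add: ep_def)
 have "mu\<^sup>2 \<le> mu" using assms by (simp add: power2_eq_square mult_left_le)
 then show "ep mu \<le> 2 * mu" "ep mu \<le> 2" using 1 assms by auto
qed

definition "lipE G B = abs bb * (aa * (2 * ccon s)) + abs bb * (160 * (2 * ccon s * G)) + 48 * aa * (2 * Cr * ccon s * G + 4 * Cr * ccon (s - 1) * G)
  + 2 * (24 * aa * (((2 + 1 / h) + (2 + 1 / (1 - h))) * (ccon s * (B + G))))"

definition "resE G = abs bb * (160 * (ccon s * G * G)) + 24 * aa * (2 * Cr * (ccon s * G * G))"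

text \<open>Deviations \<open>d\<close> are measured in units of \<open>mu\<close>, so a Lipschitz constant \<open>O(mu\<^sup>2)\<close> here means
\<open>O(mu)\<close> for the coded map.\<close>

lemma EE_lip:
 assumes mu: "0 < mu" "mu \<le> 1"
  and g: "bndm mu s G g" "bndm mu s G g'" and d: "bndm mu s mu d" "bndm mu s mu d'"
  and gd: "\<And>xi. g xi - g' xi = d xi - d' xi"
  and D: "bndm mu s (mu * D) (\<lambda>xi. d xi - d' xi)"
  and p: "bnd2 s B p" "bnd2 s B p'" "bnd2 s D (\<lambda>t xi. p t xi - p' t xi)"
  and q: "bnd2 s B q" "bnd2 s B q'" "bnd2 s D (\<lambda>t xi. q t xi - q' t xi)"
 shows "bndm mu s (lipE G B * mu\<^sup>2 * D) (\<lambda>xi. EE mu g d p q xi - EE mu g' d' p' q' xi)" proof -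
 define hh where "hh = (2 + 1 / h) + (2 + 1 / (1 - h))"
 have mu0: "0 \<le> mu" using mu by simp
 have h': "0 < 1 - h" using h by simp
 have D0: "0 \<le> D" using bndm_nonneg[OF D] mu by (simp add: zero_le_mult_iff)
 have G0: "0 \<le> G" using bndm_nonneg[OF g(1)] .
 have B0: "0 \<le> B" using bnd2D[OF p(1), of 0 0] abs_ge_zero order_trans[of 0 "abs (p 0 0)" B] by simp
 have gD: "bndm mu s (mu * D) (\<lambda>xi. g xi - g' xi)" using D by (simp add: gd)
 have T1: "bndm mu s (aa * (2 * ccon s * mu * (mu * D))) (\<lambda>xi. MM xi * (conv d d xi - conv d' d' xi))"
 proof (rule bndm_mult'[OF bndm_conv_diff[OF d D s2 mu0] MM_bounds(4)])
  show "abs (MM xi) \<le> aa" for xi using MM_bounds(1,2)[of xi] by simp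
 qed
 note gg = bndm_conv_diff[OF g gD s2 mu0]
 have T2: "bndm mu s (160 * mu\<^sup>2 * (2 * ccon s * G * (mu * D))) (\<lambda>xi. (PP mu xi - MM xi) * (conv g g xi - conv g' g' xi))"
  by (rule bndm_mult[OF bndm_bnd(1)[OF mu0 gg] _ PP_MM[OF mu] mu0])
    (intro continuous_intros PP_cont[OF mu] MM_bounds(4))
 have T3: "bndm mu s (48 * aa * mu * (2 * Cr * ccon s * G * mu * D + 4 * Cr * ccon (s - 1) * G * mu * D)) (\<lambda>xi. PP mu xi * (RR mu g g xi - RR mu g' g' xi))"
 proof (rule PP_smooth[OF mu])
  note r1 = RR_basic[OF mu0 mu(2) gD g(1)] and r2 = RR_basic[OF mu0 mu(2) g(2) gD]
  note e = RR_diff[OF mu0 mu(2) g(1) g(2) gD]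
  show "bnd s (2 * Cr * ccon s * G * mu * D) (\<lambda>xi. RR mu g g xi - RR mu g' g' xi)"
   unfolding e using bnd_add[OF r1(2) r2(2)] by (rule bnd_weaken) (auto simp: algebra_simps)
  show "bnd (s - 1) (mu * (4 * Cr * ccon (s - 1) * G * mu * D)) (\<lambda>xi. RR mu g g xi - RR mu g' g' xi)"
   unfolding e using bnd_add[OF r1(3) r2(3)] by (rule bnd_weaken) (auto simp: algebra_simps)
  show "0 \<le> 4 * Cr * ccon (s - 1) * G * mu * D" using Cr_nonneg ccon_nonneg G0 mu D0 by simp
 qed
 have T4: "bndm mu s (24 * aa * (hh * (ccon s * (mu * D * B + G * D))))
   (\<lambda>xi. PP mu xi * ((NN mu h g p xi - NN mu h g' p' xi) + (NN mu (1 - h) g q xi - NN mu (1 - h) g' q' xi)))"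
 proof (rule bndm_mult[OF _ PP_cont[OF mu] PP_bound[OF mu] mu0])
  show "bnd s (hh * (ccon s * (mu * D * B + G * D)))
    (\<lambda>xi. (NN mu h g p xi - NN mu h g' p' xi) + (NN mu (1 - h) g q xi - NN mu (1 - h) g' q' xi))"
   using bnd_add[OF layer_diff_facts(3)[OF g gD p mu0 s2 h(1)] layer_diff_facts(3)[OF g gD q mu0 s2 h']]
   by (simp add: hh_def algebra_simps)
 qed
 have eq: "EE mu g d p q xi - EE mu g' d' p' q' xi = (- bb) * (MM xi * (conv d d xi - conv d' d' xi))
   + (- bb) * ((PP mu xi - MM xi) * (conv g g xi - conv g' g' xi)) + (- 1) * (PP mu xi * (RR mu g g xi - RR mu g' g' xi))
   + (- ep mu) * (PP mu xi * ((NN mu h g p xi - NN mu h g' p' xi) + (NN mu (1 - h) g q xi - NN mu (1 - h) g' q' xi)))" for xi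
  by (simp add: EE_def algebra_simps)
 have "bndm mu s (abs (- bb) * (aa * (2 * ccon s * mu * (mu * D))) + abs (- bb) * (160 * mu\<^sup>2 * (2 * ccon s * G * (mu * D)))
   + abs (- 1) * (48 * aa * mu * (2 * Cr * ccon s * G * mu * D + 4 * Cr * ccon (s - 1) * G * mu * D))
   + abs (- ep mu) * (24 * aa * (hh * (ccon s * (mu * D * B + G * D))))) (\<lambda>xi. EE mu g d p q xi - EE mu g' d' p' q' xi)"
  unfolding eq by (intro bndm_add bndm_cmult T1 T2 T3 T4)
 then show ?thesis proof (rule bndm_weaken)
  define Z where "Z = mu\<^sup>2 * D"
  have Z0: "0 \<le> Z" using D0 by (simp add: Z_def)
  have hh0: "0 \<le> hh" using h by (simp add: hh_def)
  have a: "abs (- bb) * (aa * (2 * ccon s * mu * (mu * D))) = (abs bb * (aa * (2 * ccon s))) * Z"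
   by (simp add: Z_def power2_eq_square)
  have "abs (- bb) * (160 * mu\<^sup>2 * (2 * ccon s * G * (mu * D))) = (abs bb * (160 * (2 * ccon s * G))) * (mu * Z)"
   by (simp add: Z_def)
  also have "... \<le> (abs bb * (160 * (2 * ccon s * G))) * Z"
   using mu Z0 ccon_nonneg G0 by (intro mult_left_mono mult_left_le_one_le) auto
  finally have b: "abs (- bb) * (160 * mu\<^sup>2 * (2 * ccon s * G * (mu * D))) \<le> (abs bb * (160 * (2 * ccon s * G))) * Z" .
  have c: "abs (- 1) * (48 * aa * mu * (2 * Cr * ccon s * G * mu * D + 4 * Cr * ccon (s - 1) * G * mu * D))
    = (48 * aa * (2 * Cr * ccon s * G + 4 * Cr * ccon (s - 1) * G)) * Z" by (simp add: Z_def power2_eq_square algebra_simps)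
  have "abs (- ep mu) * (24 * aa * (hh * (ccon s * (mu * D * B + G * D)))) \<le> (2 * mu\<^sup>2) * (24 * aa * (hh * (ccon s * (D * B + G * D))))"
  proof (rule mult_mono)
   show "24 * aa * (hh * (ccon s * (mu * D * B + G * D))) \<le> 24 * aa * (hh * (ccon s * (D * B + G * D)))"
    using aa hh0 ccon_nonneg mu D0 B0 by (intro mult_left_mono add_mono mult_right_mono mult_left_le_one_le) auto
  qed (use ep_bounds[OF mu] aa hh0 ccon_nonneg mu D0 B0 G0 in auto)
  also have "... = (2 * (24 * aa * (hh * (ccon s * (B + G))))) * Z" by (simp add: Z_def algebra_simps)
  finally have e: "abs (- ep mu) * (24 * aa * (hh * (ccon s * (mu * D * B + G * D)))) \<le> (2 * (24 * aa * (hh * (ccon s * (B + G))))) * Z" .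
  show "abs (- bb) * (aa * (2 * ccon s * mu * (mu * D))) + abs (- bb) * (160 * mu\<^sup>2 * (2 * ccon s * G * (mu * D)))
   + abs (- 1) * (48 * aa * mu * (2 * Cr * ccon s * G * mu * D + 4 * Cr * ccon (s - 1) * G * mu * D))
   + abs (- ep mu) * (24 * aa * (hh * (ccon s * (mu * D * B + G * D)))) \<le> lipE G B * mu\<^sup>2 * D" proof -
   have "lipE G B * mu\<^sup>2 * D = lipE G B * Z" by (simp add: Z_def)
   then show ?thesis using a b c e unfolding lipE_def hh_def[symmetric] by (simp only: distrib_right add_mono order_refl)
  qed
 qed simp
qed

text \<open>At the limiting profile two more derivatives are available, hence \<open>RR\<close> is \<open>O(mu\<^sup>2)\<close>. This,
rather than the cruder \<open>O(mu)\<close>, makes the error of the profile \<open>O(mu\<^sup>2)\<close>.\<close>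

lemma EE_base:
 assumes mu: "0 < mu" "mu \<le> 1" and G: "bnd (s + 2) G g0"
 shows "bndm mu s (resE G * mu\<^sup>2) (EE mu g0 (\<lambda>_. 0) (\<lambda>_ _. 0) (\<lambda>_ _. 0))" proof -
 have mu0: "0 \<le> mu" using mu by simp
 have g: "bndm mu s G g0" using bnd_weaken[OF G, of "s + 1" G] by (intro bndm_of_bnd mu mu0) auto
 have z: "conv f (\<lambda>_. 0) xi = 0" "conv (\<lambda>_. 0) f xi = 0" for f xi by (simp_all add: conv_def)
 have NN0: "NN mu d g0 (\<lambda>_ _. 0) xi = 0" for d xi by (simp add: NN_def SS_def JJ_def srcf_def z)
 have T2: "bndm mu s (160 * mu\<^sup>2 * (ccon s * G * G)) (\<lambda>xi. (PP mu xi - MM xi) * conv g0 g0 xi)"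
  by (rule bndm_mult[OF bndm_bnd(1)[OF mu0 bndm_conv[OF g g s2 mu0]] _ PP_MM[OF mu] mu0])
    (intro continuous_intros PP_cont[OF mu] MM_bounds(4))
 have T3: "bndm mu s (24 * aa * (mu\<^sup>2 * (2 * Cr * (ccon s * G * G)))) (\<lambda>xi. PP mu xi * RR mu g0 g0 xi)"
  by (rule bndm_mult[OF RR_smooth[OF mu0 mu(2) G] PP_cont[OF mu] PP_bound[OF mu] mu0])
 have eq: "EE mu g0 (\<lambda>_. 0) (\<lambda>_ _. 0) (\<lambda>_ _. 0) = (\<lambda>xi. (- bb) * ((PP mu xi - MM xi) * conv g0 g0 xi) + (- 1) * (PP mu xi * RR mu g0 g0 xi))"
  by (rule ext) (simp add: EE_def z NN0)
 have "bndm mu s (abs (- bb) * (160 * mu\<^sup>2 * (ccon s * G * G)) + abs (- 1) * (24 * aa * (mu\<^sup>2 * (2 * Cr * (ccon s * G * G))))) (EE mu g0 (\<lambda>_. 0) (\<lambda>_ _. 0) (\<lambda>_ _. 0))"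
  unfolding eq by (intro bndm_add bndm_cmult T2 T3)
 then show ?thesis by (rule bndm_weaken) (auto simp: resE_def algebra_simps)
qed

lemma EE_even:
 assumes mu: "0 < mu" "mu \<le> 1" and g: "bndm mu s G g" and p: "bnd2 s B p" "bnd2 s B q"
  and ev: "evn g" "evn d" "sym2 p" "sym2 q"
 shows "evn (EE mu g d p q)" proof -
 have mu0: "0 \<le> mu" and h': "0 < 1 - h" using mu h by auto
 note e = evnD[OF evn_conv[OF ev(1) ev(1)]] evnD[OF evn_conv[OF ev(2) ev(2)]] evnD[OF RR_even[OF ev(1) ev(1)]]
  evnD[OF evn_NN[OF g p(1) mu0 s2 h(1) ev(1,3)]] evnD[OF evn_NN[OF g p(2) mu0 s2 h' ev(1,4)]]
 show ?thesis unfolding evn_def EE_def e PP_even[OF mu] MM_bounds(5) by simp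
qed

end

lemma rr_bndm:
 assumes s: "2 \<le> s" and C: "\<And>f A. bnd s A f \<Longrightarrow> evn f \<Longrightarrow> bnd (s + 1) (C * A) (FT (rrw f))"
  and f: "bndm mu s A f" "evn f" and mu: "0 \<le> mu" "mu \<le> 1"
 shows "bndm mu s ((1 + C) * A) (rr f)" proof -
 have "bndm mu s (A + C * A) (rr f)" unfolding rr_def[abs_def]
  by (rule bndm_add[OF f(1) bndm_of_bnd[OF C[OF bndm_bnd(1)[OF mu(1) f(1)] f(2)] mu]])
 then show ?thesis by (simp add: distrib_right)
qed

context two_layers
begin

definition "lipP d w G B = 2 / d * (1 + abs w * (ccon s * G)) + (2 + 1 / d) * (ccon s * ((2 / d * G + 2 * B) + G * (2 / d + 2)))"

lemma layP_lip_mu: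
 assumes mu: "0 < mu" "mu \<le> 1" and d: "0 < d" "d \<le> 1" and sg: "abs sg = 1"
  and g: "bndm mu s G g" "bndm mu s G g'" "bndm mu s (mu * D) (\<lambda>xi. g xi - g' xi)"
  and p: "bnd2 s B p" "bnd2 s B p'" "bnd2 s D (\<lambda>t xi. p t xi - p' t xi)"
 shows "bnd2 s (lipP d w G B * mu * D) (\<lambda>t xi. layP mu (ep mu) aa d sg w g p t xi - layP mu (ep mu) aa d sg w g' p' t xi)"
proof -
 have mu0: "0 \<le> mu" and e0: "0 \<le> ep mu" and a: "0 \<le> aa" "aa \<le> 1" using mu ep_bounds[OF mu] aa by auto
 have D0: "0 \<le> D" using bndm_nonneg[OF g(3)] mu by (simp add: zero_le_mult_iff)
 have G0: "0 \<le> G" using bndm_nonneg[OF g(1)] .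
 have B0: "0 \<le> B" using bnd2D[OF p(1), of 0 0] abs_ge_zero order_trans[of 0 "abs (p 0 0)" B] by simp
 have "2 / d * (mu * D + abs w * (ccon s * G * (mu * D))) + (2 + 1 / d) * (ccon s * (mu * D * (2 / d * G + ep mu * B) + G * (2 / d * (mu * D) + ep mu * D)))
   \<le> 2 / d * (mu * D + abs w * (ccon s * G * (mu * D))) + (2 + 1 / d) * (ccon s * (mu * D * (2 / d * G + 2 * B) + G * (2 / d * (mu * D) + (2 * mu) * D)))"
  using ep_bounds[OF mu] mu D0 G0 B0 ccon_nonneg d by (intro add_mono mult_left_mono mult_right_mono order_refl) auto
 also have "... = lipP d w G B * mu * D" unfolding lipP_def by (simp add: algebra_simps)
 finally show ?thesis by (rule bnd2_weaken[OF layP_lip[OF g p mu0 s2 d a sg e0] order_refl])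
qed

text \<open>The terms independent of \<open>d\<close> cancel because \<open>g0\<close> solves the limiting equation.\<close>

lemma profile_equation:
 assumes mu: "0 \<le> mu" and d: "bndm mu s A d" and E: "d xi - 12 / (4 + xi\<^sup>2) * conv s0 d xi = EE mu (\<lambda>xi. g0 xi + d xi) d p q xi"
 defines "g \<equiv> \<lambda>xi. g0 xi + d xi"
 shows "g xi + PP mu xi * (bb * conv g g xi + RR mu g g xi + ep mu * (NN mu h g p xi + NN mu (1 - h) g q xi)) = 0" proof -
 obtain G where G: "bnd s G g0" using g0_bnd by blast
 note db = bndm_bnd(1)[OF mu d]
 have gx: "g xi = g0 xi + d xi" by (simp add: g_def)
 have nz: "4 + xi\<^sup>2 \<noteq> 0" using zero_le_power2[of xi] by linarith
 have g0s: "conv g0 f xi = - (3 / theta h w0 w1) * conv s0 f xi" for f unfolding g0_def[abs_def] by (rule conv_cmult_left)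
 have bM: "bb * MM xi = 2 * theta h w0 w1 / (4 + xi\<^sup>2)" using aa by (simp add: bb_def MM_def)
 have c1: "bb * MM xi * conv g0 d xi = - 6 / (4 + xi\<^sup>2) * conv s0 d xi"
  unfolding bM g0s using th nz by (simp add: field_simps)
 have c2: "bb * MM xi * conv g0 g0 xi = - g0 xi" proof -
  have "conv s0 g0 xi = - (3 / theta h w0 w1) * conv s0 s0 xi" unfolding g0_def[abs_def] by (rule conv_cmult_right)
  then have "bb * MM xi * conv g0 g0 xi = (3 / theta h w0 w1) * (6 / (4 + xi\<^sup>2) * conv s0 s0 xi)"
   unfolding bM g0s using th nz by (simp add: field_simps power2_eq_square)
  also have "6 / (4 + xi\<^sup>2) * conv s0 s0 xi = s0 xi" by (rule s0_eq[symmetric])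
  finally show ?thesis unfolding g0_def[of xi] by simp
 qed
 have gg: "conv g g xi = conv g0 g0 xi + 2 * conv g0 d xi + conv d d xi"
  unfolding g_def conv_add_left[OF G db bnd_add[OF G db] s2] conv_add_right[OF G G db s2] conv_add_right[OF db G db s2]
  by (simp add: conv_commute[of d g0])
 have E': "EE mu g d p q xi = - (bb * MM xi) * conv d d xi - PP mu xi * (bb * conv g g xi) + bb * MM xi * conv g g xi
  - PP mu xi * RR mu g g xi - PP mu xi * (ep mu * (NN mu h g p xi + NN mu (1 - h) g q xi))" by (simp add: EE_def algebra_simps)
 have "bb * MM xi * conv g g xi = - g0 xi - 12 / (4 + xi\<^sup>2) * conv s0 d xi + bb * MM xi * conv d d xi"
  unfolding gg distrib_left c2 using c1 by (simp add: mult.left_commute)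
 moreover have "x + y + (a' + b' + c') = 0"
  if "m = - x - k + n" "y - k = e" "e = - n - a' + m - b' - c'" for x y a' b' c' m n k e :: real using that by linarith
 ultimately show ?thesis using E[folded g_def] E' unfolding distrib_left gx minus_mult_left[symmetric] by blast
qed

definition "profile mu C g p q \<longleftrightarrow> evn g \<and> sym2 p \<and> sym2 q
  \<and> bndm mu s C g \<and> bndm mu s (C * mu\<^sup>2) (\<lambda>xi. g xi - g0 xi) \<and> bnd2 s C p \<and> bnd2 s C q
  \<and> (\<forall>xi. g xi + PP mu xi * (bb * conv g g xi + RR mu g g xi + ep mu * (NN mu h g p xi + NN mu (1 - h) g q xi)) = 0)
  \<and> (\<forall>t\<in>{-1..1}. \<forall>xi. p t xi = layP mu (ep mu) aa h 1 w0 g p t xi \<and> q t xi = layP mu (ep mu) aa (1 - h) (- 1) w1 g q t xi)"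

text \<open>The coded map contracts a fixed product of balls once \<open>mu\<close> is small. Its first component maps this
set into a ball of radius \<open>O(mu)\<close>; in the original units the profile is then within \<open>O(mu\<^sup>2)\<close>
of \<open>g0\<close>.\<close>

lemma profile_exists:
 "\<exists>C mu0. 0 < mu0 \<and> mu0 \<le> 1 \<and> 0 \<le> C \<and> (\<forall>mu. 0 < mu \<and> mu < mu0 \<longrightarrow> (\<exists>g p q. profile mu C g p q))"
proof -
 have h': "0 < 1 - h" "1 - h \<le> 1" "h \<le> 1" using h by auto
 have a: "0 \<le> aa" "aa \<le> 1" using aa by auto
 obtain \<Gamma> where \<Gamma>: "bnd (s + 2) \<Gamma> g0" using g0_bnd by blast
 have \<Gamma>0: "0 \<le> \<Gamma>" by (rule bndD(4)[OF \<Gamma>])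
 obtain Cw where Cw0: "0 \<le> Cw" and Cw: "\<And>f A. bnd s A f \<Longrightarrow> evn f \<Longrightarrow> bnd (s + 1) (Cw * A) (FT (rrw f))"
  using rr_bnd[OF s2] by blast
 define G where "G = \<Gamma> + 1"
 \<comment> \<open>the bound of \<open>layP_bnd\<close> for the field generated by \<open>g0\<close> alone; one more unit leaves room for the contraction\<close>
 define B0 where "B0 d w = 2 / d * (\<Gamma> + abs w / 2 * (ccon s * \<Gamma> * \<Gamma>)) + (2 + 1 / d) * (ccon s * \<Gamma> * (2 / d * \<Gamma>))" for d w :: real
 define B where "B = B0 h w0 + B0 (1 - h) w1 + 1"
 define R where "R = 1 + 2 * B"
 have B00: "0 \<le> B0 d w" if "0 < d" for d w using that \<Gamma>0 ccon_nonneg by (simp add: B0_def)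
 have B1: "1 \<le> B" "B0 h w0 \<le> B - 1" "B0 (1 - h) w1 \<le> B - 1" and R0: "0 \<le> R"
  using B00[OF h(1), of w0] B00[OF h'(1), of w1] by (auto simp: B_def R_def)
 have G0: "0 \<le> G" using \<Gamma>0 by (simp add: G_def)
 define K where "K = (1 + Cw) * lipE G B + lipP h w0 G B + lipP (1 - h) w1 G B"
 have L0: "0 \<le> (1 + Cw) * lipE G B" "0 \<le> lipP h w0 G B" "0 \<le> lipP (1 - h) w1 G B" "0 \<le> (1 + Cw) * resE \<Gamma>"
  using Cw0 aa G0 B1 ccon_nonneg Cr_nonneg h \<Gamma>0 by (auto simp: lipE_def lipP_def resE_def)
 have K0: "0 \<le> K" "(1 + Cw) * lipE G B \<le> K" "lipP h w0 G B \<le> K" "lipP (1 - h) w1 G B \<le> K" using L0 by (auto simp: K_def)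
 define M where "M = (1 + Cw) * resE \<Gamma> + K * R + K + 1"
 have M1: "1 \<le> M" "K \<le> M" "K * R \<le> M" "(1 + Cw) * resE \<Gamma> + K * R \<le> M" using K0 R0 L0 by (auto simp: M_def)
 \<comment> \<open>\<open>M\<close> bounds the Lipschitz constant and the size of the image, both per unit of \<open>mu\<close>\<close>
 define mu0 where "mu0 = 1 / (2 * M)"
 have mu0: "0 < mu0" "mu0 \<le> 1" using M1 by (auto simp: mu0_def)
 define C where "C = G + B + M"
 have C0: "0 \<le> C" "G \<le> C" "B \<le> C" "M \<le> C" using G0 B1 M1 by (auto simp: C_def)
 have "\<exists>g p q. profile mu C g p q" if mul: "0 < mu" "mu < mu0" for mu proof -
  have mu: "0 < mu" "mu \<le> 1" "0 \<le> mu" using mul mu0 by auto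
  have e0: "0 \<le> ep mu" using ep_bounds[OF mu(1,2)] by simp
  have "M * mu \<le> 1 / 2" using mul M1 unfolding mu0_def by (simp add: field_simps)
  then have Ml: "x * mu \<le> 1 / 2" if "x \<le> M" for x using mult_right_mono[OF that mu(3)] by linarith
  \<comment> \<open>the unknowns are coded by bounded continuous functions, so that every point of the ball is an admissible triple\<close>
  define S where "S = cball (0 :: real \<Rightarrow>\<^sub>C real) 1 \<times> (cball (0 :: (real \<times> real) \<Rightarrow>\<^sub>C real) B \<times> cball (0 :: (real \<times> real) \<Rightarrow>\<^sub>C real) B)"
  define \<delta> where "\<delta> x = dec1 s mu (fst x)" for x :: code
  define g where "g x = (\<lambda>xi. g0 xi + \<delta> x xi)" for x
  define p where "p x = dec2 s (fst (snd x))" for x :: code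
  define q where "q x = dec2 s (snd (snd x))" for x :: code
  define E where "E x = EE mu (g x) (\<delta> x) (p x) (q x)" for x
  define P where "P x = layP mu (ep mu) aa h 1 w0 (g x) (p x)" for x
  define Q where "Q x = layP mu (ep mu) aa (1 - h) (- 1) w1 (g x) (q x)" for x
  define \<Phi> where "\<Phi> x = (enc1 s mu (rr (E x)), enc2 s (P x), enc2 s (Q x))" for x
  have g0m: "bndm mu s \<Gamma> g0" using bnd_weaken[OF \<Gamma>, of "s + 1" \<Gamma>] by (intro bndm_of_bnd mu) auto
  have S0: "0 \<in> S" using B1 by (auto simp: S_def zero_prod_def)
  have xS: "norm (fst x) \<le> 1" "norm (fst (snd x)) \<le> B" "norm (snd (snd x)) \<le> B" if "x \<in> S" for x
   using that by (auto simp: S_def)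
  have ev: "evn (\<delta> x)" "evn (g x)" "sym2 (p x)" "sym2 (q x)" for x
   using g0_even dec1_facts(2)[OF mu(1), of s "fst x"] by (auto simp: evn_def g_def \<delta>_def p_def q_def dec2_facts)
  have \<delta>b: "bndm mu s (mu * norm (fst x)) (\<delta> x)" for x unfolding \<delta>_def by (rule dec1_facts(1)[OF mu(1)])
  have \<delta>1: "bndm mu s mu (\<delta> x)" if "x \<in> S" for x
   using xS(1)[OF that] mu by (intro bndm_weaken[OF \<delta>b]) (auto simp: mult_left_le)
  have gG: "bndm mu s G (g x)" if "x \<in> S" for x
   unfolding g_def by (rule bndm_weaken[OF bndm_add[OF g0m \<delta>1[OF that]]]) (use mu in \<open>auto simp: G_def\<close>)
  have pB: "bnd2 s B (p x)" "bnd2 s B (q x)" if "x \<in> S" for x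
   unfolding p_def q_def using xS[OF that] by (auto intro: bnd2_weaken[OF dec2_facts(1)])
  have dz: "norm (fst z) \<le> norm z \<and> norm (fst (snd z)) \<le> norm z \<and> norm (snd (snd z)) \<le> norm z"
   for z :: code proof -
   obtain a b c where "z = (a, b, c)" by (cases z)
   then show ?thesis using norm_fst_le[of a "(b, c)"] norm_snd_le[of "(b, c)" a] norm_fst_le[of b c] norm_snd_le[of c b] by simp
  qed
  have dD: "norm (fst x - fst y) \<le> dist x y" "norm (fst (snd x) - fst (snd y)) \<le> dist x y" "norm (snd (snd x) - snd (snd y)) \<le> dist x y"
   for x y :: code using dz[of "x - y"] by (simp_all add: dist_norm)
  have \<delta>D: "bndm mu s (mu * dist x y) (\<lambda>xi. \<delta> x xi - \<delta> y xi)" for x y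
   unfolding \<delta>_def dec1_facts(3)[OF mu(1)] using dD(1)[of x y] mu
   by (intro bndm_weaken[OF dec1_facts(1)[OF mu(1)]]) (auto intro: mult_left_mono)
  then have gD: "bndm mu s (mu * dist x y) (\<lambda>xi. g x xi - g y xi)" for x y by (simp add: g_def)
  have pD: "bnd2 s (dist x y) (\<lambda>t xi. p x t xi - p y t xi)" "bnd2 s (dist x y) (\<lambda>t xi. q x t xi - q y t xi)" for x y
   unfolding p_def q_def dec2_facts(3) using dD(2,3)[of x y] by (auto intro: bnd2_weaken[OF dec2_facts(1)])
  have ED: "bndm mu s (lipE G B * mu\<^sup>2 * dist x y) (\<lambda>xi. E x xi - E y xi)" if "x \<in> S" "y \<in> S" for x y
   unfolding E_def by (rule EE_lip[OF mu(1,2) gG gG \<delta>1 \<delta>1 _ \<delta>D pB(1) pB(1) pD(1) pB(2) pB(2) pD(2)]) (use that in \<open>auto simp: g_def\<close>)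
  have PD: "bnd2 s (lipP h w0 G B * mu * dist x y) (\<lambda>t xi. P x t xi - P y t xi)"
   "bnd2 s (lipP (1 - h) w1 G B * mu * dist x y) (\<lambda>t xi. Q x t xi - Q y t xi)" if "x \<in> S" "y \<in> S" for x y
   unfolding P_def Q_def
   by (rule layP_lip_mu[OF mu(1,2) _ _ _ gG[OF that(1)] gG[OF that(2)] gD]; use h h' pB[OF that(1)] pB[OF that(2)] pD in simp)+
  have zero: "\<delta> 0 = (\<lambda>_. 0)" "p 0 = (\<lambda>_ _. 0)" "q 0 = (\<lambda>_ _. 0)" "g 0 = g0"
   by (auto simp: \<delta>_def p_def q_def g_def dec1_def dec2_def fun_eq_iff)
  have E0: "bndm mu s (resE \<Gamma> * mu\<^sup>2) (E 0)" unfolding E_def zero by (rule EE_base[OF mu(1,2) \<Gamma>])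
  have P0: "bnd2 s (B - 1) (P 0)" "bnd2 s (B - 1) (Q 0)" proof -
   have z: "bnd2 s 0 (\<lambda>_ _. 0)" by (simp add: bnd2_def)
   show "bnd2 s (B - 1) (P 0)" "bnd2 s (B - 1) (Q 0)" unfolding P_def Q_def zero
    using bnd2_weaken[OF layP_bnd[OF g0m z mu(3) s2 h(1) h'(3) a _ e0, of 1 w0], of s "B - 1"] B1
     bnd2_weaken[OF layP_bnd[OF g0m z mu(3) s2 h'(1,2) a _ e0, of "- 1" w1], of s "B - 1"] by (simp_all add: B0_def)
  qed
  have Eb: "bndm mu s (resE \<Gamma> * mu\<^sup>2 + lipE G B * mu\<^sup>2 * dist x 0) (E x)" if "x \<in> S" for x
   using bndm_add[OF E0 ED[OF that S0]] by simp
  have Pb: "bnd2 s (B - 1 + lipP h w0 G B * mu * dist x 0) (P x)" "bnd2 s (B - 1 + lipP (1 - h) w1 G B * mu * dist x 0) (Q x)" if "x \<in> S" for x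
   using bnd2_add[OF P0(1) PD(1)[OF that S0]] bnd2_add[OF P0(2) PD(2)[OF that S0]] by simp_all
  have Eev: "evn (E x)" if "x \<in> S" for x unfolding E_def by (rule EE_even[OF mu(1,2) gG[OF that] pB[OF that] ev(2,1,3,4)])
  have rrE: "bndm mu s ((1 + Cw) * A) (rr f)" "evn (rr f)" if "bndm mu s A f" "evn f" for f A
   using rr_bndm[OF s2 Cw that mu(3,2)] rr_even[OF bnd_weaken[OF bndm_bnd(1)[OF mu(3) that(1)] s2 order_refl] evnD[OF that(2)]]
   by (auto simp: evn_def)
  have lip1: "norm (enc1 s mu (rr (E x)) - enc1 s mu (rr (E y))) \<le> (1 + Cw) * lipE G B * mu * dist x y" if xy: "x \<in> S" "y \<in> S" for x y
  proof -
   note b = Eb[OF xy(1)] Eb[OF xy(2)] and e = Eev[OF xy(1)] Eev[OF xy(2)]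
   have ed: "evn (\<lambda>xi. E x xi - E y xi)" using e by (simp add: evn_def)
   have "enc1 s mu (rr (E x)) - enc1 s mu (rr (E y)) = enc1 s mu (\<lambda>xi. rr (E x) xi - rr (E y) xi)"
    by (rule enc1_facts(3)[OF mu(1) rrE(1)[OF b(1) e(1)] rrE(1)[OF b(2) e(2)]])
   also have "(\<lambda>xi. rr (E x) xi - rr (E y) xi) = rr (\<lambda>xi. E x xi - E y xi)"
    by (rule ext, rule rr_diff[symmetric, OF bnd_weaken[OF bndm_bnd(1)[OF mu(3) b(1)] s2 order_refl] evnD[OF e(1)]
       bnd_weaken[OF bndm_bnd(1)[OF mu(3) b(2)] s2 order_refl] evnD[OF e(2)]])
   also have "norm (enc1 s mu ...) \<le> (1 + Cw) * (lipE G B * mu\<^sup>2 * dist x y) / mu"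
    by (rule enc1_facts(1)[OF mu(1) rrE(1)[OF ED[OF xy] ed]])
   also have "... = (1 + Cw) * lipE G B * mu * dist x y" using mu by (simp add: power2_eq_square)
   finally show ?thesis .
  qed
  have lip2: "norm (enc2 s (P x) - enc2 s (P y)) \<le> lipP h w0 G B * mu * dist x y"
    "norm (enc2 s (Q x) - enc2 s (Q y)) \<le> lipP (1 - h) w1 G B * mu * dist x y" if xy: "x \<in> S" "y \<in> S" for x y
   unfolding enc2_facts(3)[OF Pb(1)[OF xy(1)] Pb(1)[OF xy(2)]] enc2_facts(3)[OF Pb(2)[OF xy(1)] Pb(2)[OF xy(2)]]
   by (rule enc2_facts(1)[OF PD(1)[OF xy]], rule enc2_facts(1)[OF PD(2)[OF xy]])
  have sum3: "norm z \<le> norm (fst z) + (norm (fst (snd z)) + norm (snd (snd z)))"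
   for z :: code using norm_Pair_le[of "fst z" "snd z"] norm_Pair_le[of "fst (snd z)" "snd (snd z)"] by simp
  have R: "dist x 0 \<le> R" if "x \<in> S" for x using sum3[of x] xS[OF that] by (simp add: R_def)
  have small: "k * mu * dist x 0 \<le> 1 / 2" if "x \<in> S" "k \<le> K" "0 \<le> k" for x k proof -
   have "k * dist x 0 \<le> K * R" using R[OF that(1)] that(2,3) K0 by (intro mult_mono) auto
   then have "k * dist x 0 \<le> M" using M1 by linarith
   from Ml[OF this] show ?thesis by (simp add: mult_ac)
  qed
  have comp1: "norm (enc1 s mu (rr (E x))) \<le> M * mu" if "x \<in> S" for x proof -
   have "norm (enc1 s mu (rr (E 0))) \<le> (1 + Cw) * (resE \<Gamma> * mu\<^sup>2) / mu"
    by (rule enc1_facts(1)[OF mu(1) rrE(1)[OF E0 Eev[OF S0]]])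
   also have "... = (1 + Cw) * resE \<Gamma> * mu" using mu by (simp add: power2_eq_square)
   finally have "norm (enc1 s mu (rr (E 0))) \<le> (1 + Cw) * resE \<Gamma> * mu" .
   moreover have "(1 + Cw) * lipE G B * mu * dist x 0 \<le> K * R * mu" proof -
    have "(1 + Cw) * lipE G B * dist x 0 \<le> K * R" using R[OF that] K0 by (intro mult_mono) auto
    from mult_right_mono[OF this mu(3)] show ?thesis by (simp add: mult_ac)
   qed
   ultimately have "norm (enc1 s mu (rr (E x))) \<le> ((1 + Cw) * resE \<Gamma> + K * R) * mu"
    using norm_triangle_sub[of "enc1 s mu (rr (E x))" "enc1 s mu (rr (E 0))"] lip1[OF that S0] unfolding distrib_right by linarith
   also have "... \<le> M * mu" by (rule mult_right_mono[OF M1(4) mu(3)])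
   finally show ?thesis .
  qed
  have "\<exists>!x\<in>S. \<Phi> x = x" proof (rule Banach_fix[where c = "1 / 2"])
   show "Topological_Spaces.complete S" unfolding S_def by (intro complete_eq_closed[THEN iffD2] closed_Times closed_cball)
   show "S \<noteq> {}" using S0 by auto
   show "\<Phi> ` S \<subseteq> S" proof
    fix y assume "y \<in> \<Phi> ` S"
    then obtain x where x: "x \<in> S" "y = \<Phi> x" by blast
    have "norm (enc1 s mu (rr (E x))) \<le> 1" using comp1[OF x(1)] Ml[OF order_refl] by linarith
    moreover have "norm (enc2 s (P x)) \<le> B" "norm (enc2 s (Q x)) \<le> B"
     using enc2_facts(1)[OF Pb(1)[OF x(1)]] enc2_facts(1)[OF Pb(2)[OF x(1)]] small[OF x(1) K0(3) L0(2)] small[OF x(1) K0(4) L0(3)] by linarith+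
    ultimately show "y \<in> S" by (simp add: x(2) \<Phi>_def S_def)
   qed
   show "dist (\<Phi> x) (\<Phi> y) \<le> 1 / 2 * dist x y" if xy: "x \<in> S" "y \<in> S" for x y proof -
    have "dist (\<Phi> x) (\<Phi> y) \<le> norm (enc1 s mu (rr (E x)) - enc1 s mu (rr (E y)))
      + (norm (enc2 s (P x) - enc2 s (P y)) + norm (enc2 s (Q x) - enc2 s (Q y)))"
     unfolding dist_norm using sum3[of "\<Phi> x - \<Phi> y"] by (simp add: \<Phi>_def)
    also have "... \<le> (1 + Cw) * lipE G B * mu * dist x y + (lipP h w0 G B * mu * dist x y + lipP (1 - h) w1 G B * mu * dist x y)"
     by (intro add_mono lip1[OF xy] lip2[OF xy])
    also have "... = (K * mu) * dist x y" by (simp add: K_def algebra_simps)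
    also have "... \<le> 1 / 2 * dist x y" by (rule mult_right_mono[OF Ml[OF M1(2)]]) simp
    finally show ?thesis .
   qed
  qed auto
  then obtain x where x: "x \<in> S" "\<Phi> x = x" by blast
  then have fx: "enc1 s mu (rr (E x)) = fst x" "enc2 s (P x) = fst (snd x)" "enc2 s (Q x) = snd (snd x)"
   by (auto simp: \<Phi>_def prod_eq_iff)
  have du: "\<delta> x = rr (E x)"
   using enc1_facts(2)[OF mu(1) rrE(1)[OF Eb[OF x(1)] Eev[OF x(1)]] rrE(2)[OF Eb[OF x(1)] Eev[OF x(1)]]] fx(1) by (simp add: \<delta>_def)
  have "mu * norm (fst x) \<le> C * mu\<^sup>2" proof -
   have "norm (fst x) \<le> M * mu" using comp1[OF x(1)] fx(1) by simp
   also have "... \<le> C * mu" by (rule mult_right_mono[OF C0(4) mu(3)])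
   finally show ?thesis using mult_left_mono[of "norm (fst x)" "C * mu" mu] mu by (simp add: power2_eq_square mult_ac)
  qed
  then have close: "bndm mu s (C * mu\<^sup>2) (\<lambda>xi. g x xi - g0 xi)"
   using bndm_weaken[OF \<delta>b[of x] order_refl] by (simp add: g_def)
  have pq: "p x t xi = P x t xi \<and> q x t xi = Q x t xi" if "t \<in> {-1..1}" for t xi proof -
   have sy: "sym2 (P x)" "sym2 (Q x)" unfolding P_def Q_def
    by (rule sym2_layP[OF gG[OF x(1)] pB(1)[OF x(1)] mu(3) s2 _ _ a _ e0 ev(2,3)]; use h h' in simp)
      (rule sym2_layP[OF gG[OF x(1)] pB(2)[OF x(1)] mu(3) s2 _ _ a _ e0 ev(2,4)]; use h h' in simp)
   show ?thesis using enc2_facts(2)[OF Pb(1)[OF x(1)] sy(1) that, of xi] enc2_facts(2)[OF Pb(2)[OF x(1)] sy(2) that, of xi] fx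
    by (simp add: p_def q_def)
  qed
  have lin: "\<delta> x xi - 12 / (4 + xi\<^sup>2) * conv s0 (\<delta> x) xi = E x xi" for xi
   unfolding du by (rule rr_eq[OF bnd_weaken[OF bndm_bnd(1)[OF mu(3) Eb[OF x(1)]] s2 order_refl] evnD[OF Eev[OF x(1)]]])
  have "profile mu C (g x) (p x) (q x)" unfolding profile_def proof (intro conjI ballI allI ev close)
   show "bndm mu s C (g x)" by (rule bndm_weaken[OF gG[OF x(1)] order_refl C0(2)])
   show "bnd2 s C (p x)" "bnd2 s C (q x)" by (rule bnd2_weaken[OF pB(1)[OF x(1)] order_refl C0(3)] bnd2_weaken[OF pB(2)[OF x(1)] order_refl C0(3)])+
   show "g x xi + PP mu xi * (bb * conv (g x) (g x) xi + RR mu (g x) (g x) xi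
    + ep mu * (NN mu h (g x) (p x) xi + NN mu (1 - h) (g x) (q x) xi)) = 0" for xi
    unfolding g_def by (rule profile_equation[OF mu(3) \<delta>1[OF x(1)] lin[unfolded E_def g_def]])
  qed (use pq in \<open>auto simp: P_def Q_def\<close>)
  then show ?thesis by blast
 qed
 then show ?thesis using mu0 C0 by blast
qed

end

section \<open>The continuity of the horizontal velocity in Fourier variables\<close>

lemma conv_t_deriv:
 assumes f: "bnd s A f" and F: "bnd2 s B F" and F': "bnd2 s B' F'" and s: "2 \<le> s"
  and d: "\<And>t xi. t \<in> {-1..1} \<Longrightarrow> ((\<lambda>t. F t xi) has_real_derivative F' t xi) (at t within {-1..1})"
  and t: "t \<in> {-1..1}"
 shows "((\<lambda>t. conv f (F t) xi) has_real_derivative conv f (F' t) xi) (at t within {-1..1})"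
 unfolding conv_def has_real_derivative_iff_has_vector_derivative proof (rule has_vector_derivative_integral_dominated)
 show "convex {-1..1::real}" "t \<in> {-1..1}" using t by auto
 show "integrable lborel (\<lambda>r. f (xi - r) * F u r)" if "u \<in> {-1..1}" for u
  by (rule conv_integrable[OF f bnd2_slice[OF F that] s])
 show "((\<lambda>u. f (xi - r) * F u r) has_vector_derivative f (xi - r) * F' u r) (at u within {-1..1})" if "u \<in> {-1..1}" for u r
  using DERIV_cmult[OF d[OF that, of r], of "f (xi - r)"] by (simp add: has_real_derivative_iff_has_vector_derivative)
 show "(\<lambda>r. f (xi - r) * F' u r) \<in> borel_measurable lborel" if "u \<in> {-1..1}" for u
  using conv_integrable[OF f bnd2_slice[OF F' that] s, of xi] by (rule borel_measurable_integrable)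
 show "integrable lborel (\<lambda>r. A * (B' * (1 / (1 + abs r)^s)))" by (intro integrable_mult_right integrable_weight s)
 show "norm (f (xi - r) * F' u r) \<le> A * (B' * (1 / (1 + abs r)^s))" if "u \<in> {-1..1}" for u r
  using bndD(5)[OF f, of "xi - r"] bndD(3)[OF bnd2_slice[OF F' that], of r]
   mult_mono[of "abs (f (xi - r))" A "abs (F' u r)" "B' / (1 + abs r)^s"] bndD(4)[OF f] by (simp add: abs_mult)
qed

lemma el_deriv: "((\<lambda>t. el k t) has_real_derivative - k * el k t) (at t within S)"
 unfolding el_def by (auto intro!: derivative_eq_intros simp: algebra_simps)

lemma conv_xi:
 assumes "bnd s A f" "bnd s B g" "bnd s A' (\<lambda>x. x * f x)" "bnd s B' (\<lambda>x. x * g x)" "2 \<le> s"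
 shows "xi * conv f g xi = conv (\<lambda>x. x * f x) g xi + conv f (\<lambda>x. x * g x) xi" proof -
 have "(LBINT t. (xi - t) * f (xi - t) * g t) + (LBINT t. f (xi - t) * (t * g t))
  = (LBINT t. (xi - t) * f (xi - t) * g t + f (xi - t) * (t * g t))"
  by (rule Bochner_Integration.integral_add[symmetric, OF conv_integrable[OF assms(3,2,5), of xi] conv_integrable[OF assms(1,4,5), of xi]])
 also have "(\<lambda>t. (xi - t) * f (xi - t) * g t + f (xi - t) * (t * g t)) = (\<lambda>t. xi * (f (xi - t) * g t))"
  by (auto simp: algebra_simps)
 finally show ?thesis unfolding conv_def by simp
qed

text \<open>For the leading exponential field the integrand is an exact derivative, that of
\<open>z exp (k z) (g \<star> G z)\<close> up to the factor \<open>d\<close>: multiplication by \<open>xi\<close> is a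
derivation of convolution and \<open>G\<close> solves \<open>G' = - mu d xi G\<close>.\<close>

lemma JJ_srcf_el:
 assumes g: "bndm mu s A g" and mu: "0 \<le> mu" and d: "0 < d" "d \<le> 1" and s: "3 \<le> s"
 defines "G \<equiv> \<lambda>t xi. el (mu * d * xi) t * g xi"
 shows "d * JJ (mu * d * xi) (\<lambda>z. srcf mu d g G z xi) 1
  = exp (mu * d * xi) * conv g (G 1) xi + exp (- (mu * d * xi)) * conv g (G (- 1)) xi" proof -
 define k where "k = mu * d * xi"
 obtain s' where s': "s = Suc s'" "2 \<le> s'" using s by (cases s) auto
 have s2: "2 \<le> s" using s by simp
 note gb = bndm_bnd[OF mu g]
 have G: "bnd2 s (2 * A) G" unfolding G_def using bnd2_el[OF g mu _ d(2)] d by simp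
 have G': "bnd2 s' (2 * A) G" by (rule bnd2_weaken[OF G]) (auto simp: s')
 have xG: "bnd2 s' (2 * A) (\<lambda>t xi. xi * G t xi)" using G unfolding s' by (rule bnd2_xi)
 have dG: "bnd2 s' (abs (- (mu * d)) * (2 * A)) (\<lambda>t xi. - (mu * d) * (xi * G t xi))" by (rule bnd2_cmult[OF xG])
 have g': "bnd s' A g" "bnd s' A (\<lambda>x. x * g x)"
  using bnd_weaken[OF gb(1), of s' A] gb(1) bnd_xi[of s' A g] by (auto simp: s')
 have D: "((\<lambda>t. conv g (G t) xi) has_real_derivative conv g (\<lambda>xi. - (mu * d) * (xi * G t xi)) xi) (at t within {-1..1})"
  if "t \<in> {-1..1}" for t proof (rule conv_t_deriv[OF g'(1) G' dG s'(2) _ that])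
  fix t r :: real
  show "((\<lambda>t. G t r) has_real_derivative - (mu * d) * (r * G t r)) (at t within {-1..1})"
   unfolding G_def using DERIV_cmult_right[OF el_deriv[of "mu * d * r" t "{-1..1}"], of "g r"]
   by (rule DERIV_cong) (simp add: mult_ac)
 qed
 have s0: "conv (slope mu g) (G z) xi = mu * conv (\<lambda>x. x * g x) (G z) xi" for z
  using conv_cmult_left[of mu "\<lambda>x. x * g x" "G z" xi] by (simp add: mult_ac)
 have e: "d * (exp (k * z) * srcf mu d g G z xi) = exp (k * z) * conv g (G z) xi +
   z * (k * exp (k * z) * conv g (G z) xi + exp (k * z) * conv g (\<lambda>xi. - (mu * d) * (xi * G z xi)) xi)"
  if z: "z \<in> {-1..1}" for z proof -
  note cx = conv_xi[OF g'(1) bnd2_slice[OF G' z] g'(2) bnd2_slice[OF xG z] s'(2), of xi]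
  have "k * conv g (G z) xi = mu * d * (conv (\<lambda>x. x * g x) (G z) xi + conv g (\<lambda>x. x * G z x) xi)"
   unfolding cx[symmetric] k_def by simp
  moreover have "conv g (\<lambda>xi. - (mu * d) * (xi * G z xi)) xi = - (mu * d) * conv g (\<lambda>x. x * G z x) xi"
   by (rule conv_cmult_right)
  ultimately have q: "k * conv g (G z) xi + conv g (\<lambda>xi. - (mu * d) * (xi * G z xi)) xi = mu * d * conv (\<lambda>x. x * g x) (G z) xi"
   by (simp add: algebra_simps)
  have "exp (k * z) * conv g (G z) xi +
   z * (k * exp (k * z) * conv g (G z) xi + exp (k * z) * conv g (\<lambda>xi. - (mu * d) * (xi * G z xi)) xi)
   = exp (k * z) * (conv g (G z) xi + z * (k * conv g (G z) xi + conv g (\<lambda>xi. - (mu * d) * (xi * G z xi)) xi))"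
   by (simp add: algebra_simps)
  also have "... = d * (exp (k * z) * srcf mu d g G z xi)" unfolding q srcf_def s0 using d by (simp add: field_simps)
  finally show ?thesis by simp
 qed
 have "((\<lambda>z. d * (exp (k * z) * srcf mu d g G z xi)) has_integral
   1 * (exp (k * 1) * conv g (G 1) xi) - (- 1) * (exp (k * - 1) * conv g (G (- 1)) xi)) {-1..1}"
 proof (rule fundamental_theorem_of_calculus)
  fix z :: real assume z: "z \<in> {-1..1}"
  have "((\<lambda>z. z * (exp (k * z) * conv g (G z) xi)) has_real_derivative d * (exp (k * z) * srcf mu d g G z xi)) (at z within {-1..1})"
   unfolding e[OF z] by (rule derivative_eq_intros refl D[OF z])+ simp
  then show "((\<lambda>z. z * (exp (k * z) * conv g (G z) xi)) has_vector_derivative d * (exp (k * z) * srcf mu d g G z xi)) (at z within {-1..1})"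
   by (simp add: has_real_derivative_iff_has_vector_derivative)
 qed simp
 from integral_unique[OF this] show ?thesis by (simp add: JJ_def k_def)
qed

lemma bnd_ch:
 assumes g: "bndm mu s A g" and mu: "0 \<le> mu" and d: "0 \<le> d" "d \<le> 1"
 shows "bnd s A (\<lambda>x. ch (mu * d * x) * g x)" proof (rule bnd_dom[OF g[unfolded bndm_def]])
 show "continuous_on UNIV (\<lambda>x. ch (mu * d * x) * g x)"
  by (intro continuous_intros bndm_cont[OF mu g] continuous_on_compose2[OF ch_cont]) auto
 fix x :: real
 have "abs (mu * d * x) = d * (mu * abs x)" using mu d by (simp add: abs_mult)
 also have "... \<le> 1 * (mu * abs x)" using mu d by (intro mult_right_mono) auto
 finally have "ch (mu * d * x) \<le> 1 + mu * abs x" using ch_upper_abs[of "mu * d * x"] by linarith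
 moreover have "0 \<le> ch (mu * d * x)" using ch_ge_1[of "mu * d * x"] by linarith
 ultimately show "abs (ch (mu * d * x) * g x) \<le> \<bar>(1 + mu * \<bar>x\<bar>) * g x\<bar>"
  using mu by (simp add: abs_mult mult_right_mono)
qed

text \<open>The effect of the displaced surface on the leading field, to first order in the elevation.
Multiplied by \<open>- sg a / d\<close>, the coefficient of that field, the term with the square of the wave
number has the same size and opposite sign in the two layers and drops out of the
continuity condition.\<close>

lemma NN_el:
 assumes g: "bndm mu s A g" and mu: "0 \<le> mu" and d: "0 < d" "d \<le> 1" and s: "3 \<le> s"
 defines "G \<equiv> \<lambda>t xi. el (mu * d * xi) t * g xi"
 shows "NN mu d g G xi = ch (mu * d * xi) / d * conv g (\<lambda>x. ch (mu * d * x) * g x) xi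
  - d * conv g (\<lambda>x. (mu * x)\<^sup>2 * g x) xi" proof -
 define k where "k = mu * d * xi"
 obtain s' where s': "s = Suc s'" "2 \<le> s'" using s by (cases s) auto
 have s2: "2 \<le> s" using s by simp
 note gb = bndm_bnd[OF mu g]
 have G: "bnd2 s (2 * A) G" unfolding G_def using bnd2_el[OF g mu _ d(2)] d by simp
 have G1: "bnd s (2 * A) (G 1)" "bnd s (2 * A) (G (- 1))" by (rule bnd2_slice[OF G], simp)+
 define P where "P = (\<lambda>x. ch (mu * d * x) * g x)"
 define Q where "Q = (slope mu g)"
 have Qb: "bnd s A Q" unfolding Q_def by (rule gb(2))
 have Pb: "bnd s A P" unfolding P_def using bnd_ch[OF g mu _ d(2)] d by simp
 have ed: "ee r = (ch r + r) / 2" "ee (- r) = (ch r - r) / 2" for r using ee_diff[of r] by (auto simp: ch_def)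
 have ed2: "2 * ee (- r) * y = ch r * y - r * y" "2 * ee r * y = ch r * y + r * y" for r y
  unfolding ed(1)[of r] ed(2)[of r] by (simp_all add: left_diff_distrib distrib_right)
 have G1eq: "G 1 x = P x + (- d) * Q x" "G (- 1) x = P x + d * Q x" for x
  unfolding G_def P_def Q_def el_ends ed2(1)[of "mu * d * x"] ed2(2)[of "mu * d * x"] by simp_all
 have cG: "conv f (G 1) xi = conv f P xi - d * conv f Q xi" "conv f (G (- 1)) xi = conv f P xi + d * conv f Q xi"
  if "bnd s C f" for f C unfolding G1eq[abs_def]
  using conv_add_right[OF that Pb bnd_cmult[OF Qb, of "- d"] s2, of xi] conv_add_right[OF that Pb bnd_cmult[OF Qb, of d] s2, of xi]
  unfolding conv_cmult_right by simp_all
 have xQ: "bnd s' A (\<lambda>x. x * Q x)" using Qb unfolding s' by (rule bnd_xi)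
 have kQ: "mu * (xi * conv g Q xi) = conv Q Q xi + conv g (\<lambda>x. (mu * x)\<^sup>2 * g x) xi" proof -
  have "bnd s' A g" "bnd s' A Q" "bnd s' A (\<lambda>x. x * g x)"
   using bnd_weaken[OF gb(1), of s' A] bnd_weaken[OF Qb, of s' A] gb(1) bnd_xi[of s' A g] by (auto simp: s')
  then have "mu * (xi * conv g Q xi) = mu * (conv (\<lambda>x. x * g x) Q xi + conv g (\<lambda>x. x * Q x) xi)"
   using conv_xi[OF _ _ _ xQ s'(2)] by simp
  also have "... = conv (\<lambda>x. mu * (x * g x)) Q xi + conv g (\<lambda>x. mu * (x * Q x)) xi"
   by (simp add: conv_cmult_left conv_cmult_right distrib_left)
  also have "(\<lambda>x. mu * (x * g x)) = Q" by (simp add: Q_def mult_ac)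
  also have "(\<lambda>x. mu * (x * Q x)) = (\<lambda>x. (mu * x)\<^sup>2 * g x)" by (simp add: Q_def power2_eq_square mult_ac)
  finally show ?thesis .
 qed
 have J: "d * JJ k (\<lambda>z. srcf mu d g G z xi) 1 = exp k * conv g (G 1) xi + exp (- k) * conv g (G (- 1)) xi"
  using JJ_srcf_el[OF g mu d s, of xi] unfolding G_def k_def .
 have "NN mu d g G xi = ee k * exp (- k) * JJ k (\<lambda>z. srcf mu d g G z xi) 1 + d * conv Q Q xi"
  unfolding NN_def SS_ends(1) Q_def[symmetric] cG[OF Qb] k_def by simp
 also have "JJ k (\<lambda>z. srcf mu d g G z xi) 1 = (exp k * conv g (G 1) xi + exp (- k) * conv g (G (- 1)) xi) / d"
  unfolding J[symmetric] using d by simp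
 also have "ee k * exp (- k) * ... = (ee k * (exp (- k) * exp k) * conv g (G 1) xi + ee k * (exp (- k) * exp (- k)) * conv g (G (- 1)) xi) / d"
  by (simp add: algebra_simps add_divide_distrib)
 also have "exp (- k) * exp k = 1" by (simp add: exp_add[symmetric])
 also have "ee k * (exp (- k) * exp (- k)) = ee (- k)" using ee_exp[of k] by (simp add: exp_add[symmetric])
 also have "(ee k * 1 * conv g (G 1) xi + ee (- k) * conv g (G (- 1)) xi) / d = ch k / d * conv g P xi - k * conv g Q xi"
  unfolding cG[OF gb(1)] ed(1)[of k] ed(2)[of k] using d by (simp add: field_simps)
 also have "k * conv g Q xi = d * (mu * (xi * conv g Q xi))" by (simp add: k_def mult_ac)
 finally show ?thesis unfolding kQ by (simp add: P_def k_def algebra_simps)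
qed

lemma layF_even_part:
 assumes d: "d \<noteq> 0"
  and p: "\<And>t. t \<in> {-1..1} \<Longrightarrow> p t xi = layP mu e a d sg w g p t xi"
 shows "(layF mu e a d sg g p 1 xi + layF mu e a d sg g p (- 1) xi) / 2
  = - sg * (ch (mu * d * xi) / d * ((a + e) * g xi + e * (w / 2) * conv g g xi) + e * NN mu d g (layF mu e a d sg g p) xi)"
proof -
 have e: "ch k = (el k 1 + el k (- 1)) / 2" for k by (simp add: el_ends ch_def)
 define F where "F = layF mu e a d sg g p"
 have F: "F t xi = (- sg * (a / d)) * (el (mu * d * xi) t * g xi) + e * ((- sg / d) * (el (mu * d * xi) t * (g xi + w / 2 * conv g g xi))
   + sg * (SS (mu * d) (srcf mu d g F) t xi + t * conv (slope mu g) (F t) xi))" if "t \<in> {-1..1}" for t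
  unfolding F_def layF_def[of mu e a d sg g p t xi] p[OF that] layP_def ..
 have id: "((- sg * (a / d)) * (x * y) + e * ((- sg / d) * (x * (y + w / 2 * z)) + sg * (S + 1 * c)) +
   ((- sg * (a / d)) * (x' * y) + e * ((- sg / d) * (x' * (y + w / 2 * z)) + sg * (S + - 1 * c')))) / 2
   = - sg * ((x + x') / 2 / d * ((a + e) * y + e * (w / 2) * z) + e * (- S - (c - c') / 2))" for x x' y z S c c'
  using d by (simp add: field_simps)
 show ?thesis unfolding F_def[symmetric] F[of 1, simplified] F[of "- 1", simplified] NN_def e SS_ends(2) using id by simp
qed

context two_layers
begin

lemma RR_conv:
 assumes mu: "0 \<le> mu" and g: "bndm mu s A g"
 shows "RR mu g g xi = (w0 * (Cs mu h xi - 1 / h) + w1 * (Cs mu (1 - h) xi - 1 / (1 - h))) / 2 * conv g g xi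
  - aa * ((Cs mu h xi * conv g (\<lambda>x. Cs mu h x * g x) xi - 1 / h\<^sup>2 * conv g g xi)
   - (Cs mu (1 - h) xi * conv g (\<lambda>x. Cs mu (1 - h) x * g x) xi - 1 / (1 - h)\<^sup>2 * conv g g xi))" proof -
 note gb = bndm_bnd(1)[OF mu g]
 have Cb: "bnd s (abs (1 / d) * A) (\<lambda>x. Cs mu d x * g x)" if "0 \<le> d" "d \<le> 1" for d
  using bnd_cmult[OF bnd_ch[OF g mu that], of "1 / d"] by (simp add: Cs_def)
 have i: "integrable lborel (\<lambda>t. g (xi - t) * g t)" "integrable lborel (\<lambda>t. g (xi - t) * (Cs mu h t * g t))"
  "integrable lborel (\<lambda>t. g (xi - t) * (Cs mu (1 - h) t * g t))"
  using conv_integrable[OF gb gb s2] conv_integrable[OF gb Cb[of h] s2] conv_integrable[OF gb Cb[of "1 - h"] s2] h by auto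
 define a where "a = (w0 * (Cs mu h xi - 1 / h) + w1 * (Cs mu (1 - h) xi - 1 / (1 - h))) / 2 + aa / h\<^sup>2 - aa / (1 - h)\<^sup>2"
 have "rs mu xi t * (g (xi - t) * g t) = a * (g (xi - t) * g t) - aa * Cs mu h xi * (g (xi - t) * (Cs mu h t * g t))
   + aa * Cs mu (1 - h) xi * (g (xi - t) * (Cs mu (1 - h) t * g t))" for t unfolding rs_def a_def by (simp add: algebra_simps)
 then have "RR mu g g xi = (LBINT t. a * (g (xi - t) * g t) - aa * Cs mu h xi * (g (xi - t) * (Cs mu h t * g t))
   + aa * Cs mu (1 - h) xi * (g (xi - t) * (Cs mu (1 - h) t * g t)))" unfolding RR_def by simp
 also have "... = a * conv g g xi - aa * Cs mu h xi * conv g (\<lambda>x. Cs mu h x * g x) xi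
   + aa * Cs mu (1 - h) xi * conv g (\<lambda>x. Cs mu (1 - h) x * g x) xi" unfolding conv_def using i by simp
 finally show ?thesis by (simp add: a_def algebra_simps)
qed

text \<open>The even part of a field in \<open>t\<close> yields the real part of the velocity. As \<open>w0 - w1 = 1\<close>, the
horizontal velocity is continuous exactly when the real parts of the two fields differ by \<open>- \<eta>\<close> at
the interface, and in Fourier variables this is the profile equation multiplied by \<open>ep mu\<close> and
divided by the symbol \<open>PP\<close>.\<close>

lemma interface_jump:
 assumes mu: "0 < mu" "mu \<le> 1" and prof: "profile mu C g p q"
 defines "F \<equiv> layF mu (ep mu) aa h 1 g p" and "G \<equiv> layF mu (ep mu) aa (1 - h) (- 1) g q"
 shows "(F 1 xi + F (- 1) xi) / 2 - (G 1 xi + G (- 1) xi) / 2 = - g xi" proof -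
 have g: "bndm mu s C g" and pq: "bnd2 s C p" "bnd2 s C q"
  and profile: "g xi + PP mu xi * (bb * conv g g xi + RR mu g g xi + ep mu * (NN mu h g p xi + NN mu (1 - h) g q xi)) = 0"
  and p: "\<And>t. t \<in> {-1..1} \<Longrightarrow> p t xi = layP mu (ep mu) aa h 1 w0 g p t xi"
  and q: "\<And>t. t \<in> {-1..1} \<Longrightarrow> q t xi = layP mu (ep mu) aa (1 - h) (- 1) w1 g q t xi"
  using prof by (auto simp: profile_def)
 have mu0: "0 \<le> mu" and h': "0 < 1 - h" "1 - h \<le> 1" "h \<le> 1" using mu h by auto
 define e where "e = ep mu"
 have e0: "e > 0" using ep_bounds[OF mu] by (simp add: e_def)
 define k where "k d = conv g (\<lambda>x. Cs mu d x * g x) xi" for d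
 define q2 where "q2 = conv g (\<lambda>x. (mu * x)\<^sup>2 * g x) xi"
 have el: "NN mu d g (\<lambda>t xi. el (mu * d * xi) t * g xi) xi = d * (Cs mu d xi * k d) - d * q2" if "0 < d" "d \<le> 1" for d
 proof -
  have "k d = 1 / d * conv g (\<lambda>x. ch (mu * d * x) * g x) xi"
   unfolding k_def conv_cmult_right[symmetric] by (simp add: Cs_def)
  then show ?thesis unfolding NN_el[OF g mu0 that s] q2_def[symmetric] using that by (simp add: Cs_def)
 qed
 have NNl: "NN mu d g (layF mu e aa d sg g p) xi = - sg * aa * (Cs mu d xi * k d - q2) + e * NN mu d g p xi"
  if d: "0 < d" "d \<le> 1" and p: "bnd2 s C p" for d sg p proof -
  let ?G = "\<lambda>t xi. el (mu * d * xi) t * g xi" and ?c = "- sg * (aa / d)"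
  have G: "bnd2 s (2 * C) ?G" using bnd2_el[OF g mu0 _ d(2)] d by simp
  have z: "bnd2 s 0 (\<lambda>_ _. 0)" by (simp add: bnd2_def)
  have "NN mu d g (layF mu e aa d sg g p) xi = NN mu d g (\<lambda>t xi. ?c * ?G t xi) xi + e * NN mu d g p xi"
   unfolding layF_def[abs_def] by (rule NN_add_right[OF g bnd2_cmult[OF G] p mu0 s2 d(1)])
  also have "NN mu d g (\<lambda>t xi. ?c * ?G t xi) xi = ?c * NN mu d g ?G xi"
   using NN_add_right[OF g z G mu0 s2 d(1), of ?c xi] NN_add_right[OF g z z mu0 s2 d(1), of 1 xi] by simp
  also have "... = - sg * aa * (Cs mu d xi * k d - q2)" unfolding el[OF d] using d by (simp add: field_simps)
  finally show ?thesis .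
 qed
 define c0 where "c0 = Cs mu h xi"
 define c1 where "c1 = Cs mu (1 - h) xi"
 define n where "n = NN mu h g p xi + NN mu (1 - h) g q xi"
 define gg where "gg = conv g g xi"
 \<comment> \<open>because \<open>w0 - w1 = 1\<close>, this is the symbol of the quadratic part at \<open>mu = 0\<close>\<close>
 have bbe: "bb = (w0 / h + w1 / (1 - h)) / 2 - aa * (1 / h\<^sup>2 - 1 / (1 - h)\<^sup>2)" proof -
  have nz: "h \<noteq> 0" "1 - h \<noteq> 0" using h by auto
  have "w0 = 1 + w1" using w by simp
  then show ?thesis unfolding bb_def theta_def aa_def using nz
   by (simp add: divide_simps power2_eq_square) (simp add: algebra_simps)
 qed
 have sumN: "NN mu h g F xi + NN mu (1 - h) g G xi = - aa * (c0 * k h - c1 * k (1 - h)) + e * n"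
  unfolding F_def G_def e_def[symmetric] NNl[OF h(1) h'(3) pq(1)] NNl[OF h'(1,2) pq(2)] c0_def c1_def n_def
  by (simp add: algebra_simps)
 have RRe: "bb * gg + RR mu g g xi + e * n = (w0 * c0 + w1 * c1) / 2 * gg + (NN mu h g F xi + NN mu (1 - h) g G xi)" proof -
  have "((w0 * x + w1 * y) / 2 - aa * (x2 - y2)) * gg + ((w0 * (c0 - x) + w1 * (c1 - y)) / 2 * gg
    - aa * ((c0 * k h - x2 * gg) - (c1 * k (1 - h) - y2 * gg))) + e * n
   = (w0 * c0 + w1 * c1) / 2 * gg + (- aa * (c0 * k h - c1 * k (1 - h)) + e * n)" for x y x2 y2 by (simp add: field_simps)
  from this[of "1 / h" "1 / (1 - h)" "1 / h\<^sup>2" "1 / (1 - h)\<^sup>2"] show ?thesis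
   unfolding sumN RR_conv[OF mu0 g] bbe c0_def[symmetric] c1_def[symmetric] k_def[symmetric] gg_def[symmetric] by simp
 qed
 have ct: "c0 + c1 = tau mu xi + 1 / aa" using aa(3) by (simp add: tau_def c0_def c1_def)
 \<comment> \<open>the speed \<open>aa + e\<close> is critical at \<open>e = 0\<close>: the coefficient of \<open>g\<close> vanishes there for \<open>xi = 0\<close>\<close>
 have P: "e * (g xi / PP mu xi) = (aa + e) * (c0 + c1) * g xi - g xi"
  unfolding ct PP_def e_def ep_def using mu aa by (simp add: field_simps power2_eq_square)
 have "g xi / PP mu xi + ((w0 * c0 + w1 * c1) / 2 * gg + (NN mu h g F xi + NN mu (1 - h) g G xi)) = 0"
  using profile PP_pos[OF mu, of xi] unfolding RRe[symmetric] e_def[symmetric] n_def[symmetric] gg_def[symmetric]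
  by (simp add: field_simps)
 then have "e * (g xi / PP mu xi + ((w0 * c0 + w1 * c1) / 2 * gg + (NN mu h g F xi + NN mu (1 - h) g G xi))) = 0" by simp
 then have *: "(aa + e) * (c0 + c1) * g xi - g xi + e * ((w0 * c0 + w1 * c1) / 2 * gg) + e * (NN mu h g F xi + NN mu (1 - h) g G xi) = 0"
  unfolding distrib_left P by simp
 have ev: "(F 1 xi + F (- 1) xi) / 2 = - 1 * (c0 * ((aa + e) * g xi + e * (w0 / 2) * gg) + e * NN mu h g F xi)"
  "(G 1 xi + G (- 1) xi) / 2 = - (- 1) * (c1 * ((aa + e) * g xi + e * (w1 / 2) * gg) + e * NN mu (1 - h) g G xi)"
  unfolding F_def G_def c0_def c1_def gg_def e_def Cs_def
  by (rule layF_even_part[OF _ p], use h in simp, assumption, rule layF_even_part[OF _ q], use h in simp, assumption)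
 show ?thesis unfolding ev using * by (simp add: algebra_simps add_divide_distrib)
qed

end

section \<open>From a flattened layer to the physical layer\<close>

text \<open>The chain rule: the hypothesis \<open>CR\<close> makes the real derivative of the composed function at \<open>z\<close>
multiplication by one complex number.\<close>

lemma flattened_holomorphic:
 fixes f fX ft :: "real \<Rightarrow> real \<Rightarrow> complex" and D D' :: "real \<Rightarrow> real"
 assumes fX: "\<And>X t. t \<in> {-1<..<1} \<Longrightarrow> ((\<lambda>X. f X t) has_vector_derivative fX X t) (at X)"
  and ft: "\<And>X t. t \<in> {-1<..<1} \<Longrightarrow> ((\<lambda>t. f X t) has_vector_derivative ft X t) (at t within {-1<..<1})"
  and cont: "continuous_on (UNIV \<times> {-1<..<1}) (\<lambda>p. ft (fst p) (snd p))"
  and D: "\<And>X. (D has_real_derivative D' X) (at X)" "\<And>X. 0 < D X"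
  and CR: "\<And>X t. t \<in> {-1<..<1} \<Longrightarrow> ft X t * (1 + \<i> * (t * D' X)) = fX X t * (\<i> * D X)"
  and z: "abs (Im z) < D (Re z)"
 shows "((\<lambda>z. f (Re z) (Im z / D (Re z))) has_field_derivative
   fX (Re z) (Im z / D (Re z)) / (1 + \<i> * (Im z / D (Re z) * D' (Re z)))) (at z)" proof -
 define X where "X = Re z"
 define t where "t = Im z / D X"
 have t: "t \<in> {-1<..<1}" using z D(2)[of X] by (auto simp: t_def X_def abs_less_iff field_simps)
 have op: "open (UNIV \<times> {-1<..<1::real} :: (real \<times> real) set)" by (intro open_Times) auto
 have "((\<lambda>(X, t). f X t) has_derivative (\<lambda>(dx, dt). dx *\<^sub>R fX X t + blinfun_scaleR_left (ft X t) dt)) (at (X, t) within UNIV \<times> {-1<..<1})"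
 proof (rule has_derivative_partialsI)
  show "((\<lambda>X. f X t) has_derivative (\<lambda>dx. dx *\<^sub>R fX X t)) (at X within UNIV)"
   using fX[OF t, of X] by (simp add: has_vector_derivative_def)
  show "((\<lambda>t. f X t) has_derivative blinfun_apply (blinfun_scaleR_left (ft X t))) (at t within {-1<..<1})"
   if "t \<in> {-1<..<1}" for X t using ft[OF that, of X] by (simp add: has_vector_derivative_def)
  have "continuous_on (UNIV \<times> {-1<..<1}) (\<lambda>p. blinfun_scaleR_left (ft (fst p) (snd p)))"
   by (intro continuous_intros cont)
  then show "continuous (at (X, t) within UNIV \<times> {-1<..<1}) (\<lambda>(X, t). blinfun_scaleR_left (ft X t))"
   using t unfolding continuous_on_eq_continuous_within case_prod_unfold by auto
 qed (use t in auto)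
 then have d1: "((\<lambda>p. f (fst p) (snd p)) has_derivative (\<lambda>q. fst q *\<^sub>R fX X t + snd q *\<^sub>R ft X t)) (at (X, t))"
  using at_within_open[OF _ op, of "(X, t)"] t by (simp add: case_prod_unfold)
 have dD: "((\<lambda>z. D (Re z)) has_derivative (\<lambda>h. D' X * Re h)) (at z)"
  using DERIV_compose_FDERIV[where f = D and g = Re, OF D(1) bounded_linear_imp_has_derivative[OF bounded_linear_Re]]
  by (simp add: X_def mult.commute)
 have nz: "D (Re z) \<noteq> 0" "D X \<noteq> 0" using D(2)[of X] by (auto simp: X_def)
 have d2: "((\<lambda>z. (Re z, Im z / D (Re z))) has_derivative (\<lambda>h. (Re h, (Im h - t * (D' X * Re h)) / D X))) (at z)"
 proof (rule has_derivative_Pair)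
  show "(Re has_derivative Re) (at z)" by (rule bounded_linear_imp_has_derivative[OF bounded_linear_Re])
  have "((\<lambda>z. Im z / D (Re z)) has_derivative (\<lambda>h. (Im h * D (Re z) - Im z * (D' X * Re h)) / (D (Re z) * D (Re z)))) (at z)"
   by (rule has_derivative_divide'[OF bounded_linear_imp_has_derivative[OF bounded_linear_Im] dD nz(1)])
  also have "(\<lambda>h. (Im h * D (Re z) - Im z * (D' X * Re h)) / (D (Re z) * D (Re z))) = (\<lambda>h. (Im h - t * (D' X * Re h)) / D X)"
   using nz by (auto simp: fun_eq_iff t_def X_def field_simps)
  finally show "((\<lambda>z. Im z / D (Re z)) has_derivative (\<lambda>h. (Im h - t * (D' X * Re h)) / D X)) (at z)" .
 qed
 have d1': "((\<lambda>p. f (fst p) (snd p)) has_derivative (\<lambda>q. fst q *\<^sub>R fX X t + snd q *\<^sub>R ft X t)) (at (Re z, Im z / D (Re z)))"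
  using d1 by (simp add: X_def t_def)
 have d3: "((\<lambda>z. f (Re z) (Im z / D (Re z))) has_derivative
   (\<lambda>h. Re h *\<^sub>R fX X t + ((Im h - t * (D' X * Re h)) / D X) *\<^sub>R ft X t)) (at z)"
  using has_derivative_compose[OF d2 d1'] by simp
 define W where "W = 1 + \<i> * (t * D' X)"
 have W: "W \<noteq> 0" by (simp add: W_def complex_eq_iff)
 define G where "G = fX X t / W"
 have e: "fX X t = G * W" "ft X t = G * (\<i> * D X)" proof -
  have "ft X t * W = fX X t * (\<i> * D X)" using CR[OF t, of X] by (simp add: W_def)
  then show "fX X t = G * W" "ft X t = G * (\<i> * D X)" using W by (simp_all add: G_def field_simps)
 qed
 have "(\<lambda>h. Re h *\<^sub>R fX X t + ((Im h - t * (D' X * Re h)) / D X) *\<^sub>R ft X t) = (\<lambda>h. G * h)" proof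
  fix h :: complex
  have "((Im h - t * (D' X * Re h)) / D X) *\<^sub>R ft X t = G * (\<i> * (Im h - t * (D' X * Re h)))"
   unfolding e scaleR_conv_of_real using nz by (simp add: field_simps)
  then have "Re h *\<^sub>R fX X t + ((Im h - t * (D' X * Re h)) / D X) *\<^sub>R ft X t
    = G * (Re h * W + \<i> * (Im h - t * (D' X * Re h)))" unfolding e(1) scaleR_conv_of_real by (simp add: algebra_simps)
  also have "Re h * W + \<i> * (Im h - t * (D' X * Re h)) = h" by (simp add: W_def complex_eq_iff algebra_simps)
  finally show "Re h *\<^sub>R fX X t + ((Im h - t * (D' X * Re h)) / D X) *\<^sub>R ft X t = G * h" .
 qed
 then have "((\<lambda>z. f (Re z) (Im z / D (Re z))) has_field_derivative G) (at z)"
  using d3 unfolding has_field_derivative_def by (simp only:)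
 then show ?thesis unfolding G_def W_def X_def t_def .
qed

lemma FF_scale_deriv:
 assumes "bnd r C b" "3 \<le> r"
 shows "((\<lambda>X. FF b (mu * X)) has_vector_derivative of_real mu * (\<i> * FF (\<lambda>xi. xi * b xi) (mu * X))) (at X)"
proof -
 have "((\<lambda>X. mu * X) has_vector_derivative mu) (at X)"
  by (auto intro!: derivative_eq_intros simp flip: has_real_derivative_iff_has_vector_derivative)
 from vector_diff_chain_at[OF this FF_x_deriv[OF assms, of "mu * X"]]
 show ?thesis by (simp add: o_def scaleR_conv_of_real)
qed

lemma FF_odd_imag:
 assumes "\<And>xi. b (- xi) = - b xi" shows "Re (FF b x) = 0" "FF b (- x) = - FF b x" proof -
 have "FF (\<lambda>xi. b (- xi)) x = - FF b x" using FF_cmult[of "-1" b x] by (simp add: assms)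
 then have "cnj (FF b x) = - FF b x" by (simp add: FF_cnj)
 then show "Re (FF b x) = 0" by (simp add: complex_eq_iff)
 show "FF b (- x) = - FF b x" using FF_cmult[of "-1" b x] by (simp add: FF_uminus assms)
qed

text \<open>One flattened layer of depth \<open>d\<close>, with its wall at zero and its surface at \<open>DD X\<close>. Here \<open>e\<close> is
the amplitude, \<open>w\<close> the vorticity and \<open>a\<close> the speed at the undisturbed surface. The upper layer is
turned upside down, which is expressed by \<open>sg = -1\<close>.\<close>

locale layer =
 fixes mu e a d sg w A B :: real and s :: nat and g :: "real \<Rightarrow> real" and p :: "real \<Rightarrow> real \<Rightarrow> real"
 assumes mu: "0 < mu" and e: "0 < e" and a: "0 \<le> a" "a \<le> 1" and d: "0 < d" "d \<le> 1" and sg: "abs sg = 1" and s: "5 \<le> s"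
  and g: "bndm mu s A g" "evn g" and p: "bnd2 s B p" "sym2 p"
  and peq: "\<And>t xi. t \<in> {-1..1} \<Longrightarrow> p t xi = layP mu e a d sg w g p t xi"
  and pos: "\<And>X. 0 < d + sg * (e * Re (FF g (mu * X)))"
begin

definition "eta X = e * Re (FF g (mu * X))"
definition "deta X = e * Re (\<i> * FF (slope mu g) (mu * X))"
definition "Fo = layF mu e a d sg g p"
definition "ff X t = of_real e * FF (Fo t) (mu * X)"
definition "ffX X t = of_real e * (of_real mu * (\<i> * FF (\<lambda>xi. xi * Fo t xi) (mu * X)))"
definition "DD X = d + sg * eta X"
definition "ZX X t = 1 + \<i> * (t * (sg * deta X))"
definition "ffT X t = ffX X t * (\<i> * DD X) / ZX X t"

lemma s23: "2 \<le> s" "3 \<le> s" and mu0: "0 \<le> mu" and e0: "0 \<le> e" using s mu e by auto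

lemmas gb = bndm_bnd[OF mu0 g(1)]

lemma Kg_odd: "(slope mu g) (- x) = - (slope mu g) x" using evnD[OF g(2)] by simp

lemma eta_c: "of_real (eta X) = of_real e * FF g (mu * X)"
 unfolding eta_def of_real_mult FF_even_real(2)[of g, OF evnD[OF g(2)], symmetric] ..

lemma deta_c: "of_real (deta X) = of_real e * (\<i> * FF (slope mu g) (mu * X))" proof -
 note FF_odd_imag(1)[of "slope mu g", OF Kg_odd, of "mu * X"]
 then show ?thesis by (simp add: deta_def complex_eq_iff)
qed

lemma eta_deriv: "(eta has_real_derivative deta X) (at X)" proof -
 have "((\<lambda>X. e * Re (FF g (mu * X))) has_vector_derivative e * Re (of_real mu * (\<i> * FF (\<lambda>xi. xi * g xi) (mu * X)))) (at X)"
  by (intro has_vector_derivative_mult_right bounded_linear.has_vector_derivative[OF bounded_linear_Re] FF_scale_deriv[OF gb(1) s23(2)])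
 moreover have "of_real mu * FF (\<lambda>xi. xi * g xi) (mu * X) = FF (slope mu g) (mu * X)"
  using FF_cmult[of mu "\<lambda>xi. xi * g xi"] by (simp add: mult.assoc)
 then have "of_real mu * (\<i> * FF (\<lambda>xi. xi * g xi) (mu * X)) = \<i> * FF (slope mu g) (mu * X)"
  by (simp add: mult.left_commute)
 ultimately show ?thesis unfolding eta_def[abs_def] deta_def has_real_derivative_iff_has_vector_derivative by simp
qed

lemma eta_cont: "continuous_on S eta" by (rule continuous_on_subset[OF DERIV_continuous_on[OF eta_deriv]]) auto

lemma deta_cont: "continuous_on S deta"
 unfolding deta_def by (intro continuous_intros continuous_on_compose2[OF FF_continuous[OF gb(2) s23(1)]]) auto

lemma DD_pos: "0 < DD X" using pos by (simp add: DD_def eta_def)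

lemma DD_deriv: "(DD has_real_derivative sg * deta X) (at X)"
 unfolding DD_def[abs_def] by (auto intro!: derivative_eq_intros eta_deriv)

lemma DD_cont: "continuous_on S DD" unfolding DD_def by (intro continuous_intros eta_cont)

lemma ZX_nz: "ZX X t \<noteq> 0" by (simp add: ZX_def complex_eq_iff)

lemma ZX_ge: "1 \<le> norm (ZX X t)" proof -
 have "abs (Re (ZX X t)) \<le> norm (ZX X t)" by (rule abs_Re_le_cmod)
 then show ?thesis by (simp add: ZX_def)
qed

definition "BF = 2 / d * A + e * B"
lemma Fo_bnd: "bnd2 s BF Fo" unfolding Fo_def BF_def by (rule layF_bnd[OF g(1) p(1) mu0 d a sg e0])
lemma Fo_sym: "sym2 Fo" unfolding Fo_def by (rule sym2_layF[OF g(2) p(2)])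

lemma ff_cnj: "t \<in> {-1..1} \<Longrightarrow> ff X (- t) = cnj (ff X t)" "t \<in> {-1..1} \<Longrightarrow> ff (- X) t = cnj (ff X t)"
proof -
 assume t: "t \<in> {-1..1}"
 have "(\<lambda>xi. Fo t (- xi)) = Fo (- t)" using sym2D[OF Fo_sym, of "- t"] t by auto
 then show "ff X (- t) = cnj (ff X t)" by (simp add: ff_def FF_cnj)
 show "ff (- X) t = cnj (ff X t)" by (simp add: ff_def FF_cnj FF_uminus)
qed

definition "Ho t xi = Fo t xi - e * sg * (t * conv (slope mu g) (Fo t) xi)"
definition "mo xi = (a + e) * g xi + e * (w / 2) * conv g g xi"
definition "Qo t xi = d * Fo t xi + e * sg * conv g (Fo t) xi"

lemma Ho_eq:
 assumes t: "t \<in> {-1..1}"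
 shows "Ho t xi = (- sg / d) * (el (mu * d * xi) t * mo xi) + e * sg * SS (mu * d) (srcf mu d g Fo) t xi" proof -
 have "Fo t xi = (- sg * (a / d)) * (el (mu * d * xi) t * g xi) + e * ((- sg / d) * (el (mu * d * xi) t * (g xi + w / 2 * conv g g xi))
   + sg * (SS (mu * d) (srcf mu d g Fo) t xi + t * conv (slope mu g) (Fo t) xi))"
  unfolding Fo_def layF_def[of mu e a d sg g p t xi] peq[OF t] layP_def ..
 then have "Ho t xi = (- sg * (a / d)) * (el (mu * d * xi) t * g xi) + e * ((- sg / d) * (el (mu * d * xi) t * (g xi + w / 2 * conv g g xi))
   + sg * (SS (mu * d) (srcf mu d g Fo) t xi + t * conv (slope mu g) (Fo t) xi)) - e * sg * (t * conv (slope mu g) (Fo t) xi)"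
  unfolding Ho_def by simp
 moreover have "(- sg * (a / d)) * (x * y) + e * ((- sg / d) * (x * (y + w / 2 * z)) + sg * (S + c)) - e * sg * c
  = (- sg / d) * (x * ((a + e) * y + e * (w / 2) * z)) + e * sg * S" for x y z S c using d by (simp add: field_simps)
 ultimately show ?thesis unfolding mo_def by simp
qed

lemma Ho_deriv:
 assumes t: "t \<in> {-1..1}"
 shows "((\<lambda>t. Ho t xi) has_real_derivative - mu * (xi * Qo t xi)) (at t within {-1..1})" proof -
 let ?H = "\<lambda>t. (- sg / d) * (el (mu * d * xi) t * mo xi) + e * sg * SS (mu * d) (srcf mu d g Fo) t xi"
 let ?S = "srcf mu d g Fo t xi"
 note sc = layer_facts(4)[OF g(1) Fo_bnd mu0 s23(1) d(1), of xi]
 have "(?H has_real_derivative (- sg / d) * (- (mu * d * xi) * el (mu * d * xi) t * mo xi)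
    + e * sg * (- (mu * d * xi) * (SS (mu * d) (srcf mu d g Fo) t xi + ?S))) (at t within {-1..1})"
  by (intro DERIV_add DERIV_cmult DERIV_cmult_right el_deriv SS_deriv[where F = "srcf mu d g Fo", OF sc t])
 also have "(- sg / d) * (- (mu * d * xi) * el (mu * d * xi) t * mo xi)
    + e * sg * (- (mu * d * xi) * (SS (mu * d) (srcf mu d g Fo) t xi + ?S)) = - (mu * d * xi) * (Ho t xi + e * sg * ?S)"
  unfolding Ho_eq[OF t] by (simp add: algebra_simps)
 also have "... = - mu * (xi * Qo t xi)" unfolding Ho_def srcf_def Qo_def using d by (simp add: field_simps)
 finally have "(?H has_real_derivative - mu * (xi * Qo t xi)) (at t within {-1..1})" .
 then show ?thesis by (rule has_field_derivative_transform_within[OF _ zero_less_one t]) (use Ho_eq in auto)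
qed

lemma Qo_bnd: "\<exists>C. bnd2 s C Qo"
 unfolding Qo_def[abs_def] using bnd2_add[OF bnd2_cmult[OF Fo_bnd] bnd2_cmult[OF bnd2_conv_slope(2)[OF g(1) Fo_bnd mu0 s23(1)]]] by blast

lemma Ho_bnd: "\<exists>C. bnd2 s C Ho"
 unfolding Ho_def[abs_def] using bnd2_diff[OF Fo_bnd bnd2_cmult[OF bnd2_tmult[OF bnd2_conv_slope(1)[OF g(1) Fo_bnd mu0 s23(1)]]]] by blast

lemma ff_ZX:
 assumes t: "t \<in> {-1..1}" shows "ff X t * ZX X t = of_real e * FF (Ho t) (mu * X)" proof -
 note Fb = bnd2_slice[OF Fo_bnd t]
 have i: "integrable lborel (Fo t)" "integrable lborel (\<lambda>xi. e * sg * t * conv (slope mu g) (Fo t) xi)"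
  using bnd_integrable(1)[OF Fb s23(1)] bnd_integrable(1)[OF bnd_conv[OF gb(2) Fb s23(1)] s23(1)] by auto
 have "FF (Ho t) (mu * X) = FF (Fo t) (mu * X) - of_real (e * sg * t) * (FF (slope mu g) (mu * X) * FF (Fo t) (mu * X))"
  using FF_diff[OF i, of "mu * X"] unfolding FF_cmult FF_conv[OF gb(2) Fb s23(1)] Ho_def[abs_def] by (simp add: mult_ac)
 moreover have "\<i> * (t * (sg * deta X)) = - (of_real (e * sg * t) * FF (slope mu g) (mu * X))" proof -
  have "\<i> * (T * (S * (E * (\<i> * Q)))) = - (E * S * T * Q)" for T S E Q proof -
   have "\<i> * (T * (S * (E * (\<i> * Q)))) = (\<i> * \<i>) * (E * S * T * Q)" by (simp only: mult_ac)
   then show ?thesis by simp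
  qed
  then show ?thesis unfolding deta_c of_real_mult by blast
 qed
 then have "ZX X t = 1 - of_real (e * sg * t) * FF (slope mu g) (mu * X)" by (simp add: ZX_def)
 ultimately show ?thesis unfolding ff_def by (simp only: right_diff_distrib mult_1_right mult_1_left mult_ac)
qed

lemma ff_DD:
 assumes t: "t \<in> {-1..1}" shows "ff X t * DD X = of_real e * FF (Qo t) (mu * X)" proof -
 note Fb = bnd2_slice[OF Fo_bnd t]
 have i: "integrable lborel (\<lambda>xi. d * Fo t xi)" "integrable lborel (\<lambda>xi. e * sg * conv g (Fo t) xi)"
  using bnd_integrable(1)[OF Fb s23(1)] bnd_integrable(1)[OF bnd_conv[OF gb(1) Fb s23(1)] s23(1)] by auto
 show ?thesis
  using FF_add[OF i, of "mu * X"] unfolding FF_cmult FF_conv[OF gb(1) Fb s23(1)] Qo_def[abs_def] DD_def ff_def of_real_add of_real_mult eta_c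
  by (simp add: algebra_simps)
qed

lemma ff_X_deriv:
 assumes t: "t \<in> {-1..1}" shows "((\<lambda>X. ff X t) has_vector_derivative ffX X t) (at X)" unfolding ff_def ffX_def
 by (intro has_vector_derivative_mult_right FF_scale_deriv[OF bnd2_slice[OF Fo_bnd t] s23(2)])

text \<open>By \<open>Ho_deriv\<close> the \<open>t\<close>-derivative of \<open>f Z\<^sub>X\<close> is a frequency integral of \<open>Qo\<close>. Differentiating \<open>f D\<close>
along the layer identifies this integral, and the Cauchy--Riemann equation in flattened coordinates
results.\<close>

lemma ff_T_deriv:
 assumes t: "t \<in> {-1..1}" shows "((\<lambda>t. ff X t) has_vector_derivative ffT X t) (at t within {-1..1})" proof -
 obtain C where C: "bnd2 s C Qo" using Qo_bnd by blast
 obtain C' where C': "bnd2 s C' Ho" using Ho_bnd by blast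
 obtain s' where s': "s = Suc s'" "2 \<le> s'" using s by (cases s) auto
 have "bnd2 s' C (\<lambda>t xi. xi * Qo t xi)" using C unfolding s' by (rule bnd2_xi)
 from bnd2_cmult[OF this, of "- mu"] have dH: "bnd2 s' (abs (- mu) * C) (\<lambda>t xi. - mu * (xi * Qo t xi))" .
 let ?q = "FF (\<lambda>xi. xi * Qo t xi) (mu * X)"
 have "((\<lambda>t. of_real e * FF (Ho t) (mu * X)) has_vector_derivative of_real e * FF (\<lambda>xi. - mu * (xi * Qo t xi)) (mu * X)) (at t within {-1..1})"
  by (rule has_vector_derivative_mult_right, rule FF_t_deriv[OF C' dH s23(1) s'(2) Ho_deriv t])
 also have "FF (\<lambda>xi. - mu * (xi * Qo t xi)) (mu * X) = of_real (- mu) * ?q" by (rule FF_cmult)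
 finally have H: "((\<lambda>t. of_real e * FF (Ho t) (mu * X)) has_vector_derivative of_real e * (of_real (- mu) * ?q)) (at t within {-1..1})" .
 have Zi: "((\<lambda>t. inverse (ZX X t)) has_vector_derivative - (inverse (ZX X t) * (\<i> * (sg * deta X)) * inverse (ZX X t))) (at t within {-1..1})"
 proof -
  let ?c = "of_real (sg * deta X)"
  have "((\<lambda>z. inverse (1 + \<i> * (z * ?c))) has_field_derivative
    - (inverse (1 + \<i> * (of_real t * ?c)) * (\<i> * ?c) * inverse (1 + \<i> * (of_real t * ?c)))) (at (of_real t))"
   by (rule derivative_eq_intros refl | use ZX_nz[of X t] in \<open>simp add: ZX_def\<close>)+
  from has_vector_derivative_real_field[OF this, of "{-1..1}"] show ?thesis by (simp add: ZX_def)
 qed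
 have "((\<lambda>t. of_real e * FF (Ho t) (mu * X) * inverse (ZX X t)) has_vector_derivative
   of_real e * FF (Ho t) (mu * X) * (- (inverse (ZX X t) * (\<i> * (sg * deta X)) * inverse (ZX X t))) + of_real e * (of_real (- mu) * ?q) * inverse (ZX X t)) (at t within {-1..1})"
  by (rule has_vector_derivative_mult[OF H Zi])
 then have 1: "((\<lambda>t. ff X t) has_vector_derivative
   of_real e * FF (Ho t) (mu * X) * (- (inverse (ZX X t) * (\<i> * (sg * deta X)) * inverse (ZX X t))) + of_real e * (of_real (- mu) * ?q) * inverse (ZX X t)) (at t within {-1..1})"
  by (rule has_vector_derivative_transform[OF t, rotated])
    (use ff_ZX ZX_nz in \<open>simp add: field_simps\<close>)
 \<comment> \<open>the same quantity, differentiated along the layer\<close>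
 have q: "of_real e * (of_real mu * (\<i> * ?q)) = ffX X t * DD X + ff X t * (sg * deta X)"
 proof (rule vector_derivative_unique_at)
  show "((\<lambda>X. of_real e * FF (Qo t) (mu * X)) has_vector_derivative of_real e * (of_real mu * (\<i> * ?q))) (at X)"
   by (intro has_vector_derivative_mult_right FF_scale_deriv[OF bnd2_slice[OF C t] s23(2)])
  have "((\<lambda>X. of_real (DD X) :: complex) has_vector_derivative of_real (sg * deta X)) (at X)"
   by (intro has_vector_derivative_of_real) (use DD_deriv in \<open>simp add: has_real_derivative_iff_has_vector_derivative\<close>)
  from has_vector_derivative_mult[OF ff_X_deriv[OF t] this]
  show "((\<lambda>X. of_real e * FF (Qo t) (mu * X)) has_vector_derivative ffX X t * DD X + ff X t * (sg * deta X)) (at X)"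
   unfolding ff_DD[OF t] by (simp add: add.commute)
 qed
 have "of_real e * (of_real (- mu) * ?q) = \<i> * (of_real e * (of_real mu * (\<i> * ?q)))" proof -
  have "\<i> * (E * (M * (\<i> * Q))) = E * (- M * Q)" for E M Q proof -
   have "\<i> * (E * (M * (\<i> * Q))) = (\<i> * \<i>) * (E * M * Q)" by (simp only: mult_ac)
   then show ?thesis by simp
  qed
  then show ?thesis unfolding of_real_minus by (rule sym)
 qed
 also have "... = \<i> * (ffX X t * DD X + ff X t * (sg * deta X))" unfolding q ..
 finally have q2: "of_real e * (of_real (- mu) * ?q) = \<i> * (ffX X t * DD X + ff X t * (sg * deta X))" .
 have "of_real e * FF (Ho t) (mu * X) * (- (inverse (ZX X t) * (\<i> * (sg * deta X)) * inverse (ZX X t))) + of_real e * (of_real (- mu) * ?q) * inverse (ZX X t) = ffT X t"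
  unfolding q2 ff_ZX[OF t, symmetric] ffT_def using ZX_nz[of X t] by (simp add: field_simps)
 with 1 show ?thesis by simp
qed

end

context layer
begin

definition "CL = {z. abs (Im z) \<le> DD (Re z)}"
definition "tt z = Im z / DD (Re z)"
definition "GG z = ff (Re z) (tt z)"
definition "GG' z = ffX (Re z) (tt z) / ZX (Re z) (tt z)"

lemma tt_mem: "z \<in> CL \<Longrightarrow> tt z \<in> {-1..1}"
 using DD_pos[of "Re z"] by (auto simp: CL_def tt_def abs_le_iff field_simps)

lemma Fo_xi_bnd: "bnd2 (s - 1) BF (\<lambda>t xi. xi * Fo t xi)" using Fo_bnd s bnd2_xi[of "s - 1" BF Fo] by simp

lemma FF_scaled_cont:
 assumes "bnd2 r C F" "2 \<le> r"
 shows "continuous_on ({-1..1} \<times> UNIV) (\<lambda>p. FF (F (fst p)) (mu * snd p))"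
 using continuous_on_compose2[OF FF_continuous2[OF assms], of "{-1..1} \<times> UNIV" "\<lambda>p. (fst p, mu * snd p)"]
 by (force intro!: continuous_intros)

lemma ff_cont: "continuous_on ({-1..1} \<times> UNIV) (\<lambda>p. ff (snd p) (fst p))"
 unfolding ff_def by (intro continuous_intros FF_scaled_cont[OF Fo_bnd s23(1)])

lemma ffX_cont: "continuous_on ({-1..1} \<times> UNIV) (\<lambda>p. ffX (snd p) (fst p))"
 unfolding ffX_def using s by (intro continuous_intros FF_scaled_cont[OF Fo_xi_bnd]) auto

lemma ZX_cont: "continuous_on S (\<lambda>p. ZX (snd p) (fst p))"
 unfolding ZX_def by (intro continuous_intros continuous_on_compose2[OF deta_cont]) auto

lemma ffT_cont: "continuous_on ({-1..1} \<times> UNIV) (\<lambda>p. ffT (snd p) (fst p))" unfolding ffT_def using ZX_nz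
 by (intro continuous_intros ffX_cont ZX_cont continuous_on_compose2[OF DD_cont]) auto

lemma GG_deriv:
 assumes z: "abs (Im z) < DD (Re z)" shows "(GG has_field_derivative GG' z) (at z)" proof -
 have sub: "{-1<..<1} \<subseteq> {-1..1::real}" by auto
 have "continuous_on (UNIV \<times> {-1<..<1}) (\<lambda>p. (\<lambda>q. ffT (snd q) (fst q)) (snd p, fst p))"
  by (rule continuous_on_compose2[OF ffT_cont]) (auto intro!: continuous_intros)
 then have c: "continuous_on (UNIV \<times> {-1<..<1}) (\<lambda>p. ffT (fst p) (snd p))" by simp
 have "((\<lambda>z. ff (Re z) (Im z / DD (Re z))) has_field_derivative
   ffX (Re z) (Im z / DD (Re z)) / (1 + \<i> * (Im z / DD (Re z) * (sg * deta (Re z))))) (at z)"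
 proof (rule flattened_holomorphic[of ff ffX ffT DD "\<lambda>X. sg * deta X"])
  fix X t :: real assume t: "t \<in> {-1<..<1}"
  then have t': "t \<in> {-1..1}" by auto
  show "((\<lambda>X. ff X t) has_vector_derivative ffX X t) (at X)" by (rule ff_X_deriv[OF t'])
  show "((\<lambda>t. ff X t) has_vector_derivative ffT X t) (at t within {-1<..<1})"
   by (rule has_vector_derivative_within_subset[OF ff_T_deriv[OF t'] sub])
  show "ffT X t * (1 + \<i> * (t * (sg * deta X))) = ffX X t * (\<i> * DD X)"
   using ZX_nz[of X t] unfolding ffT_def ZX_def by (simp del: of_real_mult)
 qed (use c DD_deriv DD_pos z in auto)
 then show ?thesis unfolding GG_def[abs_def] GG'_def ZX_def tt_def by simp
qed

lemma tt_cont: "continuous_on S tt"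
 unfolding tt_def using DD_pos by (intro continuous_intros continuous_on_compose2[OF DD_cont] ballI) (auto simp: less_le)

lemma GG_cont: "continuous_on CL GG" "continuous_on CL GG'" proof -
 have im: "(\<lambda>z. (tt z, Re z)) ` CL \<subseteq> {-1..1} \<times> UNIV" using tt_mem by auto
 have cc: "continuous_on CL (\<lambda>z. (tt z, Re z))" by (intro continuous_intros tt_cont)
 show "continuous_on CL GG" unfolding GG_def using continuous_on_compose2[OF ff_cont cc im] by simp
 have "continuous_on CL (\<lambda>z. ffX (Re z) (tt z))" using continuous_on_compose2[OF ffX_cont cc im] by simp
 moreover have "continuous_on CL (\<lambda>z. ZX (Re z) (tt z))" using continuous_on_compose2[OF ZX_cont cc subset_UNIV] by simp
 ultimately show "continuous_on CL GG'" unfolding GG'_def using ZX_nz by (intro continuous_on_divide) auto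
qed

lemma GG_bound:
 assumes "z \<in> CL" shows "norm (GG z) \<le> e * (BF * wint)" "norm (GG' z) \<le> e * mu * (BF * wint)"
  "norm (ffX (Re z) (tt z)) \<le> e * mu * (BF * wint)" proof -
 note t = tt_mem[OF assms]
 have "norm (FF (Fo (tt z)) (mu * Re z)) \<le> BF * wint" by (rule FF_bound[OF bnd2_slice[OF Fo_bnd t] s23(1)])
 then show "norm (GG z) \<le> e * (BF * wint)" using e0 by (simp add: GG_def ff_def norm_mult mult_left_mono)
 have "norm (FF (\<lambda>xi. xi * Fo (tt z) xi) (mu * Re z)) \<le> BF * wint"
  using s by (intro FF_bound[OF bnd2_slice[OF Fo_xi_bnd t]]) simp
 then have "(e * mu) * norm (FF (\<lambda>xi. xi * Fo (tt z) xi) (mu * Re z)) \<le> (e * mu) * (BF * wint)"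
  using e0 mu0 by (intro mult_left_mono) auto
 then show X: "norm (ffX (Re z) (tt z)) \<le> e * mu * (BF * wint)" using e0 mu0 by (simp add: ffX_def norm_mult mult_ac)
 have "norm (GG' z) = norm (ffX (Re z) (tt z)) / norm (ZX (Re z) (tt z))" by (simp add: GG'_def norm_divide)
 also have "... \<le> norm (ffX (Re z) (tt z)) / 1" using ZX_ge[of "Re z" "tt z"] by (intro divide_left_mono) auto
 finally show "norm (GG' z) \<le> e * mu * (BF * wint)" using X by simp
qed

lemma eta_even: "eta (- X) = eta X" and deta_odd: "deta (- X) = - deta X"
 using FF_even_real(3)[of g "mu * X", OF evnD[OF g(2)]] FF_odd_imag(2)[of "slope mu g" "mu * X", OF Kg_odd]
 by (simp_all add: eta_def deta_def)

lemma DD_even: "DD (- X) = DD X" by (simp add: DD_def eta_even)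

lemma GG_reflect: "z \<in> CL \<Longrightarrow> GG (- cnj z) = cnj (GG z)"
 unfolding GG_def tt_def using ff_cnj(2)[of "Im z / DD (Re z)" "Re z"] tt_mem[of z] by (simp add: DD_even tt_def)

lemma GG_wall: "Im z = 0 \<Longrightarrow> Im (GG z) = 0" using ff_cnj(1)[of 0 "Re z"] by (simp add: GG_def tt_def complex_eq_iff)

lemma GG_top: "GG (Complex X (DD X)) = ff X 1" using DD_pos[of X] by (simp add: GG_def tt_def)

lemma interface_even_part:
 "Re (ff X 1) = e * Re (FF (\<lambda>xi. (Fo 1 xi + Fo (- 1) xi) / 2) (mu * X))" proof -
 have i: "integrable lborel (Fo 1)" "integrable lborel (Fo (- 1))"
  using bnd_integrable(1)[OF bnd2_slice[OF Fo_bnd] s23(1)] by auto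
 have "Re (FF (\<lambda>xi. 1 / 2 * (Fo 1 xi + Fo (- 1) xi)) (mu * X)) = (Re (FF (Fo 1) (mu * X)) + Re (FF (Fo (- 1)) (mu * X))) / 2"
  unfolding FF_cmult FF_add[OF i] by simp
 moreover have "e * Re (FF (Fo (- 1)) (mu * X)) = e * Re (FF (Fo 1) (mu * X))"
  using ff_cnj(1)[of 1 X] by (simp add: ff_def complex_eq_iff)
 then have "Re (FF (Fo (- 1)) (mu * X)) = Re (FF (Fo 1) (mu * X))" using e by simp
 ultimately show ?thesis by (simp add: ff_def)
qed

text \<open>As \<open>f Z\<^sub>X\<close> takes conjugate values at \<open>t = -1\<close> and \<open>t = 1\<close>, its jump determines its imaginary
part at the interface. The operator \<open>SS\<close> contributes nothing to the jump, the exponential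
contributes the prescribed flux.\<close>

lemma kinematic: "- Im (ff X 1) = sg * deta X * (a + e + w * eta X + Re (ff X 1))" proof -
 define Kg where "Kg xi = mu * xi * g xi" for xi
 define x where "x = mu * X"
 note t1 = Ho_eq[of 1] Ho_eq[of "- 1"]
 obtain s' where s': "s = Suc s'" "2 \<le> s'" using s by (cases s) auto
 have Kgb: "bnd s A Kg" unfolding Kg_def by (rule gb(2))
 have Kge: "Kg = (\<lambda>x. mu * (x * g x))" by (auto simp: Kg_def)
 have gs: "bnd s' A g" "bnd s' A (\<lambda>x. x * g x)"
  using bnd_weaken[OF gb(1), of s' A] gb(1) bnd_xi[of s' A g] by (auto simp: s')
 have c: "mu * xi * conv g g xi = 2 * conv Kg g xi" for xi
  using conv_xi[OF gs(1,1,2,2) s'(2), of xi] conv_commute[of g "\<lambda>x. x * g x"] unfolding Kge conv_cmult_left by simp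
 have Hd: "Ho 1 xi - Ho (- 1) xi = 2 * sg * ((a + e) * Kg xi + e * w * conv Kg g xi)" for xi proof -
  have "Ho 1 xi - Ho (- 1) xi = (- sg / d) * ((el (mu * d * xi) 1 - el (mu * d * xi) (- 1)) * mo xi)"
   using t1[of xi] SS_ends(2)[of "mu * d"] by (simp add: algebra_simps)
  also have "el (mu * d * xi) 1 - el (mu * d * xi) (- 1) = - 2 * (mu * d * xi)"
   using ee_diff[of "mu * d * xi"] by (simp add: el_ends)
  also have "(- sg / d) * (- 2 * (mu * d * xi) * mo xi) = 2 * sg * ((a + e) * Kg xi + e * (w / 2) * (mu * xi * conv g g xi))"
   using d by (simp add: mo_def Kg_def field_simps)
  finally show ?thesis unfolding c by simp
 qed
 have "bnd s (abs (a + e) * A) (\<lambda>xi. (a + e) * Kg xi)" "bnd s (abs (e * w) * (ccon s * A * A)) (\<lambda>xi. e * w * conv Kg g xi)"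
  by (intro bnd_cmult Kgb bnd_conv gb(1) s23)+
 note i1 = bnd_integrable(1)[OF this(1) s23(1)] bnd_integrable(1)[OF this(2) s23(1)]
 obtain C where C: "bnd2 s C Ho" using Ho_bnd by blast
 have i2: "integrable lborel (Ho 1)" "integrable lborel (Ho (- 1))" using bnd_integrable(1)[OF bnd2_slice[OF C] s23(1)] by auto
 have "ff X 1 * ZX X 1 - ff X (- 1) * ZX X (- 1) = of_real e * FF (\<lambda>xi. Ho 1 xi - Ho (- 1) xi) x"
  using ff_ZX[of 1 X] ff_ZX[of "- 1" X] FF_diff[OF i2] by (simp add: x_def right_diff_distrib)
 also have "... = of_real (2 * sg) * ((of_real (a + e) + of_real w * (of_real e * FF g x)) * (of_real e * FF Kg x))"
  unfolding Hd FF_cmult FF_add[OF i1] FF_conv[OF Kgb gb(1) s23(1)] of_real_mult of_real_add by (simp add: algebra_simps)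
 also have "of_real e * FF g x = of_real (eta X)" unfolding eta_c x_def ..
 also have "of_real e * FF Kg x = - \<i> * of_real (deta X)" proof -
  have "- \<i> * (E * (\<i> * Q)) = E * Q" for E Q proof -
   have "\<i> * (E * (\<i> * Q)) = (\<i> * \<i>) * (E * Q)" by (simp only: mult_ac)
   then show ?thesis by simp
  qed
  then show ?thesis unfolding deta_c x_def Kg_def by (rule sym)
 qed
 finally have *: "ff X 1 * ZX X 1 - ff X (- 1) * ZX X (- 1)
   = of_real (2 * sg) * ((of_real (a + e) + of_real w * of_real (eta X)) * (- \<i> * of_real (deta X)))" .
 have "sg * sg = 1" using sg by (auto simp: abs_if split: if_splits)
 have "Im (ff X 1 * ZX X 1 - ff X (- 1) * ZX X (- 1)) = 2 * (sg * deta X * Re (ff X 1) + Im (ff X 1))"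
  using ff_cnj(1)[of 1 X] by (simp add: ZX_def algebra_simps)
 moreover have "Im (of_real (2 * sg) * ((of_real (a + e) + of_real w * of_real (eta X)) * (- \<i> * of_real (deta X))))
  = - (2 * sg * (a + e + w * eta X) * deta X)" by (simp add: algebra_simps)
 ultimately show ?thesis unfolding * by (simp add: algebra_simps)
qed

end

text \<open>The even part is a multiple of \<open>cosh (k t)\<close>; it lies between its value \<open>ch k\<close> at the ends and
\<open>ch k - k\<^sup>2\<close>.\<close>

lemma el_even_part:
 assumes t: "t \<in> {-1..1}" shows "abs ((el k t + el k (- t)) / 2 - 1) \<le> k\<^sup>2" proof -
 have main: "abs ((el k t + el k (- t)) / 2 - 1) \<le> k\<^sup>2" if k: "0 \<le> k" for k proof -
  define c where "c = 2 * ee k * exp (- k)"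
  have c0: "0 \<le> c" using ee_pos[of k] by (simp add: c_def)
  have E: "(el k t + el k (- t)) / 2 = c * cosh (k * t)" if "t \<in> {-1..1}" for t
   by (simp add: el_def c_def cosh_def exp_add[symmetric] field_simps)
  have E1: "c * cosh k = ch k" using E[of 1] by (simp add: el_ends ch_def)
  have cs: "c * sinh k = k" proof -
   have "c * sinh k = ee k * (exp (- k) * exp k - exp (- k) * exp (- k))" by (simp add: c_def sinh_def algebra_simps)
   also have "exp (- k) * exp k - exp (- k) * exp (- k) = 1 - exp (- 2 * k)" by (simp add: exp_add[symmetric])
   finally show ?thesis by (simp only: ee_mult)
  qed
  have "0 \<le> k * sinh k - cosh k + 1"
   by (rule nonneg_from_deriv[of "\<lambda>k. k * sinh k - cosh k + 1" "\<lambda>k. k * cosh k"])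
     (use k in \<open>auto intro!: derivative_eq_intros simp: mult_nonneg_nonneg\<close>)
  moreover have "1 \<le> cosh (k * t)" by (rule cosh_real_ge_1)
  ultimately have "cosh k - cosh (k * t) \<le> k * sinh k" by linarith
  then have "c * (cosh k - cosh (k * t)) \<le> c * (k * sinh k)" by (rule mult_left_mono[OF _ c0])
  also have "... = k * (c * sinh k)" by (simp only: mult_ac)
  also have "... = k\<^sup>2" unfolding cs by (simp add: power2_eq_square)
  finally have lo: "ch k - k\<^sup>2 \<le> c * cosh (k * t)" unfolding right_diff_distrib E1 by linarith
  have "cosh (k * t) = cosh (abs (k * t))" by (simp add: cosh_real_abs)
  also have "... \<le> cosh k" proof (rule cosh_real_nonneg_le_iff[THEN iffD2])
   show "abs (k * t) \<le> k" using k t mult_left_mono[of "abs t" 1 k] by (auto simp: abs_mult abs_le_iff)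
  qed (use k in auto)
  finally have "c * cosh (k * t) \<le> ch k" using mult_left_mono[OF _ c0] E1 by metis
  then show ?thesis unfolding E[OF t] using lo ch_ge_1[of k] ch_taylor(2)[of k] zero_le_power2[of k] by linarith
 qed
 show ?thesis proof (cases "0 \<le> k")
  case False
  then show ?thesis using main[of "- k"] el_reflect[of k t] el_reflect[of k "- t"] by (simp add: add.commute)
 qed (rule main)
qed

lemma Re_FF_sym2:
 assumes F: "bnd2 s C F" "sym2 F" "3 \<le> s" and t: "t \<in> {-1..1}"
 shows "Re (FF (F t) x) = Re (FF (\<lambda>xi. (F t xi + F (- t) xi) / 2) x)"
  "Re (\<i> * FF (\<lambda>xi. xi * F t xi) x) = Re (\<i> * FF (\<lambda>xi. xi * ((F t xi + F (- t) xi) / 2)) x)" proof -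
 obtain s' where s': "s = Suc s'" "2 \<le> s'" using F(3) by (cases s) auto
 have t': "- t \<in> {-1..1}" using t by auto
 have i: "integrable lborel (F t)" "integrable lborel (F (- t))" using bnd_integrable(1)[OF bnd2_slice[OF F(1)]] t t' F(3) by auto
 have xF: "bnd2 s' C (\<lambda>t xi. xi * F t xi)" using F(1) unfolding s' by (rule bnd2_xi)
 have j: "integrable lborel (\<lambda>xi. xi * F t xi)" "integrable lborel (\<lambda>xi. xi * F (- t) xi)"
  using bnd_integrable(1)[OF bnd2_slice[OF xF t] s'(2)] bnd_integrable(1)[OF bnd2_slice[OF xF t'] s'(2)] by auto
 have r: "F (- t) xi = F t (- xi)" for xi using sym2D[OF F(2) t, of "- xi"] by simp
 have "FF (F (- t)) x = cnj (FF (F t) x)" unfolding FF_cnj r ..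
 moreover have "Re (FF (\<lambda>xi. 1 / 2 * (F t xi + F (- t) xi)) x) = (Re (FF (F t) x) + Re (FF (F (- t)) x)) / 2"
  unfolding FF_cmult FF_add[OF i] by simp
 ultimately show "Re (FF (F t) x) = Re (FF (\<lambda>xi. (F t xi + F (- t) xi) / 2) x)" by simp
 have "FF (\<lambda>xi. xi * F (- t) xi) x = - cnj (FF (\<lambda>xi. xi * F t xi) x)"
  unfolding FF_cnj r using FF_cmult[of "- 1" "\<lambda>xi. - xi * F t (- xi)" x] by simp
 moreover have "FF (\<lambda>xi. 1 / 2 * (xi * F t xi + xi * F (- t) xi)) x = of_real (1 / 2) * (FF (\<lambda>xi. xi * F t xi) x + FF (\<lambda>xi. xi * F (- t) xi) x)"
  unfolding FF_cmult FF_add[OF j] ..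
 ultimately have "FF (\<lambda>xi. 1 / 2 * (xi * F t xi + xi * F (- t) xi)) x = \<i> * of_real (Im (FF (\<lambda>xi. xi * F t xi) x))"
  by (simp add: complex_eq_iff)
 moreover have "(\<lambda>xi. xi * ((F t xi + F (- t) xi) / 2)) = (\<lambda>xi. 1 / 2 * (xi * F t xi + xi * F (- t) xi))"
  by (auto simp: distrib_left)
 ultimately show "Re (\<i> * FF (\<lambda>xi. xi * F t xi) x) = Re (\<i> * FF (\<lambda>xi. xi * ((F t xi + F (- t) xi) / 2)) x)"
  by (simp only:) simp
qed

context layer
begin

text \<open>The difference between the even part of the field and its long wave limit. Two powers of the weight
are spent on turning \<open>(mu d xi)\<^sup>2\<close> into \<open>mu\<^sup>2\<close>.\<close>

definition "Wo t xi = (Fo t xi + Fo (- t) xi) / 2 + sg * (a / d) * g xi"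
definition "WB = mu\<^sup>2 * A + e * B"

lemma ad: "0 \<le> a / d * d" "a / d * d \<le> 1" using a d by auto

lemma Wo_bnd:
 assumes t: "t \<in> {-1..1}"
 shows "bnd (s - 2) WB (Wo t)" proof (rule bndI)
 have t': "- t \<in> {-1..1}" using t by auto
 note Fb = bnd2_slice[OF Fo_bnd t] bnd2_slice[OF Fo_bnd t']
 note pb = bnd2_slice[OF p(1) t] bnd2_slice[OF p(1) t']
 show "continuous_on UNIV (Wo t)" unfolding Wo_def by (intro continuous_intros bndD(1)[OF Fb(1)] bndD(1)[OF Fb(2)] bndD(1)[OF gb(1)]) auto
 fix xi :: real
 define k where "k = mu * d * xi"
 define E where "E = (el k t + el k (- t)) / 2 - 1"
 have W: "Wo t xi = (- sg * (a / d)) * (E * g xi) + e * ((p t xi + p (- t) xi) / 2)"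
  unfolding Wo_def Fo_def layF_def k_def[symmetric] E_def by (simp add: algebra_simps add_divide_distrib diff_divide_distrib)
 have "abs E \<le> k\<^sup>2" unfolding E_def by (rule el_even_part[OF t])
 then have "abs E * abs (g xi) \<le> k\<^sup>2 * abs (g xi)" by (rule mult_right_mono) simp
 then have "(a / d) * (abs E * abs (g xi)) \<le> (a / d) * (k\<^sup>2 * abs (g xi))" using a d by (intro mult_left_mono) auto
 also have "... = (a / d * d) * d * (mu\<^sup>2 * ((abs xi)\<^sup>2 * abs (g xi)))" by (simp add: k_def power_mult_distrib power2_eq_square mult_ac)
 also have "... \<le> 1 * 1 * (mu\<^sup>2 * (A / (1 + abs xi)^(s - 2)))" proof (intro mult_mono ad d)
  have "(abs xi)\<^sup>2 * abs (g xi) \<le> (1 + abs xi)\<^sup>2 * (A / (1 + abs xi)^s)"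
   by (intro mult_mono power_mono bndD(3)[OF gb(1)]) auto
  also have "(1 + abs xi)^s = (1 + abs xi)^(s - 2) * (1 + abs xi)\<^sup>2" proof -
   have "(1 + abs xi)^(s - 2 + 2) = (1 + abs xi)^(s - 2) * (1 + abs xi)\<^sup>2" by (rule power_add)
   moreover have "s - 2 + 2 = s" using s by simp
   ultimately show ?thesis by (simp only:)
  qed
  finally show "(abs xi)\<^sup>2 * abs (g xi) \<le> A / (1 + abs xi)^(s - 2)" by simp
 qed (use a d in auto)
 finally have 1: "abs ((- sg * (a / d)) * (E * g xi)) \<le> mu\<^sup>2 * A / (1 + abs xi)^(s - 2)"
  using sg a d by (simp add: abs_mult)
 have "abs (p t xi) \<le> B / (1 + abs xi)^(s - 2)" "abs (p (- t) xi) \<le> B / (1 + abs xi)^(s - 2)"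
  using bndD(3)[OF bnd_weaken[OF pb(1), of "s - 2" B]] bndD(3)[OF bnd_weaken[OF pb(2), of "s - 2" B]] by auto
 then have "abs ((p t xi + p (- t) xi) / 2) \<le> B / (1 + abs xi)^(s - 2)" by (rule half_sum_le)
 then have "e * abs ((p t xi + p (- t) xi) / 2) \<le> e * (B / (1 + abs xi)^(s - 2))" using e0 by (rule mult_left_mono)
 then have 2: "abs (e * ((p t xi + p (- t) xi) / 2)) \<le> e * B / (1 + abs xi)^(s - 2)" using e0 by (simp add: abs_mult)
 show "abs (Wo t xi) \<le> WB / (1 + abs xi)^(s - 2)"
  unfolding W WB_def add_divide_distrib[of "mu\<^sup>2 * A"] using 1 2 by linarith
qed

lemma s5: "2 \<le> s - 2" "s - 2 = Suc (s - 3)" "2 \<le> s - 3" using s by auto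

lemma u_approx:
 assumes t: "t \<in> {-1..1}"
 shows "abs (Re (ff X t) + sg * (a / d) * eta X) \<le> e * (WB * wint)" proof -
 have t': "- t \<in> {-1..1}" using t by auto
 note Fb = bnd2_slice[OF Fo_bnd t] bnd2_slice[OF Fo_bnd t']
 have b: "bnd s (abs (1 / 2) * (BF + BF)) (\<lambda>xi. 1 / 2 * (Fo t xi + Fo (- t) xi))" "bnd s (abs (sg * (a / d)) * A) (\<lambda>xi. sg * (a / d) * g xi)"
  by (intro bnd_cmult bnd_add Fb gb)+
 have "Re (FF (Wo t) (mu * X)) = Re (FF (\<lambda>xi. (Fo t xi + Fo (- t) xi) / 2) (mu * X)) + sg * (a / d) * Re (FF g (mu * X))"
  using FF_add[OF bnd_integrable(1)[OF b(1) s23(1)] bnd_integrable(1)[OF b(2) s23(1)], of "mu * X"]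
  unfolding FF_cmult[of "sg * (a / d)"] by (simp add: Wo_def[abs_def])
 then have "Re (ff X t) + sg * (a / d) * eta X = e * Re (FF (Wo t) (mu * X))"
  using Re_FF_sym2(1)[OF Fo_bnd Fo_sym s23(2) t, of "mu * X"] by (simp add: ff_def eta_def algebra_simps)
 moreover have "abs (Re (FF (Wo t) (mu * X))) \<le> WB * wint"
  using abs_Re_le_cmod FF_bound[OF Wo_bnd[OF t] s5(1)] order_trans by blast
 ultimately show ?thesis using e0 by (simp add: abs_mult mult_left_mono)
qed

lemma deta_bound: "abs (deta X) \<le> e * mu * (A * wint)" "abs (eta X) \<le> e * (A * wint)" proof -
 have gx: "bnd (s - 1) A (\<lambda>xi. xi * g xi)" using bnd_xi[of "s - 1" A g] gb(1) s by simp
 have "norm (FF (\<lambda>xi. xi * g xi) (mu * X)) \<le> A * wint" using s by (intro FF_bound[OF gx]) auto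
 then have 1: "mu * norm (FF (\<lambda>xi. xi * g xi) (mu * X)) \<le> mu * (A * wint)" by (rule mult_left_mono[OF _ mu0])
 have "norm (complex_of_real (deta X)) = e * (mu * norm (FF (\<lambda>xi. xi * g xi) (mu * X)))"
  unfolding deta_c mult.assoc FF_cmult using e0 mu0 by (simp add: norm_mult)
 then show "abs (deta X) \<le> e * mu * (A * wint)" using mult_left_mono[OF 1 e0] by (simp add: mult.assoc)
 have "norm (complex_of_real (eta X)) = e * norm (FF g (mu * X))" unfolding eta_c using e0 by (simp add: norm_mult)
 then show "abs (eta X) \<le> e * (A * wint)" using mult_left_mono[OF FF_bound[OF gb(1) s23(1), of "mu * X"] e0] by simp
qed

definition "UX = e * mu * (WB * wint) + e * mu * (BF * wint) * (e * mu * (A * wint))"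

lemma uX_approx:
 assumes z: "z \<in> CL"
 shows "abs (Re (GG' z) + sg * (a / d) * deta (Re z)) \<le> UX" proof -
 define t where "t = tt z"
 define X where "X = Re z"
 have t: "t \<in> {-1..1}" and t': "- t \<in> {-1..1}" using tt_mem[OF z] by (auto simp: t_def)
 note Fb = bnd2_slice[OF Fo_xi_bnd t] bnd2_slice[OF Fo_xi_bnd t']
 have s1: "2 \<le> s - 1" using s by simp
 have gx: "bnd (s - 1) A (\<lambda>xi. xi * g xi)" using bnd_xi[of "s - 1" A g] gb(1) s by simp
 have b: "bnd (s - 1) (abs (1 / 2) * (BF + BF)) (\<lambda>xi. 1 / 2 * (xi * Fo t xi + xi * Fo (- t) xi))"
   "bnd (s - 1) (abs (sg * (a / d)) * A) (\<lambda>xi. sg * (a / d) * (xi * g xi))" by (intro bnd_cmult bnd_add Fb gx)+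
 have xW: "(\<lambda>xi. xi * Wo t xi) = (\<lambda>xi. 1 / 2 * (xi * Fo t xi + xi * Fo (- t) xi) + sg * (a / d) * (xi * g xi))"
  "(\<lambda>xi. 1 / 2 * (xi * Fo t xi + xi * Fo (- t) xi)) = (\<lambda>xi. xi * ((Fo t xi + Fo (- t) xi) / 2))"
  by (auto simp: Wo_def algebra_simps add_divide_distrib)
 have F: "FF (\<lambda>xi. xi * Wo t xi) (mu * X) = FF (\<lambda>xi. xi * ((Fo t xi + Fo (- t) xi) / 2)) (mu * X) + of_real (sg * (a / d)) * FF (\<lambda>xi. xi * g xi) (mu * X)"
  unfolding xW(1) FF_add[OF bnd_integrable(1)[OF b(1) s1] bnd_integrable(1)[OF b(2) s1]] FF_cmult[of "sg * (a / d)"] xW(2) ..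
 have dt: "deta X = e * (mu * Re (\<i> * FF (\<lambda>xi. xi * g xi) (mu * X)))" unfolding deta_def mult.assoc FF_cmult by simp
 have fx: "Re (ffX X t) = e * (mu * Re (\<i> * FF (\<lambda>xi. xi * ((Fo t xi + Fo (- t) xi) / 2)) (mu * X)))"
  unfolding Re_FF_sym2(2)[OF Fo_bnd Fo_sym s23(2) t, symmetric] by (simp add: ffX_def)
 have "Re (ffX X t) + sg * (a / d) * deta X = e * (mu * Re (\<i> * FF (\<lambda>xi. xi * Wo t xi) (mu * X)))"
  unfolding dt fx F by (simp add: algebra_simps)
 moreover have "abs (Re (\<i> * FF (\<lambda>xi. xi * Wo t xi) (mu * X))) \<le> WB * wint" proof -
  have "bnd (s - 3) WB (\<lambda>xi. xi * Wo t xi)" using Wo_bnd[OF t] unfolding s5(2) by (rule bnd_xi)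
  from FF_bound[OF this s5(3), of "mu * X"] show ?thesis
   using abs_Im_le_cmod[of "FF (\<lambda>xi. xi * Wo t xi) (mu * X)"] by simp
 qed
 moreover have "abs (e * (mu * R)) \<le> e * mu * C" if "abs R \<le> C" for R C
  using mult_left_mono[OF that, of "e * mu"] e0 mu0 by (simp add: abs_mult mult.assoc)
 ultimately have 1: "abs (Re (ffX X t) + sg * (a / d) * deta X) \<le> e * mu * (WB * wint)" by (simp only:)
 have eq: "GG' z - ffX X t = ffX X t * (1 - ZX X t) / ZX X t"
  unfolding GG'_def using ZX_nz[of X t] by (simp add: X_def t_def field_simps)
 have "abs (Re (GG' z) - Re (ffX X t)) \<le> norm (ffX X t * (1 - ZX X t) / ZX X t)"
  using abs_Re_le_cmod[of "GG' z - ffX X t"] unfolding eq[symmetric] by simp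
 also have "... = norm (ffX X t) * norm (1 - ZX X t) / norm (ZX X t)" by (simp add: norm_mult norm_divide)
 also have "... \<le> norm (ffX X t) * norm (1 - ZX X t) / 1"
  using ZX_ge[of X t] by (intro divide_left_mono) (auto intro: mult_nonneg_nonneg)
 also have "... \<le> e * mu * (BF * wint) * (e * mu * (A * wint))" proof -
  have "norm (1 - ZX X t) = abs t * abs (deta X)" using sg by (simp add: ZX_def norm_mult)
  also have "... \<le> 1 * abs (deta X)" using t by (intro mult_right_mono) auto
  finally have "norm (1 - ZX X t) \<le> e * mu * (A * wint)" using deta_bound(1)[of X] by linarith
  then have "norm (ffX X t) * norm (1 - ZX X t) \<le> e * mu * (BF * wint) * (e * mu * (A * wint))"
   using GG_bound(3)[OF z] unfolding X_def t_def by (intro mult_mono) (auto intro: order_trans[OF norm_ge_zero])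
  then show ?thesis by simp
 qed
 finally have "abs (Re (GG' z) - Re (ffX X t)) \<le> e * mu * (BF * wint) * (e * mu * (A * wint))" .
 then show ?thesis using 1 unfolding UX_def X_def[symmetric] by linarith
qed

text \<open>The imaginary part vanishes on the wall and its vertical derivative is the real part of \<open>GG'\<close>,
so the error for \<open>U\<^sub>X\<close> is integrated from the wall.\<close>

lemma v_approx:
 assumes Y: "0 \<le> Y" "Y \<le> DD X"
 shows "abs (Im (GG (Complex X Y)) + sg * (a / d) * deta X * Y) \<le> UX * Y" proof (cases "Y = 0")
 case True then show ?thesis using GG_wall[of "Complex X 0"] by simp
next
 case False
 define h where "h y = Im (GG (Complex X y)) + sg * (a / d) * deta X * y" for y
 have sub: "Complex X y \<in> CL" if "y \<in> {0..Y}" for y using that Y by (auto simp: CL_def)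
 have Cc: "continuous_on S (\<lambda>y. Complex X y)" for S unfolding Complex_eq by (intro continuous_intros)
 have hc: "continuous_on {0..Y} h"
  unfolding h_def using sub by (intro continuous_intros continuous_on_compose2[OF GG_cont(1) Cc]) auto
 have hd: "(h has_derivative (\<lambda>x. x * (Re (GG' (Complex X y)) + sg * (a / d) * deta X))) (at y)" if y: "0 < y" "y < Y" for y
 proof -
  have "(GG has_field_derivative GG' (Complex X y)) (at (Complex X y))" using y Y by (intro GG_deriv) auto
  moreover have "((\<lambda>y. Complex X y) has_vector_derivative \<i>) (at y)"
   unfolding Complex_eq by (auto intro!: derivative_eq_intros)
  ultimately have "((\<lambda>y. GG (Complex X y)) has_vector_derivative \<i> * GG' (Complex X y)) (at y)"
   using field_vector_diff_chain_at[of "\<lambda>y. Complex X y" \<i> y GG] by (simp add: o_def)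
  from bounded_linear.has_vector_derivative[OF bounded_linear_Im this]
  have "((\<lambda>y. Im (GG (Complex X y))) has_real_derivative Re (GG' (Complex X y))) (at y)"
   by (simp add: has_real_derivative_iff_has_vector_derivative)
  then have "(h has_real_derivative Re (GG' (Complex X y)) + sg * (a / d) * deta X) (at y)"
   unfolding h_def[abs_def] by (rule DERIV_add[OF _ DERIV_cmult_Id])
  from this[unfolded has_field_derivative_def] show ?thesis by (rule has_derivative_eq_rhs) (rule ext, rule mult.commute)
 qed
 have "0 < Y" using Y False by simp
 from mvt[OF this hc hd] obtain y where y: "0 < y" "y < Y" and "h Y - h 0 = (Y - 0) * (Re (GG' (Complex X y)) + sg * (a / d) * deta X)"
  by blast
 then have "h Y = Y * (Re (GG' (Complex X y)) + sg * (a / d) * deta X)" using GG_wall[of "Complex X 0"] by (simp add: h_def)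
 moreover have "abs (Re (GG' (Complex X y)) + sg * (a / d) * deta X) \<le> UX" using uX_approx[OF sub[of y]] y by simp
 then have "abs (Re (GG' (Complex X y)) + sg * (a / d) * deta X) * Y \<le> UX * Y" using Y by (intro mult_right_mono) auto
 ultimately show ?thesis using Y by (simp add: h_def abs_mult mult.commute)
qed

end

section \<open>Real analyticity\<close>

text \<open>Expand \<open>(z - z0)^n\<close> in the power series of \<open>f\<close> by the binomial theorem. The resulting double
series converges absolutely when \<open>|x - x0| + |y - y0|\<close> is less than the radius, and may therefore
be reordered by the powers of \<open>x - x0\<close> and \<open>y - y0\<close>.\<close>

lemma real_analytic_Re:
 assumes hol: "f holomorphic_on T" "open T" and S: "\<And>x y. (x, y) \<in> S \<Longrightarrow> Complex x y \<in> T"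
  and W: "\<And>x y. Complex x y \<in> T \<Longrightarrow> W (x, y) = Re (f (Complex x y))"
 shows "real_analytic_on2 W S" unfolding real_analytic_on2_def proof (intro ballI, clarify)
 fix x0 y0 assume "(x0, y0) \<in> S"
 define z0 where "z0 = Complex x0 y0"
 have "z0 \<in> T" using S \<open>(x0, y0) \<in> S\<close> by (simp add: z0_def)
 then obtain r0 where r0: "0 < r0" "ball z0 r0 \<subseteq> T" using hol(2) open_contains_ball by blast
 then have holb: "f holomorphic_on ball z0 r0" using hol(1) holomorphic_on_subset by blast
 define c where "c n = (deriv ^^ n) f z0 / fact n" for n
 define A where "A = (\<lambda>(i, j). Re (c (i + j) * of_nat ((i + j) choose i) * \<i>^j))"
 have main: "((\<lambda>(i, j). A (i, j) * (x - x0)^i * (y - y0)^j) has_sum W (x, y)) UNIV"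
  if xy: "abs (x - x0) < r0 / 2" "abs (y - y0) < r0 / 2" for x y proof -
  define dx where "dx = x - x0"
  define dy where "dy = y - y0"
  define \<rho> where "\<rho> = abs dx + abs dy"
  have \<rho>: "0 \<le> \<rho>" "\<rho> < r0" using xy by (auto simp: \<rho>_def dx_def dy_def)
  define z where "z = Complex x y"
  have zz: "z - z0 = of_real dx + \<i> * of_real dy" by (simp add: z_def z0_def dx_def dy_def complex_eq_iff)
  have "norm (z - z0) \<le> \<rho>" unfolding zz \<rho>_def by (rule order_trans[OF norm_triangle_ineq]) (simp add: norm_mult)
  then have zb: "z \<in> ball z0 r0" using \<rho> by (simp add: dist_norm norm_minus_commute)
  have fs: "(\<lambda>n. c n * (z - z0)^n) sums f z" unfolding c_def by (rule holomorphic_power_series[OF holb zb])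
  define r1 where "r1 = (\<rho> + r0) / 2"
  have r1: "\<rho> < r1" "r1 < r0" "0 \<le> r1" using \<rho> by (auto simp: r1_def)
  have "z0 + of_real r1 \<in> ball z0 r0" using r1 by (simp add: dist_norm)
  from holomorphic_power_series[OF holb this]
  have "summable (\<lambda>n. c n * of_real r1^n)" by (simp add: c_def sums_iff)
  then have sn: "summable (\<lambda>n. norm (c n * of_real \<rho>^n))" by (rule powser_insidea) (use r1 \<rho> in auto)
  define G where "G = (\<lambda>(n, k). c n * of_nat (n choose k) * of_real dx^k * (\<i> * of_real dy)^(n - k))"
  have bin: "(\<Sum>k\<le>n. G (n, k)) = c n * (z - z0)^n" for n
   unfolding zz binomial_ring G_def by (simp add: sum_distrib_left mult_ac)
  have binn: "(\<Sum>k\<le>n. norm (G (n, k))) = norm (c n * of_real \<rho>^n)" for n proof -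
   have "(\<Sum>k\<le>n. norm (G (n, k))) = norm (c n) * (\<Sum>k\<le>n. of_nat (n choose k) * abs dx^k * abs dy^(n - k))"
    unfolding G_def by (simp add: sum_distrib_left norm_mult norm_power mult_ac)
   also have "... = norm (c n) * \<rho>^n" unfolding \<rho>_def binomial_ring ..
   finally show ?thesis using \<rho> by (simp add: norm_mult norm_power)
  qed
  have ab: "(\<lambda>p. norm (G p)) summable_on (SIGMA n:UNIV. {..n})"
   unfolding Infinite_Sum.abs_summable_on_Sigma_iff proof (intro conjI ballI)
   show "(\<lambda>k. norm (G (n, k))) summable_on {..n}" for n by (rule summable_on_finite) simp
   have "(\<lambda>n. norm (c n * of_real \<rho>^n)) summable_on UNIV"
    by (subst summable_on_UNIV_nonneg_real_iff) (use sn in auto)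
   then show "(\<lambda>n. norm (\<Sum>\<^sub>\<infinity>k\<in>{..n}. norm (G (n, k)))) summable_on UNIV"
    unfolding infsum_finite[OF finite_atMost] binn by simp
  qed
  have cs: "((\<lambda>n. c n * (z - z0)^n) has_sum f z) UNIV" proof (rule norm_summable_imp_has_sum[OF _ fs])
   show "summable (\<lambda>n. norm (c n * (z - z0)^n))" proof (rule summable_comparison_test'[OF sn])
    show "norm (norm (c n * (z - z0)^n)) \<le> norm (c n * of_real \<rho>^n)" for n
     using power_mono[OF \<open>norm (z - z0) \<le> \<rho>\<close> norm_ge_zero, of n] \<rho>(1)
     by (simp add: norm_mult norm_power mult_left_mono)
   qed
  qed
  have hs: "(G has_sum f z) (SIGMA n:UNIV. {..n})" proof (rule has_sum_SigmaI[OF _ cs abs_summable_summable[OF ab]])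
   show "((\<lambda>k. G (n, k)) has_sum c n * (z - z0)^n) {..n}" for n
    using has_sum_finite[of "{..n}" "\<lambda>k. G (n, k)"] by (simp add: bin)
  qed
  have bij: "bij_betw (\<lambda>(i, j). (i + j, i)) UNIV (SIGMA n:(UNIV::nat set). {..n})"
   by (rule bij_betwI[where g = "\<lambda>(n, k). (k, n - k)"]) auto
  have "((\<lambda>p. G ((\<lambda>(i, j). (i + j, i)) p)) has_sum f z) UNIV"
   using has_sum_reindex_bij_betw[OF bij, of G "f z"] hs by simp
  from has_sum_Re[OF this]
  have "((\<lambda>p. Re (G ((\<lambda>(i, j). (i + j, i)) p))) has_sum Re (f z)) UNIV" .
  also have "(\<lambda>p. Re (G ((\<lambda>(i, j). (i + j, i)) p))) = (\<lambda>(i, j). A (i, j) * (x - x0)^i * (y - y0)^j)"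
  proof (rule ext)
   fix p :: "nat \<times> nat"
   obtain i j where p: "p = (i, j)" by (cases p)
   have "G (i + j, i) = (c (i + j) * of_nat ((i + j) choose i) * \<i>^j) * of_real (dx^i * dy^j)"
    unfolding G_def by (simp add: power_mult_distrib)
   then have "Re (G (i + j, i)) = Re (c (i + j) * of_nat ((i + j) choose i) * \<i>^j) * (dx^i * dy^j)"
    by (simp only: Re_complex_of_real Im_complex_of_real times_complex.sel mult_zero_right diff_zero)
   then show "Re (G ((\<lambda>(i, j). (i + j, i)) p)) = (\<lambda>(i, j). A (i, j) * (x - x0)^i * (y - y0)^j) p"
    by (simp add: p A_def dx_def dy_def mult.assoc)
  qed
  also have "Re (f z) = W (x, y)" using W zb r0 by (simp add: z_def subset_iff)
  finally show ?thesis .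
 qed
 show "\<exists>r>0. \<exists>a. \<forall>x y. abs (x - x0) < r \<and> abs (y - y0) < r \<longrightarrow>
   ((\<lambda>(i, j). a (i, j) * (x - x0)^i * (y - y0)^j) has_sum W (x, y)) UNIV"
  by (rule exI[of _ "r0 / 2"], rule conjI, use r0 in simp, rule exI[of _ A]) (use main in blast)
qed

section \<open>Regularity of real parts\<close>

text \<open>The closed set \<open>K\<close> contains the closure of \<open>Om\<close> and carries the continuous extensions.\<close>

lemma holo_C1:
 assumes Om: "open Om" "closed K" "Om \<subseteq> K"
  and D: "\<And>x y. (x, y) \<in> Om \<Longrightarrow> (F has_field_derivative F' (Complex x y)) (at (Complex x y))"
  and c: "continuous_on K (\<lambda>p. F (Complex (fst p) (snd p)))" "continuous_on K (\<lambda>p. F' (Complex (fst p) (snd p)))"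
  and W: "\<And>x y. (x, y) \<in> Om \<Longrightarrow> W (x, y) = Re (F (Complex x y))"
  and b: "\<And>p. p \<in> Om \<Longrightarrow> abs (W p) \<le> M" "\<And>x y. (x, y) \<in> Om \<Longrightarrow> norm (F' (Complex x y)) \<le> M'"
 shows "Cn_closure 1 Om W" "\<And>x y. (x, y) \<in> Om \<Longrightarrow> dX W (x, y) = Re (F' (Complex x y))"
  "\<And>x y. (x, y) \<in> Om \<Longrightarrow> dY W (x, y) = Re (\<i> * F' (Complex x y))" proof -
 have cl: "closure Om \<subseteq> K" using Om(2,3) by (rule closure_minimal[rotated])
 have line: "((\<lambda>t. W ((x, y) + t *\<^sub>R v)) has_real_derivative Re (Complex (fst v) (snd v) * F' (Complex x y))) (at 0)"
  if xy: "(x, y) \<in> Om" for x y v proof -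
  have ev: "\<forall>\<^sub>F t in nhds 0. (x, y) + t *\<^sub>R v \<in> Om" proof -
   have "((\<lambda>t. (x, y) + t *\<^sub>R v) \<longlongrightarrow> (x, y) + 0 *\<^sub>R v) (nhds 0)"
    by (intro tendsto_intros filterlim_ident)
   then show ?thesis using topological_tendstoD[OF _ Om(1), of "\<lambda>t. (x, y) + t *\<^sub>R v"] xy by simp
  qed
  have "((\<lambda>t. Complex x y + of_real t * Complex (fst v) (snd v)) has_vector_derivative Complex (fst v) (snd v)) (at 0)"
   by (auto intro!: derivative_eq_intros has_vector_derivative_real_field)
  moreover have "(F has_field_derivative F' (Complex x y)) (at (Complex x y + of_real 0 * Complex (fst v) (snd v)))"
   using D[OF xy] by simp
  ultimately have "((F \<circ> (\<lambda>t. Complex x y + of_real t * Complex (fst v) (snd v))) has_vector_derivative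
    Complex (fst v) (snd v) * F' (Complex x y)) (at 0)" by (rule field_vector_diff_chain_at)
  from bounded_linear.has_vector_derivative[OF bounded_linear_Re this]
  have d: "((\<lambda>t. Re (F (Complex x y + of_real t * Complex (fst v) (snd v)))) has_real_derivative Re (Complex (fst v) (snd v) * F' (Complex x y))) (at 0)"
   by (simp add: has_real_derivative_iff_has_vector_derivative o_def)
  have "\<forall>\<^sub>F t in nhds 0. Re (F (Complex x y + of_real t * Complex (fst v) (snd v))) = W ((x, y) + t *\<^sub>R v)"
   using ev proof eventually_elim
   case (elim t)
   have "Complex x y + of_real t * Complex (fst v) (snd v) = Complex (x + t * fst v) (y + t * snd v)"
    by (simp add: complex_eq_iff)
   moreover have "(x, y) + t *\<^sub>R v = (x + t * fst v, y + t * snd v)" by (simp add: prod_eq_iff)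
   ultimately show ?case using W elim by simp
  qed
  from DERIV_cong_ev[OF refl this refl] d show ?thesis by simp
 qed
 have pd: "partial_deriv v W (x, y) = Re (Complex (fst v) (snd v) * F' (Complex x y))" if "(x, y) \<in> Om" for x y v
  unfolding partial_deriv_def by (rule DERIV_imp_deriv[OF line[OF that]])
 show "dX W (x, y) = Re (F' (Complex x y))" if "(x, y) \<in> Om" for x y
  using pd[OF that, of "(1, 0)"] by (simp add: complex_eq_iff)
 have i: "Complex 0 1 = \<i>" by (simp add: complex_eq_iff)
 show "dY W (x, y) = Re (\<i> * F' (Complex x y))" if "(x, y) \<in> Om" for x y
  using pd[OF that, of "(0, 1)"] by (simp only: fst_conv snd_conv i)
 have C0: "C0_closure Om W" unfolding C0_closure_def proof (intro conjI exI[of _ "\<lambda>p. Re (F (Complex (fst p) (snd p)))"])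
  show "bounded (W ` Om)" using b(1) by (auto simp: bounded_iff intro!: exI[of _ M])
  show "continuous_on (closure Om) (\<lambda>p. Re (F (Complex (fst p) (snd p))))"
   by (intro continuous_on_Re continuous_on_subset[OF c(1) cl])
 qed (use W in auto)
 have C1: "C0_closure Om (partial_deriv v W)" for v unfolding C0_closure_def
 proof (intro conjI exI[of _ "\<lambda>p. Re (Complex (fst v) (snd v) * F' (Complex (fst p) (snd p)))"] ballI)
  have "norm (partial_deriv v W p) \<le> norm (Complex (fst v) (snd v)) * M'" if p: "p \<in> Om" for p proof -
   obtain x y where xy: "p = (x, y)" by (cases p)
   have "norm (partial_deriv v W p) \<le> norm (Complex (fst v) (snd v) * F' (Complex x y))"
    unfolding xy real_norm_def pd[OF p[unfolded xy]] by (rule abs_Re_le_cmod)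
   also have "... \<le> norm (Complex (fst v) (snd v)) * M'" unfolding norm_mult using b(2) p xy by (intro mult_left_mono) auto
   finally show ?thesis .
  qed
  then show "bounded (partial_deriv v W ` Om)" unfolding bounded_iff by blast
  show "continuous_on (closure Om) (\<lambda>p. Re (Complex (fst v) (snd v) * F' (Complex (fst p) (snd p))))"
   by (intro continuous_on_Re continuous_on_mult continuous_on_const continuous_on_subset[OF c(2) cl])
  fix p assume "p \<in> Om"
  then show "Re (Complex (fst v) (snd v) * F' (Complex (fst p) (snd p))) = partial_deriv v W p"
   using pd[of "fst p" "snd p" v] by simp
 qed
 have fd: "(\<lambda>t. W (p + t *\<^sub>R v)) field_differentiable (at 0)" if "p \<in> Om" for p v
  using line[of "fst p" "snd p" v] that unfolding field_differentiable_def prod.collapse by blast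
 show "Cn_closure 1 Om W" unfolding One_nat_def Cn_closure.simps using C0 C1 fd by blast
qed

text \<open>The Cauchy--Riemann equations of \<open>R = u - i v\<close> say that \<open>(u, v)\<close> is free of divergence and
rotation, and the shear adds the vorticity \<open>w\<close>.\<close>

lemma complex_velocity:
 fixes R R' :: "complex \<Rightarrow> complex" and U V :: "real \<times> real \<Rightarrow> real"
 assumes Om: "open Om" "closed K" "Om \<subseteq> K"
  and D: "\<And>x y. (x, y) \<in> Om \<Longrightarrow> (R has_field_derivative R' (Complex x y)) (at (Complex x y))"
  and c: "continuous_on K (\<lambda>p. R (Complex (fst p) (snd p)))" "continuous_on K (\<lambda>p. R' (Complex (fst p) (snd p)))"
  and U: "\<And>x y. (x, y) \<in> Om \<Longrightarrow> U (x, y) = Re (R (Complex x y)) + w * y + k"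
  and V: "\<And>x y. (x, y) \<in> Om \<Longrightarrow> V (x, y) = - Im (R (Complex x y))"
  and b: "\<And>x y. (x, y) \<in> Om \<Longrightarrow> norm (R (Complex x y)) \<le> M"
   "\<And>x y. (x, y) \<in> Om \<Longrightarrow> norm (R' (Complex x y)) \<le> M'" "\<And>x y. (x, y) \<in> Om \<Longrightarrow> abs y \<le> 1"
 shows "Cn_closure 1 Om U" "Cn_closure 1 Om V" "\<And>p. p \<in> Om \<Longrightarrow> dX U p + dY V p = 0"
  "\<And>p. p \<in> Om \<Longrightarrow> dY U p - dX V p = w" "real_analytic_on2 U Om" "real_analytic_on2 V Om" proof -
 define F where "F z = R z + of_real k - \<i> * of_real w * z" for z
 define F' where "F' z = R' z - \<i> * of_real w" for z
 have D1: "(F has_field_derivative F' (Complex x y)) (at (Complex x y))" if "(x, y) \<in> Om" for x y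
  unfolding F_def[abs_def] F'_def by (auto intro!: derivative_eq_intros D[OF that])
 have D2: "((\<lambda>z. \<i> * R z) has_field_derivative (\<lambda>z. \<i> * R' z) (Complex x y)) (at (Complex x y))" if "(x, y) \<in> Om" for x y
  by (auto intro!: derivative_eq_intros D[OF that])
 have id: "continuous_on K (\<lambda>p. Complex (fst p) (snd p))" unfolding Complex_eq by (intro continuous_intros)
 have c1: "continuous_on K (\<lambda>p. F (Complex (fst p) (snd p)))" "continuous_on K (\<lambda>p. F' (Complex (fst p) (snd p)))"
  unfolding F_def F'_def by (intro continuous_intros c id)+
 have c2: "continuous_on K (\<lambda>p. \<i> * R (Complex (fst p) (snd p)))" "continuous_on K (\<lambda>p. \<i> * R' (Complex (fst p) (snd p)))"
  by (intro continuous_intros c)+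
 have UV: "U (x, y) = Re (F (Complex x y))" "V (x, y) = Re (\<i> * R (Complex x y))" if "(x, y) \<in> Om" for x y
  using U[OF that] V[OF that] by (simp_all add: F_def)
 have bU: "abs (U p) \<le> M + abs w + abs k" "abs (V p) \<le> M" if "p \<in> Om" for p proof -
  obtain x y where p: "p = (x, y)" by (cases p)
  have "abs (w * y) \<le> abs w" using mult_left_mono[OF b(3) abs_ge_zero[of w]] that p by (simp add: abs_mult)
  then show "abs (U p) \<le> M + abs w + abs k" "abs (V p) \<le> M"
   using that U[of x y] V[of x y] b(1)[of x y] abs_Re_le_cmod[of "R (Complex x y)"] abs_Im_le_cmod[of "R (Complex x y)"]
   unfolding p by linarith+
 qed
 have b1: "norm (F' (Complex x y)) \<le> M' + abs w" "norm (\<i> * R' (Complex x y)) \<le> M'" if "(x, y) \<in> Om" for x y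
  using norm_triangle_ineq4[of "R' (Complex x y)" "\<i> * of_real w"] b(2)[OF that] by (simp_all add: F'_def norm_mult)
 note h1 = holo_C1[OF Om D1 c1 UV(1) bU(1) b1(1)]
 note h2 = holo_C1[of Om K "\<lambda>z. \<i> * R z" "\<lambda>z. \<i> * R' z", OF Om D2 c2 UV(2) bU(2) b1(2)]
 show "Cn_closure 1 Om U" "Cn_closure 1 Om V" by (rule h1(1) h2(1); assumption)+
 have d: "dX U (x, y) = Re (F' (Complex x y))" "dY U (x, y) = Re (\<i> * F' (Complex x y))"
  "dX V (x, y) = Re (\<i> * R' (Complex x y))" "dY V (x, y) = Re (\<i> * (\<i> * R' (Complex x y)))"
  if "(x, y) \<in> Om" for x y by (rule h1(2); (assumption | rule that))
   (rule h1(3) h2(2) h2(3); (assumption | rule that))+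
 show "dX U p + dY V p = 0" "dY U p - dX V p = w" if "p \<in> Om" for p using d[of "fst p" "snd p"] that by (simp_all add: F'_def)
 define T where "T = (\<lambda>z. (Re z, Im z)) -` Om"
 have T: "open T" unfolding T_def by (intro open_vimage Om continuous_intros)
 have TC: "Complex x y \<in> T \<longleftrightarrow> (x, y) \<in> Om" for x y by (simp add: T_def)
 have Th: "F holomorphic_on T" if "\<And>x y. (x, y) \<in> Om \<Longrightarrow> (F has_field_derivative F' (Complex x y)) (at (Complex x y))" for F F'
 proof (rule holomorphic_onI)
  fix z assume "z \<in> T"
  then have "(Re z, Im z) \<in> Om" by (simp add: T_def)
  from that[OF this] have "(F has_field_derivative F' z) (at z)" by simp
  then show "F field_differentiable at z within T"
   unfolding field_differentiable_def by (blast intro: has_field_derivative_at_within)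
 qed
 show "real_analytic_on2 U Om" by (rule real_analytic_Re[OF Th[OF D1] T]; ((simp only: TC)?; (assumption | erule UV(1))?))
 show "real_analytic_on2 V Om"
  by (rule real_analytic_Re[where f = "\<lambda>z. \<i> * R z", OF Th[OF D2] T]; ((simp only: TC)?; (assumption | erule UV(2))?))
qed

lemma Cn_closure_FF:
 assumes "bnd (n + 3) A b"
 shows "Cn_closure n UNIV (\<lambda>X::real. Re (c * FF b (mu * X)))" using assms proof (induction n arbitrary: b c)
 have C0: "C0_closure UNIV (\<lambda>X::real. Re (c * FF b (mu * X)))" if b: "bnd r A b" "2 \<le> r" for b c and r
  unfolding C0_closure_def proof (intro conjI exI[of _ "\<lambda>X. Re (c * FF b (mu * X))"])
  have "norm (Re (c * FF b (mu * X))) \<le> norm c * (A * wint)" for X proof -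
   have "norm (Re (c * FF b (mu * X))) \<le> norm (c * FF b (mu * X))" unfolding real_norm_def by (rule abs_Re_le_cmod)
   also have "... \<le> norm c * (A * wint)" unfolding norm_mult by (intro mult_left_mono FF_bound[OF b]) auto
   finally show ?thesis .
  qed
  then show "bounded (range (\<lambda>X. Re (c * FF b (mu * X))))" by (auto simp: bounded_iff)
  show "continuous_on (closure UNIV) (\<lambda>X. Re (c * FF b (mu * X)))"
   by (intro continuous_on_Re continuous_on_mult continuous_on_const continuous_on_compose2[OF FF_continuous[OF b, of UNIV]] continuous_on_id subset_UNIV)
 qed auto
 {
  case 0
  then show ?case using C0[of 3 b c] by simp
 next
  case (Suc n)
  have D: "((\<lambda>t. Re (c * FF b (mu * (X + t *\<^sub>R 1)))) has_real_derivative Re (c * (mu * \<i>) * FF (\<lambda>xi. xi * b xi) (mu * X))) (at 0)" for X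
  proof -
   have "((\<lambda>X. Re (c * FF b (mu * X))) has_vector_derivative Re (c * (of_real mu * (\<i> * FF (\<lambda>xi. xi * b xi) (mu * X))))) (at X)"
    by (intro bounded_linear.has_vector_derivative[OF bounded_linear_Re] has_vector_derivative_mult_right FF_scale_deriv[OF Suc.prems]) simp
   then have "((\<lambda>X. Re (c * FF b (mu * X))) has_real_derivative Re (c * (mu * \<i>) * FF (\<lambda>xi. xi * b xi) (mu * X))) (at X)"
    by (simp only: has_real_derivative_iff_has_vector_derivative mult.assoc)
   from DERIV_shift[of "\<lambda>X. Re (c * FF b (mu * X))" _ 0 X, THEN iffD1] this show ?thesis by (simp add: add.commute)
  qed
  have pd: "partial_deriv 1 (\<lambda>X. Re (c * FF b (mu * X))) = (\<lambda>X. Re (c * (mu * \<i>) * FF (\<lambda>xi. xi * b xi) (mu * X)))"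
   unfolding partial_deriv_def by (rule ext, rule DERIV_imp_deriv[OF D])
  have "bnd (n + 3) A (\<lambda>xi. xi * b xi)" using Suc.prems bnd_xi[of "n + 3" A b] by simp
  from Suc.IH[OF this] have n: "Cn_closure n UNIV (partial_deriv 1 (\<lambda>X. Re (c * FF b (mu * X))))" unfolding pd .
  have fd: "(\<lambda>t. Re (c * FF b (mu * (X + t *\<^sub>R 1)))) field_differentiable (at 0)" for X
   using D[of X] unfolding field_differentiable_def by blast
  have "C0_closure UNIV (\<lambda>X. Re (c * FF b (mu * X)))" by (rule C0[OF Suc.prems]) simp
  then show ?case unfolding Cn_closure.simps Basis_real_def using n fd by blast
 }
qed

section \<open>The two-layer flow\<close>

locale flow = two_layers h w0 w1 s for h w0 w1 :: real and s :: nat +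
 fixes mu C :: real and g :: "real \<Rightarrow> real" and p q :: "real \<Rightarrow> real \<Rightarrow> real"
 assumes mu: "0 < mu" "mu \<le> 1" and s5: "5 \<le> s" and prof: "profile mu C g p q"
  and small: "ep mu * (C * wint) < h" "ep mu * (C * wint) < 1 - h"
begin

lemma gC: "bndm mu s C g" "evn g" and pC: "bnd2 s C p" "sym2 p" and qC: "bnd2 s C q" "sym2 q"
 using prof by (auto simp: profile_def)

lemma eta_small: "abs (ep mu * Re (FF g (mu * X))) < h" "abs (ep mu * Re (FF g (mu * X))) < 1 - h" proof -
 have m0: "0 \<le> mu" using mu by simp
 have e: "0 < ep mu" by (rule ep_bounds(1)[OF mu])
 have "abs (Re (FF g (mu * X))) \<le> C * wint"
  using abs_Re_le_cmod[of "FF g (mu * X)"] FF_bound[OF bndm_bnd(1)[OF m0 gC(1)] s2, of "mu * X"] by linarith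
 then have "abs (ep mu * Re (FF g (mu * X))) \<le> ep mu * (C * wint)" using e by (simp add: abs_mult mult_left_mono)
 then show "abs (ep mu * Re (FF g (mu * X))) < h" "abs (ep mu * Re (FF g (mu * X))) < 1 - h" using small by linarith+
qed

sublocale lower: layer mu "ep mu" aa h 1 w0 C C s g p proof unfold_locales
 show "0 < h + 1 * (ep mu * Re (FF g (mu * X)))" for X using eta_small(1)[of X] by linarith
qed (use mu ep_bounds[OF mu] aa h s5 prof in \<open>auto simp: profile_def\<close>)

sublocale upper: layer mu "ep mu" aa "1 - h" "- 1" w1 C C s g q proof unfold_locales
 show "0 < 1 - h + - 1 * (ep mu * Re (FF g (mu * X)))" for X using eta_small(2)[of X] by linarith
qed (use mu ep_bounds[OF mu] aa h s5 prof in \<open>auto simp: profile_def\<close>)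

abbreviation "\<eta> \<equiv> lower.eta"

lemma DD: "lower.DD X = h + \<eta> X" "upper.DD X = 1 - h - \<eta> X" by (simp_all add: lower.DD_def upper.DD_def)

lemma eta_range: "0 < h + \<eta> X" "h + \<eta> X < 1" using lower.DD_pos[of X] upper.DD_pos[of X] by (auto simp: DD)

lemma jump: "Re (lower.ff X 1) - Re (upper.ff X 1) = - \<eta> X" proof -
 have b: "bnd s (abs (1 / 2) * (lower.BF + lower.BF)) (\<lambda>xi. 1 / 2 * (lower.Fo 1 xi + lower.Fo (- 1) xi))"
  "bnd s (abs (1 / 2) * (upper.BF + upper.BF)) (\<lambda>xi. 1 / 2 * (upper.Fo 1 xi + upper.Fo (- 1) xi))"
  by (intro bnd_cmult bnd_add bnd2_slice[OF lower.Fo_bnd] bnd2_slice[OF upper.Fo_bnd]; simp)+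
 have i: "integrable lborel (\<lambda>xi. (lower.Fo 1 xi + lower.Fo (- 1) xi) / 2)" "integrable lborel (\<lambda>xi. (upper.Fo 1 xi + upper.Fo (- 1) xi) / 2)"
  using bnd_integrable(1)[OF b(1) s2] bnd_integrable(1)[OF b(2) s2] by simp_all
 have j: "(lower.Fo 1 xi + lower.Fo (- 1) xi) / 2 - (upper.Fo 1 xi + upper.Fo (- 1) xi) / 2 = - g xi" for xi
  unfolding lower.Fo_def upper.Fo_def by (rule interface_jump[OF mu prof])
 have "FF (\<lambda>xi. - 1 * g xi) (mu * X) = FF (\<lambda>xi. (lower.Fo 1 xi + lower.Fo (- 1) xi) / 2) (mu * X) - FF (\<lambda>xi. (upper.Fo 1 xi + upper.Fo (- 1) xi) / 2) (mu * X)"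
  unfolding FF_diff[OF i, symmetric] j by simp
 then have "Re (FF (\<lambda>xi. (lower.Fo 1 xi + lower.Fo (- 1) xi) / 2) (mu * X)) - Re (FF (\<lambda>xi. (upper.Fo 1 xi + upper.Fo (- 1) xi) / 2) (mu * X)) = - Re (FF g (mu * X))"
  unfolding FF_cmult by (simp add: complex_eq_iff)
 then show ?thesis unfolding lower.interface_even_part upper.interface_even_part lower.eta_def
  by (simp add: right_diff_distrib[symmetric])
qed

text \<open>In the upper layer the vertical coordinate is reversed, which changes the sign of \<open>V\<close>.\<close>

definition "U r = (if snd r \<le> h + \<eta> (fst r)
  then Re (lower.GG (Complex (fst r) (snd r))) + w0 * (snd r - h) + aa + ep mu
  else Re (upper.GG (Complex (fst r) (1 - snd r))) + w1 * (snd r - h) + aa + ep mu)"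
definition "V r = (if snd r \<le> h + \<eta> (fst r)
  then - Im (lower.GG (Complex (fst r) (snd r))) else Im (upper.GG (Complex (fst r) (1 - snd r))))"

lemma top_values:
 "lower.GG (Complex X (h + \<eta> X)) = lower.ff X 1" "upper.GG (Complex X (1 - (h + \<eta> X))) = upper.ff X 1"
 using lower.GG_top[of X] upper.GG_top[of X] by (simp_all add: DD algebra_simps)

lemma UV_lower:
 assumes "Y \<le> h + \<eta> X"
 shows "U (X, Y) = Re (lower.GG (Complex X Y)) + w0 * (Y - h) + aa + ep mu" "V (X, Y) = - Im (lower.GG (Complex X Y))"
 using assms by (auto simp: U_def V_def)

lemma UV_upper:
 assumes "h + \<eta> X \<le> Y"
 shows "U (X, Y) = Re (upper.GG (Complex X (1 - Y))) + w1 * (Y - h) + aa + ep mu" "V (X, Y) = Im (upper.GG (Complex X (1 - Y)))"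
proof -
 have "U (X, h + \<eta> X) = Re (upper.GG (Complex X (1 - (h + \<eta> X)))) + w1 * (h + \<eta> X - h) + aa + ep mu"
  using jump[of X] w unfolding top_values UV_lower(1)[OF order_refl] by (simp add: algebra_simps)
 moreover have "V (X, h + \<eta> X) = Im (upper.GG (Complex X (1 - (h + \<eta> X))))" proof -
  have "aa + ep mu + w0 * \<eta> X + Re (lower.ff X 1) = aa + ep mu + w1 * \<eta> X + Re (upper.ff X 1)"
   using jump[of X] w by (simp add: algebra_simps)
  then show ?thesis using lower.kinematic[of X] upper.kinematic[of X] unfolding top_values UV_lower(2)[OF order_refl] by simp
 qed
 ultimately show "U (X, Y) = Re (upper.GG (Complex X (1 - Y))) + w1 * (Y - h) + aa + ep mu" "V (X, Y) = Im (upper.GG (Complex X (1 - Y)))"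
  using assms by (cases "Y = h + \<eta> X"; force simp: U_def V_def)+
qed

definition "Om0 = Omega0 h \<eta>"
definition "Om1 = Omega1 h \<eta>"
definition "K0 = {r :: real \<times> real. 0 \<le> snd r \<and> snd r \<le> h + \<eta> (fst r)}"
definition "K1 = {r :: real \<times> real. h + \<eta> (fst r) \<le> snd r \<and> snd r \<le> 1}"

lemma eta_cont2: "continuous_on S f \<Longrightarrow> continuous_on S (\<lambda>x. \<eta> (f x))"
 by (rule continuous_on_compose2[OF lower.eta_cont _ subset_UNIV])

lemma regions: "open Om0" "open Om1" "closed K0" "closed K1" "Om0 \<subseteq> K0" "Om1 \<subseteq> K1" "K0 \<union> K1 = channel"
proof -
 have "Om0 = {r. 0 < snd r} \<inter> {r. snd r < h + \<eta> (fst r)}" "Om1 = {r. h + \<eta> (fst r) < snd r} \<inter> {r. snd r < 1}"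
  by (auto simp: Om0_def Omega0_def Om1_def Omega1_def)
 then show "open Om0" "open Om1" by (auto intro!: open_Int open_Collect_less continuous_intros eta_cont2)
 show "closed K0" "closed K1" unfolding K0_def K1_def
  by (intro closed_Collect_conj closed_Collect_le continuous_intros eta_cont2)+
 show "Om0 \<subseteq> K0" "Om1 \<subseteq> K1" by (auto simp: Om0_def Omega0_def Om1_def Omega1_def K0_def K1_def)
 have "0 \<le> Y \<and> Y \<le> h + \<eta> X \<or> h + \<eta> X \<le> Y \<and> Y \<le> 1 \<longleftrightarrow> 0 \<le> Y \<and> Y \<le> 1" for X Y
  using eta_range[of X] by linarith
 then show "K0 \<union> K1 = channel" unfolding K0_def K1_def channel_def by (intro set_eqI) (simp add: mem_Times_iff)
qed

text \<open>The upper field in the coordinates of the channel; conjugating twice keeps it holomorphic.\<close>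

definition "RU z = cnj (upper.GG (cnj (z - \<i>)))"
definition "RU' z = cnj (upper.GG' (cnj (z - \<i>)))"

lemma RU_eq: "RU (Complex X Y) = cnj (upper.GG (Complex X (1 - Y)))" "RU' (Complex X Y) = cnj (upper.GG' (Complex X (1 - Y)))"
proof -
 have "cnj (Complex X Y - \<i>) = Complex X (1 - Y)" by (simp add: complex_eq_iff)
 then show "RU (Complex X Y) = cnj (upper.GG (Complex X (1 - Y)))" "RU' (Complex X Y) = cnj (upper.GG' (Complex X (1 - Y)))"
  by (simp_all add: RU_def RU'_def)
qed

lemma mem0: "(X, Y) \<in> K0 \<Longrightarrow> Complex X Y \<in> lower.CL" "(X, Y) \<in> Om0 \<Longrightarrow> abs Y < lower.DD X"
 by (auto simp: K0_def lower.CL_def DD Om0_def Omega0_def)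

lemma mem1: "(X, Y) \<in> K1 \<Longrightarrow> Complex X (1 - Y) \<in> upper.CL" "(X, Y) \<in> Om1 \<Longrightarrow> abs (1 - Y) < upper.DD X"
 by (auto simp: K1_def upper.CL_def DD Om1_def Omega1_def)

lemma Complex_cont: "continuous_on S f \<Longrightarrow> continuous_on S k \<Longrightarrow> continuous_on S (\<lambda>x. Complex (f x) (k x))"
 unfolding Complex_eq by (intro continuous_intros)

lemma lower_cont: "continuous_on K0 (\<lambda>r. lower.GG (Complex (fst r) (snd r)))" "continuous_on K0 (\<lambda>r. lower.GG' (Complex (fst r) (snd r)))"
 by (rule continuous_on_compose2[OF lower.GG_cont(1)] continuous_on_compose2[OF lower.GG_cont(2)];
   use mem0(1) in \<open>auto intro!: Complex_cont continuous_intros\<close>)+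

lemma upper_cont: "continuous_on K1 (\<lambda>r. RU (Complex (fst r) (snd r)))" "continuous_on K1 (\<lambda>r. RU' (Complex (fst r) (snd r)))"
proof -
 have "continuous_on K1 (\<lambda>r. upper.GG (Complex (fst r) (1 - snd r)))" "continuous_on K1 (\<lambda>r. upper.GG' (Complex (fst r) (1 - snd r)))"
  by (rule continuous_on_compose2[OF upper.GG_cont(1)] continuous_on_compose2[OF upper.GG_cont(2)];
   use mem1(1) in \<open>auto intro!: Complex_cont continuous_intros\<close>)+
 then show "continuous_on K1 (\<lambda>r. RU (Complex (fst r) (snd r)))" "continuous_on K1 (\<lambda>r. RU' (Complex (fst r) (snd r)))"
  unfolding RU_eq by (intro continuous_on_cnj; simp)+
qed

lemma RU_deriv:
 assumes "(X, Y) \<in> Om1" shows "(RU has_field_derivative RU' (Complex X Y)) (at (Complex X Y))" proof -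
 let ?z = "Complex X Y - \<i>"
 have e: "cnj ?z = Complex X (1 - Y)" by (simp add: complex_eq_iff)
 have "(upper.GG has_field_derivative upper.GG' (cnj ?z)) (at (cnj ?z))"
  unfolding e using mem1(2)[OF assms] by (intro upper.GG_deriv) simp
 then have "(cnj \<circ> upper.GG \<circ> cnj has_field_derivative cnj (upper.GG' (cnj ?z))) (at ?z)"
  using has_field_derivative_cnj_cnj[of upper.GG "upper.GG' (cnj ?z)" ?z] by simp
 moreover have "((\<lambda>z. z - \<i>) has_field_derivative 1) (at (Complex X Y))" by (auto intro!: derivative_eq_intros)
 ultimately have "((\<lambda>z. (cnj \<circ> upper.GG \<circ> cnj) (z - \<i>)) has_field_derivative cnj (upper.GG' (cnj ?z)) * 1) (at (Complex X Y))"
  by (rule DERIV_chain2)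
 then show ?thesis unfolding RU_def[abs_def] RU'_def by (simp add: o_def)
qed

lemma eta_Cn: "n + 3 \<le> s \<Longrightarrow> Cn_closure n UNIV \<eta>" proof -
 assume n: "n + 3 \<le> s"
 have "bnd (n + 3) C g" by (rule bnd_weaken[OF lower.gb(1) n order_refl])
 from Cn_closure_FF[OF this, of "of_real (ep mu)" mu]
 show ?thesis by (simp add: lower.eta_def[abs_def])
qed

lemma n_bounds: "0 \<le> aa" "0 \<le> ep mu" using aa ep_bounds[OF mu] by auto

lemma region_range: "(X, Y) \<in> K0 \<union> K1 \<Longrightarrow> abs Y \<le> 1" unfolding regions(7) by (simp add: channel_def)

lemma lower_fields:
 "Cn_closure 1 Om0 U" "Cn_closure 1 Om0 V" "\<And>r. r \<in> Om0 \<Longrightarrow> dX U r + dY V r = 0"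
 "\<And>r. r \<in> Om0 \<Longrightarrow> dY U r - dX V r = w0" "real_analytic_on2 U Om0" "real_analytic_on2 V Om0" proof -
 have D: "(lower.GG has_field_derivative lower.GG' (Complex x y)) (at (Complex x y))" if "(x, y) \<in> Om0" for x y
  using mem0(2)[OF that] by (intro lower.GG_deriv) simp
 have UV: "U (x, y) = Re (lower.GG (Complex x y)) + w0 * y + (aa + ep mu - w0 * h)" "V (x, y) = - Im (lower.GG (Complex x y))"
  if "(x, y) \<in> Om0" for x y using UV_lower[of y x] that by (simp_all add: Om0_def Omega0_def algebra_simps)
 have K: "(x, y) \<in> K0" if "(x, y) \<in> Om0" for x y using that regions(5) by blast
 note b = lower.GG_bound(1)[OF mem0(1)[OF K]] lower.GG_bound(2)[OF mem0(1)[OF K]] region_range[OF UnI1[OF K]]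
 note cv = complex_velocity[of Om0 K0 lower.GG lower.GG' U w0 _ V, OF regions(1,3,5) D lower_cont UV b]
 show "Cn_closure 1 Om0 U" "Cn_closure 1 Om0 V" "real_analytic_on2 U Om0" "real_analytic_on2 V Om0"
  by (rule cv(1) cv(2) cv(5) cv(6); assumption)+
 show "dX U r + dY V r = 0" "dY U r - dX V r = w0" if "r \<in> Om0" for r by (rule cv(3) cv(4); (assumption | rule that))+
qed

lemma upper_fields:
 "Cn_closure 1 Om1 U" "Cn_closure 1 Om1 V" "\<And>r. r \<in> Om1 \<Longrightarrow> dX U r + dY V r = 0"
 "\<And>r. r \<in> Om1 \<Longrightarrow> dY U r - dX V r = w1" "real_analytic_on2 U Om1" "real_analytic_on2 V Om1" proof -
 have UV: "U (x, y) = Re (RU (Complex x y)) + w1 * y + (aa + ep mu - w1 * h)" "V (x, y) = - Im (RU (Complex x y))"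
  if "(x, y) \<in> Om1" for x y using UV_upper[of x y] that by (simp_all add: Om1_def Omega1_def RU_eq algebra_simps)
 have K: "(x, y) \<in> K1" if "(x, y) \<in> Om1" for x y using that regions(6) by blast
 have b: "norm (RU (Complex x y)) \<le> ep mu * (upper.BF * wint)" "norm (RU' (Complex x y)) \<le> ep mu * mu * (upper.BF * wint)"
  if "(x, y) \<in> Om1" for x y unfolding RU_eq complex_mod_cnj by (rule upper.GG_bound[OF mem1(1)[OF K[OF that]]])+
 note cv = complex_velocity[of Om1 K1 RU RU' U w1 _ V, OF regions(2,4,6) RU_deriv upper_cont UV b region_range[OF UnI2[OF K]]]
 show "Cn_closure 1 Om1 U" "Cn_closure 1 Om1 V" "real_analytic_on2 U Om1" "real_analytic_on2 V Om1"
  by (rule cv(1) cv(2) cv(5) cv(6); assumption)+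
 show "dX U r + dY V r = 0" "dY U r - dX V r = w1" if "r \<in> Om1" for r by (rule cv(3) cv(4); (assumption | rule that))+
qed

lemma UV_cont: "continuous_on channel U" "continuous_on channel V" proof -
 have l: "continuous_on K0 (\<lambda>r. Re (lower.GG (Complex (fst r) (snd r))) + w0 * (snd r - h) + aa + ep mu)"
  "continuous_on K0 (\<lambda>r. - Im (lower.GG (Complex (fst r) (snd r))))" by (intro continuous_intros lower_cont)+
 have u: "continuous_on K1 (\<lambda>r. Re (RU (Complex (fst r) (snd r))) + w1 * (snd r - h) + aa + ep mu)"
  "continuous_on K1 (\<lambda>r. - Im (RU (Complex (fst r) (snd r))))" by (intro continuous_intros upper_cont)+
 have "continuous_on K0 U" by (rule continuous_on_eq[OF l(1)]) (use UV_lower(1) in \<open>auto simp: K0_def\<close>)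
 moreover have "continuous_on K0 V" by (rule continuous_on_eq[OF l(2)]) (use UV_lower(2) in \<open>auto simp: K0_def\<close>)
 moreover have "continuous_on K1 U" by (rule continuous_on_eq[OF u(1)]) (use UV_upper(1) in \<open>auto simp: K1_def RU_eq\<close>)
 moreover have "continuous_on K1 V" by (rule continuous_on_eq[OF u(2)]) (use UV_upper(2) in \<open>auto simp: K1_def RU_eq\<close>)
 ultimately show "continuous_on channel U" "continuous_on channel V"
  unfolding regions(7)[symmetric] by (auto intro: continuous_on_closed_Un regions)
qed

lemma closure_layers: "closure (Om0 \<union> Om1) \<subseteq> channel"
 using regions(5-7) by (intro closure_minimal) (auto simp: channel_def intro: closed_Times)

theorem solution: "two_layer_solution h w0 w1 U V \<eta>" unfolding two_layer_solution_def Om0_def[symmetric] Om1_def[symmetric]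
proof (intro conjI allI ballI)
 show "Cn_closure 2 UNIV \<eta>" using s5 by (intro eta_Cn) simp
 fix X show "0 < h + \<eta> X" "h + \<eta> X < 1" by (rule eta_range)+
next
 fix W assume "W \<in> {U, V}"
 then have W: "W = U \<or> W = V" by simp
 show "Cn_closure 1 Om0 W" "Cn_closure 1 Om1 W" using W lower_fields(1,2) upper_fields(1,2) by blast+
 have c: "continuous_on channel W" using W UV_cont by blast
 show c': "continuous_on (closure (Om0 \<union> Om1)) W" by (rule continuous_on_subset[OF c closure_layers])
 have "C0_closure Om0 W" "C0_closure Om1 W" using \<open>Cn_closure 1 Om0 W\<close> \<open>Cn_closure 1 Om1 W\<close> by simp_all
 then have "bounded (W ` (Om0 \<union> Om1))" unfolding C0_closure_def image_Un bounded_Un by blast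
 then show "Cn_closure 0 (Om0 \<union> Om1) W" using c' by (auto simp: C0_closure_def)
next
 fix r
 show "r \<in> Om0 \<union> Om1 \<Longrightarrow> dX U r + dY V r = 0" using lower_fields(3) upper_fields(3) by blast
 show "r \<in> Om0 \<Longrightarrow> dY U r - dX V r = w0" "r \<in> Om1 \<Longrightarrow> dY U r - dX V r = w1" by (rule lower_fields upper_fields; assumption)+
next
 fix X
 show "V (X, 1) = 0" using UV_upper(2)[of X 1] eta_range[of X] upper.GG_wall[of "Complex X 0"] by simp
 show "V (X, 0) = 0" using UV_lower(2)[of 0 X] eta_range[of X] lower.GG_wall[of "Complex X 0"] by simp
 have "deriv \<eta> X = lower.deta X" by (rule DERIV_imp_deriv[OF lower.eta_deriv])
 then show "deriv \<eta> X * U (X, h + \<eta> X) - V (X, h + \<eta> X) = 0"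
  using lower.kinematic[of X] unfolding UV_lower[OF order_refl] top_values by (simp add: algebra_simps)
qed

lemma eta_localised: "localised \<eta>" proof -
 have "((\<lambda>X. ep mu * Re (FF g (mu * X))) \<longlongrightarrow> ep mu * Re 0) at_top"
  by (intro tendsto_intros filterlim_compose[OF FF_tendsto_0_at_top[OF lower.gb(1) s2]] filterlim_tendsto_pos_mult_at_top[OF tendsto_const mu(1)] filterlim_ident)
 moreover have "((\<lambda>X. ep mu * Re (FF g (mu * X))) \<longlongrightarrow> ep mu * Re 0) at_bot"
  by (intro tendsto_intros filterlim_compose[OF FF_tendsto_0_at_bot[OF lower.gb(1) s2]] filterlim_tendsto_pos_mult_at_bot[OF tendsto_const mu(1)] filterlim_ident)
 ultimately show ?thesis by (simp add: localised_def lower.eta_def[abs_def])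
qed

lemma UV_symmetric:
 assumes "Y \<in> {0..1}" shows "U (- X, Y) = U (X, Y)" "V (- X, Y) = - V (X, Y)" proof -
 have "(X, Y) \<in> K0 \<union> K1" using assms unfolding regions(7) by (simp add: channel_def)
 then have "(X, Y) \<in> K0 \<or> (X, Y) \<in> K1" by simp
 then have "U (- X, Y) = U (X, Y) \<and> V (- X, Y) = - V (X, Y)" proof
  assume k: "(X, Y) \<in> K0"
  then have Y: "Y \<le> h + \<eta> X" by (simp add: K0_def)
  then have Y': "Y \<le> h + \<eta> (- X)" by (simp add: lower.eta_even)
  have "Complex (- X) Y = - cnj (Complex X Y)" by (simp add: complex_eq_iff)
  then show ?thesis unfolding UV_lower[OF Y] UV_lower[OF Y'] using lower.GG_reflect[OF mem0(1)[OF k]] by simp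
 next
  assume k: "(X, Y) \<in> K1"
  then have Y: "h + \<eta> X \<le> Y" by (simp add: K1_def)
  then have Y': "h + \<eta> (- X) \<le> Y" by (simp add: lower.eta_even)
  have "Complex (- X) (1 - Y) = - cnj (Complex X (1 - Y))" by (simp add: complex_eq_iff)
  then show ?thesis unfolding UV_upper[OF Y] UV_upper[OF Y'] using upper.GG_reflect[OF mem1(1)[OF k]] by simp
 qed
 then show "U (- X, Y) = U (X, Y)" "V (- X, Y) = - V (X, Y)" by auto
qed

lemma UV_analytic: "real_analytic_on2 U (Om0 \<union> Om1)" "real_analytic_on2 V (Om0 \<union> Om1)"
 using lower_fields(5,6) upper_fields(5,6) unfolding real_analytic_on2_def by blast+

end

section \<open>Comparison with the explicit approximation\<close>

lemma scaled_FF_bounds: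
 assumes b: "bnd r A b" "3 \<le> r" and e: "0 \<le> e" "0 \<le> mu"
 shows "abs (e * Re (FF b (mu * X))) \<le> e * (A * wint)" "abs (e * Re (\<i> * FF (slope mu b) (mu * X))) \<le> e * mu * (A * wint)"
proof -
 obtain r' where r': "r = Suc r'" "2 \<le> r'" using b(2) by (cases r) auto
 have "abs (Re (FF b (mu * X))) \<le> A * wint"
  using abs_Re_le_cmod[of "FF b (mu * X)"] FF_bound[OF b(1), of "mu * X"] b(2) by linarith
 then show "abs (e * Re (FF b (mu * X))) \<le> e * (A * wint)" using e by (simp add: abs_mult mult_left_mono)
 have "bnd r' A (\<lambda>xi. xi * b xi)" using b(1) unfolding r' by (rule bnd_xi)
 from FF_bound[OF this r'(2), of "mu * X"]
 have "abs (Re (\<i> * FF (\<lambda>xi. xi * b xi) (mu * X))) \<le> A * wint"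
  using abs_Im_le_cmod[of "FF (\<lambda>xi. xi * b xi) (mu * X)"] by simp
 then have "e * mu * abs (Re (\<i> * FF (\<lambda>xi. xi * b xi) (mu * X))) \<le> e * mu * (A * wint)" using e by (intro mult_left_mono) auto
 moreover have "e * Re (\<i> * FF (slope mu b) (mu * X)) = e * mu * Re (\<i> * FF (\<lambda>xi. xi * b xi) (mu * X))"
  unfolding mult.assoc[of mu] FF_cmult by simp
 ultimately show "abs (e * Re (\<i> * FF (slope mu b) (mu * X))) \<le> e * mu * (A * wint)"
  using e by (simp only: abs_mult abs_of_nonneg)
qed

locale soliton_flow = flow +
 fixes G :: real
 assumes g0G: "bnd s G g0"
  and small0: "ep mu * (G * wint) < h" "ep mu * (G * wint) < 1 - h"
begin

definition "ebar X = ep mu * Re (FF g0 (mu * X))"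
definition "debar X = ep mu * Re (\<i> * FF (slope mu g0) (mu * X))"
abbreviation "deta \<equiv> lower.deta"

lemma m0: "0 \<le> mu" "0 < ep mu" "0 \<le> ep mu" "ep mu \<le> 2 * mu\<^sup>2" "mu\<^sup>2 \<le> 1" "3 \<le> s"
 using mu ep_bounds[OF mu] s5 by (auto simp: abs_square_le_1)

lemma eta_bar_eq: "eta_bar h w0 w1 (ep mu) X = ebar X" proof -
 have "sqrt (3 * ep mu) = sqrt ((2 * aa * mu)\<^sup>2)" by (simp add: ep_def power2_eq_square)
 also have "... = 2 * aa * mu" using mu n_bounds by (simp add: real_sqrt_abs)
 finally have "sqrt (3 * ep mu) / (2 * h * (1 - h)) = mu" using h by (simp add: aa_def)
 moreover have "FF g0 (mu * X) = of_real (- (3 / theta h w0 w1)) * sech2 (mu * X)"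
  unfolding g0_def[abs_def] FF_cmult FF_s0 by simp
 ultimately show ?thesis by (simp add: eta_bar_def ebar_def sech2_def power_divide)
qed

lemma ebar_deriv: "(ebar has_real_derivative debar X) (at X)" proof -
 have "((\<lambda>X. ep mu * Re (FF g0 (mu * X))) has_vector_derivative ep mu * Re (of_real mu * (\<i> * FF (\<lambda>xi. xi * g0 xi) (mu * X)))) (at X)"
  by (intro has_vector_derivative_mult_right bounded_linear.has_vector_derivative[OF bounded_linear_Re] FF_scale_deriv[OF g0G m0(6)])
 moreover have "Re (of_real mu * (\<i> * FF (\<lambda>xi. xi * g0 xi) (mu * X))) = Re (\<i> * FF (slope mu g0) (mu * X))"
  unfolding mult.assoc[of mu] FF_cmult by simp
 ultimately show ?thesis unfolding ebar_def[abs_def] debar_def has_real_derivative_iff_has_vector_derivative by (simp only:)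
qed

lemma ebar_cont: "continuous_on S f \<Longrightarrow> continuous_on S (\<lambda>x. ebar (f x))"
 by (rule continuous_on_compose2[OF DERIV_continuous_on[OF has_field_derivative_at_within[OF ebar_deriv]] _ subset_UNIV])

lemma debar_cont: "continuous_on S f \<Longrightarrow> continuous_on S (\<lambda>x. debar (f x))" proof -
 assume f: "continuous_on S f"
 obtain r' where r': "s = Suc r'" "2 \<le> r'" using m0(6) by (cases s) auto
 have "bnd r' (abs mu * G) (\<lambda>xi. mu * (xi * g0 xi))" using g0G unfolding r' by (intro bnd_cmult bnd_xi)
 then have c: "continuous_on UNIV (FF (slope mu g0))" using FF_continuous[OF _ r'(2)] by (simp add: mult.assoc)
 have "continuous_on S (\<lambda>x. FF (slope mu g0) (mu * f x))"
  by (rule continuous_on_compose2[OF c _ subset_UNIV]) (intro continuous_on_mult continuous_on_const f)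
 then show ?thesis unfolding debar_def by (intro continuous_on_Re continuous_on_mult continuous_on_const)
qed

lemma close: "bndm mu s (C * mu\<^sup>2) (\<lambda>xi. g xi - g0 xi)" using prof by (simp add: profile_def)

lemma eta_bounds:
 "abs (\<eta> X) \<le> ep mu * (C * wint)" "abs (deta X) \<le> ep mu * mu * (C * wint)"
 "abs (ebar X) \<le> ep mu * (G * wint)" "abs (debar X) \<le> ep mu * mu * (G * wint)"
 "abs (\<eta> X - ebar X) \<le> ep mu * (C * mu\<^sup>2 * wint)" "abs (deta X - debar X) \<le> ep mu * mu * (C * mu\<^sup>2 * wint)"
proof -
 note cb = bndm_bnd(1)[OF m0(1) close]
 show "abs (\<eta> X) \<le> ep mu * (C * wint)" "abs (deta X) \<le> ep mu * mu * (C * wint)" by (rule lower.deta_bound)+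
 show "abs (ebar X) \<le> ep mu * (G * wint)" "abs (debar X) \<le> ep mu * mu * (G * wint)"
  unfolding ebar_def debar_def by (rule scaled_FF_bounds[OF g0G m0(6,3,1)])+
 note i = bnd_integrable(1)[OF lower.gb(1) s2] bnd_integrable(1)[OF g0G s2]
 have "\<eta> X - ebar X = ep mu * Re (FF (\<lambda>xi. g xi - g0 xi) (mu * X))"
  unfolding FF_diff[OF i] lower.eta_def ebar_def by (simp add: right_diff_distrib)
 then show "abs (\<eta> X - ebar X) \<le> ep mu * (C * mu\<^sup>2 * wint)"
  using scaled_FF_bounds(1)[OF cb m0(6,3,1), of X] by simp
 obtain r' where r': "s = Suc r'" "2 \<le> r'" using m0(6) by (cases s) auto
 have "bnd r' (abs mu * G) (\<lambda>xi. mu * (xi * g0 xi))" using g0G unfolding r' by (intro bnd_cmult bnd_xi)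
 from bnd_integrable(1)[OF this r'(2)] have j: "integrable lborel (slope mu g0)" by (simp only: mult.assoc)
 have "FF (\<lambda>xi. mu * xi * (g xi - g0 xi)) (mu * X) = FF (slope mu g) (mu * X) - FF (slope mu g0) (mu * X)"
  unfolding right_diff_distrib by (rule FF_diff[OF bnd_integrable(1)[OF lower.gb(2) s2] j])
 then have "deta X - debar X = ep mu * Re (\<i> * FF (\<lambda>xi. mu * xi * (g xi - g0 xi)) (mu * X))"
  unfolding lower.deta_def debar_def by (simp add: right_diff_distrib)
 then show "abs (deta X - debar X) \<le> ep mu * mu * (C * mu\<^sup>2 * wint)"
  using scaled_FF_bounds(2)[OF cb m0(6,3,1), of X] by (simp only:)
qed

lemma ebar_range: "0 < h + ebar X" "h + ebar X < 1" using eta_bounds(3)[of X] small0 by auto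

lemma C_nonneg: "0 \<le> C" "0 \<le> C * wint" "0 \<le> G * wint" using bndm_nonneg[OF gC(1)] bndD(4)[OF g0G] wint_nonneg by auto

lemma ratio: "aa / h = 1 - h" "aa / (1 - h) = h" using h by (simp_all add: aa_def)

lemma WB_le: "lower.WB \<le> 3 * C * mu\<^sup>2" "upper.WB \<le> 3 * C * mu\<^sup>2" proof -
 have "ep mu * C \<le> 2 * mu\<^sup>2 * C" by (rule mult_right_mono[OF m0(4) C_nonneg(1)])
 then show "lower.WB \<le> 3 * C * mu\<^sup>2" "upper.WB \<le> 3 * C * mu\<^sup>2" unfolding lower.WB_def upper.WB_def by (simp_all add: mult_ac)
qed

lemma U_lower_approx:
 assumes "(X, Y) \<in> K0"
 shows "abs (U (X, Y) - (w0 * (Y - h) + aa + ep mu - (1 - h) * \<eta> X)) \<le> 3 * (ep mu * (C * mu\<^sup>2 * wint))" proof -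
 have Y: "Y \<le> h + \<eta> X" using assms by (simp add: K0_def)
 have "abs (Re (lower.GG (Complex X Y)) + (1 - h) * \<eta> X) \<le> ep mu * (lower.WB * wint)"
  using lower.u_approx[OF lower.tt_mem[OF mem0(1)[OF assms]], of X] by (simp add: lower.GG_def ratio)
 also have "... \<le> ep mu * (3 * C * mu\<^sup>2 * wint)" by (intro mult_left_mono mult_right_mono WB_le m0 wint_nonneg)
 finally show ?thesis unfolding UV_lower(1)[OF Y] by (simp add: algebra_simps)
qed

lemma U_upper_approx:
 assumes "(X, Y) \<in> K1"
 shows "abs (U (X, Y) - (w1 * (Y - h) + aa + ep mu + h * \<eta> X)) \<le> 3 * (ep mu * (C * mu\<^sup>2 * wint))" proof -
 have Y: "h + \<eta> X \<le> Y" using assms by (simp add: K1_def)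
 have "abs (Re (upper.GG (Complex X (1 - Y))) - h * \<eta> X) \<le> ep mu * (upper.WB * wint)"
  using upper.u_approx[OF upper.tt_mem[OF mem1(1)[OF assms]], of X] by (simp add: upper.GG_def ratio)
 also have "... \<le> ep mu * (3 * C * mu\<^sup>2 * wint)" by (intro mult_left_mono mult_right_mono WB_le m0 wint_nonneg)
 finally show ?thesis unfolding UV_upper(1)[OF Y] by (simp add: algebra_simps)
qed

definition "Ub X Y = (if Y \<le> h + ebar X then w0 * (Y - h) + aa + ep mu - (1 - h) * ebar X else w1 * (Y - h) + aa + ep mu + h * ebar X)"

lemma U_bar_eq: "U_bar h w0 w1 (ep mu) (X, Y) = Ub X Y" by (simp add: U_bar_def Ub_def eta_bar_eq aa_def)

text \<open>The two branches of the approximate velocity differ by the height above the approximate interface.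
Between the two interfaces, where the exact and the approximate velocity use different branches, the
difference is thus at most the distance of the interfaces, which is \<open>O(\<epsilon>\<^sup>2)\<close>.\<close>

lemma branch_difference: "w0 * (Y - h) - (1 - h) * e - (w1 * (Y - h) + h * e) = Y - h - e" using w by (simp add: algebra_simps)

lemma Ub_cases:
 obtains "Y \<le> h + ebar X" "Ub X Y = w0 * (Y - h) + aa + ep mu - (1 - h) * ebar X"
 | "h + ebar X < Y" "Ub X Y = w1 * (Y - h) + aa + ep mu + h * ebar X" by (cases "Y \<le> h + ebar X") (auto simp: Ub_def)

lemma channel_cases:
 assumes "(X, Y) \<in> channel" obtains "(X, Y) \<in> K0" "Y \<le> h + \<eta> X" | "(X, Y) \<in> K1" "h + \<eta> X \<le> Y"
proof -
 have "(X, Y) \<in> K0 \<or> (X, Y) \<in> K1" using assms unfolding regions(7)[symmetric] by simp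
 moreover have "(X, Y) \<in> K0 \<Longrightarrow> Y \<le> h + \<eta> X" "(X, Y) \<in> K1 \<Longrightarrow> h + \<eta> X \<le> Y" by (simp_all add: K0_def K1_def)
 ultimately show thesis using that by blast
qed

lemma weight_diff: "abs ((1 - h) * x) \<le> abs x" "abs (h * x) \<le> abs x" using h by (auto simp: abs_mult mult_left_le_one_le)

lemma U_approx:
 assumes "(X, Y) \<in> channel"
 shows "abs (U (X, Y) - Ub X Y) \<le> 5 * (ep mu * (C * mu\<^sup>2 * wint))" proof -
 define R where "R = ep mu * (C * mu\<^sup>2 * wint)"
 define D where "D = \<eta> X - ebar X"
 have D: "abs D \<le> R" unfolding D_def R_def by (rule eta_bounds)
 have tri: "abs (x - y) \<le> 5 * R" if "abs (x - z) \<le> 3 * R" "abs (z - y) \<le> 2 * R" for x y z using that by linarith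
 have wd: "abs ((1 - h) * D) \<le> R" "abs (h * D) \<le> R" using weight_diff[of D] D by linarith+
 define E where "E = Y - h - ebar X"
 have E: "w0 * (Y - h) - (1 - h) * ebar X = w1 * (Y - h) + h * ebar X + E"
  using branch_difference[of Y "ebar X"] by (simp add: E_def)
 from assms show ?thesis unfolding R_def[symmetric] proof (cases rule: channel_cases)
  case 1
  let ?z = "w0 * (Y - h) + aa + ep mu - (1 - h) * \<eta> X"
  have z: "?z = w0 * (Y - h) + aa + ep mu - (1 - h) * ebar X - (1 - h) * D" by (simp add: D_def algebra_simps)
  have ED: "E \<le> D" using 1(2) by (simp add: E_def D_def)
  have "abs (?z - Ub X Y) \<le> 2 * R" proof (cases rule: Ub_cases[of Y X])
   case 1
   have "?z - Ub X Y = - ((1 - h) * D)" unfolding z 1(2) by simp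
   then show ?thesis using wd by linarith
  next
   case 2
   have "?z - Ub X Y = E - (1 - h) * D" unfolding z 2(2) using E by simp
   moreover have "0 < E" using 2(1) by (simp add: E_def)
   ultimately show ?thesis using ED D wd(1) by linarith
  qed
  with U_lower_approx[OF 1(1)] show "abs (U (X, Y) - Ub X Y) \<le> 5 * R" unfolding R_def[symmetric] by (rule tri)
 next
  case 2
  let ?z = "w1 * (Y - h) + aa + ep mu + h * \<eta> X"
  have z: "?z = w1 * (Y - h) + aa + ep mu + h * ebar X + h * D" by (simp add: D_def algebra_simps)
  have ED: "D \<le> E" using 2(2) by (simp add: E_def D_def)
  have "abs (?z - Ub X Y) \<le> 2 * R" proof (cases rule: Ub_cases[of Y X])
   case 1
   have "?z - Ub X Y = h * D - E" unfolding z 1(2) using E by simp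
   moreover have "E \<le> 0" using 1(1) by (simp add: E_def)
   ultimately show ?thesis using ED D wd(2) by linarith
  next
   case 2
   have "?z - Ub X Y = h * D" unfolding z 2(2) by simp
   then show ?thesis using wd by linarith
  qed
  with U_upper_approx[OF 2(1)] show "abs (U (X, Y) - Ub X Y) \<le> 5 * R" unfolding R_def[symmetric] by (rule tri)
 qed
qed

definition "Vb X Y = (if Y \<le> h + ebar X then (1 - h) * Y * debar X else (h * (1 - Y) + ebar X) * debar X)"

lemma dX_Ub: "Y < h + ebar X \<Longrightarrow> dX (U_bar h w0 w1 (ep mu)) (X, Y) = - (1 - h) * debar X"
 "h + ebar X < Y \<Longrightarrow> dX (U_bar h w0 w1 (ep mu)) (X, Y) = h * debar X" proof -
 have d: "((\<lambda>t. ebar (X + t)) has_real_derivative debar X) (at 0)"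
  using DERIV_shift[of ebar "debar X" 0 X] ebar_deriv[of X] by (simp add: add.commute)
 have c: "((\<lambda>t. h + ebar (X + t)) \<longlongrightarrow> h + ebar X) (nhds 0)" proof -
  have "((\<lambda>t. ebar (X + t)) \<longlongrightarrow> ebar (X + 0)) (nhds 0)"
   using DERIV_isCont[OF d] tendsto_at_iff_tendsto_nhds[of "\<lambda>t. ebar (X + t)" 0] by (simp add: isCont_def)
  then show ?thesis by (intro tendsto_intros) simp
 qed
 have e: "U_bar h w0 w1 (ep mu) ((X, Y) + t *\<^sub>R (1, 0)) = Ub (X + t) Y" for t by (simp add: U_bar_eq)
 show "dX (U_bar h w0 w1 (ep mu)) (X, Y) = - (1 - h) * debar X" if "Y < h + ebar X"
  unfolding partial_deriv_def e proof (rule DERIV_imp_deriv)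
  have A: "((\<lambda>t. w0 * (Y - h) + aa + ep mu - (1 - h) * ebar (X + t)) has_real_derivative - (1 - h) * debar X) (at 0)"
   by (rule derivative_eq_intros refl d)+ (simp add: algebra_simps)
  have B: "\<forall>\<^sub>F t in nhds 0. w0 * (Y - h) + aa + ep mu - (1 - h) * ebar (X + t) = Ub (X + t) Y"
   using order_tendstoD(1)[OF c that] by eventually_elim (simp add: Ub_def)
  show "((\<lambda>t. Ub (X + t) Y) has_real_derivative - (1 - h) * debar X) (at 0)"
   by (rule DERIV_cong_ev[OF refl B refl, THEN iffD1, OF A])
 qed
 show "dX (U_bar h w0 w1 (ep mu)) (X, Y) = h * debar X" if "h + ebar X < Y" unfolding partial_deriv_def e
 proof (rule DERIV_imp_deriv)
  have A: "((\<lambda>t. w1 * (Y - h) + aa + ep mu + h * ebar (X + t)) has_real_derivative h * debar X) (at 0)"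
   by (auto intro!: derivative_eq_intros d)
  have B: "\<forall>\<^sub>F t in nhds 0. w1 * (Y - h) + aa + ep mu + h * ebar (X + t) = Ub (X + t) Y"
   using order_tendstoD(2)[OF c that] by eventually_elim (simp add: Ub_def)
  show "((\<lambda>t. Ub (X + t) Y) has_real_derivative h * debar X) (at 0)"
   by (rule DERIV_cong_ev[OF refl B refl, THEN iffD1, OF A])
 qed
qed

text \<open>The integrand is constant below and above the approximate interface. For \<open>Y = 1\<close> the value is
\<open>ebar debar\<close>, not zero: the approximation violates the wall condition by \<open>O(\<epsilon>\<^sup>5\<^sup>/\<^sup>2)\<close>.\<close>

lemma V_bar_eq:
 assumes "0 \<le> Y" shows "V_bar h w0 w1 (ep mu) (X, Y) = Vb X Y" proof -
 let ?f = "\<lambda>Y'. dX (U_bar h w0 w1 (ep mu)) (X, Y')" and ?i = "h + ebar X"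
 have lo: "(?f has_integral (- (1 - h) * debar X) * b) {0..b}" if "0 \<le> b" "b \<le> ?i" for b
 proof (rule has_integral_spike_finite[of "{?i}" "{0..b}" ?f "\<lambda>_. - (1 - h) * debar X"])
  show "((\<lambda>_. - (1 - h) * debar X) has_integral (- (1 - h) * debar X) * b) {0..b}"
   using has_integral_const_real[of "- (1 - h) * debar X" 0 b] that by (simp add: mult.commute)
 qed (use that dX_Ub(1) in auto)
 have up: "(?f has_integral (h * debar X) * (b - ?i)) {?i..b}" if "?i \<le> b" for b
 proof (rule has_integral_spike_finite[of "{?i}" "{?i..b}" ?f "\<lambda>_. h * debar X"])
  show "((\<lambda>_. h * debar X) has_integral (h * debar X) * (b - ?i)) {?i..b}"
   using has_integral_const_real[of "h * debar X" ?i b] that by (simp add: mult.commute)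
 qed (use that dX_Ub(2) in auto)
 show ?thesis proof (cases "Y \<le> ?i")
  case True
  from integral_unique[OF lo[OF assms True]] show ?thesis by (simp add: V_bar_def Vb_def True algebra_simps)
 next
  case False
  have "(?f has_integral (- (1 - h) * debar X) * ?i + (h * debar X) * (Y - ?i)) {0..Y}"
   by (rule has_integral_combine[OF _ _ lo up]) (use False ebar_range[of X] in auto)
  from integral_unique[OF this] False show ?thesis by (simp add: V_bar_def Vb_def algebra_simps)
 qed
qed

definition "VE = lower.UX + upper.UX + ep mu * mu * (C * mu\<^sup>2 * wint) + ep mu * mu * (G * wint) * (ep mu * (C * wint) + 2 * (ep mu * (G * wint)))"

lemma UX_nonneg: "0 \<le> lower.UX" "0 \<le> upper.UX" proof -
 have a0: "Complex 0 0 \<in> lower.CL" "Complex 0 0 \<in> upper.CL"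
  using lower.DD_pos[of 0] upper.DD_pos[of 0] by (auto simp: lower.CL_def upper.CL_def)
 show "0 \<le> lower.UX" "0 \<le> upper.UX"
  using order_trans[OF abs_ge_zero lower.uX_approx[OF a0(1)]] order_trans[OF abs_ge_zero upper.uX_approx[OF a0(2)]] by auto
qed

lemma V_approx:
 assumes ch: "(X, Y) \<in> channel"
 shows "abs (V (X, Y) - Vb X Y) \<le> VE" proof -
 have Y01: "0 \<le> Y" "Y \<le> 1" using ch by (auto simp: channel_def)
 define M where "M = ep mu * (C * wint) + 2 * (ep mu * (G * wint))"
 \<comment> \<open>both fields are a slope times a piecewise linear profile\<close>
 have key: "abs (v - b * dbar) \<le> VE"
  if v: "abs (v - a * deta X) \<le> lower.UX + upper.UX" and a: "abs a \<le> 1" and ab: "abs (a - b) \<le> M" and db: "dbar = debar X" for v a b dbar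
 proof -
  have "abs (a * (deta X - debar X)) \<le> 1 * (ep mu * mu * (C * mu\<^sup>2 * wint))"
   unfolding abs_mult by (intro mult_mono a eta_bounds) auto
  moreover have "abs ((a - b) * debar X) \<le> M * (ep mu * mu * (G * wint))"
   unfolding abs_mult by (intro mult_mono ab eta_bounds) (use abs_ge_zero[of "a - b"] ab in auto)
  moreover have "v - b * dbar = (v - a * deta X) + a * (deta X - debar X) + (a - b) * debar X" by (simp add: db algebra_simps)
  ultimately show ?thesis using v unfolding VE_def M_def[symmetric] mult.commute[of M] by linarith
 qed
 have eb: "abs (\<eta> X) \<le> ep mu * (C * wint)" "abs (ebar X) \<le> ep mu * (G * wint)" "0 \<le> ep mu * (C * wint)" "0 \<le> ep mu * (G * wint)"
  using eta_bounds(1,3)[of X] abs_ge_zero[of "\<eta> X"] abs_ge_zero[of "ebar X"] by linarith+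
 note M = eb M_def
 from ch show ?thesis proof (cases rule: channel_cases)
  case 1
  have "abs (Im (lower.GG (Complex X Y)) + (1 - h) * deta X * Y) \<le> lower.UX * Y"
   using lower.v_approx[of Y X] Y01 1(2) by (simp add: DD ratio)
  also have "... \<le> lower.UX * 1" by (intro mult_left_mono UX_nonneg Y01)
  finally have "abs (Im (lower.GG (Complex X Y)) + (1 - h) * deta X * Y) \<le> lower.UX" by simp
  moreover have "- Im (lower.GG (Complex X Y)) - (1 - h) * Y * deta X = - (Im (lower.GG (Complex X Y)) + (1 - h) * deta X * Y)"
   by (simp add: algebra_simps)
  ultimately have v: "abs (V (X, Y) - (1 - h) * Y * deta X) \<le> lower.UX + upper.UX"
   unfolding UV_lower(2)[OF 1(2)] using UX_nonneg(2) by linarith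
  have a: "abs ((1 - h) * Y) \<le> 1" using h Y01 weight_diff(1)[of Y] by linarith
  show ?thesis proof (cases "Y \<le> h + ebar X")
   case True
   then show ?thesis unfolding Vb_def using key[OF v a, of "(1 - h) * Y"] M by simp
  next
   case False
   have "(1 - h) * Y - (h * (1 - Y) + ebar X) = Y - h - ebar X" by (simp add: algebra_simps)
   then have "abs ((1 - h) * Y - (h * (1 - Y) + ebar X)) \<le> M" using False 1(2) M by linarith
   from key[OF v a this refl] show ?thesis using False by (simp add: Vb_def)
  qed
 next
  case 2
  have "abs (Im (upper.GG (Complex X (1 - Y))) - h * deta X * (1 - Y)) \<le> upper.UX * (1 - Y)"
   using upper.v_approx[of "1 - Y" X] Y01 2(2) by (simp add: DD ratio)
  also have "... \<le> upper.UX * 1" using Y01 by (intro mult_left_mono UX_nonneg) auto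
  finally have "abs (Im (upper.GG (Complex X (1 - Y))) - h * deta X * (1 - Y)) \<le> upper.UX" by simp
  moreover have "h * deta X * (1 - Y) = h * (1 - Y) * deta X" by (simp add: algebra_simps)
  ultimately have v: "abs (V (X, Y) - h * (1 - Y) * deta X) \<le> lower.UX + upper.UX"
   unfolding UV_upper(2)[OF 2(2)] using UX_nonneg(1) by linarith
  have a: "abs (h * (1 - Y)) \<le> 1" using h Y01 weight_diff(2)[of "1 - Y"] by linarith
  show ?thesis proof (cases "Y \<le> h + ebar X")
   case True
   have "h * (1 - Y) - (1 - h) * Y = h - Y" by (simp add: algebra_simps)
   then have "abs (h * (1 - Y) - (1 - h) * Y) \<le> M" using True 2(2) M by linarith
   from key[OF v a this refl] show ?thesis using True by (simp add: Vb_def)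
  next
   case False
   have "abs (h * (1 - Y) - (h * (1 - Y) + ebar X)) \<le> M" using M by linarith
   from key[OF v a this refl] show ?thesis using False by (simp add: Vb_def)
  qed
 qed
qed

end

lemma Linf_norm_le:
 assumes "continuous_on S f" "closed S" "\<And>p. p \<in> S \<Longrightarrow> abs (f p) \<le> c"
 shows "Linf_norm S f \<le> ereal c" unfolding Linf_norm_def proof (rule esssup_I)
 have "S \<in> sets lebesgue" using assms(2) by (simp add: borel_closed sets_completionI_sets)
 from continuous_imp_measurable_on_sets_lebesgue[OF assms(1) this]
 show "(\<lambda>p. ereal (abs (f p))) \<in> borel_measurable (lebesgue_on S)" by measurable
 show "AE p in lebesgue_on S. ereal (abs (f p)) \<le> ereal c"
  by (rule AE_I2) (use assms(3) in \<open>simp add: space_restrict_space\<close>)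
qed

text \<open>On a null set the essential supremum would be \<open>-\<infinity>\<close>.\<close>

lemma Linf_norm_nonneg:
 assumes "cbox a b \<subseteq> S" "S \<in> sets lebesgue" "box a b \<noteq> {}"
 shows "0 \<le> Linf_norm S f" proof -
 have "emeasure lebesgue (cbox a b) \<le> emeasure lebesgue S" by (rule emeasure_mono[OF assms(1,2)])
 moreover have "0 < emeasure lebesgue (cbox a b)"
  using assms(3) by (auto simp: emeasure_lborel_cbox_eq box_ne_empty inner_diff_left intro!: prod_pos less_imp_le)
 ultimately have "emeasure (lebesgue_on S) (space (lebesgue_on S)) \<noteq> 0"
  using assms(2) by (simp add: emeasure_restrict_space space_restrict_space)
 then have "esssup (lebesgue_on S) (\<lambda>_. 0 :: ereal) = 0" by (rule esssup_const)
 moreover have "esssup (lebesgue_on S) (\<lambda>_. 0 :: ereal) \<le> esssup (lebesgue_on S) (\<lambda>p. ereal (abs (f p)))"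
  by (rule esssup_mono) auto
 ultimately show ?thesis by (simp add: Linf_norm_def)
qed

lemma channel_closed: "closed channel" unfolding channel_def by (intro closed_Times closed_UNIV closed_atLeastAtMost)

lemma Linf_norm_nonneg': "0 \<le> Linf_norm channel f" "0 \<le> Linf_norm UNIV k" for k :: "real \<Rightarrow> real" proof -
 have "cbox (0, 0) (1, 1) \<subseteq> channel" by (auto simp: channel_def cbox_Pair_eq)
 moreover have "channel \<in> sets lebesgue" using channel_closed by (simp add: borel_closed sets_completionI_sets)
 moreover have "box (0 :: real, 0 :: real) (1, 1) \<noteq> {}" by (auto simp: box_ne_empty Basis_prod_def)
 ultimately show "0 \<le> Linf_norm channel f" by (rule Linf_norm_nonneg)
 show "0 \<le> Linf_norm UNIV k" by (rule Linf_norm_nonneg[of 0 1]) auto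
qed

lemma continuous_on_layers:
 fixes i :: "real \<Rightarrow> real"
 assumes "continuous_on UNIV i" "continuous_on S f" "continuous_on S k"
  and "\<And>X. (X, i X) \<in> S \<Longrightarrow> f (X, i X) = k (X, i X)"
 shows "continuous_on S (\<lambda>r. if snd r \<le> i (fst r) then f r else k r)" proof -
 have "continuous_on S (\<lambda>r. if snd r - i (fst r) \<le> 0 then f r else k r)" proof (rule continuous_on_cases_le)
  show "continuous_on S (\<lambda>r. snd r - i (fst r))"
   by (intro continuous_intros continuous_on_compose2[OF assms(1) _ subset_UNIV])
  show "f r = k r" if "r \<in> S" "snd r - i (fst r) = 0" for r proof -
   have "r = (fst r, i (fst r))" using that(2) by (simp add: prod_eq_iff)
   then show ?thesis using assms(4)[of "fst r"] that(1) by simp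
  qed
 qed (auto intro: continuous_on_subset[OF assms(2)] continuous_on_subset[OF assms(3)])
 then show ?thesis by simp
qed

context soliton_flow
begin

lemma Ub_cont: "continuous_on S (U_bar h w0 w1 (ep mu))" proof -
 have "continuous_on UNIV (\<lambda>r. if snd r \<le> h + ebar (fst r) then w0 * (snd r - h) + aa + ep mu - (1 - h) * ebar (fst r)
   else w1 * (snd r - h) + aa + ep mu + h * ebar (fst r))" proof (rule continuous_on_layers[of "\<lambda>X. h + ebar X"])
  fix X show "w0 * (snd (X, h + ebar X) - h) + aa + ep mu - (1 - h) * ebar (fst (X, h + ebar X))
   = w1 * (snd (X, h + ebar X) - h) + aa + ep mu + h * ebar (fst (X, h + ebar X))"
   using branch_difference[of "h + ebar X" "ebar X"] by simp
 qed (intro continuous_intros ebar_cont)+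
 also have "(\<lambda>r. if snd r \<le> h + ebar (fst r) then w0 * (snd r - h) + aa + ep mu - (1 - h) * ebar (fst r)
   else w1 * (snd r - h) + aa + ep mu + h * ebar (fst r)) = U_bar h w0 w1 (ep mu)"
  using U_bar_eq[of "fst r" "snd r" for r] by (auto simp: Ub_def fun_eq_iff)
 finally show ?thesis by (rule continuous_on_subset) simp
qed

lemma Vb_cont: "continuous_on channel (V_bar h w0 w1 (ep mu))" proof -
 have "continuous_on channel (\<lambda>r. if snd r \<le> h + ebar (fst r) then (1 - h) * snd r * debar (fst r) else (h * (1 - snd r) + ebar (fst r)) * debar (fst r))"
 proof (rule continuous_on_layers[of "\<lambda>X. h + ebar X"])
  fix X show "(1 - h) * snd (X, h + ebar X) * debar (fst (X, h + ebar X))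
   = (h * (1 - snd (X, h + ebar X)) + ebar (fst (X, h + ebar X))) * debar (fst (X, h + ebar X))" by (simp add: algebra_simps)
 qed (intro continuous_intros ebar_cont debar_cont)+
 then show ?thesis proof (rule continuous_on_eq)
  fix r assume "r \<in> channel"
  then have "0 \<le> snd r" by (auto simp: channel_def)
  from V_bar_eq[OF this, of "fst r"]
  show "(if snd r \<le> h + ebar (fst r) then (1 - h) * snd r * debar (fst r) else (h * (1 - snd r) + ebar (fst r)) * debar (fst r)) = V_bar h w0 w1 (ep mu) r"
   by (simp add: Vb_def)
 qed
qed

lemma Ustar_cont: "continuous_on S (\<lambda>r. Ustar h w0 w1 (snd r))" for S :: "(real \<times> real) set" proof -
 have "continuous_on S (\<lambda>r. if snd r \<le> (\<lambda>_. h) (fst r) then w0 * (snd r - h) + h * (1 - h) else w1 * (snd r - h) + h * (1 - h))"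
  by (rule continuous_on_layers[where i = "\<lambda>_. h" and f = "\<lambda>r. w0 * (snd r - h) + h * (1 - h)" and k = "\<lambda>r. w1 * (snd r - h) + h * (1 - h)"])
   (auto intro!: continuous_intros)
 then show ?thesis by (simp add: Ustar_def)
qed

lemma mu_sq: "mu\<^sup>2 = 3 / (4 * aa\<^sup>2) * ep mu" using aa by (simp add: ep_def)

lemma Linf_U: "Linf_norm channel (\<lambda>r. U r - U_bar h w0 w1 (ep mu) r) \<le> ereal (15 * (C * wint) / (4 * aa\<^sup>2) * (ep mu)\<^sup>2)"
proof (rule Linf_norm_le[OF _ channel_closed])
 show "continuous_on channel (\<lambda>r. U r - U_bar h w0 w1 (ep mu) r)" by (intro continuous_intros UV_cont Ub_cont)
 fix r assume r: "r \<in> channel"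
 have "abs (U r - U_bar h w0 w1 (ep mu) r) \<le> 5 * (ep mu * (C * mu\<^sup>2 * wint))"
  using U_approx[of "fst r" "snd r"] U_bar_eq[of "fst r" "snd r"] r by simp
 also have "... = 15 * (C * wint) / (4 * aa\<^sup>2) * (ep mu)\<^sup>2" unfolding mu_sq using aa by (simp add: field_simps power2_eq_square)
 finally show "abs (U r - U_bar h w0 w1 (ep mu) r) \<le> 15 * (C * wint) / (4 * aa\<^sup>2) * (ep mu)\<^sup>2" .
qed

lemma Linf_eta: "Linf_norm UNIV (\<lambda>X. \<eta> X - eta_bar h w0 w1 (ep mu) X) \<le> ereal (3 * (C * wint) / (4 * aa\<^sup>2) * (ep mu)\<^sup>2)"
proof (rule Linf_norm_le[OF _ closed_UNIV])
 show "continuous_on UNIV (\<lambda>X. \<eta> X - eta_bar h w0 w1 (ep mu) X)"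
  unfolding eta_bar_eq by (intro continuous_intros eta_cont2 ebar_cont)
 fix X
 have "abs (\<eta> X - eta_bar h w0 w1 (ep mu) X) \<le> ep mu * (C * mu\<^sup>2 * wint)" unfolding eta_bar_eq by (rule eta_bounds)
 also have "... = 3 * (C * wint) / (4 * aa\<^sup>2) * (ep mu)\<^sup>2" unfolding mu_sq using aa by (simp add: field_simps power2_eq_square)
 finally show "abs (\<eta> X - eta_bar h w0 w1 (ep mu) X) \<le> 3 * (C * wint) / (4 * aa\<^sup>2) * (ep mu)\<^sup>2" .
qed

lemma Linf_eta0: "Linf_norm UNIV \<eta> \<le> ereal (C * wint * ep mu)"
 by (rule Linf_norm_le[OF eta_cont2[OF continuous_on_id] closed_UNIV]) (use eta_bounds(1) in \<open>simp add: mult_ac\<close>)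

lemma BF_le: "lower.BF \<le> (2 / h + 2) * C" "upper.BF \<le> (2 / (1 - h) + 2) * C" proof -
 have "ep mu * C \<le> 2 * C" using m0(4,5) by (intro mult_right_mono C_nonneg) linarith
 then show "lower.BF \<le> (2 / h + 2) * C" "upper.BF \<le> (2 / (1 - h) + 2) * C"
  unfolding lower.BF_def upper.BF_def distrib_right by auto
qed

lemma V_small:
 assumes "r \<in> channel" shows "abs (V r) \<le> (4 + 2 / h + 2 / (1 - h)) * (C * wint) * ep mu" proof -
 have r: "(fst r, snd r) \<in> channel" using assms by simp
 have nn: "0 \<le> 2 / h * (C * wint)" "0 \<le> 2 / (1 - h) * (C * wint)" "0 \<le> C * wint" using C_nonneg h by auto
 have b: "lower.BF * wint \<le> (4 + 2 / h + 2 / (1 - h)) * (C * wint)" "upper.BF * wint \<le> (4 + 2 / h + 2 / (1 - h)) * (C * wint)"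
  using mult_right_mono[OF BF_le(1) wint_nonneg] mult_right_mono[OF BF_le(2) wint_nonneg] nn
  unfolding distrib_right mult.assoc by linarith+
 from r show ?thesis proof (cases rule: channel_cases)
  case 1
  have "abs (V (fst r, snd r)) \<le> ep mu * (lower.BF * wint)"
   unfolding UV_lower(2)[OF 1(2)] using abs_Im_le_cmod[of "lower.GG (Complex (fst r) (snd r))"] lower.GG_bound(1)[OF mem0(1)[OF 1(1)]] by linarith
  also have "... \<le> ep mu * ((4 + 2 / h + 2 / (1 - h)) * (C * wint))" by (rule mult_left_mono[OF b(1) m0(3)])
  finally show ?thesis by (simp add: mult_ac)
 next
  case 2
  have "abs (V (fst r, snd r)) \<le> ep mu * (upper.BF * wint)"
   unfolding UV_upper(2)[OF 2(2)] using abs_Im_le_cmod[of "upper.GG (Complex (fst r) (1 - snd r))"] upper.GG_bound(1)[OF mem1(1)[OF 2(1)]] by linarith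
  also have "... \<le> ep mu * ((4 + 2 / h + 2 / (1 - h)) * (C * wint))" by (rule mult_left_mono[OF b(2) m0(3)])
  finally show ?thesis by (simp add: mult_ac)
 qed
qed

lemma Linf_V0: "Linf_norm channel V \<le> ereal ((4 + 2 / h + 2 / (1 - h)) * (C * wint) * ep mu)"
 by (rule Linf_norm_le[OF UV_cont(2) channel_closed V_small])

lemma U_Ustar:
 assumes "(X, Y) \<in> channel" shows "abs (U (X, Y) - Ustar h w0 w1 Y) \<le> (5 * (C * wint) + 2 * (G * wint) + 1) * ep mu"
proof -
 have "ep mu * (C * mu\<^sup>2 * wint) \<le> ep mu * (C * 1 * wint)"
  by (intro mult_left_mono mult_right_mono m0 C_nonneg wint_nonneg)
 then have 1: "abs (U (X, Y) - Ub X Y) \<le> 5 * (C * wint) * ep mu" using U_approx[OF assms] by (simp add: mult_ac)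
 have e: "abs (ebar X) \<le> G * wint * ep mu" using eta_bounds(3)[of X] by (simp add: mult_ac)
 have wd: "abs ((1 - h) * ebar X) \<le> abs (ebar X)" "abs (h * ebar X) \<le> abs (ebar X)" by (rule weight_diff)+
 have w: "w0 * (Y - h) = w1 * (Y - h) + (Y - h)" using w by (simp add: algebra_simps)
 have 2: "abs (Ub X Y - Ustar h w0 w1 Y) \<le> 2 * abs (ebar X) + ep mu" proof (cases rule: Ub_cases[of Y X])
  case 1
  show ?thesis proof (cases "Y \<le> h")
   case True
   have "Ub X Y - Ustar h w0 w1 Y = ep mu - (1 - h) * ebar X" using True 1(2) by (simp add: Ustar_def aa_def)
   then show ?thesis using wd m0 by linarith
  next
   case False
   have "Ub X Y - Ustar h w0 w1 Y = ep mu - (1 - h) * ebar X + (Y - h)" using False 1(2) w by (simp add: Ustar_def aa_def)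
   then show ?thesis using wd m0 1(1) False by linarith
  qed
 next
  case 2
  show ?thesis proof (cases "Y \<le> h")
   case True
   have "Ub X Y - Ustar h w0 w1 Y = ep mu + h * ebar X - (Y - h)" using True 2(2) w by (simp add: Ustar_def aa_def)
   then show ?thesis using wd m0 2(1) True by linarith
  next
   case False
   have "Ub X Y - Ustar h w0 w1 Y = ep mu + h * ebar X" using False 2(2) by (simp add: Ustar_def aa_def)
   then show ?thesis using wd m0 by linarith
  qed
 qed
 have "(5 * (C * wint) + 2 * (G * wint) + 1) * ep mu = 5 * (C * wint) * ep mu + 2 * (G * wint * ep mu) + ep mu"
  by (simp add: algebra_simps)
 then show ?thesis using 1 2 e by linarith
qed

lemma Linf_U0: "Linf_norm channel (\<lambda>(X, Y). U (X, Y) - Ustar h w0 w1 Y) \<le> ereal ((5 * (C * wint) + 2 * (G * wint) + 1) * ep mu)"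
proof (rule Linf_norm_le[OF _ channel_closed])
 show "continuous_on channel (\<lambda>(X, Y). U (X, Y) - Ustar h w0 w1 Y)"
  unfolding case_prod_unfold prod.collapse by (intro continuous_on_diff UV_cont Ustar_cont)
qed (use U_Ustar in auto)

definition "Vcon = (6 * (C * wint) + C * wint) * (3 / (4 * aa\<^sup>2)) + (4 + 2 / h + 2 / (1 - h)) * (C * wint) * (C * wint)
 + (G * wint) * (C * wint + 2 * (G * wint))"

lemma VE_le: "VE \<le> Vcon * ((ep mu)\<^sup>2 * mu)" proof -
 define e where "e = ep mu"
 define x where "x = C * wint"
 define y where "y = G * wint"
 define c2 where "c2 = 3 / (4 * aa\<^sup>2)"
 note e0 = m0(3)[folded e_def]
 have x0: "0 \<le> x" "0 \<le> y" using C_nonneg by (auto simp: x_def y_def)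
 have W: "e * mu * (WB * wint) \<le> e * mu * (3 * x * (c2 * e))" if "WB \<le> 3 * C * mu\<^sup>2" for WB proof -
  have "WB * wint \<le> 3 * C * mu\<^sup>2 * wint" by (rule mult_right_mono[OF that wint_nonneg])
  also have "... = 3 * x * (c2 * e)" unfolding mu_sq by (simp add: x_def c2_def e_def)
  finally show ?thesis using e0 m0(1) by (intro mult_left_mono) auto
 qed
 have F: "e * mu * (BF * wint) * (e * mu * x) \<le> e * e * mu * (c * x * x)" if "BF \<le> c * C" "0 \<le> c" for BF c proof -
  have "BF * wint \<le> c * x" using mult_right_mono[OF that(1) wint_nonneg] by (simp add: x_def mult.assoc)
  then have b1: "e * mu * (BF * wint) \<le> e * mu * (c * x)" using e0 m0(1) by (intro mult_left_mono) auto
  have b2: "e * mu * x \<le> e * 1 * x" by (intro mult_right_mono mult_left_mono mu(2) e0 x0)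
  have "e * mu * (BF * wint) * (e * mu * x) \<le> e * mu * (c * x) * (e * 1 * x)"
   using e0 m0(1) x0 that(2) by (intro mult_mono[OF b1 b2]) auto
  then show ?thesis by (simp add: mult_ac)
 qed
 have u1: "lower.UX \<le> e * mu * (3 * x * (c2 * e)) + e * e * mu * ((2 / h + 2) * x * x)"
  unfolding lower.UX_def e_def x_def by (intro add_mono W[unfolded e_def x_def] F[unfolded e_def x_def] WB_le BF_le) (use h in auto)
 have u2: "upper.UX \<le> e * mu * (3 * x * (c2 * e)) + e * e * mu * ((2 / (1 - h) + 2) * x * x)"
  unfolding upper.UX_def e_def x_def by (intro add_mono W[unfolded e_def x_def] F[unfolded e_def x_def] WB_le BF_le) (use h in auto)
 have c: "e * mu * (C * mu\<^sup>2 * wint) = e * mu * (x * (c2 * e))" unfolding mu_sq by (simp add: x_def c2_def e_def)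
 have r: "e * mu * y * (e * x + 2 * (e * y)) = e * e * mu * (y * (x + 2 * y))" by (simp add: algebra_simps)
 have "VE \<le> e * mu * (3 * x * (c2 * e)) + e * e * mu * ((2 / h + 2) * x * x) + (e * mu * (3 * x * (c2 * e)) + e * e * mu * ((2 / (1 - h) + 2) * x * x))
   + e * mu * (x * (c2 * e)) + e * e * mu * (y * (x + 2 * y))"
  using add_mono[OF add_mono[OF add_mono[OF u1 u2] eq_refl[OF c]] eq_refl[OF r]] unfolding VE_def e_def x_def y_def .
 also have "... = Vcon * (e\<^sup>2 * mu)"
  unfolding Vcon_def x_def[symmetric] y_def[symmetric] c2_def[symmetric] by (simp add: algebra_simps power2_eq_square)
 finally show ?thesis by (simp add: e_def)
qed

lemma Linf_V: "Linf_norm channel (\<lambda>r. V r - V_bar h w0 w1 (ep mu) r) \<le> ereal (Vcon * ((ep mu)\<^sup>2 * mu))"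
proof (rule Linf_norm_le[OF _ channel_closed])
 show "continuous_on channel (\<lambda>r. V r - V_bar h w0 w1 (ep mu) r)" by (intro continuous_intros UV_cont Vb_cont)
 fix r assume r: "r \<in> channel"
 then have "0 \<le> snd r" by (auto simp: channel_def)
 from V_bar_eq[OF this, of "fst r"] have "abs (V r - V_bar h w0 w1 (ep mu) r) \<le> VE"
  using V_approx[of "fst r" "snd r"] r by simp
 then show "abs (V r - V_bar h w0 w1 (ep mu) r) \<le> Vcon * ((ep mu)\<^sup>2 * mu)" using VE_le by linarith
qed

end

section \<open>The family of solitary waves\<close>

text \<open>One constant \<open>K\<close> serves all estimates, so that a solution can be chosen for each \<open>eps\<close>
separately.\<close>

definition "solitary_wave h w0 w1 N K eps U V \<eta> \<longleftrightarrow>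
   two_layer_solution h w0 w1 U V \<eta> \<and> localised \<eta> \<and>
   real_analytic_on2 U (Omega0 h \<eta> \<union> Omega1 h \<eta>) \<and> real_analytic_on2 V (Omega0 h \<eta> \<union> Omega1 h \<eta>) \<and>
   Cn_closure N UNIV \<eta> \<and>
   (\<forall>X. \<forall>Y\<in>{0..1}. U (- X, Y) = U (X, Y)) \<and> (\<forall>X. \<forall>Y\<in>{0..1}. V (- X, Y) = - V (X, Y)) \<and> (\<forall>X. \<eta> (- X) = \<eta> X) \<and>
   Linf_norm channel (\<lambda>(X, Y). U (X, Y) - Ustar h w0 w1 Y) \<le> ereal (K * eps) \<and>
   Linf_norm channel V \<le> ereal (K * eps) \<and> Linf_norm UNIV \<eta> \<le> ereal (K * eps) \<and>
   Linf_norm channel (\<lambda>r. U r - U_bar h w0 w1 eps r) \<le> ereal (K * eps\<^sup>2) \<and>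
   Linf_norm channel (\<lambda>r. V r - V_bar h w0 w1 eps r) \<le> ereal (K * eps powr (5 / 2)) \<and>
   Linf_norm UNIV (\<lambda>X. \<eta> X - eta_bar h w0 w1 eps X) \<le> ereal (K * eps\<^sup>2)"

context two_layers
begin

text \<open>Given \<open>eps\<close>, the wave number is \<open>mu = sqrt (3 eps) / (2 h (1 - h))\<close>, which inverts \<open>ep\<close>.
Smallness of \<open>mu\<close> also keeps the exact and the approximate interface inside the channel.\<close>

lemma solitary_wave_family:
 assumes s5: "5 \<le> s" and N: "N + 3 \<le> s"
 shows "\<exists>K eps0. 0 < eps0 \<and> (\<forall>eps. 0 < eps \<and> eps < eps0 \<longrightarrow> (\<exists>U V \<eta>. solitary_wave h w0 w1 N K eps U V \<eta>))"
proof -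
 obtain C mu0 where mu0: "0 < mu0" "mu0 \<le> 1" and C0: "0 \<le> C"
  and fp: "\<And>mu. 0 < mu \<Longrightarrow> mu < mu0 \<Longrightarrow> \<exists>g p q. profile mu C g p q"
  using profile_exists by blast
 obtain G where G: "bnd s G g0" using g0_bnd by blast
 have G0: "0 \<le> G" by (rule bndD(4)[OF G])
 define x where "x = C * wint"
 define y where "y = G * wint"
 have xy: "0 \<le> x" "0 \<le> y" using C0 G0 wint_nonneg by (auto simp: x_def y_def)
 define m where "m = min h (1 - h)"
 have m: "0 < m" "m \<le> h" "m \<le> 1 - h" using h by (auto simp: m_def)
 define mu1 where "mu1 = min mu0 (m / (2 * (x + y) + 1))"
 have d0: "0 < 2 * (x + y) + 1" using xy by (intro add_nonneg_pos) auto
 have mu1: "0 < mu1" "mu1 \<le> 1" "mu1 \<le> mu0" "mu1 * (2 * (x + y) + 1) \<le> m" proof -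
  show "0 < mu1" "mu1 \<le> 1" "mu1 \<le> mu0" using mu0 m d0 by (auto simp: mu1_def)
  have "mu1 \<le> m / (2 * (x + y) + 1)" by (simp add: mu1_def)
  then show "mu1 * (2 * (x + y) + 1) \<le> m" using d0 by (simp add: pos_le_divide_eq)
 qed
 define Vc where "Vc = (6 * x + x) * (3 / (4 * aa\<^sup>2)) + (4 + 2 / h + 2 / (1 - h)) * x * x + y * (x + 2 * y)"
 have nn: "0 \<le> 15 * x / (4 * aa\<^sup>2)" "0 \<le> 3 * x / (4 * aa\<^sup>2)" "0 \<le> (4 + 2 / h + 2 / (1 - h)) * x" "0 \<le> 5 * x + 2 * y + 1"
  "0 \<le> Vc * (sqrt 3 / (2 * aa))" using xy h aa by (auto simp: Vc_def)
 define K where "K = 15 * x / (4 * aa\<^sup>2) + 3 * x / (4 * aa\<^sup>2) + x + (4 + 2 / h + 2 / (1 - h)) * x + (5 * x + 2 * y + 1) + Vc * (sqrt 3 / (2 * aa))"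
 have K: "15 * x / (4 * aa\<^sup>2) \<le> K" "3 * x / (4 * aa\<^sup>2) \<le> K" "x \<le> K" "(4 + 2 / h + 2 / (1 - h)) * x \<le> K" "5 * x + 2 * y + 1 \<le> K"
  "Vc * (sqrt 3 / (2 * aa)) \<le> K" using nn xy unfolding K_def by linarith+
 have le: "ereal (k * r) \<le> ereal (K * r)" if "k \<le> K" "0 \<le> r" for k r using mult_right_mono[OF that] by simp
 have main: "\<exists>U V \<eta>. solitary_wave h w0 w1 N K eps U V \<eta>"
  if eps: "0 < eps" "eps < ep mu1" for eps proof -
  define mu where "mu = sqrt (3 * eps) / (2 * aa)"
  have mu: "0 < mu" using eps aa by (simp add: mu_def)
  have e: "ep mu = eps" using eps aa by (simp add: ep_def mu_def power_divide power_mult_distrib)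
  have "mu < mu1" proof (rule ccontr)
   assume "\<not> mu < mu1"
   then have "mu1\<^sup>2 \<le> mu\<^sup>2" using mu1 by (intro power_mono) auto
   then have "ep mu1 \<le> ep mu" unfolding ep_def by (intro divide_right_mono mult_left_mono) auto
   then show False using eps e by simp
  qed
  then have mu': "mu < mu0" "mu \<le> 1" "mu < mu1" using mu1 by auto
  from fp[OF mu mu'(1)] obtain g p q where gpq: "profile mu C g p q" by blast
  have sm: "ep mu * z < m" if z: "0 \<le> z" "z \<le> x + y" for z proof -
   have "ep mu * z \<le> 2 * mu * (x + y)" using ep_bounds[OF mu mu'(2)] z mu by (intro mult_mono) auto
   also have "... < mu * (2 * (x + y) + 1)" using mu by (simp add: algebra_simps)
   also have "... \<le> mu1 * (2 * (x + y) + 1)" using mu'(3) d0 by (intro mult_right_mono) auto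
   finally show ?thesis using mu1(4) by linarith
  qed
  have sm': "ep mu * (C * wint) < m" "ep mu * (G * wint) < m" using sm[of x] sm[of y] xy by (auto simp: x_def y_def)
  interpret sf: soliton_flow h w0 w1 s mu C g p q G by unfold_locales (fact mu mu' s5 gpq G | use sm' m in linarith)+
  have c: "sf.Vcon * ((ep mu)\<^sup>2 * mu) = Vc * (sqrt 3 / (2 * aa)) * eps powr (5 / 2)" proof -
   have "eps powr (5 / 2) = eps powr 2 * eps powr (1 / 2)" by (simp add: powr_add[symmetric])
   then have "eps powr (5 / 2) = eps\<^sup>2 * sqrt eps" using eps by (simp add: powr_half_sqrt)
   then show ?thesis unfolding e by (simp add: mu_def sf.Vcon_def Vc_def x_def y_def real_sqrt_mult)
  qed
  note b = sf.Linf_U0 sf.Linf_V0 sf.Linf_eta0 sf.Linf_U sf.Linf_V sf.Linf_eta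
  note b' = b[unfolded c, unfolded e, folded x_def y_def]
  have e0: "0 \<le> eps" "0 \<le> eps\<^sup>2" "0 \<le> eps powr (5 / 2)" using eps by auto
  have "solitary_wave h w0 w1 N K eps sf.U sf.V sf.lower.eta" unfolding solitary_wave_def proof (intro conjI allI ballI)
   show "two_layer_solution h w0 w1 sf.U sf.V sf.lower.eta" by (rule sf.solution)
   show "localised sf.lower.eta" by (rule sf.eta_localised)
   show "real_analytic_on2 sf.U (Omega0 h sf.lower.eta \<union> Omega1 h sf.lower.eta)"
    "real_analytic_on2 sf.V (Omega0 h sf.lower.eta \<union> Omega1 h sf.lower.eta)"
    using sf.UV_analytic unfolding sf.Om0_def sf.Om1_def by auto
   show "Cn_closure N UNIV sf.lower.eta" by (rule sf.eta_Cn[OF N])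
   show "sf.U (- X, Y) = sf.U (X, Y)" "sf.V (- X, Y) = - sf.V (X, Y)" if "Y \<in> {0..1}" for X Y
    using sf.UV_symmetric[OF that] by auto
   show "sf.lower.eta (- X) = sf.lower.eta X" for X by (rule sf.lower.eta_even)
  qed ((unfold e)?, rule order_trans[OF b'(1) le[OF K(5) e0(1)]] order_trans[OF b'(2) le[OF K(4) e0(1)]] order_trans[OF b'(3) le[OF K(3) e0(1)]]
    order_trans[OF b'(4) le[OF K(1) e0(2)]] order_trans[OF b'(5) le[OF K(6) e0(3)]] order_trans[OF b'(6) le[OF K(2) e0(2)]])+
  then show ?thesis by blast
 qed
 have "0 < ep mu1" by (rule ep_bounds(1)[OF mu1(1,2)])
 then show ?thesis using main by blast
qed

end

lemma Linf_tendsto_0: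
 fixes L :: "real \<Rightarrow> ereal"
 assumes "0 < eps0" "\<And>eps. 0 < eps \<Longrightarrow> eps < eps0 \<Longrightarrow> L eps \<le> ereal (K * eps)" "\<And>eps. 0 \<le> L eps"
 shows "(L \<longlongrightarrow> 0) (at_right 0)"
proof (rule tendsto_sandwich[of "\<lambda>_. 0" L "at_right 0" "\<lambda>eps. ereal (K * eps)"])
 have "((\<lambda>eps. K * eps) \<longlongrightarrow> K * 0) (at_right 0)" by (intro tendsto_intros)
 then show "((\<lambda>eps. ereal (K * eps)) \<longlongrightarrow> 0) (at_right 0)" by (simp add: zero_ereal_def)
 show "\<forall>\<^sub>F eps in at_right 0. L eps \<le> ereal (K * eps)"
  using eventually_at_right_real[OF assms(1)] by eventually_elim (use assms(2) in auto)
qed (use assms(3) in auto)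

theorem theorem1p1:
  fixes N :: nat and h \<omega>0 \<omega>1 :: real
  assumes "N \<ge> 4"
    and "0 < h" and "h < 1"
    and "\<omega>0 - \<omega>1 = 1"
    and "theta h \<omega>0 \<omega>1 \<noteq> 0"
  shows "\<exists>(U :: real \<Rightarrow> real \<times> real \<Rightarrow> real) (V :: real \<Rightarrow> real \<times> real \<Rightarrow> real)
            (\<eta> :: real \<Rightarrow> real \<Rightarrow> real).
    (\<exists>\<epsilon>0>0. \<forall>\<epsilon>. 0 < \<epsilon> \<and> \<epsilon> < \<epsilon>0 \<longrightarrow>
       two_layer_solution h \<omega>0 \<omega>1 (U \<epsilon>) (V \<epsilon>) (\<eta> \<epsilon>) \<and>
       localised (\<eta> \<epsilon>) \<and>
       real_analytic_on2 (U \<epsilon>) (Omega0 h (\<eta> \<epsilon>) \<union> Omega1 h (\<eta> \<epsilon>)) \<and>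
       real_analytic_on2 (V \<epsilon>) (Omega0 h (\<eta> \<epsilon>) \<union> Omega1 h (\<eta> \<epsilon>)) \<and>
       Cn_closure N UNIV (\<eta> \<epsilon>) \<and>
       (\<forall>X. \<forall>Y\<in>{0..1}. U \<epsilon> (- X, Y) = U \<epsilon> (X, Y)) \<and>
       (\<forall>X. \<forall>Y\<in>{0..1}. V \<epsilon> (- X, Y) = - V \<epsilon> (X, Y)) \<and>
       (\<forall>X. \<eta> \<epsilon> (- X) = \<eta> \<epsilon> X)) \<and>
    ((\<lambda>\<epsilon>. Linf_norm channel (\<lambda>(X, Y). U \<epsilon> (X, Y) - Ustar h \<omega>0 \<omega>1 Y)) \<longlongrightarrow> 0) (at_right 0) \<and>
    ((\<lambda>\<epsilon>. Linf_norm channel (V \<epsilon>)) \<longlongrightarrow> 0) (at_right 0) \<and>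
    ((\<lambda>\<epsilon>. Linf_norm UNIV (\<eta> \<epsilon>)) \<longlongrightarrow> 0) (at_right 0) \<and>
    (\<exists>C. \<forall>\<^sub>F \<epsilon> in at_right 0.
       Linf_norm channel (\<lambda>p. U \<epsilon> p - U_bar h \<omega>0 \<omega>1 \<epsilon> p) \<le> ereal (C * \<epsilon>\<^sup>2)) \<and>
    (\<exists>C. \<forall>\<^sub>F \<epsilon> in at_right 0.
       Linf_norm channel (\<lambda>p. V \<epsilon> p - V_bar h \<omega>0 \<omega>1 \<epsilon> p) \<le> ereal (C * \<epsilon> powr (5 / 2))) \<and>
    (\<exists>C. \<forall>\<^sub>F \<epsilon> in at_right 0.
       Linf_norm UNIV (\<lambda>X. \<eta> \<epsilon> X - eta_bar h \<omega>0 \<omega>1 \<epsilon> X) \<le> ereal (C * \<epsilon>\<^sup>2))"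
proof -
 interpret two_layers h \<omega>0 \<omega>1 "N + 4" by unfold_locales (use assms in auto)
 have N: "5 \<le> N + 4" "N + 3 \<le> N + 4" using assms(1) by auto
 obtain K eps0 where eps0: "0 < eps0" and ex: "\<And>eps. 0 < eps \<Longrightarrow> eps < eps0 \<Longrightarrow> \<exists>U V \<eta>. solitary_wave h \<omega>0 \<omega>1 N K eps U V \<eta>"
  using solitary_wave_family[OF N] by blast
 have "\<forall>eps. \<exists>r. 0 < eps \<and> eps < eps0 \<longrightarrow> solitary_wave h \<omega>0 \<omega>1 N K eps (fst r) (fst (snd r)) (snd (snd r))"
 proof (intro allI)
  fix eps show "\<exists>r. 0 < eps \<and> eps < eps0 \<longrightarrow> solitary_wave h \<omega>0 \<omega>1 N K eps (fst r) (fst (snd r)) (snd (snd r))"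
  proof (cases "0 < eps \<and> eps < eps0")
   case True
   then obtain U V \<eta> where "solitary_wave h \<omega>0 \<omega>1 N K eps U V \<eta>" using ex by blast
   then show ?thesis by (intro exI[of _ "(U, V, \<eta>)"]) simp
  next
   case False
   then show ?thesis by blast
  qed
 qed
 from choice[OF this] obtain r where r: "\<forall>eps. 0 < eps \<and> eps < eps0 \<longrightarrow> solitary_wave h \<omega>0 \<omega>1 N K eps (fst (r eps)) (fst (snd (r eps))) (snd (snd (r eps)))" ..
 define U where "U = (\<lambda>eps. fst (r eps))"
 define V where "V = (\<lambda>eps. fst (snd (r eps)))"
 define \<eta> where "\<eta> = (\<lambda>eps. snd (snd (r eps)))"
 have all: "solitary_wave h \<omega>0 \<omega>1 N K eps (U eps) (V eps) (\<eta> eps)" if "0 < eps" "eps < eps0" for eps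
  using r that by (simp add: U_def V_def \<eta>_def)
 note wave = all[unfolded solitary_wave_def]
 have near: "\<forall>\<^sub>F eps in at_right 0. 0 < eps \<and> eps < eps0"
  using eventually_at_right_real[OF eps0] by eventually_elim simp
 show ?thesis
 proof (rule exI[of _ U], rule exI[of _ V], rule exI[of _ \<eta>], intro conjI)
  show "\<exists>eps0>0. \<forall>eps. 0 < eps \<and> eps < eps0 \<longrightarrow>
   two_layer_solution h \<omega>0 \<omega>1 (U eps) (V eps) (\<eta> eps) \<and> localised (\<eta> eps) \<and>
   real_analytic_on2 (U eps) (Omega0 h (\<eta> eps) \<union> Omega1 h (\<eta> eps)) \<and>
   real_analytic_on2 (V eps) (Omega0 h (\<eta> eps) \<union> Omega1 h (\<eta> eps)) \<and> Cn_closure N UNIV (\<eta> eps) \<and>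
   (\<forall>X. \<forall>Y\<in>{0..1}. U eps (- X, Y) = U eps (X, Y)) \<and>
   (\<forall>X. \<forall>Y\<in>{0..1}. V eps (- X, Y) = - V eps (X, Y)) \<and> (\<forall>X. \<eta> eps (- X) = \<eta> eps X)"
   by (rule exI[of _ eps0], rule conjI[OF eps0], intro allI impI, elim conjE) (drule (1) wave, blast)
  show "((\<lambda>eps. Linf_norm channel (\<lambda>(X, Y). U eps (X, Y) - Ustar h \<omega>0 \<omega>1 Y)) \<longlongrightarrow> 0) (at_right 0)"
   "((\<lambda>eps. Linf_norm channel (V eps)) \<longlongrightarrow> 0) (at_right 0)"
   "((\<lambda>eps. Linf_norm UNIV (\<eta> eps)) \<longlongrightarrow> 0) (at_right 0)"
   by (rule Linf_tendsto_0[OF eps0 _ Linf_norm_nonneg'(1)] Linf_tendsto_0[OF eps0 _ Linf_norm_nonneg'(2)]; drule (1) wave; elim conjE; assumption)+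
  show "\<exists>C. \<forall>\<^sub>F eps in at_right 0. Linf_norm channel (\<lambda>p. U eps p - U_bar h \<omega>0 \<omega>1 eps p) \<le> ereal (C * eps\<^sup>2)"
   by (rule exI[of _ K], rule eventually_mono[OF near], elim conjE, drule (1) wave) (elim conjE, assumption)
  show "\<exists>C. \<forall>\<^sub>F eps in at_right 0. Linf_norm channel (\<lambda>p. V eps p - V_bar h \<omega>0 \<omega>1 eps p) \<le> ereal (C * eps powr (5 / 2))"
   by (rule exI[of _ K], rule eventually_mono[OF near], elim conjE, drule (1) wave) (elim conjE, assumption)
  show "\<exists>C. \<forall>\<^sub>F eps in at_right 0. Linf_norm UNIV (\<lambda>X. \<eta> eps X - eta_bar h \<omega>0 \<omega>1 eps X) \<le> ereal (C * eps\<^sup>2)"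
   by (rule exI[of _ K], rule eventually_mono[OF near], elim conjE, drule (1) wave) (elim conjE, assumption)
 qed
qed

end
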